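(* Let $\mathbf X_1,\mathbf X_2,\dots$ be i.i.d. random vectors in $\mathbb R^d$ with cdf $F$. Suppose that for some $\mathbf a_n>\mathbf 0$ and $\mathbf b_n$, $\Pr[\mathbf a_n^{-1}(\bigvee_{i=1}^n\mathbf X_i-\mathbf b_n)\le\mathbf x]\to G(\mathbf x)$ in distribution as $n\to\infty$, where $G$ is a GEV cdf with $0<G(\mathbf 0)<1$ and with parameters $\boldsymbol\gamma$ and $\boldsymbol\sigma>\mathbf 0$. Let $N_n=\sum_{i=1}^n\delta_{\mathbf a_n^{-1}(\mathbf X_i-\mathbf b_n)}$. Then, for some random vector $\mathbf R$ which satisfies Condition (R), $$N_n\xrightarrow{d}P_r\quad\text{on }S_{\boldsymbol\gamma},\quad\text{as }n\to\infty,$$ where $P_r=\sum_{i\ge1}\delta_{(\mathbf R_i/T_i^{\boldsymbol\gamma}-\boldsymbol\sigma/\boldsymbol\gamma)}$. Conversely, for any such $P_r$ (given by $\boldsymbol\gamma$, $\boldsymbol\sigma>\mathbf 0$ and an $\mathbf R$ satisfying Condition (R)), there exist a GEV cdf $G$ and sequences $\mathbf a_n>\mathbf 0$ and $\mathbf b_n$, with $0<G_j(b_{n,j})<1$ and $G_j(b_{n,j})\to1$ for $j=1,\dots,d$, such that $N_n\xrightarrow{d}P_r$ on $S_{\boldsymbol\gamma}$ holds for $F=G$.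
   Context: Notation. Operations and relations on $d$-vectors are componentwise; $\bigvee$ is (componentwise) maximum; $\delta_{\mathbf x}$ is a unit point mass at $\mathbf x$; $\xrightarrow{d}$ for point processes is weak convergence. GEV distributions. A $d$-variate GEV cdf $G$ is a cdf with non-degenerate margins that is max-stable: for each $t>0$ there are $\mathbf a_t\in(0,\infty)^d$, $\mathbf b_t\in\mathbb R^d$ with $G(\mathbf a_t\mathbf x+\mathbf b_t)^t=G(\mathbf x)$. Its margins are $G_j(x)=\exp\{-(1+\gamma_j\frac{x-\mu_j}{\alpha_j})^{-1/\gamma_j}\}$ for $x$ with $\alpha_j+\gamma_j(x-\mu_j)>0$ (read as $\exp\{-e^{-(x-\mu_j)/\alpha_j}\}$ if $\gamma_j=0$), with $\gamma_j,\mu_j\in\mathbb R$, $\alpha_j>0$. Put $\sigma_j=\alpha_j-\gamma_j\mu_j$, and let $\boldsymbol\eta$ be the vector of lower endpoints of the margins ($\eta_j=-\sigma_j/\gamma_j$ if $\gamma_j>0$, $\eta_j=-\infty$ otherwise). State space. $I_j=[-\sigma_j/\gamma_j,\infty)$, $[-\infty,\infty)$ or $[-\infty,-\sigma_j/\gamma_j)$ according to whether $\gamma_j>0$, $\gamma_j=0$ or $\gamma_j<0$; $\bar S_{\boldsymbol\gamma}=I_1\times\cdots\times I_d$ and $S_{\boldsymbol\gamma}=\bar S_{\boldsymbol\gamma}\setminus\{\boldsymbol\eta\}$. Condition (R) (relative to $\boldsymbol\gamma$ and $\boldsymbol\sigma>\mathbf 0$): the components of the random vector $\mathbf R$ satisfy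 $R_j\in[0,\infty)$ if $\gamma_j>0$, $R_j\in[-\infty,\infty)$ if $\gamma_j=0$, $R_j\in[-\infty,0)$ if $\gamma_j<0$; and $0<\mathrm E[|R_j|^{1/\gamma_j}]<\infty$ if $\gamma_j\ne0$, and $0<\mathrm E[\exp(R_j/\sigma_j)]<\infty$ if $\gamma_j=0$, for $j=1,\dots,d$. Limit process. $0<T_1<T_2<\cdots$ are the points of a unit-rate Poisson process on $[0,\infty)$, and $(\mathbf R_i)_{i\ge1}$ are independent copies of $\mathbf R$, independent of $(T_i)_{i\ge1}$. When $\gamma_j=0$, the $j$-th component $R_{i,j}/T_i^0-\sigma_j/0$ of the points of $P_r$ is interpreted as $R_{i,j}-\sigma_j\log T_i$.
   Formalization: In the direct half, coordinates of points of N_n below the lower endpoint η are raised to η; if such points were just discarded the claim fails, e.g. for X=(Z,−Z) or (−Z,Z) with equal probability, Z standard Pareto, a_n=b_n=(n/2,n/2). *)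

theory Defs
  imports "HOL-Probability.Probability"
begin

section \<open>Point processes and their weak convergence\<close>

text \<open>The sum over \<open>i \<in> I\<close> of the unit point masses at \<open>x i\<close>, restricted to \<open>S\<close>, obtained as the
  image of a counting measure.\<close>

definition dirac_sum :: "'a::topological_space set \<Rightarrow> 'i set \<Rightarrow> ('i \<Rightarrow> 'a) \<Rightarrow> 'a measure"
  where "dirac_sum S I x = distr (count_space {i \<in> I. x i \<in> S}) (restrict_space borel S) x"

lemma emeasure_dirac_sum:
  assumes "A \<in> sets (restrict_space borel S)"
  shows "emeasure (dirac_sum S I x) A
       = emeasure (count_space UNIV) {i \<in> I. x i \<in> A}"
proof -
  have A: "A \<subseteq> S"
    using sets.sets_into_space[OF assms] by (simp add: space_restrict_space)
  have "emeasure (dirac_sum S I x) A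
      = emeasure (count_space {i \<in> I. x i \<in> S}) (x -` A \<inter> {i \<in> I. x i \<in> S})"
    unfolding dirac_sum_def using assms
    by (subst emeasure_distr) (auto simp: space_restrict_space)
  also have "x -` A \<inter> {i \<in> I. x i \<in> S} = {i \<in> I. x i \<in> A}"
    using A by auto
  finally show ?thesis
    using A by (simp add: emeasure_count_space subset_eq)
qed

definition point_measures :: "'a::topological_space set \<Rightarrow> 'a measure set"
  where "point_measures S =
    {\<mu>. sets \<mu> = sets (restrict_space borel S) \<and>
        (\<forall>A\<in>sets \<mu>. emeasure \<mu> A \<in> insert \<infinity> (range of_nat)) \<and>
        (\<forall>K. compact K \<and> K \<subseteq> S \<longrightarrow> emeasure \<mu> K < \<infinity>)}"

text \<open>Nonnegative continuous functions on \<open>S\<close> whose support is compact in \<open>S\<close>; their values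
  outside \<open>S\<close> play no role.\<close>

definition test_functions :: "'a::topological_space set \<Rightarrow> ('a \<Rightarrow> real) set"
  where "test_functions S =
    {f. continuous_on S f \<and> (\<forall>x\<in>S. 0 \<le> f x) \<and>
        (\<exists>K. compact K \<and> K \<subseteq> S \<and> (\<forall>x\<in>S - K. f x = 0))}"

definition vague_topology :: "'a::topological_space set \<Rightarrow> 'a measure topology"
  where "vague_topology S = topology_generated_by
    {{\<mu> \<in> point_measures S. (\<integral>x. f x \<partial>\<mu>) \<in> U} | f U. f \<in> test_functions S \<and> open U}"

lemma topspace_vague_topology: "topspace (vague_topology S) = point_measures S"
proof -
  have "(\<lambda>x. 0) \<in> test_functions S"
    unfolding test_functions_def by (auto intro: exI[of _ "{}"])
  then have "point_measures S \<in> {{\<mu> \<in> point_measures S. (\<integral>x. f x \<partial>\<mu>) \<in> U} |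
      f U. f \<in> test_functions S \<and> open U}"
    by (intro CollectI exI[of _ "\<lambda>x. 0"] exI[of _ UNIV]) auto
  then show ?thesis
    unfolding vague_topology_def topology_generated_by_topspace by blast
qed

text \<open>Random elements of a topological space. They need only lie in the space almost surely: for
  instance, the points of a Poisson process are locally finite only almost surely.\<close>

definition random_element :: "'b topology \<Rightarrow> 'w measure \<Rightarrow> ('w \<Rightarrow> 'b) \<Rightarrow> bool"
  where "random_element T M Z \<longleftrightarrow>
    (AE \<omega> in M. Z \<omega> \<in> topspace T) \<and>
    (\<forall>U. openin T U \<longrightarrow> {\<omega> \<in> space M. Z \<omega> \<in> U} \<in> sets M)"

definition converges_weakly ::
  "'b topology \<Rightarrow> 'w measure \<Rightarrow> (nat \<Rightarrow> 'w \<Rightarrow> 'b) \<Rightarrow> 'v measure \<Rightarrow> ('v \<Rightarrow> 'b) \<Rightarrow> bool"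
  where "converges_weakly T M Z M' Z' \<longleftrightarrow>
    (\<forall>n. random_element T M (Z n)) \<and> random_element T M' Z' \<and>
    (\<forall>\<Phi>. continuous_map T euclideanreal \<Phi> \<and> bounded (\<Phi> ` topspace T) \<longrightarrow>
      (\<lambda>n. LINT \<omega>:{\<omega> \<in> space M. Z n \<omega> \<in> topspace T}|M. \<Phi> (Z n \<omega>))
        \<longlonglongrightarrow> (LINT \<omega>:{\<omega> \<in> space M'. Z' \<omega> \<in> topspace T}|M'. \<Phi> (Z' \<omega>)))"

section \<open>Distribution functions and GEV distributions\<close>

definition joint_cdf :: "(real^'d) measure \<Rightarrow> real^'d \<Rightarrow> real"
  where "joint_cdf Q x = measure Q {..x}"

definition margin :: "(real^'d) measure \<Rightarrow> 'd \<Rightarrow> real \<Rightarrow> real"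
  where "margin Q j = cdf (distr Q borel (\<lambda>x. x $ j))"

definition iid_with_cdf :: "'w measure \<Rightarrow> (nat \<Rightarrow> 'w \<Rightarrow> real^'d) \<Rightarrow> (real^'d \<Rightarrow> real) \<Rightarrow> bool"
  where "iid_with_cdf M X F \<longleftrightarrow>
    prob_space M \<and> prob_space.indep_vars M (\<lambda>_. borel) X UNIV \<and>
    (\<forall>i x. measure M {\<omega> \<in> space M. X i \<omega> \<le> x} = F x)"

definition gev :: "(real^'d) measure \<Rightarrow> bool"
  where "gev Q \<longleftrightarrow>
    prob_space Q \<and> sets Q = sets borel \<and>
    (\<forall>j. \<not> (\<exists>c. AE x in Q. x $ j = c)) \<and>
    (\<forall>t>0. \<exists>a b :: real^'d. (\<forall>j. 0 < a $ j) \<and>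
       (\<forall>x. joint_cdf Q (a * x + b) powr t = joint_cdf Q x))"

definition gev_parameters :: "(real^'d) measure \<Rightarrow> real^'d \<Rightarrow> real^'d \<Rightarrow> real^'d \<Rightarrow> bool"
  where "gev_parameters Q \<gamma> \<mu> \<alpha> \<longleftrightarrow>
    (\<forall>j. 0 < \<alpha> $ j \<and>
      (\<forall>x. 0 < \<alpha> $ j + \<gamma> $ j * (x - \<mu> $ j) \<longrightarrow>
        margin Q j x =
          (if \<gamma> $ j = 0 then exp (- exp (- (x - \<mu> $ j) / \<alpha> $ j))
           else exp (- ((1 + \<gamma> $ j * (x - \<mu> $ j) / \<alpha> $ j) powr (- 1 / \<gamma> $ j))))))"

section \<open>State space\<close>

definition lower_endpoint :: "real^'d \<Rightarrow> real^'d \<Rightarrow> ereal^'d"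
  where "lower_endpoint \<gamma> \<sigma> = (\<chi> j. if \<gamma> $ j > 0 then ereal (- \<sigma> $ j / \<gamma> $ j) else -\<infinity>)"

definition state_interval :: "real \<Rightarrow> real \<Rightarrow> ereal set"
  where "state_interval g s =
    (if g > 0 then {ereal (- s / g)..<\<infinity>}
     else if g = 0 then {-\<infinity>..<\<infinity>}
     else {-\<infinity>..<ereal (- s / g)})"

definition state_space :: "real^'d \<Rightarrow> real^'d \<Rightarrow> (ereal^'d) set"
  where "state_space \<gamma> \<sigma> =
    {y. \<forall>j. y $ j \<in> state_interval (\<gamma> $ j) (\<sigma> $ j)} - {lower_endpoint \<gamma> \<sigma>}"

section \<open>The sample point process\<close>

definition normalized :: "real^'d \<Rightarrow> real^'d \<Rightarrow> real^'d \<Rightarrow> ereal^'d"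
  where "normalized a b x = (\<chi> j. ereal ((x $ j - b $ j) / a $ j))"

definition raise_to :: "ereal^'d \<Rightarrow> ereal^'d \<Rightarrow> ereal^'d"
  where "raise_to \<eta> y = (\<chi> j. max (\<eta> $ j) (y $ j))"

definition sample_pp_plain :: "real^'d \<Rightarrow> real^'d \<Rightarrow> (nat \<Rightarrow> real^'d) \<Rightarrow> (nat \<Rightarrow> real^'d)
    \<Rightarrow> (nat \<Rightarrow> 'w \<Rightarrow> real^'d) \<Rightarrow> nat \<Rightarrow> 'w \<Rightarrow> (ereal^'d) measure"
  where "sample_pp_plain \<gamma> \<sigma> a b X n \<omega> =
    dirac_sum (state_space \<gamma> \<sigma>) {..<n} (\<lambda>i. normalized (a n) (b n) (X i \<omega>))"

text \<open>Coordinates below the lower endpoint are moved up to it. Discarding such observations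
  instead would falsify the convergence: let \<open>d = 2\<close>, \<open>\<gamma> = \<sigma> = (1, 1)\<close>, \<open>a\<^sub>n = b\<^sub>n = (n/2, n/2)\<close>,
  let \<open>Z\<close> be standard Pareto and \<open>X\<close> be \<open>(Z, - Z)\<close> or \<open>(- Z, Z)\<close>, with probability one half
  each. The normalized maxima converge to independent shifted Frechet variables, but every
  observation has a coordinate below the lower endpoint \<open>- 1\<close>.\<close>

definition sample_pp :: "real^'d \<Rightarrow> real^'d \<Rightarrow> (nat \<Rightarrow> real^'d) \<Rightarrow> (nat \<Rightarrow> real^'d)
    \<Rightarrow> (nat \<Rightarrow> 'w \<Rightarrow> real^'d) \<Rightarrow> nat \<Rightarrow> 'w \<Rightarrow> (ereal^'d) measure"
  where "sample_pp \<gamma> \<sigma> a b X n \<omega> =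
    dirac_sum (state_space \<gamma> \<sigma>) {..<n}
      (\<lambda>i. raise_to (lower_endpoint \<gamma> \<sigma>) (normalized (a n) (b n) (X i \<omega>)))"

section \<open>The limit process\<close>

definition range_R :: "real \<Rightarrow> ereal set"
  where "range_R g =
    (if g > 0 then {0..<\<infinity>} else if g = 0 then {-\<infinity>..<\<infinity>} else {-\<infinity>..<0})"

text \<open>The quantities \<open>\<bar>r\<bar> powr (1 / g)\<close> and \<open>exp (r / s)\<close>, for \<open>r \<in> range_R g\<close>. The only infinite
  value in \<open>range_R g\<close> is \<open>-\<infinity>\<close>, with \<open>g \<le> 0\<close>, and both quantities vanish there.\<close>

definition moment_R :: "real \<Rightarrow> real \<Rightarrow> ereal \<Rightarrow> real"
  where "moment_R g s r =
    (if \<bar>r\<bar> = \<infinity> then 0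
     else if g = 0 then exp (real_of_ereal r / s)
     else \<bar>real_of_ereal r\<bar> powr (1 / g))"

definition condition_R :: "real^'d \<Rightarrow> real^'d \<Rightarrow> (ereal^'d) measure \<Rightarrow> bool"
  where "condition_R \<gamma> \<sigma> L \<longleftrightarrow>
    prob_space L \<and> sets L = sets borel \<and>
    (\<forall>j. (AE r in L. r $ j \<in> range_R (\<gamma> $ j)) \<and>
         0 < (\<integral>\<^sup>+ r. ennreal (moment_R (\<gamma> $ j) (\<sigma> $ j) (r $ j)) \<partial>L) \<and>
         (\<integral>\<^sup>+ r. ennreal (moment_R (\<gamma> $ j) (\<sigma> $ j) (r $ j)) \<partial>L) < \<infinity>)"

text \<open>Counts are extended-valued, since \<open>card\<close> would be \<open>0\<close> on infinite sets. Prescribing the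
  law of the counts makes them finite almost surely.\<close>

definition point_count :: "(nat \<Rightarrow> 'v \<Rightarrow> real) \<Rightarrow> real set \<Rightarrow> 'v \<Rightarrow> ennreal"
  where "point_count T A \<omega> = emeasure (count_space UNIV) {i. T i \<omega> \<in> A}"

definition unit_poisson_points :: "'v measure \<Rightarrow> (nat \<Rightarrow> 'v \<Rightarrow> real) \<Rightarrow> bool"
  where "unit_poisson_points M T \<longleftrightarrow>
    (\<forall>i. T i \<in> borel_measurable M) \<and>
    (AE \<omega> in M. 0 < T 0 \<omega> \<and> strict_mono (\<lambda>i. T i \<omega>)) \<and>
    (\<forall>s t k. 0 \<le> s \<and> s < t \<longrightarrow>
      measure M {\<omega> \<in> space M. point_count T {s<..t} \<omega> = of_nat k} = pmf (poisson_pmf (t - s)) k) \<and>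
    (\<forall>u::nat \<Rightarrow> real. 0 \<le> u 0 \<and> strict_mono u \<longrightarrow>
      prob_space.indep_vars M (\<lambda>_. borel) (\<lambda>i. point_count T {u i<..u (Suc i)}) UNIV)"

text \<open>\<open>L\<close> is the law of the generic random vector of which the \<open>R i\<close> are independent copies.\<close>

definition limit_ingredients :: "(ereal^'d) measure \<Rightarrow> 'v measure \<Rightarrow> (nat \<Rightarrow> 'v \<Rightarrow> ereal^'d)
    \<Rightarrow> (nat \<Rightarrow> 'v \<Rightarrow> real) \<Rightarrow> bool"
  where "limit_ingredients L M R T \<longleftrightarrow>
    prob_space M \<and>
    prob_space.indep_vars M (\<lambda>_. borel) R UNIV \<and> (\<forall>i. distr M borel (R i) = L) \<and>
    unit_poisson_points M T \<and>
    prob_space.indep_set M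
      (sets (vimage_algebra (space M) (\<lambda>\<omega> i. R i \<omega>) (\<Pi>\<^sub>M i\<in>UNIV. borel)))
      (sets (vimage_algebra (space M) (\<lambda>\<omega> i. T i \<omega>) (\<Pi>\<^sub>M i\<in>UNIV. borel)))"

definition limit_point :: "real^'d \<Rightarrow> real^'d \<Rightarrow> ereal^'d \<Rightarrow> real \<Rightarrow> ereal^'d"
  where "limit_point \<gamma> \<sigma> r t =
    (\<chi> j. if \<gamma> $ j = 0 then r $ j - ereal (\<sigma> $ j * ln t)
          else r $ j / ereal (t powr (\<gamma> $ j)) - ereal (\<sigma> $ j / \<gamma> $ j))"

definition limit_pp :: "real^'d \<Rightarrow> real^'d \<Rightarrow> (nat \<Rightarrow> 'v \<Rightarrow> ereal^'d) \<Rightarrow> (nat \<Rightarrow> 'v \<Rightarrow> real)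
    \<Rightarrow> 'v \<Rightarrow> (ereal^'d) measure"
  where "limit_pp \<gamma> \<sigma> R T \<omega> =
    dirac_sum (state_space \<gamma> \<sigma>) UNIV (\<lambda>i. limit_point \<gamma> \<sigma> (R i \<omega>) (T i \<omega>))"

end

(* Coordinatewise monotone maps carry the state space to the closed orthant without its origin. There
   the limit process becomes the process of the points W_i / T_i, where W_i has the components
   moment_R. This is a Poisson process whose intensity gives the complement of the box [0, z] the mass
   V z = E[max_j W_j / z_j], so its Laplace functionals are explicit. Those of N_n equal (1 - A_n / n)^n
   with A_n = n E[1 - exp (- f (Y))] for a single normalized observation Y, and they converge as soon as
   the means n P(Y outside [0, z]) converge to V z. The latter holds because F^n converges at the
   corresponding points. Laplace functionals determine weak convergence since a countable family of
   them embeds the point measures homeomorphically into the Hilbert cube, where Stone-Weierstrass and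
   Moreau envelopes handle an arbitrary bounded continuous function.

   For a given G, the law of W comes from the spectral representation of the max-stable exponent
   V = - log G. It is a limit, as p tends to 1, of the angular part of G tilted by the p-th power of
   the norm; those tilted laws have the p-analogues of the required moments exactly.

   Conversely, G is taken to be the law of the componentwise supremum of the points of P_r, and the
   norming vectors are those of its max-stability, so that F(a_n x + b_n)^n = G(x) for every n. *)
theory Submission
  imports Defs
begin

section \<open>Stone-Weierstrass approximation by linear spans\<close>

text \<open>Tilting by the first power of the norm is impossible because a unit Frechet variable has
  infinite mean. For p < 1 the p-th moment is finite and cancels, leaving E[(max_j v_j / x_j)^p] =
  (V x / V 1)^p, which is continuous at p = 1. On the sample side the obstacle is that observations
  may leave the state space. Below a lower endpoint they are raised, which does not affect
  comparisons with interior corners; beyond an upper endpoint they drop out, which is harmless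
  because they lie outside every box and V z is small for large z. On the limit side the intensity
  is infinite near the origin, so every approximation carries a factor vanishing there: the
  indicator of the complement of a box, or a bump that belongs to the countable family and so has
  convergent integrals. Distribution functions see only boxes, whose indicators are discontinuous,
  but staircases of them approximate the coordinates uniformly. For the constructed G, max-stability
  is needed at all arguments; beyond the upper endpoints it follows by truncation to interior
  points.\<close>

text \<open>Finite products of basic open sets form a countable family, so an open set of vectors is
  a countable union of rectangles. The component space is kept general because both
  \<open>real\<close> and \<open>ereal\<close> occur.\<close>

lemma borel_measurable_vec_lambda:
  fixes f :: "'d::finite \<Rightarrow> 'w \<Rightarrow> 'a::second_countable_topology"
  assumes [measurable]: "\<And>j. f j \<in> borel_measurable M"
  shows "(\<lambda>\<omega>. \<chi> j. f j \<omega>) \<in> borel_measurable M"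
proof (rule borel_measurableI)
  fix S :: "('a^'d) set" assume S: "open S"
  obtain B :: "'a set set" where B: "countable B" "topological_basis B"
    using ex_countable_basis by blast
  define C where "C = {b \<in> PiE UNIV (\<lambda>_::'d. B). {x. \<forall>j. x $ j \<in> b j} \<subseteq> S}"
  have "countable C"
    unfolding C_def by (rule countable_subset[OF _ countable_PiE[of UNIV "\<lambda>_. B"]]) (auto simp: B)
  have "(\<lambda>\<omega>. \<chi> j. f j \<omega>) -` S \<inter> space M = (\<Union>b\<in>C. {\<omega> \<in> space M. \<forall>j. f j \<omega> \<in> b j})"
  proof (intro set_eqI iffI)
    fix \<omega> assume *: "\<omega> \<in> (\<lambda>\<omega>. \<chi> j. f j \<omega>) -` S \<inter> space M"
    then obtain A where A: "\<forall>j. open (A j) \<and> f j \<omega> \<in> A j" "\<forall>y. (\<forall>i. y $ i \<in> A i) \<longrightarrow> y \<in> S"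
      using S unfolding open_vec_def by fastforce
    have "\<forall>j. \<exists>b\<in>B. f j \<omega> \<in> b \<and> b \<subseteq> A j"
      using A(1) topological_basisE[OF B(2)] by metis
    then obtain b where "\<forall>j. b j \<in> B \<and> f j \<omega> \<in> b j \<and> b j \<subseteq> A j" by metis
    then show "\<omega> \<in> (\<Union>b\<in>C. {\<omega> \<in> space M. \<forall>j. f j \<omega> \<in> b j})"
      using A(2) * unfolding C_def by (intro UN_I[of b] CollectI conjI subsetI) blast+
  qed (auto simp: C_def)
  also have "\<dots> \<in> sets M"
  proof (rule sets.countable_UN''[OF \<open>countable C\<close>])
    fix b assume "b \<in> C"
    then have "open (b j)" for j
      using B(2) by (auto simp: C_def topological_basis_open PiE_iff)
    then have [measurable]: "b j \<in> sets borel" for j by simp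
    show "{\<omega> \<in> space M. \<forall>j. f j \<omega> \<in> b j} \<in> sets M" by measurable
  qed
  finally show "(\<lambda>\<omega>. \<chi> j. f j \<omega>) -` S \<inter> space M \<in> sets M" .
qed

lemma borel_measurable_vec_nth:
  fixes f :: "'w \<Rightarrow> 'a::topological_space^'d"
  assumes "f \<in> borel_measurable M"
  shows "(\<lambda>\<omega>. f \<omega> $ j) \<in> borel_measurable M"
proof -
  have "continuous_on UNIV (\<lambda>x::'a^'d. x $ j)"
    unfolding continuous_on_def by (auto intro!: tendsto_vec_nth tendsto_ident_at)
  from measurable_compose[OF assms borel_measurable_continuous_onI[OF this]] show ?thesis .
qed

text \<open>By order convexity of the image, a bound on one side of \<open>f x\<close> is either
  respected by all values of \<open>f\<close> or is itself a value, and then it pulls back to a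
  bound on the argument. In this form one lemma serves both the standardization and its
  inverse.\<close>

lemma continuous_on_strict_mono:
  fixes f :: "'a::linorder_topology \<Rightarrow> 'b::linorder_topology"
  assumes mono: "strict_mono_on A f"
    and interval: "\<And>u v w. u \<in> f ` A \<Longrightarrow> v \<in> f ` A \<Longrightarrow> u \<le> w \<Longrightarrow> w \<le> v \<Longrightarrow> w \<in> f ` A"
  shows "continuous_on A f"
  unfolding continuous_on_def
proof (intro ballI order_tendstoI)
  fix x a assume x: "x \<in> A" and a: "a < f x"
  show "eventually (\<lambda>y. a < f y) (at x within A)"
  proof (cases "\<exists>y\<in>A. f y \<le> a")
    case True
    then obtain y where "y \<in> A" "f y \<le> a" by blast
    then obtain x' where x': "x' \<in> A" "f x' = a"
      using interval[of _ "f x" a] x a by (fastforce dest: less_imp_le)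
    then have "x' < x"
      using a x strict_mono_on_less[OF mono x'(1) x] by simp
    then have "eventually (\<lambda>y. x' < y) (at x within A)"
      by (rule order_tendstoD(1)[OF tendsto_ident_at])
    moreover have "eventually (\<lambda>y. y \<in> A) (at x within A)" by (simp add: eventually_at_filter)
    ultimately show ?thesis
      by eventually_elim (use x' mono in \<open>auto dest: strict_mono_onD\<close>)
  next
    case False
    have "eventually (\<lambda>y. y \<in> A) (at x within A)" by (simp add: eventually_at_filter)
    then show ?thesis by eventually_elim (use False in auto)
  qed
next
  fix x a assume x: "x \<in> A" and a: "f x < a"
  show "eventually (\<lambda>y. f y < a) (at x within A)"
  proof (cases "\<exists>y\<in>A. a \<le> f y")
    case True
    then obtain y where "y \<in> A" "a \<le> f y" by blast
    then obtain x' where x': "x' \<in> A" "f x' = a"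
      using interval[of "f x" _ a] x a by (fastforce dest: less_imp_le)
    then have "x < x'"
      using a x strict_mono_on_less[OF mono x x'(1)] by simp
    then have "eventually (\<lambda>y. y < x') (at x within A)"
      by (rule order_tendstoD(2)[OF tendsto_ident_at])
    moreover have "eventually (\<lambda>y. y \<in> A) (at x within A)" by (simp add: eventually_at_filter)
    ultimately show ?thesis
      by eventually_elim (use x' mono in \<open>auto dest: strict_mono_onD\<close>)
  next
    case False
    have "eventually (\<lambda>y. y \<in> A) (at x within A)" by (simp add: eventually_at_filter)
    then show ?thesis by eventually_elim (use False in auto)
  qed
qed

section \<open>Uniform closure of a linear span\<close>

text \<open>Lists of pairs turn sums and products of combinations into list operations; repeated
  generators do no harm.\<close>

definition lincomb :: "(real \<times> ('a \<Rightarrow> real)) list \<Rightarrow> 'a \<Rightarrow> real"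
  where "lincomb l x = (\<Sum>(c, b)\<leftarrow>l. c * b x)"

definition span_approx :: "('a \<Rightarrow> real) set \<Rightarrow> 'a set \<Rightarrow> ('a \<Rightarrow> real) \<Rightarrow> bool"
  where "span_approx B K g \<longleftrightarrow>
    (\<forall>\<epsilon>>0. \<exists>l. snd ` set l \<subseteq> B \<and> (\<forall>x\<in>K. \<bar>g x - lincomb l x\<bar> \<le> \<epsilon>))"

lemma span_approxD:
  "span_approx B K g \<Longrightarrow> \<epsilon> > 0 \<Longrightarrow>
    \<exists>l. snd ` set l \<subseteq> B \<and> (\<forall>x\<in>K. \<bar>g x - lincomb l x\<bar> \<le> \<epsilon>)"
  unfolding span_approx_def by blast

lemma lincomb_simps [simp]:
  "lincomb [] x = 0" "lincomb ((c, b) # l) x = c * b x + lincomb l x"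
  "lincomb (l @ l') x = lincomb l x + lincomb l' x"
  by (auto simp: lincomb_def)

lemma lincomb_mult_exists:
  assumes mult: "\<And>b b'. b \<in> B \<Longrightarrow> b' \<in> B \<Longrightarrow> (\<lambda>x. b x * b' x) \<in> B"
    and "snd ` set l \<subseteq> B" "snd ` set l' \<subseteq> B"
  shows "\<exists>m. snd ` set m \<subseteq> B \<and> (\<forall>x. lincomb m x = lincomb l x * lincomb l' x)"
  using assms(2)
proof (induction l)
  case Nil
  then show ?case by (intro exI[of _ "[]"]) auto
next
  case (Cons p l)
  obtain c b where p: "p = (c, b)" by force
  from Cons obtain m where m: "snd ` set m \<subseteq> B" "\<And>x. lincomb m x = lincomb l x * lincomb l' x"
    by auto
  have "lincomb (map (\<lambda>(c', b'). (c * c', \<lambda>x. b x * b' x)) l') x = c * b x * lincomb l' x" for x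
    by (induction l') (auto simp: algebra_simps)
  then show ?case
    using m p Cons.prems assms(3)
    by (intro exI[of _ "map (\<lambda>(c', b'). (c * c', \<lambda>x. b x * b' x)) l' @ m"])
      (auto simp: ring_distribs intro!: mult)
qed

lemma lincomb_bounded:
  assumes "\<And>b. b \<in> B \<Longrightarrow> \<exists>c. \<forall>x\<in>K. \<bar>b x\<bar> \<le> c" "snd ` set l \<subseteq> B"
  shows "\<exists>c::real. \<forall>x\<in>K. \<bar>lincomb l x\<bar> \<le> c"
  using assms(2)
proof (induction l)
  case Nil then show ?case by (intro exI[of _ 0]) auto
next
  case (Cons p l)
  obtain a b where p: "p = (a, b)" by force
  obtain c where c: "\<forall>x\<in>K. \<bar>lincomb l x\<bar> \<le> c" using Cons by auto
  obtain d where d: "\<forall>x\<in>K. \<bar>b x\<bar> \<le> d" using assms(1)[of b] Cons.prems p by auto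
  have "\<bar>lincomb (p # l) x\<bar> \<le> \<bar>a\<bar> * d + c" if "x \<in> K" for x
  proof -
    have "\<bar>a * b x + lincomb l x\<bar> \<le> \<bar>a\<bar> * \<bar>b x\<bar> + \<bar>lincomb l x\<bar>"
      by (metis abs_mult abs_triangle_ineq)
    also have "\<dots> \<le> \<bar>a\<bar> * d + c"
      using c d that by (intro add_mono mult_left_mono) auto
    finally show ?thesis by (simp add: p)
  qed
  then show ?case by blast
qed

lemma span_approx_generator: "b \<in> B \<Longrightarrow> span_approx B K b"
  unfolding span_approx_def by (auto intro!: exI[of _ "[(1, b)]"])

lemma span_approx_const: "(\<lambda>_. 1) \<in> B \<Longrightarrow> span_approx B K (\<lambda>_. c)"
  unfolding span_approx_def by (auto intro!: exI[of _ "[(c, \<lambda>_. 1)]"])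

lemma span_approx_add:
  assumes "span_approx B K f" "span_approx B K g"
  shows "span_approx B K (\<lambda>x. f x + g x)"
  unfolding span_approx_def
proof (intro allI impI)
  fix \<epsilon> :: real assume "\<epsilon> > 0"
  then obtain l l' where l: "snd ` set l \<subseteq> B" "\<forall>x\<in>K. \<bar>f x - lincomb l x\<bar> \<le> \<epsilon> / 2"
    and l': "snd ` set l' \<subseteq> B" "\<forall>x\<in>K. \<bar>g x - lincomb l' x\<bar> \<le> \<epsilon> / 2"
    using span_approxD[OF assms(1), of "\<epsilon> / 2"] span_approxD[OF assms(2), of "\<epsilon> / 2"] by auto
  have "\<bar>f x + g x - lincomb (l @ l') x\<bar> \<le> \<epsilon>" if "x \<in> K" for x
    using bspec[OF l(2) that] bspec[OF l'(2) that] unfolding lincomb_simps by linarith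
  then show "\<exists>l. snd ` set l \<subseteq> B \<and> (\<forall>x\<in>K. \<bar>f x + g x - lincomb l x\<bar> \<le> \<epsilon>)"
    using l(1) l'(1) by (intro exI[of _ "l @ l'"]) auto
qed

lemma span_approx_mult:
  assumes mult: "\<And>b b'. b \<in> B \<Longrightarrow> b' \<in> B \<Longrightarrow> (\<lambda>x. b x * b' x) \<in> B"
    and bdd: "\<And>b. b \<in> B \<Longrightarrow> \<exists>c. \<forall>x\<in>K. \<bar>b x\<bar> \<le> c"
    and f: "span_approx B K f" and g: "span_approx B K g"
  shows "span_approx B K (\<lambda>x. f x * g x)"
  unfolding span_approx_def
proof (intro allI impI)
  fix \<epsilon> :: real assume \<epsilon>: "\<epsilon> > 0"
  \<comment> \<open>This coarse approximation serves only to bound \<open>g\<close> on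
    \<open>K\<close>. The bound fixes the accuracy required for \<open>f\<close>, and the resulting
    combination for \<open>f\<close> is bounded in turn and fixes the accuracy required for
    \<open>g\<close>.\<close>
  obtain l0 where l0: "snd ` set l0 \<subseteq> B" "\<forall>x\<in>K. \<bar>g x - lincomb l0 x\<bar> \<le> 1"
    using span_approxD[OF g, of 1] by auto
  obtain c0 where c0: "\<forall>x\<in>K. \<bar>lincomb l0 x\<bar> \<le> c0" using lincomb_bounded[OF bdd l0(1)] by blast
  define C where "C = \<bar>c0\<bar> + 1"
  have C: "C > 0" "\<forall>x\<in>K. \<bar>g x\<bar> \<le> C"
    using bspec[OF c0] bspec[OF l0(2)] unfolding C_def by (auto, smt (verit))
  obtain l where l: "snd ` set l \<subseteq> B" "\<forall>x\<in>K. \<bar>f x - lincomb l x\<bar> \<le> \<epsilon> / (2 * C)"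
    using span_approxD[OF f, of "\<epsilon> / (2 * C)"] \<epsilon> C by auto
  obtain d0 where d0: "\<forall>x\<in>K. \<bar>lincomb l x\<bar> \<le> d0" using lincomb_bounded[OF bdd l(1)] by blast
  define D where "D = \<bar>d0\<bar> + 1"
  have D: "D > 0" "\<forall>x\<in>K. \<bar>lincomb l x\<bar> \<le> D"
    using bspec[OF d0] unfolding D_def by (auto, smt (verit))
  obtain l' where l': "snd ` set l' \<subseteq> B" "\<forall>x\<in>K. \<bar>g x - lincomb l' x\<bar> \<le> \<epsilon> / (2 * D)"
    using span_approxD[OF g, of "\<epsilon> / (2 * D)"] \<epsilon> D by auto
  obtain m where m: "snd ` set m \<subseteq> B" "\<And>x. lincomb m x = lincomb l x * lincomb l' x"
    using lincomb_mult_exists[OF mult l(1) l'(1)] by blast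
  have "\<bar>f x * g x - lincomb m x\<bar> \<le> \<epsilon>" if x: "x \<in> K" for x
  proof -
    have "f x * g x - lincomb m x = (f x - lincomb l x) * g x + lincomb l x * (g x - lincomb l' x)"
      by (simp add: m algebra_simps)
    also have "\<bar>\<dots>\<bar> \<le> \<bar>f x - lincomb l x\<bar> * \<bar>g x\<bar> + \<bar>lincomb l x\<bar> * \<bar>g x - lincomb l' x\<bar>"
      by (metis abs_mult abs_triangle_ineq)
    also have "\<dots> \<le> \<epsilon> / (2 * C) * C + D * (\<epsilon> / (2 * D))"
      using x l l' C D \<epsilon> by (intro add_mono mult_mono) auto
    also have "\<dots> = \<epsilon>" using C D by (simp add: field_simps)
    finally show ?thesis .
  qed
  then show "\<exists>l. snd ` set l \<subseteq> B \<and> (\<forall>x\<in>K. \<bar>f x * g x - lincomb l x\<bar> \<le> \<epsilon>)"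
    using m(1) by blast
qed

text \<open>The generators need not be continuous. Stone-Weierstrass is applied to the algebra of
  those continuous functions that lie in the uniform closure of the span, and only this algebra has
  to separate points. This makes indicators of boxes admissible as generators.\<close>

lemma Stone_Weierstrass_span:
  fixes K :: "'a::t2_space set"
  assumes K: "compact K" and one: "(\<lambda>_. 1) \<in> B"
    and mult: "\<And>b b'. b \<in> B \<Longrightarrow> b' \<in> B \<Longrightarrow> (\<lambda>x. b x * b' x) \<in> B"
    and bdd: "\<And>b. b \<in> B \<Longrightarrow> \<exists>c. \<forall>x\<in>K. \<bar>b x\<bar> \<le> c"
    and sep: "\<And>x y. x \<in> K \<Longrightarrow> y \<in> K \<Longrightarrow> x \<noteq> y \<Longrightarrow>
      \<exists>g. continuous_on K g \<and> span_approx B K g \<and> g x \<noteq> g y"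
    and f: "continuous_on K f"
  shows "span_approx B K f"
proof -
  interpret function_ring_on "{g. continuous_on K g \<and> span_approx B K g}" K
  proof
    show "\<exists>f\<in>{g. continuous_on K g \<and> span_approx B K g}. f x \<noteq> f y"
      if "x \<in> K" "y \<in> K" "x \<noteq> y" for x y
      using sep[OF that] by blast
  qed (use K in \<open>auto intro: continuous_intros span_approx_add span_approx_const[OF one]
      span_approx_mult[OF mult bdd]\<close>)
  show ?thesis
    unfolding span_approx_def
  proof (intro allI impI)
    fix \<epsilon> :: real assume \<epsilon>: "\<epsilon> > 0"
    obtain g where g: "span_approx B K g" "\<forall>x\<in>K. \<bar>f x - g x\<bar> < \<epsilon> / 2"
      using Stone_Weierstrass_basic[OF f, of "\<epsilon> / 2"] \<epsilon> by auto
    obtain l where l: "snd ` set l \<subseteq> B" "\<forall>x\<in>K. \<bar>g x - lincomb l x\<bar> \<le> \<epsilon> / 2"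
      using span_approxD[OF g(1), of "\<epsilon> / 2"] \<epsilon> by auto
    show "\<exists>l. snd ` set l \<subseteq> B \<and> (\<forall>x\<in>K. \<bar>f x - lincomb l x\<bar> \<le> \<epsilon>)"
    proof (intro exI[of _ l] conjI ballI)
      fix x assume "x \<in> K"
      then show "\<bar>f x - lincomb l x\<bar> \<le> \<epsilon>"
        using bspec[OF l(2)] bspec[OF g(2)] by (smt (verit) field_sum_of_halves)
    qed (rule l)
  qed
qed

section \<open>Convergence of random elements embedded in the Hilbert cube\<close>

lemma integral_abs_le_AE:
  fixes f g :: "'a \<Rightarrow> real"
  assumes "integrable M f" "integrable M g" "AE x in M. \<bar>f x\<bar> \<le> g x"
  shows "\<bar>\<integral>x. f x \<partial>M\<bar> \<le> (\<integral>x. g x \<partial>M)"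
proof -
  have "\<bar>\<integral>x. f x \<partial>M\<bar> \<le> (\<integral>x. \<bar>f x\<bar> \<partial>M)" by (rule integral_abs_bound)
  also have "\<dots> \<le> (\<integral>x. g x \<partial>M)" using assms by (intro integral_mono_AE) auto
  finally show ?thesis .
qed

text \<open>A random element may leave the space on a null set, where \<open>\<Phi>\<close> is
  arbitrary; hence the default value 0. It forces the case distinction on \<open>c\<close>: for
  negative \<open>c\<close> the level set also contains the event of leaving the space.\<close>

lemma random_element_measurable:
  assumes Z: "random_element T M Z" and \<Phi>: "continuous_map T euclideanreal \<Phi>"
  shows "(\<lambda>\<omega>. if Z \<omega> \<in> topspace T then \<Phi> (Z \<omega>) else 0) \<in> borel_measurable M"
  unfolding borel_measurable_iff_greater
proof
  fix c :: real
  let ?U = "{\<mu> \<in> topspace T. \<Phi> \<mu> \<in> {c<..}}"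
  have "openin T ?U" by (rule openin_continuous_map_preimage[OF \<Phi>]) simp
  then have 1: "{\<omega> \<in> space M. Z \<omega> \<in> ?U} \<in> sets M"
    using Z unfolding random_element_def by blast
  have 2: "{\<omega> \<in> space M. Z \<omega> \<in> topspace T} \<in> sets M"
    using Z unfolding random_element_def by blast
  show "{\<omega> \<in> space M. c < (if Z \<omega> \<in> topspace T then \<Phi> (Z \<omega>) else 0)} \<in> sets M"
  proof (cases "c < 0")
    case True
    then have "{\<omega> \<in> space M. c < (if Z \<omega> \<in> topspace T then \<Phi> (Z \<omega>) else 0)}
        = {\<omega> \<in> space M. Z \<omega> \<in> ?U} \<union> (space M - {\<omega> \<in> space M. Z \<omega> \<in> topspace T})" by auto
    then show ?thesis using 1 2 by auto
  next
    case False
    then have "{\<omega> \<in> space M. c < (if Z \<omega> \<in> topspace T then \<Phi> (Z \<omega>) else 0)}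
        = {\<omega> \<in> space M. Z \<omega> \<in> ?U}" by auto
    then show ?thesis using 1 by auto
  qed
qed

lemma set_integral_random_element:
  "(LINT \<omega>:{\<omega> \<in> space M. Z \<omega> \<in> topspace T}|M. \<Phi> (Z \<omega>))
    = (LINT \<omega>|M. (if Z \<omega> \<in> topspace T then \<Phi> (Z \<omega>) else (0::real)))"
  unfolding set_lebesgue_integral_def
  by (rule Bochner_Integration.integral_cong) (auto simp: indicator_def)

text \<open>The Moreau envelopes of \<open>\<Phi>\<close> along the embedding \<open>e\<close> are continuous functions on the
  Hilbert cube that increase to \<open>\<Phi>\<close>.\<close>

definition envelope :: "('m \<Rightarrow> nat \<Rightarrow> real) \<Rightarrow> 'm set \<Rightarrow> ('m \<Rightarrow> real) \<Rightarrow> nat \<Rightarrow> (nat \<Rightarrow> real) \<Rightarrow> real"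
  where "envelope e A \<Phi> m x = (INF \<mu>\<in>A. \<Phi> \<mu> + real m * dist x (e \<mu>))"

text \<open>An infimum of functions with Lipschitz constant \<open>real m\<close> has the same
  Lipschitz constant, and this on the whole product space rather than only on the image of
  \<open>e\<close>.\<close>

lemma envelope:
  assumes A: "A \<noteq> {}" and B: "\<forall>\<mu>\<in>A. \<bar>\<Phi> \<mu>\<bar> \<le> B"
  shows envelope_le: "\<mu> \<in> A \<Longrightarrow> envelope e A \<Phi> m x \<le> \<Phi> \<mu> + real m * dist x (e \<mu>)"
    and envelope_ge: "- B \<le> envelope e A \<Phi> m x"
    and envelope_continuous: "continuous_on UNIV (envelope e A \<Phi> m)"
proof -
  have bdd: "bdd_below ((\<lambda>\<mu>. \<Phi> \<mu> + real m * dist x (e \<mu>)) ` A)" for x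
    by (rule bdd_belowI2[of _ "- B"]) (use B in \<open>fastforce intro: add_increasing2\<close>)
  show le: "envelope e A \<Phi> m x \<le> \<Phi> \<mu> + real m * dist x (e \<mu>)" if "\<mu> \<in> A" for \<mu> x
    unfolding envelope_def by (rule cINF_lower[OF bdd that])
  show "- B \<le> envelope e A \<Phi> m x"
    unfolding envelope_def
    by (rule cINF_greatest[OF A]) (use B in \<open>fastforce intro: add_increasing2\<close>)
  have lip: "envelope e A \<Phi> m x \<le> envelope e A \<Phi> m y + real m * dist x y" for x y
  proof -
    have "envelope e A \<Phi> m x - real m * dist x y \<le> \<Phi> \<mu> + real m * dist y (e \<mu>)" if "\<mu> \<in> A" for \<mu>
    proof -
      have "real m * dist x (e \<mu>) \<le> real m * (dist x y + dist y (e \<mu>))"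
        by (intro mult_left_mono dist_triangle) auto
      then show ?thesis using le[OF that, of x] by (simp add: algebra_simps)
    qed
    then have "envelope e A \<Phi> m x - real m * dist x y \<le> envelope e A \<Phi> m y"
      unfolding envelope_def[of e A \<Phi> m y] by (intro cINF_greatest[OF A])
    then show ?thesis by simp
  qed
  have "\<bar>envelope e A \<Phi> m x - envelope e A \<Phi> m y\<bar> \<le> real m * dist x y" for x y
    using lip[of x y] lip[of y x] by (auto simp: dist_commute)
  then show "continuous_on UNIV (envelope e A \<Phi> m)"
    by (intro lipschitz_on_continuous_on[of "real m"] lipschitz_onI) (auto simp: dist_real_def)
qed

text \<open>Hypothesis \<open>near\<close> is lower semicontinuity of \<open>\<Phi>\<close> read off
  the coordinates. Nearby points cannot lower the infimum by much, and distant points are penalized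
  more than the oscillation of \<open>\<Phi>\<close> can compensate.\<close>

lemma envelope_tendsto:
  assumes A: "A \<noteq> {}" and B: "\<forall>\<mu>\<in>A. \<bar>\<Phi> \<mu>\<bar> \<le> B" and \<mu>: "\<mu> \<in> A"
    and near: "\<And>\<epsilon>. \<epsilon> > 0 \<Longrightarrow> \<exists>\<delta>>0. \<forall>\<mu>'\<in>A. dist (e \<mu>) (e \<mu>') < \<delta> \<longrightarrow> \<Phi> \<mu> - \<epsilon> < \<Phi> \<mu>'"
  shows "(\<lambda>m. envelope e A \<Phi> m (e \<mu>)) \<longlonglongrightarrow> \<Phi> \<mu>"
proof (rule LIMSEQ_I)
  fix r :: real assume "r > 0"
  then obtain \<delta> where \<delta>: "\<delta> > 0" "\<And>\<mu>'. \<mu>' \<in> A \<Longrightarrow> dist (e \<mu>) (e \<mu>') < \<delta> \<Longrightarrow> \<Phi> \<mu> - r / 2 < \<Phi> \<mu>'"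
    using near[of "r / 2"] by auto
  \<comment> \<open>From this index on, the penalty at distance \<open>\<delta>\<close> is at least
    \<open>2 * B\<close>, which bounds the oscillation of \<open>\<Phi>\<close>.\<close>
  obtain n where n: "real n > 2 * B / \<delta>" using reals_Archimedean2 by blast
  have "norm (envelope e A \<Phi> m (e \<mu>) - \<Phi> \<mu>) < r" if m: "m \<ge> n" for m
  proof -
    have "\<Phi> \<mu> - r / 2 \<le> \<Phi> \<mu>' + real m * dist (e \<mu>) (e \<mu>')" if \<mu>': "\<mu>' \<in> A" for \<mu>'
    proof (cases "dist (e \<mu>) (e \<mu>') < \<delta>")
      case True
      then show ?thesis using \<delta>(2)[OF \<mu>' True] by (simp add: add_increasing2)
    next
      case False
      have "2 * B \<le> real m * \<delta>"
        using n m \<delta>(1) by (simp add: divide_less_eq) (smt (verit) mult_right_mono of_nat_le_iff)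
      also have "\<dots> \<le> real m * dist (e \<mu>) (e \<mu>')" using False by (intro mult_left_mono) auto
      finally show ?thesis using bspec[OF B \<mu>] bspec[OF B \<mu>'] \<open>r > 0\<close> by linarith
    qed
    then have "\<Phi> \<mu> - r / 2 \<le> envelope e A \<Phi> m (e \<mu>)"
      unfolding envelope_def by (intro cINF_greatest[OF A])
    moreover have "envelope e A \<Phi> m (e \<mu>) \<le> \<Phi> \<mu>"
      using envelope_le[OF A B \<mu>, where x = "e \<mu>" and e = e and m = m] by simp
    ultimately show ?thesis using \<open>r > 0\<close> by simp
  qed
  then show "\<exists>n. \<forall>m\<ge>n. norm (envelope e A \<Phi> m (e \<mu>) - \<Phi> \<mu>) < r" by blast
qed

section \<open>Polynomials on the Hilbert cube\<close>

lemma compact_cube: "compact {x::nat \<Rightarrow> real. \<forall>i. x i \<in> {0..1}}"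
proof -
  have "compactin (product_topology (\<lambda>_. euclidean) UNIV) (PiE UNIV (\<lambda>_::nat. {0..1::real}))"
    by (subst compactin_PiE) auto
  then have "compact (PiE UNIV (\<lambda>_::nat. {0..1::real}))"
    by (simp add: euclidean_product_topology flip: compactin_euclidean_iff)
  also have "PiE UNIV (\<lambda>_::nat. {0..1::real}) = {x. \<forall>i. x i \<in> {0..1}}" by auto
  finally show ?thesis .
qed

text \<open>Repetitions in the list play the role of exponents, so that a product of monomials is a
  concatenation.\<close>

definition monomial :: "nat list \<Rightarrow> (nat \<Rightarrow> real) \<Rightarrow> real"
  where "monomial l x = (\<Prod>i\<leftarrow>l. x i)"

lemma continuous_on_cube_span:
  assumes f: "continuous_on UNIV f"
  shows "span_approx (range monomial) {x. \<forall>i. x i \<in> {0..1}} f"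
proof (rule Stone_Weierstrass_span[OF compact_cube])
  show "(\<lambda>_. 1) \<in> range monomial"
    by (intro image_eqI[of _ _ "[]"]) (auto simp: monomial_def)
  show "(\<lambda>x. b x * b' x) \<in> range monomial" if "b \<in> range monomial" "b' \<in> range monomial" for b b'
  proof -
    from that obtain l l' where "b = monomial l" "b' = monomial l'" by auto
    then show ?thesis by (intro image_eqI[of _ _ "l @ l'"]) (auto simp: monomial_def)
  qed
  show "\<exists>c. \<forall>x\<in>{x. \<forall>i. x i \<in> {0..1}}. \<bar>b x\<bar> \<le> c" if "b \<in> range monomial" for b
  proof -
    from that obtain l where b: "b = monomial l" by auto
    have "\<bar>monomial l x\<bar> \<le> 1" if "\<forall>i. x i \<in> {0..1}" for x
      using that by (induction l) (auto simp: monomial_def abs_mult intro!: mult_le_one)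
    then show ?thesis using b by auto
  qed
  fix x y :: "nat \<Rightarrow> real" assume "x \<noteq> y"
  then obtain i where "x i \<noteq> y i" by auto
  moreover have "monomial [i] = (\<lambda>x. x i)" by (auto simp: monomial_def)
  moreover have "span_approx (range monomial) {x. \<forall>i. x i \<in> {0..1}} (monomial [i])"
    by (rule span_approx_generator) auto
  ultimately show "\<exists>g. continuous_on {x. \<forall>i. x i \<in> {0..1}} g
      \<and> span_approx (range monomial) {x. \<forall>i. x i \<in> {0..1}} g \<and> g x \<noteq> g y"
    by (intro exI[of _ "\<lambda>x. x i"]) (auto intro: continuous_on_subset[OF continuous_on_product_coordinates])
qed (rule continuous_on_subset[OF f], simp)

text \<open>Monomials span a dense set of continuous functions on the compact cube. The values are
  required to lie in the cube at every point, so that a uniform approximation passes directly under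
  the integrals.\<close>

lemma cube_moments_imp_tendsto:
  fixes X :: "nat \<Rightarrow> 'w \<Rightarrow> nat \<Rightarrow> real" and Y :: "'v \<Rightarrow> nat \<Rightarrow> real"
    and f :: "(nat \<Rightarrow> real) \<Rightarrow> real"
  assumes "prob_space M" "prob_space M'"
    and [measurable]: "\<And>n. X n \<in> borel_measurable M" "Y \<in> borel_measurable M'"
    and X: "\<And>n \<omega> i. X n \<omega> i \<in> {0..1}" and Y: "\<And>\<omega> i. Y \<omega> i \<in> {0..1}"
    and lim: "\<And>l. (\<lambda>n. LINT \<omega>|M. monomial l (X n \<omega>)) \<longlonglongrightarrow> (LINT \<omega>|M'. monomial l (Y \<omega>))"
    and f: "continuous_on UNIV f"
  shows "(\<lambda>n. LINT \<omega>|M. f (X n \<omega>)) \<longlonglongrightarrow> (LINT \<omega>|M'. f (Y \<omega>))"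
proof (rule LIMSEQ_I)
  interpret M: prob_space M by fact
  interpret M': prob_space M' by fact
  fix r :: real assume "r > 0"
  let ?C = "{x::nat \<Rightarrow> real. \<forall>i. x i \<in> {0..1}}"
  obtain l where l: "snd ` set l \<subseteq> range monomial" "\<And>x. x \<in> ?C \<Longrightarrow> \<bar>f x - lincomb l x\<bar> \<le> r / 4"
    using span_approxD[OF continuous_on_cube_span[OF f], of "r / 4"] \<open>r > 0\<close> by auto
  have mono_cont: "continuous_on UNIV (monomial k)" for k
    unfolding monomial_def by (induction k) (auto intro!: continuous_intros)
  have [measurable]: "f \<in> borel_measurable borel" "monomial k \<in> borel_measurable borel" for k
    using f mono_cont by (auto intro: borel_measurable_continuous_onI)
  have bdd: "\<exists>c. \<forall>x\<in>?C. \<bar>g x\<bar> \<le> c" if "continuous_on UNIV g" for g :: "_ \<Rightarrow> real"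
    using compact_imp_bounded[OF compact_continuous_image[OF continuous_on_subset[OF that] compact_cube]]
    unfolding bounded_iff by auto
  have intX: "integrable M (\<lambda>\<omega>. g (X n \<omega>))" and intY: "integrable M' (\<lambda>\<omega>. g (Y \<omega>))"
    if g: "continuous_on UNIV g" for g :: "_ \<Rightarrow> real" and n
  proof -
    obtain c where c: "\<forall>x\<in>?C. \<bar>g x\<bar> \<le> c" using bdd[OF g] by blast
    have [measurable]: "g \<in> borel_measurable borel" using g by (rule borel_measurable_continuous_onI)
    show "integrable M (\<lambda>\<omega>. g (X n \<omega>))"
      by (rule M.integrable_const_bound[of _ c]) (use c X in auto)
    show "integrable M' (\<lambda>\<omega>. g (Y \<omega>))"
      by (rule M'.integrable_const_bound[of _ c]) (use c Y in auto)
  qed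
  have L: "continuous_on UNIV (lincomb l)
      \<and> (\<lambda>n. LINT \<omega>|M. lincomb l (X n \<omega>)) \<longlonglongrightarrow> (LINT \<omega>|M'. lincomb l (Y \<omega>))"
    using l(1)
  proof (induction l)
    case (Cons p l)
    obtain c k where p: "p = (c, monomial k)" using Cons.prems by (cases p) auto
    have IH: "continuous_on UNIV (lincomb l)"
      "(\<lambda>n. LINT \<omega>|M. lincomb l (X n \<omega>)) \<longlonglongrightarrow> (LINT \<omega>|M'. lincomb l (Y \<omega>))" using Cons by auto
    have "(\<lambda>n. c * (LINT \<omega>|M. monomial k (X n \<omega>)) + (LINT \<omega>|M. lincomb l (X n \<omega>)))
      \<longlonglongrightarrow> c * (LINT \<omega>|M'. monomial k (Y \<omega>)) + (LINT \<omega>|M'. lincomb l (Y \<omega>))"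
      by (intro tendsto_intros lim IH)
    then show ?case
      using intX[OF IH(1)] intY[OF IH(1)] intX[OF mono_cont] intY[OF mono_cont] IH(1) mono_cont
      by (auto simp: p intro!: continuous_intros)
  qed auto
  have X1: "\<bar>(LINT \<omega>|M. f (X n \<omega>)) - (LINT \<omega>|M. lincomb l (X n \<omega>))\<bar> \<le> r / 4" for n
  proof -
    have "\<bar>LINT \<omega>|M. f (X n \<omega>) - lincomb l (X n \<omega>)\<bar> \<le> (LINT \<omega>|M. r / 4)"
      by (rule integral_abs_le_AE) (use l(2) X intX[OF f] intX[of "lincomb l"] L in auto)
    then show ?thesis using intX[OF f] intX[of "lincomb l"] L by (simp add: M.prob_space)
  qed
  have Y1: "\<bar>(LINT \<omega>|M'. f (Y \<omega>)) - (LINT \<omega>|M'. lincomb l (Y \<omega>))\<bar> \<le> r / 4"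
  proof -
    have "\<bar>LINT \<omega>|M'. f (Y \<omega>) - lincomb l (Y \<omega>)\<bar> \<le> (LINT \<omega>|M'. r / 4)"
      by (rule integral_abs_le_AE) (use l(2) Y intY[OF f] intY[of "lincomb l"] L in auto)
    then show ?thesis using intY[OF f] intY[of "lincomb l"] L by (simp add: M'.prob_space)
  qed
  obtain N where N: "\<And>n. n \<ge> N \<Longrightarrow>
      norm ((LINT \<omega>|M. lincomb l (X n \<omega>)) - (LINT \<omega>|M'. lincomb l (Y \<omega>))) < r / 4"
    using LIMSEQ_D[OF conjunct2[OF L], of "r / 4"] \<open>r > 0\<close> by auto
  show "\<exists>N. \<forall>n\<ge>N. norm ((LINT \<omega>|M. f (X n \<omega>)) - (LINT \<omega>|M'. f (Y \<omega>))) < r"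
  proof (intro exI[of _ N] allI impI)
    fix n assume "n \<ge> N"
    then show "norm ((LINT \<omega>|M. f (X n \<omega>)) - (LINT \<omega>|M'. f (Y \<omega>))) < r"
      using N[of n] X1[of n] Y1 \<open>r > 0\<close> unfolding real_norm_def by linarith
  qed
qed

text \<open>Hypothesis \<open>emb\<close> is sequential continuity of the inverse of
  \<open>e\<close>. It makes every continuous \<open>\<Phi>\<close> lower semicontinuous in terms of
  the coordinates, so that envelopes approximate it from below. Applying this one-sided bound to
  \<open>\<Phi>\<close> and to \<open>- \<Phi>\<close> gives the limit, and \<open>\<Phi>\<close>
  never has to be extended to the cube.\<close>

lemma embedding_moments_imp_converges_weakly:
  fixes T :: "'m topology" and e :: "'m \<Rightarrow> nat \<Rightarrow> real"
  assumes "prob_space M" "prob_space M'"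
    and Z: "\<And>n. random_element T M (Z n)" and Z': "random_element T M' Z'"
    and e_cont: "\<And>i. continuous_map T euclideanreal (\<lambda>\<mu>. e \<mu> i)"
    and e_range: "\<And>\<mu> i. \<mu> \<in> topspace T \<Longrightarrow> e \<mu> i \<in> {0..1}"
    and emb: "\<And>\<mu>s \<mu> U. \<mu> \<in> topspace T \<Longrightarrow> (\<And>k. \<mu>s k \<in> topspace T) \<Longrightarrow>
      (\<And>i. (\<lambda>k. e (\<mu>s k) i) \<longlonglongrightarrow> e \<mu> i) \<Longrightarrow> openin T U \<Longrightarrow> \<mu> \<in> U \<Longrightarrow>
      eventually (\<lambda>k. \<mu>s k \<in> U) sequentially"
    and lim: "\<And>l. (\<lambda>n. LINT \<omega>|M. (if Z n \<omega> \<in> topspace T then monomial l (e (Z n \<omega>)) else 0))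
      \<longlonglongrightarrow> (LINT \<omega>|M'. (if Z' \<omega> \<in> topspace T then monomial l (e (Z' \<omega>)) else 0))"
  shows "converges_weakly T M Z M' Z'"
proof -
  interpret M: prob_space M by fact
  interpret M': prob_space M' by fact
  let ?A = "topspace T"
  have AE: "AE \<omega> in M. Z n \<omega> \<in> ?A" "AE \<omega> in M'. Z' \<omega> \<in> ?A" for n
    using Z Z' unfolding random_element_def by auto
  then have A: "?A \<noteq> {}" using M'.AE_False by (metis (mono_tags, lifting) AE_cong empty_iff)
  define X where "X n \<omega> = (\<lambda>i. if Z n \<omega> \<in> ?A then e (Z n \<omega>) i else 0)" for n \<omega>
  define Y where "Y \<omega> = (\<lambda>i. if Z' \<omega> \<in> ?A then e (Z' \<omega>) i else 0)" for \<omega>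
  have [measurable]: "X n \<in> borel_measurable M" "Y \<in> borel_measurable M'" for n
    unfolding X_def Y_def
    by (auto intro!: measurable_coordinatewise_then_product random_element_measurable Z Z' e_cont)
  have XA: "Z n \<omega> \<in> ?A \<Longrightarrow> X n \<omega> = e (Z n \<omega>)" for n \<omega>
    by (auto simp: X_def)
  have YA: "Z' \<omega> \<in> ?A \<Longrightarrow> Y \<omega> = e (Z' \<omega>)" for \<omega>
    by (auto simp: Y_def)
  have monomial_cont: "continuous_map T euclideanreal (\<lambda>\<mu>. monomial l (e \<mu>))" for l
    unfolding monomial_def by (induction l) (auto intro!: continuous_intros e_cont)
  have [measurable]: "monomial k \<in> borel_measurable borel" for k
    unfolding monomial_def by (rule borel_measurable_continuous_onI, induction k) (auto intro!: continuous_intros)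
  have lim': "(\<lambda>n. LINT \<omega>|M. f (X n \<omega>)) \<longlonglongrightarrow> (LINT \<omega>|M'. f (Y \<omega>))" if f: "continuous_on UNIV f" for f :: "(nat \<Rightarrow> real) \<Rightarrow> real"
  proof (rule cube_moments_imp_tendsto[where f = f and X = X and Y = Y, OF assms(1,2)])
    show "X n \<omega> i \<in> {0..1}" for n \<omega> i using e_range[of "Z n \<omega>" i] by (auto simp: X_def)
    show "Y \<omega> i \<in> {0..1}" for \<omega> i using e_range[of "Z' \<omega>" i] by (auto simp: Y_def)
    fix l
    have "(LINT \<omega>|M. monomial l (X n \<omega>)) = (LINT \<omega>|M. (if Z n \<omega> \<in> ?A then monomial l (e (Z n \<omega>)) else 0))" for n
      by (rule integral_cong_AE)
        (use AE(1)[of n] in \<open>auto intro!: random_element_measurable Z monomial_cont simp: XA elim: eventually_mono\<close>)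
    moreover have "(LINT \<omega>|M'. monomial l (Y \<omega>)) = (LINT \<omega>|M'. (if Z' \<omega> \<in> ?A then monomial l (e (Z' \<omega>)) else 0))"
      by (rule integral_cong_AE)
        (use AE(2) in \<open>auto intro!: random_element_measurable Z' monomial_cont simp: YA elim: eventually_mono\<close>)
    ultimately show "(\<lambda>n. LINT \<omega>|M. monomial l (X n \<omega>)) \<longlonglongrightarrow> (LINT \<omega>|M'. monomial l (Y \<omega>))"
      using lim by simp
  qed (use f in auto)
  \<comment> \<open>If this fails, points at distance below \<open>1 / Suc k\<close> violate it;
    their coordinates converge, which contradicts \<open>emb\<close> for the open set where
    \<open>\<Phi>\<close> exceeds \<open>\<Phi> \<mu> - \<epsilon>\<close>.\<close>
  have near: "\<exists>\<delta>>0. \<forall>\<mu>'\<in>?A. dist (e \<mu>) (e \<mu>') < \<delta> \<longrightarrow> \<Phi> \<mu> - \<epsilon> < \<Phi> \<mu>'"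
    if \<Phi>: "continuous_map T euclideanreal \<Phi>" and "\<epsilon> > 0" "\<mu> \<in> ?A" for \<Phi> \<epsilon> \<mu>
  proof (rule ccontr)
    assume neg: "\<not> ?thesis"
    have "\<exists>\<mu>'\<in>?A. dist (e \<mu>) (e \<mu>') < 1 / Suc k \<and> \<not> \<Phi> \<mu> - \<epsilon> < \<Phi> \<mu>'" for k :: nat
    proof -
      have "(0::real) < 1 / Suc k" by simp
      with neg show ?thesis by blast
    qed
    then obtain \<mu>s where \<mu>s: "\<And>k. \<mu>s k \<in> ?A" "\<And>k. dist (e \<mu>) (e (\<mu>s k)) < 1 / Suc k"
      "\<And>k. \<not> \<Phi> \<mu> - \<epsilon> < \<Phi> (\<mu>s k)" by metis
    have "(\<lambda>k. e (\<mu>s k)) \<longlonglongrightarrow> e \<mu>"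
    proof (rule metric_tendsto_imp_tendsto)
      show "(\<lambda>k. 1 / real (Suc k)) \<longlonglongrightarrow> 0" by (rule LIMSEQ_Suc[OF lim_1_over_n])
      show "\<forall>\<^sub>F k in sequentially. dist (e (\<mu>s k)) (e \<mu>) \<le> dist (1 / real (Suc k)) 0"
        using \<mu>s(2) by (intro always_eventually allI) (simp add: dist_commute less_imp_le)
    qed
    then have conv: "(\<lambda>k. e (\<mu>s k) i) \<longlonglongrightarrow> e \<mu> i" for i
      by (rule continuous_on_tendsto_compose[OF continuous_on_product_coordinates[of i]]) auto
    have "openin T {\<mu>' \<in> ?A. \<Phi> \<mu>' \<in> {\<Phi> \<mu> - \<epsilon><..}}"
      by (rule openin_continuous_map_preimage[OF \<Phi>]) simp
    from emb[OF \<open>\<mu> \<in> ?A\<close> \<mu>s(1) conv this] \<open>\<mu> \<in> ?A\<close> \<open>\<epsilon> > 0\<close>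
    have "eventually (\<lambda>k. \<mu>s k \<in> {\<mu>' \<in> ?A. \<Phi> \<mu>' \<in> {\<Phi> \<mu> - \<epsilon><..}}) sequentially" by simp
    then show False using \<mu>s(3) by (auto simp: eventually_sequentially)
  qed
  \<comment> \<open>The order of limits matters: \<open>m\<close> is fixed first so that the
    envelope nearly attains the integral of \<open>\<Phi>\<close> under the limit law; then
    \<open>n\<close> tends to infinity for this continuous envelope, which stays below
    \<open>\<Phi>\<close>.\<close>
  have lower: "eventually (\<lambda>n. (LINT \<omega>|M'. (if Z' \<omega> \<in> ?A then \<Phi> (Z' \<omega>) else 0)) - r
      < (LINT \<omega>|M. (if Z n \<omega> \<in> ?A then \<Phi> (Z n \<omega>) else 0))) sequentially"
    if \<Phi>: "continuous_map T euclideanreal \<Phi>" and B': "\<forall>\<mu>\<in>?A. \<bar>\<Phi> \<mu>\<bar> \<le> B" and "r > 0"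
    for \<Phi> B r
  proof -
    note B = bspec[OF B']
    let ?e = "envelope e ?A \<Phi>"
    have B0: "0 \<le> B" using A B by (metis abs_ge_zero all_not_in_conv order_trans)
    note env = envelope_le[where \<Phi> = \<Phi> and e = e, OF A B'] envelope_ge[where \<Phi> = \<Phi> and e = e, OF A B']
      envelope_continuous[where \<Phi> = \<Phi> and e = e, OF A B']
    have [measurable]: "?e m \<in> borel_measurable borel" for m
      using env(3) by (rule borel_measurable_continuous_onI)
    have env_e: "?e m (e \<mu>) \<le> \<Phi> \<mu>" if "\<mu> \<in> ?A" for m \<mu> using env(1)[OF that, where m = m and x = "e \<mu>"] by simp
    have bound: "\<bar>?e m (e \<mu>)\<bar> \<le> B" if "\<mu> \<in> ?A" for m \<mu>
      using env_e[OF that, of m] env(2)[where m = m and x = "e \<mu>"] B[OF that] by auto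
    have mZ: "(\<lambda>\<omega>. if Z n \<omega> \<in> ?A then \<Phi> (Z n \<omega>) else 0) \<in> borel_measurable M" for n
      by (rule random_element_measurable[OF Z \<Phi>])
    have mZ': "(\<lambda>\<omega>. if Z' \<omega> \<in> ?A then \<Phi> (Z' \<omega>) else 0) \<in> borel_measurable M'"
      by (rule random_element_measurable[OF Z' \<Phi>])
    have limm: "(\<lambda>m. LINT \<omega>|M'. ?e m (Y \<omega>)) \<longlonglongrightarrow> (LINT \<omega>|M'. (if Z' \<omega> \<in> ?A then \<Phi> (Z' \<omega>) else 0))"
    proof (rule integral_dominated_convergence[where w = "\<lambda>_. B"])
      show "AE \<omega> in M'. (\<lambda>m. ?e m (Y \<omega>)) \<longlonglongrightarrow> (if Z' \<omega> \<in> ?A then \<Phi> (Z' \<omega>) else 0)"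
        using AE(2)
      proof eventually_elim
        case (elim \<omega>)
        show ?case using envelope_tendsto[where \<Phi> = \<Phi> and e = e, OF A B' elim near[OF \<Phi> _ elim]] elim by (simp add: YA)
      qed
      show "AE \<omega> in M'. norm (?e m (Y \<omega>)) \<le> B" for m
        using AE(2) by eventually_elim (simp add: YA bound)
    qed (use mZ' in auto)
    have "eventually (\<lambda>m. (LINT \<omega>|M'. (if Z' \<omega> \<in> ?A then \<Phi> (Z' \<omega>) else 0)) - r < (LINT \<omega>|M'. ?e m (Y \<omega>))) sequentially"
      by (rule order_tendstoD(1)[OF limm]) (use \<open>r > 0\<close> in simp)
    then obtain m where m: "(LINT \<omega>|M'. (if Z' \<omega> \<in> ?A then \<Phi> (Z' \<omega>) else 0)) - r < (LINT \<omega>|M'. ?e m (Y \<omega>))"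
      by (auto simp: eventually_sequentially)
    have "eventually (\<lambda>n. (LINT \<omega>|M. ?e m (X n \<omega>)) > (LINT \<omega>|M'. (if Z' \<omega> \<in> ?A then \<Phi> (Z' \<omega>) else 0)) - r) sequentially"
      by (rule order_tendstoD(1)[OF lim'[OF env(3)] m])
    then show ?thesis
    proof eventually_elim
      case (elim n)
      have "(LINT \<omega>|M. ?e m (X n \<omega>)) \<le> (LINT \<omega>|M. (if Z n \<omega> \<in> ?A then \<Phi> (Z n \<omega>) else 0))"
      proof (rule integral_mono_AE)
        show "integrable M (\<lambda>\<omega>. ?e m (X n \<omega>))"
          by (rule M.integrable_const_bound[of _ B])
            (use AE(1)[of n] in \<open>auto elim!: eventually_mono simp: XA bound\<close>)
        show "integrable M (\<lambda>\<omega>. if Z n \<omega> \<in> ?A then \<Phi> (Z n \<omega>) else 0)"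
          by (rule M.integrable_const_bound[of _ B])
            (use mZ B B0 in \<open>auto intro!: AE_I2\<close>)
        show "AE \<omega> in M. ?e m (X n \<omega>) \<le> (if Z n \<omega> \<in> ?A then \<Phi> (Z n \<omega>) else 0)"
          using AE(1)[of n] by eventually_elim (simp add: XA env_e)
      qed
      with elim show ?case by simp
    qed
  qed
  show ?thesis
    unfolding converges_weakly_def set_integral_random_element
  proof (intro conjI allI impI Z Z')
    fix \<Phi> assume \<Phi>: "continuous_map T euclideanreal \<Phi> \<and> bounded (\<Phi> ` ?A)"
    then obtain B where B: "\<forall>\<mu>\<in>?A. \<bar>\<Phi> \<mu>\<bar> \<le> B" unfolding bounded_iff by auto
    have neg: "continuous_map T euclideanreal (\<lambda>\<mu>. - \<Phi> \<mu>)" using \<Phi> by (intro continuous_intros) auto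
    have minus: "(LINT \<omega>|N. (if W \<omega> \<in> ?A then - \<Phi> (W \<omega>) else 0)) = - (LINT \<omega>|N. (if W \<omega> \<in> ?A then \<Phi> (W \<omega>) else 0))"
      for N :: "'x measure" and W
      by (subst Bochner_Integration.integral_minus[symmetric]) (rule Bochner_Integration.integral_cong, auto)
    show "(\<lambda>n. LINT \<omega>|M. (if Z n \<omega> \<in> ?A then \<Phi> (Z n \<omega>) else 0))
        \<longlonglongrightarrow> (LINT \<omega>|M'. (if Z' \<omega> \<in> ?A then \<Phi> (Z' \<omega>) else 0))"
    proof (rule tendstoI)
      fix r :: real assume "r > 0"
      have "\<forall>\<mu>\<in>?A. \<bar>- \<Phi> \<mu>\<bar> \<le> B" using B by simp
      from lower[OF conjunct1[OF \<Phi>] B \<open>r > 0\<close>] lower[OF neg this \<open>r > 0\<close>]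
      show "\<forall>\<^sub>F n in sequentially. dist (LINT \<omega>|M. (if Z n \<omega> \<in> ?A then \<Phi> (Z n \<omega>) else 0))
        (LINT \<omega>|M'. (if Z' \<omega> \<in> ?A then \<Phi> (Z' \<omega>) else 0)) < r"
        unfolding minus by eventually_elim (simp add: dist_real_def abs_less_iff)
    qed
  qed
qed

section \<open>Laplace functionals and vague convergence\<close>

lemma test_functions_add:
  assumes "f \<in> test_functions S" "g \<in> test_functions S"
  shows "(\<lambda>x. f x + g x) \<in> test_functions S"
proof -
  obtain K K' where "compact K" "K \<subseteq> S" "\<forall>x\<in>S - K. f x = 0" "compact K'" "K' \<subseteq> S" "\<forall>x\<in>S - K'. g x = 0"
    using assms unfolding test_functions_def by auto
  then show ?thesis
    using assms unfolding test_functions_def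
    by (auto intro!: continuous_intros exI[of _ "K \<union> K'"] compact_Un)
qed

lemma test_functions_zero: "(\<lambda>_. 0) \<in> test_functions S"
  unfolding test_functions_def by (auto intro!: exI[of _ "{}"])

lemma continuous_map_vague_integral:
  assumes "f \<in> test_functions S"
  shows "continuous_map (vague_topology S) euclideanreal (\<lambda>\<mu>. \<integral>x. f x \<partial>\<mu>)"
  unfolding continuous_map_def topspace_vague_topology
proof (intro conjI allI impI)
  fix U :: "real set" assume "openin euclideanreal U"
  then show "openin (vague_topology S) {\<mu> \<in> point_measures S. (\<integral>x. f x \<partial>\<mu>) \<in> U}"
    unfolding vague_topology_def using assms by (intro topology_generated_by_Basis) auto
qed auto

lemma point_measuresD:
  assumes "\<mu> \<in> point_measures S"
  shows "sets \<mu> = sets (restrict_space borel S)" "space \<mu> = S"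
    "\<And>K. compact K \<Longrightarrow> K \<subseteq> S \<Longrightarrow> emeasure \<mu> K < \<infinity>"
proof -
  show *: "sets \<mu> = sets (restrict_space borel S)" "\<And>K. compact K \<Longrightarrow> K \<subseteq> S \<Longrightarrow> emeasure \<mu> K < \<infinity>"
    using assms unfolding point_measures_def by auto
  show "space \<mu> = S" using sets_eq_imp_space_eq[OF *(1)] by (simp add: space_restrict_space)
qed

section \<open>Integrals against sums of point masses\<close>

lemma integral_dirac_sum:
  assumes S: "S \<in> sets borel" and f: "continuous_on S f"
    and fin: "finite {i \<in> I. x i \<in> S \<and> f (x i) \<noteq> 0}"
  shows "(\<integral>y. f y \<partial>dirac_sum S I x) = (\<Sum>i | i \<in> I \<and> x i \<in> S \<and> f (x i) \<noteq> (0::real). f (x i))"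
proof -
  have "(\<integral>y. f y \<partial>dirac_sum S I x) = (\<integral>i. f (x i) \<partial>count_space {i \<in> I. x i \<in> S})"
    unfolding dirac_sum_def
    by (rule integral_distr) (auto simp: space_restrict_space intro: borel_measurable_continuous_on_restrict[OF f])
  also have "\<dots> = (\<Sum>i | i \<in> {i \<in> I. x i \<in> S} \<and> f (x i) \<noteq> 0. f (x i))"
    by (rule lebesgue_integral_count_space_finite_support) (use fin in \<open>simp add: conj_ac\<close>)
  finally show ?thesis by (simp add: conj_ac)
qed

text \<open>No finiteness is assumed: a divergent sum yields 0 on both sides, by
  \<open>enn2real\<close> and by the convention for non-integrable functions. The right-hand side
  depends measurably on the points.\<close>

lemma integral_dirac_sum_nat:
  fixes x :: "nat \<Rightarrow> 'a::topological_space"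
  assumes S: "S \<in> sets borel" and f: "continuous_on S f" and pos: "\<And>y. y \<in> S \<Longrightarrow> 0 \<le> f y"
  shows "(\<integral>y. f y \<partial>dirac_sum S I x)
    = enn2real (\<Sum>i. if i \<in> I then ennreal (indicator S (x i) * f (x i)) else 0)"
proof -
  have fm: "f \<in> borel_measurable (restrict_space borel S)"
    by (rule borel_measurable_continuous_on_restrict[OF f])
  have sp: "space (dirac_sum S I x) = S" unfolding dirac_sum_def by (simp add: space_restrict_space)
  have "(\<integral>y. f y \<partial>dirac_sum S I x) = enn2real (\<integral>\<^sup>+y. ennreal (f y) \<partial>dirac_sum S I x)"
    using fm pos sp by (intro integral_eq_nn_integral AE_I2) (auto simp: dirac_sum_def)
  also have "(\<integral>\<^sup>+y. ennreal (f y) \<partial>dirac_sum S I x)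
      = (\<integral>\<^sup>+i. ennreal (f (x i)) \<partial>count_space {i \<in> I. x i \<in> S})"
    unfolding dirac_sum_def using fm
    by (intro nn_integral_distr) (auto simp: space_restrict_space)
  also have "\<dots> = (\<integral>\<^sup>+i. ennreal (f (x i)) * indicator {i \<in> I. x i \<in> S} i \<partial>count_space UNIV)"
    by (rule nn_integral_count_space_indicator) simp
  also have "\<dots> = (\<Sum>i. ennreal (f (x i)) * indicator {i \<in> I. x i \<in> S} i)"
    by (rule nn_integral_count_space_nat)
  also have "\<dots> = (\<Sum>i. if i \<in> I then ennreal (indicator S (x i) * f (x i)) else 0)"
    by (intro suminf_cong) (auto simp: indicator_def)
  finally show ?thesis .
qed

section \<open>Countable families of test functions\<close>

text \<open>In \<open>dense\<close> the error is measured against one member of the family, chosen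
  before \<epsilon>. A uniform error would not be integrable against measures of infinite mass,
  whereas the integrals of that member converge and so stay bounded along a sequence. The sets
  \<open>KK m\<close> reduce local finiteness to countably many conditions.\<close>

locale vague_family =
  fixes S :: "'a::topological_space set" and fam :: "nat \<Rightarrow> 'a \<Rightarrow> real" and KK :: "nat \<Rightarrow> 'a set"
  assumes fam: "fam i \<in> test_functions S"
    and dense: "f \<in> test_functions S \<Longrightarrow> \<exists>m. \<forall>\<epsilon>>0. \<exists>l. snd ` set l \<subseteq> range fam \<and>
      (\<forall>x\<in>S. \<bar>f x - lincomb l x\<bar> \<le> \<epsilon> * fam m x)"
    and KK: "compact (KK m)" "KK m \<subseteq> S" "KK m \<in> sets borel"
    and exhaust: "compact K \<Longrightarrow> K \<subseteq> S \<Longrightarrow> \<exists>m. K \<subseteq> KK m"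
    and S_borel: "S \<in> sets borel"
begin

lemma test_integrable:
  assumes \<mu>: "\<mu> \<in> point_measures S" and f: "f \<in> test_functions S"
  shows "integrable \<mu> f"
proof -
  obtain K where K: "compact K" "K \<subseteq> S" "\<And>x. x \<in> S - K \<Longrightarrow> f x = 0" and fc: "continuous_on S f"
    using f unfolding test_functions_def by auto
  \<comment> \<open>In a general topological space a compact set need not be Borel, so the support
    is enlarged to a measurable compact set.\<close>
  obtain m where m: "K \<subseteq> KK m" using exhaust K by blast
  obtain c where c: "\<And>x. x \<in> K \<Longrightarrow> \<bar>f x\<bar> \<le> c"
    using compact_imp_bounded[OF compact_continuous_image[OF continuous_on_subset[OF fc K(2)] K(1)]]
    unfolding bounded_iff by auto
  note D = point_measuresD[OF \<mu>]
  have "integrable \<mu> (\<lambda>x. \<bar>c\<bar> * indicator (KK m) x :: real)"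
    using D(3)[OF KK(1,2)] KK[of m] S_borel D(1)
    by (intro integrable_mult_right integrable_real_indicator) (auto simp: sets_restrict_space_iff)
  moreover have "f \<in> borel_measurable \<mu>"
    using borel_measurable_continuous_on_restrict[OF fc] by (simp add: measurable_cong_sets[OF D(1) refl])
  moreover have "AE x in \<mu>. norm (f x) \<le> norm (\<bar>c\<bar> * indicator (KK m) x :: real)"
  proof (rule AE_I2)
    fix x assume "x \<in> space \<mu>"
    then show "norm (f x) \<le> norm (\<bar>c\<bar> * indicator (KK m) x :: real)"
      using c[of x] K(3)[of x] m D(2) by (cases "x \<in> K") (auto simp: subset_eq)
  qed
  ultimately show ?thesis by (rule Bochner_Integration.integrable_bound)
qed

text \<open>The exponential brings the coordinates into the unit interval and makes their
  expectations Laplace functionals.\<close>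

definition embed :: "'a measure \<Rightarrow> nat \<Rightarrow> real"
  where "embed \<mu> i = exp (- (\<integral>x. fam i x \<partial>\<mu>))"

lemma integral_test_tendsto:
  assumes \<mu>: "\<mu> \<in> point_measures S" and \<mu>s: "\<And>k. \<mu>s k \<in> point_measures S"
    and lim: "\<And>i. (\<lambda>k. \<integral>x. fam i x \<partial>\<mu>s k) \<longlonglongrightarrow> (\<integral>x. fam i x \<partial>\<mu>)"
    and f: "f \<in> test_functions S"
  shows "(\<lambda>k. \<integral>x. f x \<partial>\<mu>s k) \<longlonglongrightarrow> (\<integral>x. f x \<partial>\<mu>)"
proof -
  have lin: "(\<forall>\<nu>\<in>point_measures S. integrable \<nu> (lincomb l)) \<and>
      (\<lambda>k. \<integral>x. lincomb l x \<partial>\<mu>s k) \<longlonglongrightarrow> (\<integral>x. lincomb l x \<partial>\<mu>)" if "snd ` set l \<subseteq> range fam" for l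
    using that
  proof (induction l)
    case (Cons p l)
    obtain c i where p: "p = (c, fam i)" using Cons.prems by (cases p) auto
    have IH: "\<And>\<nu>. \<nu> \<in> point_measures S \<Longrightarrow> integrable \<nu> (lincomb l)"
      "(\<lambda>k. \<integral>x. lincomb l x \<partial>\<mu>s k) \<longlonglongrightarrow> (\<integral>x. lincomb l x \<partial>\<mu>)" using Cons by auto
    have int: "integrable \<nu> (lincomb (p # l))"
      "(\<integral>x. lincomb (p # l) x \<partial>\<nu>) = c * (\<integral>x. fam i x \<partial>\<nu>) + (\<integral>x. lincomb l x \<partial>\<nu>)"
      if "\<nu> \<in> point_measures S" for \<nu>
    proof -
      have "lincomb (p # l) = (\<lambda>x. c * fam i x + lincomb l x)" by (simp add: p fun_eq_iff)
      then show "integrable \<nu> (lincomb (p # l))"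
        "(\<integral>x. lincomb (p # l) x \<partial>\<nu>) = c * (\<integral>x. fam i x \<partial>\<nu>) + (\<integral>x. lincomb l x \<partial>\<nu>)"
        using IH(1)[OF that] test_integrable[OF that fam[of i]] by auto
    qed
    have "(\<lambda>k. c * (\<integral>x. fam i x \<partial>\<mu>s k) + (\<integral>x. lincomb l x \<partial>\<mu>s k))
        \<longlonglongrightarrow> c * (\<integral>x. fam i x \<partial>\<mu>) + (\<integral>x. lincomb l x \<partial>\<mu>)"
      by (intro tendsto_intros lim IH)
    then show ?case using int \<mu> \<mu>s by auto
  next
    case Nil
    have "lincomb [] = (\<lambda>_::'a. 0)" by (simp add: fun_eq_iff)
    then show ?case by simp
  qed
  show ?thesis
  proof (rule LIMSEQ_I)
    fix r :: real assume r: "r > 0"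
    have fam0: "fam i x \<ge> 0" if "x \<in> S" for i x using fam[of i] that unfolding test_functions_def by auto
    obtain m where m: "\<And>\<epsilon>. \<epsilon> > 0 \<Longrightarrow> \<exists>l. snd ` set l \<subseteq> range fam \<and> (\<forall>x\<in>S. \<bar>f x - lincomb l x\<bar> \<le> \<epsilon> * fam m x)"
      using dense[OF f] by blast
    \<comment> \<open>The integral of the dominating member is eventually below \<open>c\<close>
      along the sequence, so the approximation costs at most \<open>r / 4\<close> for
      \<open>\<mu>\<close> and for \<open>\<mu>s k\<close>; the third \<open>r / 4\<close> is the
      convergence for the fixed combination.\<close>
    define c where "c = (\<integral>x. fam m x \<partial>\<mu>) + 1"
    have "(\<integral>x. fam m x \<partial>\<mu>) \<ge> 0"
      using fam0 point_measuresD(2)[OF \<mu>] by (intro integral_nonneg_AE AE_I2) auto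
    then have c: "c > 0" unfolding c_def by simp
    have "r / (4 * c) > 0" using r c by simp
    from m[OF this] obtain l where l: "snd ` set l \<subseteq> range fam"
      "\<And>x. x \<in> S \<Longrightarrow> \<bar>f x - lincomb l x\<bar> \<le> r / (4 * c) * fam m x" by auto
    have bound: "\<bar>(\<integral>x. f x \<partial>\<nu>) - (\<integral>x. lincomb l x \<partial>\<nu>)\<bar> \<le> r / (4 * c) * (\<integral>x. fam m x \<partial>\<nu>)"
      if \<nu>: "\<nu> \<in> point_measures S" for \<nu>
    proof -
      have "\<bar>\<integral>x. f x - lincomb l x \<partial>\<nu>\<bar> \<le> (\<integral>x. r / (4 * c) * fam m x \<partial>\<nu>)"
        using test_integrable[OF \<nu> f] test_integrable[OF \<nu> fam[of m]] lin[OF l(1)] \<nu> l(2)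
          point_measuresD(2)[OF \<nu>]
        by (intro integral_abs_le_AE AE_I2) auto
      then show ?thesis using test_integrable[OF \<nu> f] lin[OF l(1)] \<nu> by simp
    qed
    have "(\<lambda>k. \<integral>x. lincomb l x \<partial>\<mu>s k) \<longlonglongrightarrow> (\<integral>x. lincomb l x \<partial>\<mu>)" using lin[OF l(1)] by blast
    from tendstoD[OF this, of "r / 4"] r
    have e1: "\<forall>\<^sub>F k in sequentially. \<bar>(\<integral>x. lincomb l x \<partial>\<mu>s k) - (\<integral>x. lincomb l x \<partial>\<mu>)\<bar> < r / 4"
      unfolding dist_real_def by simp
    have e2: "\<forall>\<^sub>F k in sequentially. (\<integral>x. fam m x \<partial>\<mu>s k) < c"
      by (rule order_tendstoD(2)[OF lim]) (simp add: c_def)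
    from e1 e2 have "\<forall>\<^sub>F k in sequentially. norm ((\<integral>x. f x \<partial>\<mu>s k) - (\<integral>x. f x \<partial>\<mu>)) < r"
    proof eventually_elim
      case (elim k)
      have "r / (4 * c) * (\<integral>x. fam m x \<partial>\<mu>s k) \<le> r / (4 * c) * c"
        using elim(2) r c by (intro mult_left_mono) auto
      moreover have "r / (4 * c) * (\<integral>x. fam m x \<partial>\<mu>) \<le> r / (4 * c) * c"
        using r c by (intro mult_left_mono) (auto simp: c_def)
      moreover have "r / (4 * c) * c = r / 4" using c by simp
      ultimately show ?case
        using elim(1) bound[OF \<mu>] bound[OF \<mu>s[of k]] r unfolding real_norm_def by linarith
    qed
    then show "\<exists>no. \<forall>n\<ge>no. norm ((\<integral>x. f x \<partial>\<mu>s n) - (\<integral>x. f x \<partial>\<mu>)) < r"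
      by (simp add: eventually_sequentially)
  qed
qed

text \<open>Since the vague topology is generated by integral conditions, it suffices to check
  subbasic sets: eventual membership passes to finite intersections and to unions.\<close>

lemma embed_vague:
  assumes \<mu>: "\<mu> \<in> point_measures S" and \<mu>s: "\<And>k. \<mu>s k \<in> point_measures S"
    and lim: "\<And>i. (\<lambda>k. embed (\<mu>s k) i) \<longlonglongrightarrow> embed \<mu> i"
    and U: "openin (vague_topology S) U" "\<mu> \<in> U"
  shows "eventually (\<lambda>k. \<mu>s k \<in> U) sequentially"
proof -
  have "(\<lambda>k. - ln (embed (\<mu>s k) i)) \<longlonglongrightarrow> - ln (embed \<mu> i)" for i
    by (intro tendsto_intros lim) (simp add: embed_def)
  then have "(\<lambda>k. \<integral>x. fam i x \<partial>\<mu>s k) \<longlonglongrightarrow> (\<integral>x. fam i x \<partial>\<mu>)" for i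
    by (simp add: embed_def)
  note conv = integral_test_tendsto[OF \<mu> \<mu>s this]
  have "generate_topology_on {{\<mu> \<in> point_measures S. (\<integral>x. f x \<partial>\<mu>) \<in> U} | f U. f \<in> test_functions S \<and> open U} U"
    using U(1) unfolding vague_topology_def by (simp add: openin_topology_generated_by_iff)
  then show ?thesis
    using U(2)
  proof (induction U)
    case (Int a b)
    then show ?case by (auto intro: eventually_conj)
  next
    case (UN K)
    then obtain k where "k \<in> K" "\<mu> \<in> k" by auto
    then show ?case using UN.IH[of k] by (auto elim: eventually_mono)
  next
    case (Basis s)
    then obtain f V where s: "s = {\<mu> \<in> point_measures S. (\<integral>x. f x \<partial>\<mu>) \<in> V}"
      "f \<in> test_functions S" "open V" by auto
    then show ?case using topological_tendstoD[OF conv[OF s(2)] s(3)] Basis.prems \<mu>s by auto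
  qed auto
qed

text \<open>The embedding is a homeomorphism onto its image. This is what makes random elements
  tractable: measurability with respect to an arbitrary vaguely open set reduces to measurability of
  countably many real coordinates.\<close>

lemma embed_open:
  assumes U: "openin (vague_topology S) U"
  shows "\<exists>O'. open O' \<and> (\<forall>\<mu>\<in>point_measures S. \<mu> \<in> U \<longleftrightarrow> embed \<mu> \<in> O')"
proof -
  have "\<exists>\<delta>>0. \<forall>\<nu>\<in>point_measures S. dist (embed \<mu>) (embed \<nu>) < \<delta> \<longrightarrow> \<nu> \<in> U"
    if \<mu>: "\<mu> \<in> U" "\<mu> \<in> point_measures S" for \<mu>
  proof (rule ccontr)
    assume neg: "\<not> ?thesis"
    have "\<exists>\<nu>\<in>point_measures S. dist (embed \<mu>) (embed \<nu>) < 1 / Suc k \<and> \<nu> \<notin> U" for k :: nat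
    proof -
      have "(0::real) < 1 / Suc k" by simp
      with neg show ?thesis by blast
    qed
    then obtain \<mu>s where \<mu>s: "\<And>k. \<mu>s k \<in> point_measures S"
      "\<And>k. dist (embed \<mu>) (embed (\<mu>s k)) < 1 / Suc k" "\<And>k. \<mu>s k \<notin> U" by metis
    have "(\<lambda>k. embed (\<mu>s k)) \<longlonglongrightarrow> embed \<mu>"
    proof (rule metric_tendsto_imp_tendsto)
      show "(\<lambda>k. 1 / real (Suc k)) \<longlonglongrightarrow> 0" by (rule LIMSEQ_Suc[OF lim_1_over_n])
      show "\<forall>\<^sub>F k in sequentially. dist (embed (\<mu>s k)) (embed \<mu>) \<le> dist (1 / real (Suc k)) 0"
        using \<mu>s(2) by (intro always_eventually allI) (simp add: dist_commute less_imp_le)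
    qed
    then have "(\<lambda>k. embed (\<mu>s k) i) \<longlonglongrightarrow> embed \<mu> i" for i
      by (rule continuous_on_tendsto_compose[OF continuous_on_product_coordinates[of i]]) auto
    from embed_vague[OF \<mu>(2) \<mu>s(1) this U \<mu>(1)] \<mu>s(3) show False
      by (auto simp: eventually_sequentially)
  qed
  then obtain \<delta> where \<delta>: "\<And>\<mu>. \<mu> \<in> U \<Longrightarrow> \<mu> \<in> point_measures S \<Longrightarrow> \<delta> \<mu> > 0"
    "\<And>\<mu> \<nu>. \<mu> \<in> U \<Longrightarrow> \<mu> \<in> point_measures S \<Longrightarrow> \<nu> \<in> point_measures S \<Longrightarrow>
      dist (embed \<mu>) (embed \<nu>) < \<delta> \<mu> \<Longrightarrow> \<nu> \<in> U"
    by metis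
  show ?thesis
    by (rule exI[of _ "\<Union>\<mu>\<in>U \<inter> point_measures S. ball (embed \<mu>) (\<delta> \<mu>)"]) (use \<delta> in force)
qed

text \<open>Monomials in the coordinates of the embedding are again Laplace functionals.\<close>

lemma Laplace_imp_converges_weakly:
  assumes "prob_space M" "prob_space M'"
    and Z: "\<And>n. random_element (vague_topology S) M (Z n)" and Z': "random_element (vague_topology S) M' Z'"
    and lim: "\<And>f. f \<in> test_functions S \<Longrightarrow>
      (\<lambda>n. LINT \<omega>|M. (if Z n \<omega> \<in> point_measures S then exp (- (\<integral>x. f x \<partial>Z n \<omega>)) else 0))
      \<longlonglongrightarrow> (LINT \<omega>|M'. (if Z' \<omega> \<in> point_measures S then exp (- (\<integral>x. f x \<partial>Z' \<omega>)) else 0))"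
  shows "converges_weakly (vague_topology S) M Z M' Z'"
proof (rule embedding_moments_imp_converges_weakly[where e = embed, OF assms(1,2) Z Z'])
  show "continuous_map (vague_topology S) euclideanreal (\<lambda>\<mu>. embed \<mu> i)" for i
  proof -
    have "continuous_map euclideanreal euclideanreal (\<lambda>x. exp (- x :: real))"
      by (simp add: continuous_intros)
    from continuous_map_compose[OF continuous_map_vague_integral[OF fam[of i]] this]
    show ?thesis by (simp add: embed_def o_def)
  qed
  show "embed \<mu> i \<in> {0..1}" if "\<mu> \<in> topspace (vague_topology S)" for \<mu> i
  proof -
    have "(\<integral>x. fam i x \<partial>\<mu>) \<ge> 0"
      using fam[of i] that point_measuresD(2)[of \<mu> S]
      by (intro integral_nonneg_AE AE_I2) (auto simp: topspace_vague_topology test_functions_def)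
    then show ?thesis by (simp add: embed_def)
  qed
  fix l :: "nat list"
  define f where "f x = (\<Sum>i\<leftarrow>l. fam i x)" for x
  have "(\<lambda>x. \<Sum>i\<leftarrow>l. fam i x) \<in> test_functions S \<and>
    (\<forall>\<mu>\<in>point_measures S. monomial l (embed \<mu>) = exp (- (\<integral>x. (\<Sum>i\<leftarrow>l. fam i x) \<partial>\<mu>)))"
  proof (induction l)
    case (Cons i l)
    then have t: "(\<lambda>x. \<Sum>i\<leftarrow>l. fam i x) \<in> test_functions S" by blast
    have "monomial (i # l) (embed \<mu>) = exp (- (\<integral>x. (\<Sum>i\<leftarrow>i # l. fam i x) \<partial>\<mu>))"
      if \<mu>: "\<mu> \<in> point_measures S" for \<mu>
    proof -
      have "monomial (i # l) (embed \<mu>) = exp (- (\<integral>x. fam i x \<partial>\<mu>)) * exp (- (\<integral>x. (\<Sum>i\<leftarrow>l. fam i x) \<partial>\<mu>))"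
        using Cons \<mu> by (simp add: monomial_def embed_def)
      also have "\<dots> = exp (- (\<integral>x. fam i x + (\<Sum>i\<leftarrow>l. fam i x) \<partial>\<mu>))"
        using test_integrable[OF \<mu> t] test_integrable[OF \<mu> fam[of i]] by (simp flip: exp_add)
      finally show ?thesis by simp
    qed
    then show ?case using test_functions_add[OF fam[of i] t] by simp
  qed (auto simp: monomial_def test_functions_zero)
  then have f: "f \<in> test_functions S" "\<And>\<mu>. \<mu> \<in> point_measures S \<Longrightarrow> monomial l (embed \<mu>) = exp (- (\<integral>x. f x \<partial>\<mu>))"
    unfolding f_def[abs_def] by auto
  show "(\<lambda>n. LINT \<omega>|M. (if Z n \<omega> \<in> topspace (vague_topology S) then monomial l (embed (Z n \<omega>)) else 0))
      \<longlonglongrightarrow> (LINT \<omega>|M'. (if Z' \<omega> \<in> topspace (vague_topology S) then monomial l (embed (Z' \<omega>)) else 0))"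
    using lim[OF f(1)] by (simp add: topspace_vague_topology f(2) cong: if_cong)
qed (use embed_vague in \<open>auto simp: topspace_vague_topology\<close>)

text \<open>Masses of sums of point masses are counts, so only local finiteness is at stake, and the
  sets \<open>KK m\<close> exhaust all compact sets. The countable criterion makes this event
  measurable.\<close>

lemma dirac_sum_in_point_measures_iff:
  "dirac_sum S I x \<in> point_measures S \<longleftrightarrow> (\<forall>m. finite {i \<in> I. x i \<in> KK m})"
proof
  have KKs: "KK m \<in> sets (restrict_space borel S)" for m
    using KK[of m] S_borel by (simp add: sets_restrict_space_iff)
  have em: "emeasure (dirac_sum S I x) (KK m) < \<infinity> \<longleftrightarrow> finite {i \<in> I. x i \<in> KK m}" for m
    by (subst emeasure_dirac_sum[OF KKs]) (simp add: emeasure_count_space of_nat_less_top)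
  show "\<forall>m. finite {i \<in> I. x i \<in> KK m}" if "dirac_sum S I x \<in> point_measures S"
    using point_measuresD(3)[OF that KK(1,2)] em by blast
  assume fin: "\<forall>m. finite {i \<in> I. x i \<in> KK m}"
  have sets: "sets (dirac_sum S I x) = sets (restrict_space borel S)" by (simp add: dirac_sum_def)
  have "emeasure (dirac_sum S I x) A \<in> insert \<infinity> (range of_nat)"
    if "A \<in> sets (restrict_space borel S)" for A
    using that by (subst emeasure_dirac_sum) (auto simp: emeasure_count_space)
  moreover have "emeasure (dirac_sum S I x) K < \<infinity>" if "compact K" "K \<subseteq> S" for K
  proof -
    obtain m where "K \<subseteq> KK m" using exhaust \<open>compact K\<close> \<open>K \<subseteq> S\<close> by blast
    then have "emeasure (dirac_sum S I x) K \<le> emeasure (dirac_sum S I x) (KK m)"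
      using KKs[of m] sets by (intro emeasure_mono) auto
    then show ?thesis using em fin by (meson le_less_trans)
  qed
  ultimately show "dirac_sum S I x \<in> point_measures S"
    unfolding point_measures_def using sets by auto
qed

lemma random_element_dirac_sum:
  fixes x :: "nat \<Rightarrow> 'w \<Rightarrow> 'a"
  assumes [measurable]: "\<And>i. i \<in> I \<Longrightarrow> x i \<in> borel_measurable M"
    and AE: "AE \<omega> in M. dirac_sum S I (\<lambda>i. x i \<omega>) \<in> point_measures S"
  shows "random_element (vague_topology S) M (\<lambda>\<omega>. dirac_sum S I (\<lambda>i. x i \<omega>))"
  unfolding random_element_def topspace_vague_topology
proof (intro conjI allI impI AE)
  let ?Z = "\<lambda>\<omega>. dirac_sum S I (\<lambda>i. x i \<omega>)"
  have meas: "(\<lambda>\<omega>. \<Sum>i. if i \<in> I then ennreal (g (x i \<omega>)) else 0) \<in> borel_measurable M"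
    if g: "g \<in> borel_measurable borel" for g
  proof (rule borel_measurable_suminf_order)
    fix i show "(\<lambda>\<omega>. if i \<in> I then ennreal (g (x i \<omega>)) else 0) \<in> borel_measurable M"
      using g measurable_compose[OF assms(1) g] by (cases "i \<in> I") auto
  qed
  have "(\<Sum>i. if i \<in> I then ennreal (indicator (KK m) (y i)) else 0) = emeasure (count_space UNIV) {i \<in> I. y i \<in> KK m}"
    for m and y :: "nat \<Rightarrow> 'a"
  proof -
    have "emeasure (count_space UNIV) {i \<in> I. y i \<in> KK m}
        = (\<integral>\<^sup>+i. indicator {i \<in> I. y i \<in> KK m} i \<partial>count_space UNIV)" by simp
    also have "\<dots> = (\<Sum>i. indicator {i \<in> I. y i \<in> KK m} i)" by (rule nn_integral_count_space_nat)
    finally show ?thesis by (auto intro!: suminf_cong simp: indicator_def)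
  qed
  then have PM: "?Z \<omega> \<in> point_measures S \<longleftrightarrow>
      (\<forall>m. (\<Sum>i. if i \<in> I then ennreal (indicator (KK m) (x i \<omega>)) else 0) < \<infinity>)" for \<omega>
    by (simp add: dirac_sum_in_point_measures_iff emeasure_count_space of_nat_less_top)
  have [measurable]: "(\<lambda>\<omega>. \<Sum>i. if i \<in> I then ennreal (indicator (KK m) (x i \<omega>)) else 0) \<in> borel_measurable M" for m
    using KK(3) by (intro meas) simp
  have [measurable]: "{\<omega> \<in> space M. ?Z \<omega> \<in> point_measures S} \<in> sets M"
    unfolding PM by measurable
  have famS: "continuous_on S (fam i)" "\<And>y. y \<in> S \<Longrightarrow> 0 \<le> fam i y" for i
    using fam[of i] by (auto simp: test_functions_def)
  \<comment> \<open>By the conventions for divergent sums, \<open>E\<close> agrees with the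
    embedding at every point, also where the process is not locally finite, and \<open>E\<close> is
    measurable as a series.\<close>
  define E where "E \<omega> i = exp (- enn2real (\<Sum>j. if j \<in> I then ennreal (indicator S (x j \<omega>) * fam i (x j \<omega>)) else 0))" for \<omega> i
  have E: "E \<omega> = embed (?Z \<omega>)" for \<omega>
    unfolding E_def embed_def using integral_dirac_sum_nat[OF S_borel famS] by auto
  have famm: "(\<lambda>y. indicator S y * fam i y) \<in> borel_measurable borel" for i
    using borel_measurable_continuous_on_indicator[OF S_borel famS(1)] by simp
  have [measurable]: "E \<in> borel_measurable M"
    unfolding E_def using meas[OF famm] by (intro measurable_coordinatewise_then_product) auto
  fix U assume "openin (vague_topology S) U"
  then obtain O' where O': "open O'" "\<And>\<mu>. \<mu> \<in> point_measures S \<Longrightarrow> \<mu> \<in> U \<longleftrightarrow> embed \<mu> \<in> O'"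
    and "U \<subseteq> point_measures S"
    using embed_open openin_subset topspace_vague_topology by metis
  then have "{\<omega> \<in> space M. ?Z \<omega> \<in> U} = {\<omega> \<in> space M. ?Z \<omega> \<in> point_measures S} \<inter> (E -` O' \<inter> space M)"
    using E by auto
  also have "\<dots> \<in> sets M" using O'(1) by measurable
  finally show "{\<omega> \<in> space M. ?Z \<omega> \<in> U} \<in> sets M" .
qed

end

section \<open>Laplace functionals of marked Poisson processes\<close>

lemma sums_poisson_mean: "(\<lambda>k. real k * (x ^ k / fact k)) sums (x * exp x)"
proof -
  have "(\<lambda>k. x * (x ^ k / fact k)) sums (x * exp x)"
    using exp_converges[of x] by (intro sums_mult) (simp add: divide_inverse mult.commute)
  moreover have "x * (x ^ k / fact k) = real (Suc k) * (x ^ Suc k / fact (Suc k))" for k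
    by (simp add: field_simps del: of_nat_Suc)
  ultimately have "(\<lambda>k. real (Suc k) * (x ^ Suc k / fact (Suc k))) sums (x * exp x)" by simp
  then show ?thesis using sums_Suc_iff[of "\<lambda>k. real k * (x ^ k / fact k)" "x * exp x"] by simp
qed

text \<open>Independence of the generated sigma-algebras makes the joint law a product, so Fubini
  applies. Both integrals are kept over \<open>M\<close>, which later allows the marks to be
  integrated out with the arrival times held fixed.\<close>

lemma (in prob_space) nn_integral_indep_pair:
  assumes [measurable]: "X \<in> measurable M P" "T \<in> measurable M Q"
    and ind: "indep_set (sets (vimage_algebra (space M) X P)) (sets (vimage_algebra (space M) T Q))"
    and [measurable]: "f \<in> borel_measurable (P \<Otimes>\<^sub>M Q)"
  shows "(\<integral>\<^sup>+\<omega>. f (X \<omega>, T \<omega>) \<partial>M) = (\<integral>\<^sup>+\<omega>'. \<integral>\<^sup>+\<omega>. f (X \<omega>, T \<omega>') \<partial>M \<partial>M)"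
proof -
  interpret P: prob_space "distr M P X" by (rule prob_space_distr) simp
  interpret Q: prob_space "distr M Q T" by (rule prob_space_distr) simp
  interpret PQ: pair_prob_space "distr M P X" "distr M Q T" ..
  have eq: "distr M P X \<Otimes>\<^sub>M distr M Q T = distr M (P \<Otimes>\<^sub>M Q) (\<lambda>\<omega>. (X \<omega>, T \<omega>))"
  proof (rule pair_measure_eqI)
    fix A B assume "A \<in> sets (distr M P X)" "B \<in> sets (distr M Q T)"
    then have AB [measurable]: "A \<in> sets P" "B \<in> sets Q" by auto
    have "prob ((X -` A \<inter> space M) \<inter> (T -` B \<inter> space M)) = prob (X -` A \<inter> space M) * prob (T -` B \<inter> space M)"
      by (rule indep_setD[OF ind]) (auto intro!: in_vimage_algebra)
    moreover have "(\<lambda>\<omega>. (X \<omega>, T \<omega>)) -` (A \<times> B) \<inter> space M = (X -` A \<inter> space M) \<inter> (T -` B \<inter> space M)" by auto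
    ultimately show "emeasure (distr M P X) A * emeasure (distr M Q T) B
        = emeasure (distr M (P \<Otimes>\<^sub>M Q) (\<lambda>\<omega>. (X \<omega>, T \<omega>))) (A \<times> B)"
      by (simp add: emeasure_distr emeasure_eq_measure ennreal_mult'')
  qed (auto intro: P.sigma_finite_measure Q.sigma_finite_measure P.sigma_finite_measure_axioms Q.sigma_finite_measure_axioms)
  have "(\<integral>\<^sup>+\<omega>. f (X \<omega>, T \<omega>) \<partial>M) = (\<integral>\<^sup>+z. f z \<partial>(distr M P X \<Otimes>\<^sub>M distr M Q T))"
    unfolding eq by (simp add: nn_integral_distr)
  also have "\<dots> = (\<integral>\<^sup>+y. \<integral>\<^sup>+x. f (x, y) \<partial>distr M P X \<partial>distr M Q T)"
    by (rule PQ.nn_integral_snd[symmetric]) simp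
  also have "\<dots> = (\<integral>\<^sup>+\<omega>'. \<integral>\<^sup>+x. f (x, T \<omega>') \<partial>distr M P X \<partial>M)"
    by (subst nn_integral_distr) simp_all
  also have "\<dots> = (\<integral>\<^sup>+\<omega>'. \<integral>\<^sup>+\<omega>. f (X \<omega>, T \<omega>') \<partial>M \<partial>M)"
  proof (rule nn_integral_cong)
    fix \<omega>' assume "\<omega>' \<in> space M"
    then have [measurable]: "T \<omega>' \<in> space Q" using measurable_space[of T M Q] by simp
    show "(\<integral>\<^sup>+x. f (x, T \<omega>') \<partial>distr M P X) = (\<integral>\<^sup>+\<omega>. f (X \<omega>, T \<omega>') \<partial>M)"
      by (subst nn_integral_distr) simp_all
  qed
  finally show ?thesis .
qed

locale marked_poisson = prob_space M for M :: "'v measure" +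
  fixes N :: "'x::topological_space measure" and X :: "nat \<Rightarrow> 'v \<Rightarrow> 'x" and T :: "nat \<Rightarrow> 'v \<Rightarrow> real"
  assumes X_indep: "indep_vars (\<lambda>_. borel) X UNIV"
    and X_distr: "distr M borel (X i) = N"
    and T: "unit_poisson_points M T"
    and XT: "indep_set
      (sets (vimage_algebra (space M) (\<lambda>\<omega> i. X i \<omega>) (\<Pi>\<^sub>M i\<in>UNIV. borel)))
      (sets (vimage_algebra (space M) (\<lambda>\<omega> i. T i \<omega>) (\<Pi>\<^sub>M i\<in>UNIV. borel)))"
begin

lemma measurable_X [measurable]: "X i \<in> borel_measurable M"
  using X_indep unfolding indep_vars_def by auto

lemma measurable_T [measurable]: "T i \<in> borel_measurable M"
  using T unfolding unit_poisson_points_def by auto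

lemma sets_N [measurable_cong]: "sets N = sets borel"
  using X_distr[of 0] by (metis sets_distr)

lemma prob_space_N: "prob_space N"
  using prob_space_distr[OF measurable_X[of 0]] X_distr[of 0] by simp

lemma T_pos: "AE \<omega> in M. \<forall>i. 0 < T i \<omega>"
proof -
  have "AE \<omega> in M. 0 < T 0 \<omega> \<and> strict_mono (\<lambda>i. T i \<omega>)"
    using T unfolding unit_poisson_points_def by auto
  then show ?thesis
  proof eventually_elim
    case (elim \<omega>)
    then show ?case by (metis less_eq_nat.simps(1) order_less_le_trans strict_mono_less_eq)
  qed
qed

lemma measurable_point_count [measurable]: "A \<in> sets borel \<Longrightarrow> point_count T A \<in> borel_measurable M"
proof -
  assume [measurable]: "A \<in> sets borel"
  have "point_count T A \<omega> = (\<Sum>i. indicator A (T i \<omega>))" for \<omega>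
  proof -
    have "point_count T A \<omega> = (\<integral>\<^sup>+i. indicator {i. T i \<omega> \<in> A} i \<partial>count_space UNIV)"
      by (simp add: point_count_def)
    also have "\<dots> = (\<Sum>i. indicator {i. T i \<omega> \<in> A} i)" by (rule nn_integral_count_space_nat)
    finally show ?thesis by (auto intro!: suminf_cong simp: indicator_def)
  qed
  then have "point_count T A = (\<lambda>\<omega>. \<Sum>i. indicator A (T i \<omega>))" by auto
  then show ?thesis by simp
qed

lemma point_count_law:
  assumes "0 \<le> s" "s < t"
  shows "prob {\<omega> \<in> space M. point_count T {s<..t} \<omega> = of_nat k} = (t - s) ^ k / fact k * exp (- (t - s))"
proof -
  have "prob {\<omega> \<in> space M. point_count T {s<..t} \<omega> = of_nat k} = pmf (poisson_pmf (t - s)) k"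
    using T assms unfolding unit_poisson_points_def by blast
  then show ?thesis using assms by (simp add: pmf_poisson)
qed

text \<open>The Poisson probabilities of the finite counts already sum to 1, leaving no mass for an
  infinite count.\<close>

lemma point_count_finite:
  assumes "0 \<le> s" "s < t"
  shows "AE \<omega> in M. \<exists>k::nat. point_count T {s<..t} \<omega> = of_nat k"
proof -
  let ?A = "\<lambda>k. {\<omega> \<in> space M. point_count T {s<..t} \<omega> = of_nat k}"
  have "(\<lambda>k. prob (?A k)) sums prob (\<Union>k. ?A k)"
    by (rule finite_measure_UNION) (auto simp: disjoint_family_on_def)
  moreover have "(\<lambda>k. prob (?A k)) sums (exp (t - s) * exp (- (t - s)))"
    unfolding point_count_law[OF assms]
    using exp_converges[of "t - s"] by (intro sums_mult2) (simp add: divide_inverse mult.commute)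
  ultimately have "prob (\<Union>k. ?A k) = 1"
    using sums_unique2 by (fastforce simp flip: exp_add)
  then have "AE \<omega> in M. \<omega> \<in> (\<Union>k. ?A k)" by (subst (asm) prob_eq_1) auto
  then show ?thesis by eventually_elim auto
qed

lemma point_count_eq_of_nat:
  "point_count T A \<omega> = of_nat k \<longleftrightarrow> finite {i. T i \<omega> \<in> A} \<and> card {i. T i \<omega> \<in> A} = k"
  by (auto simp: point_count_def emeasure_count_space)

lemma finite_points: "AE \<omega> in M. \<forall>a::nat. finite {i. T i \<omega> \<in> {0<..real a}}"
proof (subst AE_all_countable, intro allI)
  fix a :: nat
  show "AE \<omega> in M. finite {i. T i \<omega> \<in> {0<..real a}}"
  proof (cases "a = 0")
    case False
    then have "AE \<omega> in M. \<exists>k::nat. point_count T {0<..real a} \<omega> = of_nat k" by (intro point_count_finite) auto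
    then show ?thesis by eventually_elim (auto simp only: point_count_eq_of_nat)
  qed auto
qed

lemma nn_integral_point_count:
  assumes "0 \<le> s" "s < t" and f: "\<And>k. 0 \<le> f k"
    and S: "(\<lambda>k. f k * ((t - s) ^ k / fact k * exp (- (t - s)))) sums S"
  shows "(\<integral>\<^sup>+\<omega>. ennreal (f (card {i. T i \<omega> \<in> {s<..t}})) \<partial>M) = ennreal S"
proof -
  let ?A = "\<lambda>k. {\<omega> \<in> space M. point_count T {s<..t} \<omega> = of_nat k}"
  have "(\<integral>\<^sup>+\<omega>. ennreal (f (card {i. T i \<omega> \<in> {s<..t}})) \<partial>M)
      = (\<integral>\<^sup>+\<omega>. (\<Sum>k. ennreal (f k) * indicator (?A k) \<omega>) \<partial>M)"
  proof (rule nn_integral_cong_AE)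
    show "AE \<omega> in M. ennreal (f (card {i. T i \<omega> \<in> {s<..t}})) = (\<Sum>k. ennreal (f k) * indicator (?A k) \<omega>)"
      using point_count_finite[OF assms(1,2)] AE_space
    proof eventually_elim
      case (elim \<omega>)
      then obtain k where k: "point_count T {s<..t} \<omega> = of_nat k" by blast
      have "(\<Sum>j. ennreal (f j) * indicator (?A j) \<omega>) = (\<Sum>j\<in>{k}. ennreal (f j) * indicator (?A j) \<omega>)"
        by (rule suminf_finite) (use k in \<open>auto simp: indicator_def\<close>)
      then show ?case using k elim(2) by (simp add: point_count_eq_of_nat indicator_def)
    qed
  qed
  also have "\<dots> = (\<Sum>k. ennreal (f k) * emeasure M (?A k))"
    by (subst nn_integral_suminf) (auto simp: nn_integral_cmult)
  also have "\<dots> = (\<Sum>k. ennreal (f k * ((t - s) ^ k / fact k * exp (- (t - s)))))"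
    unfolding emeasure_eq_measure point_count_law[OF assms(1,2)]
    using f assms(2) by (intro suminf_cong ennreal_mult[symmetric]) auto
  also have "\<dots> = ennreal S"
    using S f assms by (intro suminf_ennreal_eq) auto
  finally show ?thesis .
qed

text \<open>On infinite sets \<open>card\<close> is 0, which agrees with
  \<open>enn2real \<infinity> = 0\<close>; so the power is a function of the measurable count at
  every point.\<close>

lemma measurable_power_card [measurable]:
  assumes "A \<in> sets borel"
  shows "(\<lambda>\<omega>. (d::real) ^ card {i. T i \<omega> \<in> A}) \<in> borel_measurable M"
proof -
  have "d ^ card {i. T i \<omega> \<in> A} = d ^ nat \<lfloor>enn2real (point_count T A \<omega>)\<rfloor>" for \<omega>
    by (cases "finite {i. T i \<omega> \<in> A}") (auto simp: point_count_def emeasure_count_space)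
  moreover have "(\<lambda>\<omega>. d ^ nat \<lfloor>enn2real (point_count T A \<omega>)\<rfloor>) \<in> borel_measurable M"
    using measurable_point_count[OF assms] by measurable
  ultimately show ?thesis by simp
qed

lemma prod_points_tendsto:
  fixes g :: "nat \<Rightarrow> real"
  assumes fin: "finite {i. P i}"
  shows "(\<lambda>m. \<Prod>i<m. if P i then g i else 1) \<longlonglongrightarrow> (\<Prod>i | P i. g i)"
proof (rule tendsto_eventually)
  obtain m0 where m0: "\<And>i. P i \<Longrightarrow> i < m0" using finite_nat_set_iff_bounded[of "{i. P i}"] fin by auto
  have "(\<Prod>i<m. if P i then g i else 1) = (\<Prod>i | P i. g i)" if "m \<ge> m0" for m
    using m0 that by (intro prod.mono_neutral_cong_right) (auto intro: less_le_trans)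
  then show "\<forall>\<^sub>F m in sequentially. (\<Prod>i<m. if P i then g i else 1) = (\<Prod>i | P i. g i)"
    unfolding eventually_sequentially by blast
qed

text \<open>A limit of products over fixed finite index ranges. The case distinction on the count
  reflects the convention that a product over an infinite set is 1.\<close>

lemma measurable_prod_points [measurable (raw)]:
  fixes g :: "nat \<Rightarrow> 'v \<Rightarrow> real"
  assumes [measurable]: "A \<in> sets borel" "\<And>i. g i \<in> borel_measurable M"
  shows "(\<lambda>\<omega>. \<Prod>i | T i \<omega> \<in> A. g i \<omega>) \<in> borel_measurable M"
proof -
  have "(\<Prod>i | T i \<omega> \<in> A. g i \<omega>) = (if point_count T A \<omega> < \<infinity>
      then lim (\<lambda>m. \<Prod>i<m. if T i \<omega> \<in> A then g i \<omega> else 1) else 1)" for \<omega>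
  proof (cases "finite {i. T i \<omega> \<in> A}")
    case True
    from limI[OF prod_points_tendsto[OF this]] True show ?thesis
      by (simp add: point_count_def emeasure_count_space of_nat_less_top)
  qed (simp add: point_count_def emeasure_count_space)
  moreover have "(\<lambda>\<omega>. if point_count T A \<omega> < \<infinity>
      then lim (\<lambda>m. \<Prod>i<m. if T i \<omega> \<in> A then g i \<omega> else 1) else 1) \<in> borel_measurable M"
    by measurable
  ultimately show ?thesis by simp
qed

text \<open>The probability generating function of a Poisson variable, from the exponential
  series.\<close>

lemma expectation_power_count:
  assumes st: "0 \<le> s" "s < t" and d: "0 \<le> d" "d \<le> 1"
  shows "expectation (\<lambda>\<omega>. d ^ card {i. T i \<omega> \<in> {s<..t}}) = exp (- (t - s) * (1 - d))"
proof -
  have "(\<lambda>k. (d * (t - s)) ^ k / fact k * exp (- (t - s))) sums (exp (d * (t - s)) * exp (- (t - s)))"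
    using exp_converges[of "d * (t - s)"] by (intro sums_mult2) (simp add: divide_inverse mult.commute)
  moreover have "(d * (t - s)) ^ k / fact k * exp (- (t - s)) = d ^ k * ((t - s) ^ k / fact k * exp (- (t - s)))" for k
    by (simp add: power_mult_distrib)
  ultimately have "(\<lambda>k. d ^ k * ((t - s) ^ k / fact k * exp (- (t - s)))) sums (exp (d * (t - s)) * exp (- (t - s)))"
    by (simp only:)
  from nn_integral_point_count[OF st _ this] d
  have "(\<integral>\<^sup>+\<omega>. ennreal (d ^ card {i. T i \<omega> \<in> {s<..t}}) \<partial>M) = ennreal (exp (d * (t - s)) * exp (- (t - s)))"
    by simp
  then have "expectation (\<lambda>\<omega>. d ^ card {i. T i \<omega> \<in> {s<..t}}) = exp (d * (t - s)) * exp (- (t - s))"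
    using d by (intro integral_eq_nn_integral[THEN trans]) auto
  also have "\<dots> = exp (- (t - s) * (1 - d))" by (simp add: algebra_simps flip: exp_add)
  finally show ?thesis .
qed

lemma expectation_prod_power_count:
  fixes d :: "nat \<Rightarrow> real"
  assumes d: "\<And>k. 0 \<le> d k" "\<And>k. d k \<le> 1" and n: "0 < n"
  shows "expectation (\<lambda>\<omega>. \<Prod>k<m. d k ^ card {i. T i \<omega> \<in> {real k / n<..real (Suc k) / n}})
    = exp (- (\<Sum>k<m. (1 - d k) / n))"
proof -
  have card_eq: "d k ^ card {i. T i \<omega> \<in> A} = d k ^ nat \<lfloor>enn2real (point_count T A \<omega>)\<rfloor>" for A \<omega> k
    by (cases "finite {i. T i \<omega> \<in> A}") (auto simp: point_count_def emeasure_count_space)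
  have "strict_mono (\<lambda>k. real k / n)" using n by (intro strict_monoI) (simp add: divide_strict_right_mono)
  then have "indep_vars (\<lambda>_. borel) (\<lambda>k. point_count T {real k / n<..real (Suc k) / n}) UNIV"
    using T unfolding unit_poisson_points_def by (auto dest!: spec[of _ "\<lambda>k. real k / n"])
  then have "indep_vars (\<lambda>_. borel) (\<lambda>k. point_count T {real k / n<..real (Suc k) / n}) {..<m}"
    by (rule indep_vars_subset) simp
  then have ind: "indep_vars (\<lambda>_. borel) (\<lambda>k \<omega>. d k ^ card {i. T i \<omega> \<in> {real k / n<..real (Suc k) / n}}) {..<m}"
    unfolding card_eq by (rule indep_vars_compose2) simp
  have len: "real k / n < real (Suc k) / n" for k using n by (simp add: divide_strict_right_mono)
  have "expectation (\<lambda>\<omega>. \<Prod>k<m. d k ^ card {i. T i \<omega> \<in> {real k / n<..real (Suc k) / n}})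
      = (\<Prod>k<m. expectation (\<lambda>\<omega>. d k ^ card {i. T i \<omega> \<in> {real k / n<..real (Suc k) / n}}))"
  proof (rule indep_vars_lebesgue_integral[OF _ ind])
    fix k assume "k \<in> {..<m}"
    show "integrable M (\<lambda>\<omega>. d k ^ card {i. T i \<omega> \<in> {real k / n<..real (Suc k) / n}})"
      using d by (intro integrable_const_bound[of _ 1]) (auto intro!: power_le_one)
  qed simp
  also have "\<dots> = (\<Prod>k<m. exp (- ((1 - d k) / n)))"
  proof (rule prod.cong)
    fix k
    have 1: "real (Suc k) / n - real k / n = 1 / n" by (simp flip: diff_divide_distrib)
    have "0 \<le> real k / n" using n by simp
    from expectation_power_count[OF this len d(1)[of k] d(2)[of k]]
    show "expectation (\<lambda>\<omega>. d k ^ card {i. T i \<omega> \<in> {real k / n<..real (Suc k) / n}}) = exp (- ((1 - d k) / n))"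
      unfolding 1 by simp
  qed simp
  finally show ?thesis by (simp add: exp_sum flip: sum_negf)
qed

end

section \<open>Grid approximation of products over all points\<close>

lemma mem_grid_interval_iff:
  assumes "0 < n"
  shows "t \<in> {real k / real n<..real (Suc k) / real n} \<longleftrightarrow> \<lceil>real n * t\<rceil> = int (Suc k)"
  using assms by (auto simp: ceiling_eq_iff field_simps)

text \<open>Rounding is upwards, to the closed end of the grid interval, so the approximants reach
  \<open>t\<close> from the right. Hence right continuity is all that the integrands below have to
  satisfy, and indicators of the form \<open>c \<le> t\<close> are covered.\<close>

lemma grid_tendsto:
  shows "(\<lambda>n. real_of_int \<lceil>real (Suc n) * t\<rceil> / real (Suc n)) \<longlonglongrightarrow> t"
    and "t \<le> real_of_int \<lceil>real (Suc n) * t\<rceil> / real (Suc n)"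
proof -
  show le: "t \<le> real_of_int \<lceil>real (Suc n) * t\<rceil> / real (Suc n)" for n
    by (simp add: field_simps del: of_nat_Suc)
  have up: "real_of_int \<lceil>real (Suc n) * t\<rceil> / real (Suc n) \<le> t + 1 / real (Suc n)" for n
  proof -
    have "real_of_int \<lceil>real (Suc n) * t\<rceil> \<le> real (Suc n) * t + 1" by linarith
    then show ?thesis by (simp add: field_simps del: of_nat_Suc)
  qed
  have "(\<lambda>n. t + 1 / real (Suc n)) \<longlonglongrightarrow> t + 0"
    by (intro tendsto_intros LIMSEQ_Suc[OF lim_1_over_n])
  then show "(\<lambda>n. real_of_int \<lceil>real (Suc n) * t\<rceil> / real (Suc n)) \<longlonglongrightarrow> t"
    by (intro tendsto_sandwich[OF always_eventually[OF allI[OF le]] always_eventually[OF allI[OF up]]]) auto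
qed

context marked_poisson
begin

text \<open>With \<open>D\<close> replaced by its values at the right grid ends, the product depends
  only on the independent Poisson counts of the grid intervals. As the mesh shrinks, dominated
  convergence applies to the expectation and to the integral in the exponent.\<close>

lemma expectation_prod_points:
  fixes D :: "real \<Rightarrow> real" and a :: nat
  assumes D: "\<And>t. 0 \<le> D t" "\<And>t. D t \<le> 1" and [measurable]: "D \<in> borel_measurable borel"
    and rc: "\<And>t s. 0 < t \<Longrightarrow> s \<longlonglongrightarrow> t \<Longrightarrow> (\<And>n. t \<le> s n) \<Longrightarrow> (\<lambda>n. D (s n)) \<longlonglongrightarrow> D t"
  shows "expectation (\<lambda>\<omega>. \<Prod>i | T i \<omega> \<in> {0<..real a}. D (T i \<omega>))
    = exp (- (LINT t|lborel. indicator {0<..real a} t * (1 - D t)))"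
proof -
  define gr where "gr n t = real_of_int \<lceil>real (Suc n) * t\<rceil> / real (Suc n)" for n t
  define I where "I n k = {real k / real (Suc n)<..real (Suc k) / real (Suc n)}" for n k
  have I_iff: "t \<in> I n k \<longleftrightarrow> \<lceil>real (Suc n) * t\<rceil> = int (Suc k)" for n k t
    unfolding I_def by (rule mem_grid_interval_iff) simp
  have I_gr: "t \<in> I n k \<Longrightarrow> gr n t = real (Suc k) / real (Suc n)" for n k t
    unfolding I_iff gr_def by simp
  \<comment> \<open>As \<open>a\<close> is a natural number, the grid of mesh
    \<open>1 / Suc n\<close> ends exactly at \<open>a\<close>.\<close>
  have cover: "{0<..real a} = (\<Union>k<a * Suc n. I n k)" for n
  proof (intro set_eqI iffI)
    fix t assume t: "t \<in> {0<..real a}"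
    define k where "k = nat (\<lceil>real (Suc n) * t\<rceil> - 1)"
    have pos: "0 < \<lceil>real (Suc n) * t\<rceil>" using t by simp
    have "real (Suc n) * t \<le> real (Suc n) * real a" using t by (intro mult_left_mono) auto
    then have "\<lceil>real (Suc n) * t\<rceil> \<le> int (Suc n * a)"
      by (intro ceiling_le) (simp only: of_int_of_nat_eq of_nat_mult of_int_mult)
    then have "k < a * Suc n" using pos unfolding k_def by (auto simp: nat_less_iff mult.commute)
    moreover have "t \<in> I n k" unfolding I_iff k_def using pos by simp
    ultimately show "t \<in> (\<Union>k<a * Suc n. I n k)" by blast
  next
    fix t assume "t \<in> (\<Union>k<a * Suc n. I n k)"
    then obtain k where k: "k < a * Suc n" "t \<in> I n k" by blast
    then have "real (Suc k) \<le> real a * real (Suc n)" by (metis Suc_leI of_nat_le_iff of_nat_mult)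
    then have "real (Suc k) / real (Suc n) \<le> real a" by (simp add: pos_divide_le_eq del: of_nat_Suc)
    moreover have "0 \<le> real k / real (Suc n)" by simp
    ultimately show "t \<in> {0<..real a}"
      using k(2) unfolding I_def greaterThanAtMost_iff by linarith
  qed
  have disj: "I n k \<inter> I n l = {}" if "k \<noteq> l" for n k l using that I_iff by auto
  let ?d = "\<lambda>n k. D (real (Suc k) / real (Suc n))"
  have left: "(\<lambda>n. expectation (\<lambda>\<omega>. \<Prod>k<a * Suc n. ?d n k ^ card {i. T i \<omega> \<in> I n k}))
      \<longlonglongrightarrow> expectation (\<lambda>\<omega>. \<Prod>i | T i \<omega> \<in> {0<..real a}. D (T i \<omega>))"
  proof (rule integral_dominated_convergence[where w = "\<lambda>_. 1"])
    show "AE \<omega> in M. (\<lambda>n. \<Prod>k<a * Suc n. ?d n k ^ card {i. T i \<omega> \<in> I n k})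
        \<longlonglongrightarrow> (\<Prod>i | T i \<omega> \<in> {0<..real a}. D (T i \<omega>))"
      using finite_points
    proof eventually_elim
      case (elim \<omega>)
      then have fin: "finite {i. T i \<omega> \<in> {0<..real a}}" by blast
      have "(\<Prod>k<a * Suc n. ?d n k ^ card {i. T i \<omega> \<in> I n k}) = (\<Prod>i | T i \<omega> \<in> {0<..real a}. D (gr n (T i \<omega>)))" for n
      proof -
        have "{i. T i \<omega> \<in> {0<..real a}} = (\<Union>k<a * Suc n. {i. T i \<omega> \<in> I n k})" using cover[of n] by blast
        moreover have "finite {i. T i \<omega> \<in> I n k}" if "k < a * Suc n" for k
          by (rule finite_subset[OF _ fin]) (use cover[of n] that in blast)
        ultimately have "(\<Prod>i | T i \<omega> \<in> {0<..real a}. D (gr n (T i \<omega>)))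
            = (\<Prod>k<a * Suc n. \<Prod>i | T i \<omega> \<in> I n k. D (gr n (T i \<omega>)))"
          by (simp only:) (rule prod.UNION_disjoint, simp, simp, use disj in blast)
        also have "\<dots> = (\<Prod>k<a * Suc n. ?d n k ^ card {i. T i \<omega> \<in> I n k})"
          by (intro prod.cong refl) (simp add: I_gr)
        finally show ?thesis by simp
      qed
      moreover have "(\<lambda>n. \<Prod>i | T i \<omega> \<in> {0<..real a}. D (gr n (T i \<omega>))) \<longlonglongrightarrow> (\<Prod>i | T i \<omega> \<in> {0<..real a}. D (T i \<omega>))"
        unfolding gr_def by (intro tendsto_prod rc grid_tendsto) auto
      ultimately show ?case by simp
    qed
    show "AE \<omega> in M. norm (\<Prod>k<a * Suc n. ?d n k ^ card {i. T i \<omega> \<in> I n k}) \<le> 1" for n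
      using D by (auto simp: abs_prod power_abs intro!: prod_le_1 power_le_one AE_I2)
    show "(\<lambda>\<omega>. \<Prod>i | T i \<omega> \<in> {0<..real a}. D (T i \<omega>)) \<in> borel_measurable M" by measurable
  qed (auto simp: I_def)
  have right: "(\<lambda>n. \<Sum>k<a * Suc n. (1 - ?d n k) / real (Suc n))
      \<longlonglongrightarrow> (LINT t|lborel. indicator {0<..real a} t * (1 - D t))"
  proof -
    have "(\<Sum>k<a * Suc n. (1 - ?d n k) / real (Suc n)) = (LINT t|lborel. indicator {0<..real a} t * (1 - D (gr n t)))" for n
    proof -
      have "indicator {0<..real a} t * (1 - D (gr n t)) = (\<Sum>k<a * Suc n. (1 - ?d n k) * indicator (I n k) t)" for t
      proof (cases "t \<in> {0<..real a}")
        case True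
        then obtain k where k: "k < a * Suc n" "t \<in> I n k" using cover[of n] by blast
        have "(\<Sum>l<a * Suc n. (1 - ?d n l) * indicator (I n l) t) = (\<Sum>l\<in>{k}. (1 - ?d n l) * indicator (I n l) t)"
        proof (rule sum.mono_neutral_right)
          have "t \<notin> I n l" if "l \<noteq> k" for l using disj[of k l n] k(2) that by blast
          then show "\<forall>l\<in>{..<a * Suc n} - {k}. (1 - ?d n l) * indicator (I n l) t = 0" by simp
        qed (use k in auto)
        then show ?thesis using k I_gr[OF k(2)] True by simp
      next
        case False
        then show ?thesis using cover[of n] by (auto intro!: sum.neutral[symmetric] simp: indicator_def)
      qed
      moreover have "integrable lborel (\<lambda>t. (1 - ?d n k) * indicator (I n k) t)" for k
      proof -
        have "real k / real (Suc n) \<le> real (Suc k) / real (Suc n)" by (intro divide_right_mono) auto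
        then have "emeasure lborel (I n k) < \<infinity>" unfolding I_def by (subst emeasure_lborel_Ioc) auto
        then show ?thesis by (intro integrable_mult_right integrable_real_indicator) (auto simp: I_def)
      qed
      ultimately have "(LINT t|lborel. indicator {0<..real a} t * (1 - D (gr n t)))
          = (\<Sum>k<a * Suc n. LINT t|lborel. (1 - ?d n k) * indicator (I n k) t)"
        by (simp only:) (rule Bochner_Integration.integral_sum, blast)
      also have "\<dots> = (\<Sum>k<a * Suc n. (1 - ?d n k) / real (Suc n))"
      proof (rule sum.cong)
        fix k
        have le: "real k / real (Suc n) \<le> real (Suc k) / real (Suc n)" by (intro divide_right_mono) auto
        have diff: "real (Suc k) / real (Suc n) - real k / real (Suc n) = 1 / real (Suc n)"
          by (simp flip: diff_divide_distrib)
        have "measure lborel (I n k) = 1 / real (Suc n)"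
          unfolding I_def by (simp only: measure_lborel_Ioc[OF le] diff)
        then show "(LINT t|lborel. (1 - ?d n k) * indicator (I n k) t) = (1 - ?d n k) / real (Suc n)"
          by (simp add: I_def)
      qed simp
      finally show ?thesis by simp
    qed
    moreover have "(\<lambda>n. LINT t|lborel. indicator {0<..real a} t * (1 - D (gr n t)))
        \<longlonglongrightarrow> (LINT t|lborel. indicator {0<..real a} t * (1 - D t))"
    proof (rule integral_dominated_convergence[where w = "indicator {0<..real a}"])
      show "AE t in lborel. (\<lambda>n. indicator {0<..real a} t * (1 - D (gr n t))) \<longlonglongrightarrow> indicator {0<..real a} t * (1 - D t)"
      proof (rule AE_I2)
        fix t :: real
        show "(\<lambda>n. indicator {0<..real a} t * (1 - D (gr n t))) \<longlonglongrightarrow> indicator {0<..real a} t * (1 - D t)"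
        proof (cases "0 < t")
          case True
          then show ?thesis unfolding gr_def by (intro tendsto_intros rc grid_tendsto) auto
        qed simp
      qed
      show "AE t in lborel. norm (indicator {0<..real a} t * (1 - D (gr n t))) \<le> indicator {0<..real a} t" for n
        using D by (auto intro!: AE_I2 simp: indicator_def)
    qed (auto simp: gr_def)
    ultimately show ?thesis by simp
  qed
  have "expectation (\<lambda>\<omega>. \<Prod>k<a * Suc n. ?d n k ^ card {i. T i \<omega> \<in> I n k})
      = exp (- (\<Sum>k<a * Suc n. (1 - ?d n k) / real (Suc n)))" for n
    unfolding I_def using D by (intro expectation_prod_power_count) auto
  with left have "(\<lambda>n. exp (- (\<Sum>k<a * Suc n. (1 - ?d n k) / real (Suc n))))
      \<longlonglongrightarrow> expectation (\<lambda>\<omega>. \<Prod>i | T i \<omega> \<in> {0<..real a}. D (T i \<omega>))" by simp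
  moreover have "(\<lambda>n. exp (- (\<Sum>k<a * Suc n. (1 - ?d n k) / real (Suc n))))
      \<longlonglongrightarrow> exp (- (LINT t|lborel. indicator {0<..real a} t * (1 - D t)))"
    by (intro tendsto_intros right)
  ultimately show ?thesis by (rule LIMSEQ_unique)
qed

text \<open>Given the arrival times, the factors are independent and the i-th one integrates to
  \<open>D (T i \<omega>)\<close>. So the marks can be averaged out and the unmarked case
  applies.\<close>

lemma expectation_prod_marked_points:
  fixes h :: "'x \<Rightarrow> real \<Rightarrow> real" and a :: nat
  assumes h: "\<And>x t. 0 \<le> h x t" "\<And>x t. h x t \<le> 1"
    and hm [measurable]: "(\<lambda>(x, t). h x t) \<in> borel_measurable (borel \<Otimes>\<^sub>M borel)"
    and rc: "\<And>t s. 0 < t \<Longrightarrow> s \<longlonglongrightarrow> t \<Longrightarrow> (\<And>n. t \<le> s n) \<Longrightarrow>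
      (\<lambda>n. LINT x|N. h x (s n)) \<longlonglongrightarrow> (LINT x|N. h x t)"
  shows "expectation (\<lambda>\<omega>. \<Prod>i | T i \<omega> \<in> {0<..real a}. h (X i \<omega>) (T i \<omega>))
    = exp (- (LINT t|lborel. indicator {0<..real a} t * (1 - (LINT x|N. h x t))))"
proof -
  interpret N: prob_space N by (rule prob_space_N)
  define D where "D t = (LINT x|N. h x t)" for t
  have [measurable]: "(\<lambda>x. h x t) \<in> borel_measurable borel" for t
    using measurable_compose[OF _ hm, of "\<lambda>x. (x, t)"] by simp
  have [measurable]: "(\<lambda>\<omega>. h (X i \<omega>) (T i \<omega>)) \<in> borel_measurable M" for i
    using measurable_compose[OF _ hm, of "\<lambda>\<omega>. (X i \<omega>, T i \<omega>)"] by simp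
  have intN: "integrable N (\<lambda>x. h x t)" for t
    by (rule N.integrable_const_bound[of _ 1]) (use h in auto)
  have D: "0 \<le> D t" "D t \<le> 1" for t
    unfolding D_def using h by (auto intro!: integral_nonneg_AE N.integral_le_const intN)
  have [measurable]: "D \<in> borel_measurable borel"
    unfolding D_def by (rule N.borel_measurable_lebesgue_integral) measurable
  let ?h = "\<lambda>x t. if t \<in> {0<..real a} then h x t else 1"
  let ?D = "\<lambda>t. if t \<in> {0<..real a} then D t else 1"
  \<comment> \<open>Independence is used over the fixed range \<open>i < m\<close>, with factor 1
    for times outside the window; only afterwards does \<open>m\<close> tend to infinity to reach
    the random index set.\<close>
  have "expectation (\<lambda>\<omega>. \<Prod>i<m. ?h (X i \<omega>) (T i \<omega>)) = expectation (\<lambda>\<omega>. \<Prod>i<m. ?D (T i \<omega>))" for m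
  proof -
    have "(\<integral>\<^sup>+\<omega>. ennreal (\<Prod>i<m. ?h (X i \<omega>) (T i \<omega>)) \<partial>M)
        = (\<integral>\<^sup>+\<omega>'. \<integral>\<^sup>+\<omega>. ennreal (\<Prod>i<m. ?h (X i \<omega>) (T i \<omega>')) \<partial>M \<partial>M)"
    proof -
      have 1: "(\<lambda>\<omega> i. X i \<omega>) \<in> measurable M (PiM UNIV (\<lambda>_. borel))"
        "(\<lambda>\<omega> i. T i \<omega>) \<in> measurable M (PiM UNIV (\<lambda>_. borel))"
        by (auto intro!: measurable_PiM_single')
      have 2: "(\<lambda>(\<xi>, \<tau>). ennreal (\<Prod>i<m. ?h (\<xi> i) (\<tau> i))) \<in> borel_measurable (PiM UNIV (\<lambda>_. borel) \<Otimes>\<^sub>M PiM UNIV (\<lambda>_. borel))"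
        by measurable
      from nn_integral_indep_pair[OF 1 XT 2] show ?thesis by simp
    qed
    also have "\<dots> = (\<integral>\<^sup>+\<omega>'. ennreal (\<Prod>i<m. ?D (T i \<omega>')) \<partial>M)"
    proof (rule nn_integral_cong)
      fix \<omega>'
      have "indep_vars (\<lambda>_. borel) (\<lambda>i \<omega>. ennreal (?h (X i \<omega>) (T i \<omega>'))) {..<m}"
        by (rule indep_vars_compose2[OF indep_vars_subset[OF X_indep]]) auto
      from indep_vars_nn_integral[OF _ this]
      have "(\<integral>\<^sup>+\<omega>. ennreal (\<Prod>i<m. ?h (X i \<omega>) (T i \<omega>')) \<partial>M) = (\<Prod>i<m. \<integral>\<^sup>+\<omega>. ennreal (?h (X i \<omega>) (T i \<omega>')) \<partial>M)"
        using h by (simp add: prod_ennreal)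
      also have "\<dots> = (\<Prod>i<m. ennreal (?D (T i \<omega>')))"
      proof (rule prod.cong)
        fix i
        have "(\<integral>\<^sup>+\<omega>. ennreal (h (X i \<omega>) (T i \<omega>')) \<partial>M) = (\<integral>\<^sup>+x. ennreal (h x (T i \<omega>')) \<partial>distr M borel (X i))"
          by (rule nn_integral_distr[symmetric]) auto
        also have "\<dots> = ennreal (D (T i \<omega>'))"
          unfolding X_distr D_def using h by (intro nn_integral_eq_integral intN) auto
        finally show "(\<integral>\<^sup>+\<omega>. ennreal (?h (X i \<omega>) (T i \<omega>')) \<partial>M) = ennreal (?D (T i \<omega>'))"
          by (cases "T i \<omega>' \<in> {0<..real a}")
            (simp_all only: if_True if_False ennreal_1 nn_integral_const emeasure_space_1 mult_1 simp_thms)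
      qed simp
      also have "\<dots> = ennreal (\<Prod>i<m. ?D (T i \<omega>'))" using D by (simp add: prod_ennreal)
      finally show "(\<integral>\<^sup>+\<omega>. ennreal (\<Prod>i<m. ?h (X i \<omega>) (T i \<omega>')) \<partial>M) = ennreal (\<Prod>i<m. ?D (T i \<omega>'))" .
    qed
    finally show ?thesis
      using h D by (simp add: integral_eq_nn_integral prod_nonneg)
  qed
  moreover have "(\<lambda>m. expectation (\<lambda>\<omega>. \<Prod>i<m. ?h (X i \<omega>) (T i \<omega>)))
      \<longlonglongrightarrow> expectation (\<lambda>\<omega>. \<Prod>i | T i \<omega> \<in> {0<..real a}. h (X i \<omega>) (T i \<omega>))"
  proof (rule integral_dominated_convergence[where w = "\<lambda>_. 1"])
    show "AE \<omega> in M. (\<lambda>m. \<Prod>i<m. ?h (X i \<omega>) (T i \<omega>)) \<longlonglongrightarrow> (\<Prod>i | T i \<omega> \<in> {0<..real a}. h (X i \<omega>) (T i \<omega>))"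
      using finite_points by eventually_elim (rule prod_points_tendsto, blast)
    show "AE \<omega> in M. norm (\<Prod>i<m. ?h (X i \<omega>) (T i \<omega>)) \<le> 1" for m
      using h by (auto simp: abs_prod intro!: prod_le_1 AE_I2)
    show "(\<lambda>\<omega>. \<Prod>i | T i \<omega> \<in> {0<..real a}. h (X i \<omega>) (T i \<omega>)) \<in> borel_measurable M" by measurable
  qed auto
  moreover have "(\<lambda>m. expectation (\<lambda>\<omega>. \<Prod>i<m. ?D (T i \<omega>)))
      \<longlonglongrightarrow> expectation (\<lambda>\<omega>. \<Prod>i | T i \<omega> \<in> {0<..real a}. D (T i \<omega>))"
  proof (rule integral_dominated_convergence[where w = "\<lambda>_. 1"])
    show "AE \<omega> in M. (\<lambda>m. \<Prod>i<m. ?D (T i \<omega>)) \<longlonglongrightarrow> (\<Prod>i | T i \<omega> \<in> {0<..real a}. D (T i \<omega>))"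
      using finite_points by eventually_elim (rule prod_points_tendsto, blast)
    show "AE \<omega> in M. norm (\<Prod>i<m. ?D (T i \<omega>)) \<le> 1" for m
      using D by (auto simp: abs_prod intro!: prod_le_1 AE_I2)
    show "(\<lambda>\<omega>. \<Prod>i | T i \<omega> \<in> {0<..real a}. D (T i \<omega>)) \<in> borel_measurable M" by measurable
  qed auto
  ultimately have "expectation (\<lambda>\<omega>. \<Prod>i | T i \<omega> \<in> {0<..real a}. h (X i \<omega>) (T i \<omega>))
      = expectation (\<lambda>\<omega>. \<Prod>i | T i \<omega> \<in> {0<..real a}. D (T i \<omega>))"
    by (simp add: LIMSEQ_unique)
  also have "\<dots> = exp (- (LINT t|lborel. indicator {0<..real a} t * (1 - D t)))"
    by (rule expectation_prod_points) (use D rc in \<open>auto simp: D_def\<close>)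
  finally show ?thesis unfolding D_def .
qed

text \<open>Almost surely only finitely many factors differ from 1, so the product over the times up
  to \<open>a\<close> is eventually constant in \<open>a\<close>. The factors may be 0, so the
  formula covers void probabilities as well as Laplace functionals; \<open>Y\<close> is whichever
  measurable version is at hand.\<close>

theorem marked_Laplace:
  fixes h :: "'x \<Rightarrow> real \<Rightarrow> real"
  assumes h: "\<And>x t. 0 \<le> h x t" "\<And>x t. h x t \<le> 1"
    and hm [measurable]: "(\<lambda>(x, t). h x t) \<in> borel_measurable (borel \<Otimes>\<^sub>M borel)"
    and rc: "\<And>t s. 0 < t \<Longrightarrow> s \<longlonglongrightarrow> t \<Longrightarrow> (\<And>n. t \<le> s n) \<Longrightarrow>
      (\<lambda>n. LINT x|N. h x (s n)) \<longlonglongrightarrow> (LINT x|N. h x t)"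
    and fin: "AE \<omega> in M. finite {i. h (X i \<omega>) (T i \<omega>) \<noteq> 1}"
    and int: "integrable lborel (\<lambda>t. indicator {0<..} t * (1 - (LINT x|N. h x t)))"
    and Y: "Y \<in> borel_measurable M" "AE \<omega> in M. Y \<omega> = (\<Prod>i | h (X i \<omega>) (T i \<omega>) \<noteq> 1. h (X i \<omega>) (T i \<omega>))"
  shows "expectation Y = exp (- (LINT t|lborel. indicator {0<..} t * (1 - (LINT x|N. h x t))))"
proof -
  interpret N: prob_space N by (rule prob_space_N)
  define D where "D t = (LINT x|N. h x t)" for t
  have [measurable]: "(\<lambda>x. h x t) \<in> borel_measurable borel" for t
    using measurable_compose[OF _ hm, of "\<lambda>x. (x, t)"] by simp
  have [measurable]: "(\<lambda>\<omega>. h (X i \<omega>) (T i \<omega>)) \<in> borel_measurable M" for i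
    using measurable_compose[OF _ hm, of "\<lambda>\<omega>. (X i \<omega>, T i \<omega>)"] by simp
  have [measurable]: "D \<in> borel_measurable borel"
    unfolding D_def by (rule N.borel_measurable_lebesgue_integral) measurable
  have D: "D t \<le> 1" for t
    unfolding D_def using h by (intro N.integral_le_const N.integrable_const_bound[of _ 1]) auto
  have "(\<lambda>a. expectation (\<lambda>\<omega>. \<Prod>i | T i \<omega> \<in> {0<..real a}. h (X i \<omega>) (T i \<omega>))) \<longlonglongrightarrow> expectation Y"
  proof (rule integral_dominated_convergence[where w = "\<lambda>_. 1"])
    show "AE \<omega> in M. (\<lambda>a. \<Prod>i | T i \<omega> \<in> {0<..real a}. h (X i \<omega>) (T i \<omega>)) \<longlonglongrightarrow> Y \<omega>"
      using finite_points fin T_pos Y(2)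
    proof eventually_elim
      case (elim \<omega>)
      let ?F = "{i. h (X i \<omega>) (T i \<omega>) \<noteq> 1}"
      obtain a0 :: nat where a0: "Max (insert 0 ((\<lambda>i. T i \<omega>) ` ?F)) \<le> real a0" using real_arch_simple by blast
      have "(\<Prod>i | T i \<omega> \<in> {0<..real a}. h (X i \<omega>) (T i \<omega>)) = Y \<omega>" if a: "a \<ge> a0" for a
      proof -
        have "T i \<omega> \<le> real a" if "i \<in> ?F" for i
        proof -
          have "T i \<omega> \<le> Max (insert 0 ((\<lambda>i. T i \<omega>) ` ?F))" using elim(2) that by (intro Max_ge) auto
          then show ?thesis using a0 a by (meson of_nat_le_iff order_trans)
        qed
        then show ?thesis
          unfolding elim(4) using elim by (intro prod.mono_neutral_right) auto
      qed
      then show ?case by (intro tendsto_eventually) (auto simp: eventually_sequentially)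
    qed
    show "AE \<omega> in M. norm (\<Prod>i | T i \<omega> \<in> {0<..real a}. h (X i \<omega>) (T i \<omega>)) \<le> 1" for a
      using h by (auto simp: abs_prod intro!: prod_le_1 AE_I2)
    show "(\<lambda>\<omega>. \<Prod>i | T i \<omega> \<in> {0<..real a}. h (X i \<omega>) (T i \<omega>)) \<in> borel_measurable M" for a
      by measurable
  qed (use Y in auto)
  moreover have "(\<lambda>a. LINT t|lborel. indicator {0<..real a} t * (1 - D t)) \<longlonglongrightarrow> (LINT t|lborel. indicator {0<..} t * (1 - D t))"
  proof (rule integral_dominated_convergence[where w = "\<lambda>t. indicator {0<..} t * (1 - D t)"])
    show "AE t in lborel. (\<lambda>a. indicator {0<..real a} t * (1 - D t)) \<longlonglongrightarrow> indicator {0<..} t * (1 - D t)"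
    proof (rule AE_I2)
      fix t :: real
      obtain a0 :: nat where "t \<le> real a0" using real_arch_simple by blast
      then have "\<forall>a\<ge>a0. indicator {0<..real a} t * (1 - D t) = indicator {0<..} t * (1 - D t)"
        by (auto simp: indicator_def)
      then show "(\<lambda>a. indicator {0<..real a} t * (1 - D t)) \<longlonglongrightarrow> indicator {0<..} t * (1 - D t)"
        by (intro tendsto_eventually) (auto simp: eventually_sequentially)
    qed
    show "AE t in lborel. norm (indicator {0<..real a} t * (1 - D t)) \<le> indicator {0<..} t * (1 - D t)" for a
      using D by (auto intro!: AE_I2 simp: indicator_def)
  qed (use int in \<open>auto simp: D_def\<close>)
  then have "(\<lambda>a. exp (- (LINT t|lborel. indicator {0<..real a} t * (1 - D t))))
      \<longlonglongrightarrow> exp (- (LINT t|lborel. indicator {0<..} t * (1 - D t)))" by (intro tendsto_intros)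
  moreover have "expectation (\<lambda>\<omega>. \<Prod>i | T i \<omega> \<in> {0<..real a}. h (X i \<omega>) (T i \<omega>))
      = exp (- (LINT t|lborel. indicator {0<..real a} t * (1 - D t)))" for a
    unfolding D_def by (rule expectation_prod_marked_points[OF h hm]) (rule rc)
  ultimately show ?thesis unfolding D_def by (simp add: LIMSEQ_unique)
qed

text \<open>Campbell's formula: given a mark \<open>x\<close>, the expected number of arrivals up to
  \<open>c x\<close> is \<open>c x\<close>, so the expected number of all such points is the
  integral of \<open>c\<close>, which is finite.\<close>

theorem finite_points_below:
  assumes [measurable]: "c \<in> borel_measurable borel" and c: "integrable N c" "\<And>x. 0 \<le> c x"
  shows "AE \<omega> in M. finite {i. T i \<omega> \<le> c (X i \<omega>)}"
proof -
  have mean: "(\<integral>\<^sup>+\<omega>. (\<Sum>i. (if T i \<omega> \<le> t then 1 else 0 :: ennreal)) \<partial>M) = ennreal t" if t: "0 \<le> t" for t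
  proof -
    have "(\<integral>\<^sup>+\<omega>. (\<Sum>i. (if T i \<omega> \<le> t then 1 else 0 :: ennreal)) \<partial>M)
        = (\<integral>\<^sup>+\<omega>. ennreal (real (card {i. T i \<omega> \<in> {0<..t}})) \<partial>M)"
    proof (rule nn_integral_cong_AE)
      obtain a :: nat where "t \<le> real a" using real_arch_simple by blast
      show "AE \<omega> in M. (\<Sum>i. (if T i \<omega> \<le> t then 1 else 0 :: ennreal)) = ennreal (real (card {i. T i \<omega> \<in> {0<..t}}))"
        using finite_points T_pos
      proof eventually_elim
        case (elim \<omega>)
        have fin: "finite {i. T i \<omega> \<in> {0<..t}}"
          by (rule finite_subset[of _ "{i. T i \<omega> \<in> {0<..real a}}"]) (use elim \<open>t \<le> real a\<close> in auto)
        have "(\<Sum>i. (if T i \<omega> \<le> t then 1 else 0 :: ennreal)) = (\<Sum>i | T i \<omega> \<in> {0<..t}. (if T i \<omega> \<le> t then 1 else 0 :: ennreal))"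
          by (rule suminf_finite[OF fin]) (use elim in \<open>auto simp: indicator_def\<close>)
        also have "\<dots> = ennreal (real (card {i. T i \<omega> \<in> {0<..t}}))"
          by (simp add: indicator_def ennreal_of_nat_eq_real_of_nat)
        finally show ?case .
      qed
    qed
    also have "\<dots> = ennreal t"
    proof (cases "t = 0")
      case False
      have "(\<lambda>k. real k * ((t - 0) ^ k / fact k * exp (- (t - 0)))) sums (t * exp t * exp (- t))"
        using sums_mult2[OF sums_poisson_mean[of t], of "exp (- t)"] by (simp add: mult_ac)
      from nn_integral_point_count[OF order_refl _ _ this] t False show ?thesis by (simp flip: exp_add add: mult.assoc)
    qed simp
    finally show ?thesis .
  qed
  have "(\<integral>\<^sup>+\<omega>. (\<Sum>i. (if T i \<omega> \<le> c (X i \<omega>) then 1 else 0 :: ennreal)) \<partial>M)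
      = (\<Sum>i. \<integral>\<^sup>+\<omega>. (if T i \<omega> \<le> c (X i \<omega>) then 1 else 0 :: ennreal) \<partial>M)"
    by (rule nn_integral_suminf) measurable
  also have "\<dots> = (\<Sum>i. \<integral>\<^sup>+x. \<integral>\<^sup>+\<omega>. (if T i \<omega> \<le> c x then 1 else 0 :: ennreal) \<partial>M \<partial>N)"
  proof (rule suminf_cong)
    fix i :: nat
    interpret N: prob_space N by (rule prob_space_N)
    interpret NM: pair_sigma_finite N M ..
    have 1: "(\<lambda>\<omega> i. X i \<omega>) \<in> measurable M (PiM UNIV (\<lambda>_. borel))"
      "(\<lambda>\<omega> i. T i \<omega>) \<in> measurable M (PiM UNIV (\<lambda>_. borel))"
      by (auto intro!: measurable_PiM_single')
    have 2: "(\<lambda>(\<xi>, \<tau>). if \<tau> i \<le> c (\<xi> i) then 1 else 0 :: ennreal) \<in> borel_measurable (PiM UNIV (\<lambda>_. borel) \<Otimes>\<^sub>M PiM UNIV (\<lambda>_. borel))"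
      by measurable
    have "(\<integral>\<^sup>+\<omega>. (if T i \<omega> \<le> c (X i \<omega>) then 1 else 0 :: ennreal) \<partial>M) = (\<integral>\<^sup>+\<omega>'. \<integral>\<^sup>+\<omega>. (if T i \<omega>' \<le> c (X i \<omega>) then 1 else 0 :: ennreal) \<partial>M \<partial>M)"
      using nn_integral_indep_pair[OF 1 XT 2] by simp
    also have "\<dots> = (\<integral>\<^sup>+\<omega>'. \<integral>\<^sup>+x. (if T i \<omega>' \<le> c x then 1 else 0 :: ennreal) \<partial>N \<partial>M)"
      by (intro nn_integral_cong, subst X_distr[of i, symmetric], subst nn_integral_distr) auto
    also have "\<dots> = (\<integral>\<^sup>+x. \<integral>\<^sup>+\<omega>. (if T i \<omega> \<le> c x then 1 else 0 :: ennreal) \<partial>M \<partial>N)"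
      by (rule NM.Fubini') measurable
    finally show "(\<integral>\<^sup>+\<omega>. (if T i \<omega> \<le> c (X i \<omega>) then 1 else 0 :: ennreal) \<partial>M) = (\<integral>\<^sup>+x. \<integral>\<^sup>+\<omega>. (if T i \<omega> \<le> c x then 1 else 0 :: ennreal) \<partial>M \<partial>N)" .
  qed
  also have "\<dots> = (\<integral>\<^sup>+x. (\<Sum>i. \<integral>\<^sup>+\<omega>. (if T i \<omega> \<le> c x then 1 else 0 :: ennreal) \<partial>M) \<partial>N)"
    by (rule nn_integral_suminf[symmetric]) measurable
  also have "\<dots> = (\<integral>\<^sup>+x. ennreal (c x) \<partial>N)"
    by (intro nn_integral_cong, subst nn_integral_suminf[symmetric]) (auto simp: mean c(2))
  also have "\<dots> < \<infinity>" using c by (simp add: nn_integral_eq_integral)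
  finally have "AE \<omega> in M. (\<Sum>i. (if T i \<omega> \<le> c (X i \<omega>) then 1 else 0 :: ennreal)) \<noteq> (\<infinity>::ennreal)"
    by (intro nn_integral_PInf_AE) auto
  then show ?thesis
  proof eventually_elim
    case (elim \<omega>)
    have "(\<Sum>i. (if T i \<omega> \<le> c (X i \<omega>) then 1 else 0 :: ennreal)) = emeasure (count_space UNIV) {i. T i \<omega> \<le> c (X i \<omega>)}"
    proof -
      have "emeasure (count_space UNIV) {i. T i \<omega> \<le> c (X i \<omega>)} = (\<integral>\<^sup>+i. indicator {i. T i \<omega> \<le> c (X i \<omega>)} i \<partial>count_space UNIV)" by simp
      also have "\<dots> = (\<Sum>i. indicator {i. T i \<omega> \<le> c (X i \<omega>)} i)" by (rule nn_integral_count_space_nat)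
      finally show ?thesis by (auto intro!: suminf_cong simp: indicator_def)
    qed
    with elim show ?case by (auto simp: emeasure_count_space split: if_splits)
  qed
qed

end

section \<open>Convergence of measures determined by boxes\<close>

text \<open>For x up to 1/2, ln (1 - x) lies between - x - 2 x^2 and - x. With x = a n / n the
  quadratic error, multiplied by n, is of order a n * x and vanishes.\<close>

lemma power_one_minus_tendsto_exp:
  fixes a :: "nat \<Rightarrow> real"
  assumes a: "a \<longlonglongrightarrow> c" and nonneg: "\<And>n. 0 \<le> a n"
  shows "(\<lambda>n. (1 - a n / real n) ^ n) \<longlonglongrightarrow> exp (- c)"
proof -
  have an: "(\<lambda>n. a n / real n) \<longlonglongrightarrow> 0"
    using tendsto_mult[OF a lim_1_over_n] by (simp add: divide_inverse)
  have small: "\<forall>\<^sub>F n in sequentially. a n / real n < 1 / 2"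
    by (rule order_tendstoD(2)[OF an]) simp
  show ?thesis
  proof (rule tendsto_sandwich)
    show "\<forall>\<^sub>F n in sequentially. exp (- a n - 2 * a n * (a n / real n)) \<le> (1 - a n / real n) ^ n"
      using small eventually_gt_at_top[of 0]
    proof eventually_elim
      case (elim n)
      define x where "x = a n / real n"
      have x: "0 \<le> x" "x \<le> 1 / 2" using elim nonneg[of n] by (auto simp: x_def)
      have nx: "real n * x = a n" using elim by (simp add: x_def)
      have "real n * (- x - 2 * x\<^sup>2) \<le> real n * ln (1 - x)"
        by (intro mult_left_mono ln_one_minus_pos_lower_bound x) simp
      moreover have "real n * (- x - 2 * x\<^sup>2) = - (real n * x) - 2 * (real n * x) * x"
        by (simp add: algebra_simps power2_eq_square)
      ultimately have "exp (- a n - 2 * a n * x) \<le> exp (real n * ln (1 - x))"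
        unfolding nx by simp
      also have "\<dots> = (1 - x) ^ n" using x by (simp add: exp_of_nat_mult)
      finally show ?case by (simp add: x_def)
    qed
    show "\<forall>\<^sub>F n in sequentially. (1 - a n / real n) ^ n \<le> exp (- a n)"
      using small eventually_gt_at_top[of 0]
    proof eventually_elim
      case (elim n)
      have "(1 - a n / real n) ^ n \<le> exp (- (a n / real n)) ^ n"
        using elim by (intro power_mono) (use exp_ge_add_one_self[of "- (a n / real n)"] in auto)
      also have "\<dots> = exp (- a n)" using elim by (simp flip: exp_of_nat_mult)
      finally show ?case .
    qed
    have "(\<lambda>n. exp (- a n - 2 * a n * (a n / real n))) \<longlonglongrightarrow> exp (- c - 2 * c * 0)"
      by (intro tendsto_intros a an)
    then show "(\<lambda>n. exp (- a n - 2 * a n * (a n / real n))) \<longlonglongrightarrow> exp (- c)" by simp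
    show "(\<lambda>n. exp (- a n)) \<longlonglongrightarrow> exp (- c)" by (intro tendsto_intros a)
  qed
qed

text \<open>The step from powers of a distribution function to expected numbers of exceedances.
  Logarithms give n ln (p n) -> - v, hence p n -> 1, and near 1 the quantities - ln p and 1 - p are
  comparable up to a factor tending to 1.\<close>

lemma power_tendsto_exp_imp:
  fixes p :: "nat \<Rightarrow> real"
  assumes p: "\<And>n. 0 \<le> p n" "\<And>n. p n \<le> 1" and lim: "(\<lambda>n. p n ^ n) \<longlonglongrightarrow> exp (- v)"
  shows "(\<lambda>n. real n * (1 - p n)) \<longlonglongrightarrow> v"
proof -
  have "\<forall>\<^sub>F n in sequentially. 0 < p n ^ n" by (rule order_tendstoD(1)[OF lim]) simp
  then have pos: "\<forall>\<^sub>F n in sequentially. 0 < p n"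
    using eventually_gt_at_top[of 0]
  proof eventually_elim
    case (elim n) then show ?case using p(1)[of n] by (cases "p n = 0") (auto simp: zero_power)
  qed
  have "(\<lambda>n. - ln (p n ^ n)) \<longlonglongrightarrow> - ln (exp (- v))" by (intro tendsto_intros lim) simp
  moreover have "\<forall>\<^sub>F n in sequentially. - ln (p n ^ n) = - (real n * ln (p n))"
    using pos by eventually_elim (simp add: ln_realpow)
  ultimately have L: "(\<lambda>n. - (real n * ln (p n))) \<longlonglongrightarrow> v"
    by (simp add: tendsto_cong)
  have "(\<lambda>n. - (- (real n * ln (p n)) * (1 / real n))) \<longlonglongrightarrow> - (v * 0)"
    by (intro tendsto_intros L lim_1_over_n)
  moreover have "\<forall>\<^sub>F n in sequentially. - (- (real n * ln (p n)) * (1 / real n)) = ln (p n)"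
    using eventually_gt_at_top[of 0] by eventually_elim simp
  ultimately have "(\<lambda>n. ln (p n)) \<longlonglongrightarrow> 0" by (simp only: tendsto_cong mult_zero_right minus_zero)
  then have "(\<lambda>n. exp (ln (p n))) \<longlonglongrightarrow> exp 0" by (intro tendsto_intros)
  moreover have "\<forall>\<^sub>F n in sequentially. exp (ln (p n)) = p n" using pos by eventually_elim simp
  ultimately have p1: "p \<longlonglongrightarrow> 1" by (simp add: tendsto_cong)
  have big: "\<forall>\<^sub>F n in sequentially. 1 / 2 < p n" by (rule order_tendstoD(1)[OF p1]) simp
  show ?thesis
  proof (rule tendsto_sandwich)
    show "\<forall>\<^sub>F n in sequentially. - (real n * ln (p n)) / (1 + 2 * (1 - p n)) \<le> real n * (1 - p n)"
      using big
    proof eventually_elim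
      case (elim n)
      define x where "x = 1 - p n"
      have x: "0 \<le> x" "x \<le> 1 / 2" using elim p(2)[of n] by (auto simp: x_def)
      have "- ln (1 - x) \<le> x * (1 + 2 * x)"
        using ln_one_minus_pos_lower_bound[OF x] by (simp add: algebra_simps power2_eq_square)
      then have "real n * (- ln (1 - x)) \<le> real n * (x * (1 + 2 * x))" by (intro mult_left_mono) auto
      moreover have "0 < 1 + 2 * x" using x by simp
      ultimately have "- (real n * ln (1 - x)) / (1 + 2 * x) \<le> real n * x"
        by (simp only: pos_divide_le_eq mult.assoc mult_minus_right)
      then show ?case by (simp add: x_def)
    qed
    show "\<forall>\<^sub>F n in sequentially. real n * (1 - p n) \<le> - (real n * ln (p n))"
      using big
    proof eventually_elim
      case (elim n)
      have "real n * (1 - p n) \<le> real n * (- ln (p n))"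
        using ln_le_minus_one[of "p n"] elim by (intro mult_left_mono) auto
      then show ?case by simp
    qed
    have "(\<lambda>n. - (real n * ln (p n)) / (1 + 2 * (1 - p n))) \<longlonglongrightarrow> v / (1 + 2 * (1 - 1))"
      by (intro tendsto_intros L p1) simp
    then show "(\<lambda>n. - (real n * ln (p n)) / (1 + 2 * (1 - p n))) \<longlonglongrightarrow> v" by simp
  qed (rule L)
qed

section \<open>Indicators of boxes\<close>

text \<open>Corners are strictly positive because only the complements of such boxes have controlled
  mass. The constant is added for Stone-Weierstrass; intersections of boxes are boxes, so the family
  is closed under products.\<close>

definition box_functions :: "(real^'d \<Rightarrow> real) set"
  where "box_functions = insert (\<lambda>_. 1) {indicator {..x} | x. \<forall>j. 0 < x $ j}"

lemma box_functions_mult: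
  assumes "b \<in> box_functions" "b' \<in> box_functions"
  shows "(\<lambda>v. b v * b' v) \<in> (box_functions :: (real^'d \<Rightarrow> real) set)"
proof -
  have "(\<lambda>v. indicator {..x} v * indicator {..y} v) = (indicator {..\<chi> j. min (x $ j) (y $ j)} :: real^'d \<Rightarrow> real)" for x y
    by (auto simp: fun_eq_iff indicator_def less_eq_vec_def)
  then have "(\<lambda>v. indicator {..x} v * indicator {..y} v) \<in> (box_functions :: (real^'d \<Rightarrow> real) set)"
    if "\<forall>j. 0 < x $ j" "\<forall>j. 0 < y $ j" for x y
    using that unfolding box_functions_def by (auto intro!: exI[of _ "\<chi> j. min (x $ j) (y $ j)"])
  then show ?thesis using assms unfolding box_functions_def by auto
qed

text \<open>The sum is a staircase in \<open>y\<close> with unit steps, hence within 1 of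
  \<open>y\<close>; rescaled, it gives the error 1 / N in the approximation of a coordinate.\<close>

lemma count_less_bounds:
  "0 \<le> y \<Longrightarrow> y \<le> real K \<Longrightarrow> y - 1 \<le> (\<Sum>k=1..<Suc K. if real k < y then 1 else 0 :: real)
    \<and> (\<Sum>k=1..<Suc K. if real k < y then 1 else 0 :: real) \<le> y"
proof (induction K)
  case (Suc K)
  show ?case
  proof (cases "y \<le> real K")
    case True
    then show ?thesis using Suc by simp
  next
    case False
    then have "(\<Sum>k=1..<Suc K. if real k < y then 1 else 0 :: real) = (\<Sum>k=1..<Suc K. 1)"
      by (intro sum.cong) auto
    then show ?thesis using False Suc.prems by simp
  qed
qed simp

lemma box_span_coordinate:
  assumes M: "0 < M"
  shows "span_approx box_functions {v::real^'d. \<forall>j. 0 \<le> v $ j \<and> v $ j \<le> M} (\<lambda>v. v $ i)"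
  unfolding span_approx_def
proof (intro allI impI)
  fix \<epsilon> :: real assume "\<epsilon> > 0"
  then obtain N :: nat where N: "N > 0" "1 / real N \<le> \<epsilon>"
    by (metis less_imp_le nat_approx_posE of_nat_0_less_iff of_nat_Suc zero_less_Suc)
  obtain K :: nat where K: "real N * M \<le> real K" using real_arch_simple by blast
  \<comment> \<open>Inside the cube the other coordinates impose no condition, so this box tests
    only whether coordinate \<open>i\<close> is at most \<open>k / N\<close>.\<close>
  define x where "x k = (\<chi> j. if j = i then real k / real N else M)" for k :: nat
  \<comment> \<open>The leading constant turns each indicator into its complement: the combination
    is 1 / N times the number of grid levels strictly below coordinate \<open>i\<close>.\<close>
  define l where "l = (real K / real N, \<lambda>_. 1) # map (\<lambda>k. (- 1 / real N, indicator {..x k} :: real^'d \<Rightarrow> real)) [1..<Suc K]"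
  have "snd ` set l \<subseteq> box_functions"
    using N M unfolding l_def box_functions_def x_def by (auto intro!: exI[of _ "\<chi> j. if j = i then real _ / real N else M"])
  moreover have "\<bar>v $ i - lincomb l v\<bar> \<le> \<epsilon>" if v: "\<forall>j. 0 \<le> v $ j \<and> v $ j \<le> M" for v
  proof -
    have ind: "indicator {..x k} v = (1::real) - (if real k < real N * v $ i then 1 else 0)" for k
      using v N by (auto simp: indicator_def less_eq_vec_def x_def field_simps)
    have "lincomb l v = real K / real N + (\<Sum>k=1..<Suc K. - 1 / real N * indicator {..x k} v)"
      by (simp add: l_def lincomb_def o_def interv_sum_list_conv_sum_set_nat del: upt_Suc)
    also have "(\<Sum>k=1..<Suc K. - 1 / real N * indicator {..x k} v)
        = (\<Sum>k=1..<Suc K. - 1 / real N + (if real k < real N * v $ i then 1 else 0) / real N)"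
      unfolding ind by (intro sum.cong) (auto simp: field_simps)
    also have "\<dots> = - real K / real N + (\<Sum>k=1..<Suc K. if real k < real N * v $ i then 1 else 0) / real N"
      by (simp add: sum.distrib sum_subtractf sum_divide_distrib del: sum.op_ivl_Suc)
    finally have eq: "lincomb l v = (\<Sum>k=1..<Suc K. if real k < real N * v $ i then 1 else 0) / real N" by simp
    have "real N * v $ i \<le> real K"
      using v K N by (meson mult_left_mono of_nat_0_le_iff order_trans)
    then have b: "real N * v $ i - 1 \<le> (\<Sum>k=1..<Suc K. if real k < real N * v $ i then 1 else 0)"
      "(\<Sum>k=1..<Suc K. if real k < real N * v $ i then 1 else 0) \<le> real N * v $ i"
      using count_less_bounds[of "real N * v $ i" K] v by auto
    define S where "S = (\<Sum>k=1..<Suc K. if real k < real N * v $ i then 1 else 0 :: real)"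
    have "v $ i - S / real N = (real N * v $ i - S) / real N" using N by (simp add: field_simps)
    then have "\<bar>v $ i - S / real N\<bar> = \<bar>real N * v $ i - S\<bar> / real N" by (simp add: abs_divide)
    also have "\<dots> \<le> 1 / real N" using b unfolding S_def[symmetric] by (intro divide_right_mono) auto
    finally have "\<bar>v $ i - lincomb l v\<bar> \<le> 1 / real N" unfolding eq S_def .
    then show ?thesis using N by simp
  qed
  ultimately show "\<exists>l. snd ` set l \<subseteq> box_functions \<and>
      (\<forall>v\<in>{v. \<forall>j. 0 \<le> v $ j \<and> v $ j \<le> M}. \<bar>v $ i - lincomb l v\<bar> \<le> \<epsilon>)" by blast
qed

lemma box_span:
  fixes f :: "real^'d \<Rightarrow> real"
  assumes M: "0 < M" and f: "continuous_on {v. \<forall>j. 0 \<le> v $ j \<and> v $ j \<le> M} f"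
  shows "span_approx box_functions {v. \<forall>j. 0 \<le> v $ j \<and> v $ j \<le> M} f"
proof (rule Stone_Weierstrass_span[OF _ _ _ _ _ f])
  have "{v::real^'d. \<forall>j. 0 \<le> v $ j \<and> v $ j \<le> M} = cbox 0 (\<chi> j. M)"
    by (auto simp: mem_box_cart)
  then show "compact {v::real^'d. \<forall>j. 0 \<le> v $ j \<and> v $ j \<le> M}" by simp
  show "\<exists>c. \<forall>x\<in>{v. \<forall>j. 0 \<le> v $ j \<and> v $ j \<le> M}. \<bar>b x\<bar> \<le> c"
    if "b \<in> box_functions" for b :: "real^'d \<Rightarrow> real"
    using that by (intro exI[of _ 1]) (auto simp: box_functions_def indicator_def)
  fix x y :: "real^'d" assume "x \<noteq> y"
  then obtain i where "x $ i \<noteq> y $ i" by (auto simp: vec_eq_iff)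
  then show "\<exists>g. continuous_on {v. \<forall>j. 0 \<le> v $ j \<and> v $ j \<le> M} g \<and>
      span_approx box_functions {v. \<forall>j. 0 \<le> v $ j \<and> v $ j \<le> M} g \<and> g x \<noteq> g y"
    using box_span_coordinate[OF M, of i] by (intro exI[of _ "\<lambda>v. v $ i"]) (auto intro: continuous_intros)
qed (auto simp: box_functions_mult, simp add: box_functions_def)

text \<open>The measures may have infinite mass near the origin. Since \<open>f\<close> vanishes
  there, everything is multiplied by the indicator of the complement of a small box, whose mass is
  finite and convergent; the approximation error is then controlled by that mass.\<close>

lemma box_measures_imp_tendsto:
  fixes \<mu> :: "nat \<Rightarrow> (real^'d) measure" and f :: "real^'d \<Rightarrow> real"
  assumes sets [measurable_cong]: "\<And>n. sets (\<mu> n) = sets borel" "sets \<nu> = sets borel"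
    and fin: "\<And>n x. \<forall>j. 0 < x $ j \<Longrightarrow> emeasure (\<mu> n) (- {..x}) < \<infinity>"
      "\<And>x. \<forall>j. 0 < x $ j \<Longrightarrow> emeasure \<nu> (- {..x}) < \<infinity>"
    and lim: "\<And>x. \<forall>j. 0 < x $ j \<Longrightarrow> (\<lambda>n. measure (\<mu> n) (- {..x})) \<longlonglongrightarrow> measure \<nu> (- {..x})"
    and nonneg: "\<And>n. AE v in \<mu> n. \<forall>j. 0 \<le> v $ j" "AE v in \<nu>. \<forall>j. 0 \<le> v $ j"
    and f: "continuous_on {v. \<forall>j. 0 \<le> v $ j} f" "f \<in> borel_measurable borel"
    and \<delta>: "0 < \<delta>" "\<And>v. \<forall>j. 0 \<le> v $ j \<Longrightarrow> \<forall>j. v $ j \<le> \<delta> \<Longrightarrow> f v = 0"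
    and M: "0 < M" "\<And>v i. \<forall>j. 0 \<le> v $ j \<Longrightarrow> M < v $ i \<Longrightarrow> f v = 0"
  shows "(\<lambda>n. \<integral>v. f v \<partial>\<mu> n) \<longlonglongrightarrow> (\<integral>v. f v \<partial>\<nu>)"
proof -
  note [measurable] = f(2)
  let ?K = "{v::real^'d. \<forall>j. 0 \<le> v $ j \<and> v $ j \<le> M}"
  define d :: "real^'d" where "d = (\<chi> j. \<delta>)"
  define m :: "real^'d" where "m = (\<chi> j. M)"
  have d: "\<forall>j. 0 < d $ j" and m: "\<forall>j. 0 < m $ j" using \<delta>(1) M(1) by (auto simp: d_def m_def)
  \<comment> \<open>The complement of the intersection of two boxes splits into the complement of
    one box and the part of that box lying outside the other. So masses of complements of boxes
    determine these integrals.\<close>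
  have box: "(integrable \<rho> (\<lambda>v. indicator (- {..d}) v * b v)) \<and>
     (\<integral>v. indicator (- {..d}) v * b v \<partial>\<rho>) =
       (if b = (\<lambda>_. 1) then measure \<rho> (- {..d}) else measure \<rho> (- {..\<chi> j. min (x $ j) (\<delta>)}) - measure \<rho> (- {..x}))"
    if b: "b = (\<lambda>_. 1) \<or> b = indicator {..x}" and x: "\<forall>j. 0 < x $ j"
      and [measurable_cong]: "sets \<rho> = sets borel" and fin: "\<And>x. \<forall>j. 0 < x $ j \<Longrightarrow> emeasure \<rho> (- {..x}) < \<infinity>"
    for b x and \<rho> :: "(real^'d) measure"
  proof (cases "b = (\<lambda>_. 1)")
    case True
    then show ?thesis using fin[OF d] by (simp add: less_top)
  next
    case False
    then have b: "b = indicator {..x}" using b by simp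
    let ?y = "\<chi> j. min (x $ j) \<delta>"
    have y: "\<forall>j. 0 < ?y $ j" using x \<delta>(1) by simp
    have un: "- {..?y} = - {..x} \<union> (- {..d} \<inter> {..x})"
      by (auto simp: less_eq_vec_def d_def)
    have [measurable]: "{..z} \<in> sets \<rho>" "- {..z} \<in> sets \<rho>" for z by (auto simp: that(3))
    have f2: "emeasure \<rho> (- {..d} \<inter> {..x}) < \<infinity>"
      using fin[OF d] by (rule le_less_trans[rotated]) (auto intro!: emeasure_mono)
    have "measure \<rho> (- {..?y}) = measure \<rho> (- {..x}) + measure \<rho> (- {..d} \<inter> {..x})"
      unfolding un using fin[OF x] f2 by (intro measure_Union) auto
    moreover have "(\<lambda>v. indicator (- {..d}) v * b v) = indicator (- {..d} \<inter> {..x})"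
      by (auto simp: b fun_eq_iff indicator_def)
    ultimately show ?thesis using False f2 by (simp add: less_top)
  qed
  have lin: "snd ` set l \<subseteq> box_functions \<Longrightarrow>
      (\<forall>n. integrable (\<mu> n) (\<lambda>v. indicator (- {..d}) v * lincomb l v)) \<and>
      integrable \<nu> (\<lambda>v. indicator (- {..d}) v * lincomb l v) \<and>
      (\<lambda>n. \<integral>v. indicator (- {..d}) v * lincomb l v \<partial>\<mu> n) \<longlonglongrightarrow> (\<integral>v. indicator (- {..d}) v * lincomb l v \<partial>\<nu>)" for l
  proof (induction l)
    case (Cons p l)
    obtain c b where p: "p = (c, b)" by force
    have "b \<in> box_functions" using Cons.prems p by simp
    then obtain x where x: "b = (\<lambda>_. 1) \<or> b = indicator {..x}" "\<forall>j. 0 < x $ j"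
      using d unfolding box_functions_def by auto
    have y: "\<forall>j. 0 < (\<chi> j. min (x $ j) \<delta>) $ j" using x(2) \<delta>(1) by simp
    note b1 = box[OF x sets(1) fin(1)] and b2 = box[OF x sets(2) fin(2)]
    have bl: "(\<lambda>n. \<integral>v. indicator (- {..d}) v * b v \<partial>\<mu> n) \<longlonglongrightarrow> (\<integral>v. indicator (- {..d}) v * b v \<partial>\<nu>)"
      using b1 b2 lim[OF d] tendsto_diff[OF lim[OF y] lim[OF x(2)]] by simp
    have e: "(\<lambda>v. indicator (- {..d}) v * lincomb (p # l) v)
        = (\<lambda>v. c * (indicator (- {..d}) v * b v) + indicator (- {..d}) v * lincomb l v)"
      by (auto simp: p algebra_simps)
    have "(\<lambda>n. c * (\<integral>v. indicator (- {..d}) v * b v \<partial>\<mu> n) + (\<integral>v. indicator (- {..d}) v * lincomb l v \<partial>\<mu> n))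
        \<longlonglongrightarrow> c * (\<integral>v. indicator (- {..d}) v * b v \<partial>\<nu>) + (\<integral>v. indicator (- {..d}) v * lincomb l v \<partial>\<nu>)"
      using Cons bl by (intro tendsto_intros) auto
    then show ?case unfolding e using b1 b2 Cons by auto
  qed simp
  have approx: "\<exists>l. snd ` set l \<subseteq> box_functions \<and>
      (\<forall>v. (\<forall>j. 0 \<le> v $ j) \<longrightarrow> \<bar>f v - indicator (- {..d}) v * lincomb l v\<bar> \<le> \<epsilon> * indicator (- {..d}) v)"
    if "\<epsilon> > 0" for \<epsilon>
  proof -
    have "continuous_on ?K f" by (rule continuous_on_subset[OF f(1)]) auto
    from span_approxD[OF box_span[OF M(1) this] that]
    obtain l where l: "snd ` set l \<subseteq> box_functions" "\<And>v. v \<in> ?K \<Longrightarrow> \<bar>f v - lincomb l v\<bar> \<le> \<epsilon>"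
      by auto
    \<comment> \<open>Outside the cube the combination \<open>l\<close> is uncontrolled while
      \<open>f\<close> is 0; multiplication by the indicator of the cube removes this part and stays
      within the span.\<close>
    have mb: "snd ` set [(1, indicator {..m})] \<subseteq> (box_functions :: (real^'d \<Rightarrow> real) set)"
      using m by (auto simp: box_functions_def)
    obtain k where k: "snd ` set k \<subseteq> box_functions" "\<And>v. lincomb k v = lincomb [(1, indicator {..m})] v * lincomb l v"
      using lincomb_mult_exists[OF box_functions_mult mb l(1)] by blast
    have "\<bar>f v - indicator (- {..d}) v * lincomb k v\<bar> \<le> \<epsilon> * indicator (- {..d}) v" if v: "\<forall>j. 0 \<le> v $ j" for v
    proof (cases "v \<le> d")
      case True
      then show ?thesis using \<delta>(2)[OF v] by (auto simp: d_def less_eq_vec_def)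
    next
      case nd: False
      show ?thesis
      proof (cases "v \<le> m")
        case True
        then have "v \<in> ?K" using v by (auto simp: m_def less_eq_vec_def)
        then show ?thesis using l(2) True nd by (simp add: k)
      next
        case False
        then have "f v = 0" using M(2)[OF v] by (auto simp: m_def less_eq_vec_def not_le)
        then show ?thesis using False nd \<open>\<epsilon> > 0\<close> by (simp add: k)
      qed
    qed
    then show ?thesis using k(1) by blast
  qed
  have int: "integrable \<rho> f \<and> \<bar>(\<integral>v. f v \<partial>\<rho>) - (\<integral>v. indicator (- {..d}) v * lincomb l v \<partial>\<rho>)\<bar> \<le> \<epsilon> * measure \<rho> (- {..d})"
    if l: "\<forall>v. (\<forall>j. 0 \<le> v $ j) \<longrightarrow> \<bar>f v - indicator (- {..d}) v * lincomb l v\<bar> \<le> \<epsilon> * indicator (- {..d}) v"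
      and i: "integrable \<rho> (\<lambda>v. indicator (- {..d}) v * lincomb l v)"
      and [measurable_cong]: "sets \<rho> = sets borel" and fin: "emeasure \<rho> (- {..d}) < \<infinity>"
      and ae: "AE v in \<rho>. \<forall>j. 0 \<le> v $ j"
    for l \<epsilon> and \<rho> :: "(real^'d) measure"
  proof -
    have [measurable]: "- {..d} \<in> sets \<rho>" by (simp add: that(3))
    have e: "integrable \<rho> (\<lambda>v. \<epsilon> * indicator (- {..d}) v :: real)"
      using fin by (intro integrable_mult_right) (simp add: less_top)
    have ae': "AE v in \<rho>. \<bar>f v - indicator (- {..d}) v * lincomb l v\<bar> \<le> \<epsilon> * indicator (- {..d}) v"
      using ae by eventually_elim (use l in blast)
    have "integrable \<rho> (\<lambda>v. f v - indicator (- {..d}) v * lincomb l v)"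
    proof (rule Bochner_Integration.integrable_bound[OF e])
      show "AE v in \<rho>. norm (f v - indicator (- {..d}) v * lincomb l v) \<le> norm (\<epsilon> * indicator (- {..d}) v :: real)"
        using ae' by eventually_elim auto
    qed (use i in measurable)
    from Bochner_Integration.integrable_add[OF this i] have f: "integrable \<rho> f" by simp
    have "\<bar>\<integral>v. f v - indicator (- {..d}) v * lincomb l v \<partial>\<rho>\<bar> \<le> (\<integral>v. \<epsilon> * indicator (- {..d}) v \<partial>\<rho>)"
      using f i e ae' by (intro order_trans[OF integral_abs_bound] integral_mono_AE) auto
    then show ?thesis using f i by simp
  qed
  show ?thesis
  proof (rule LIMSEQ_I)
    fix r :: real assume r: "r > 0"
    define c where "c = measure \<nu> (- {..d}) + 1"
    have c: "c > 0" "measure \<nu> (- {..d}) < c" unfolding c_def by (auto intro: add_nonneg_pos)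
    define \<epsilon> where "\<epsilon> = r / (4 * c)"
    have \<epsilon>: "\<epsilon> > 0" "\<epsilon> * c = r / 4" using r c by (auto simp: \<epsilon>_def)
    obtain l where l: "snd ` set l \<subseteq> box_functions"
      "\<forall>v. (\<forall>j. 0 \<le> v $ j) \<longrightarrow> \<bar>f v - indicator (- {..d}) v * lincomb l v\<bar> \<le> \<epsilon> * indicator (- {..d}) v"
      using approx[OF \<epsilon>(1)] by blast
    note L = lin[OF l(1)]
    let ?s = "\<lambda>v. indicator (- {..d}) v * lincomb l v"
    have "\<forall>\<^sub>F n in sequentially. \<bar>(\<integral>v. ?s v \<partial>\<mu> n) - (\<integral>v. ?s v \<partial>\<nu>)\<bar> < r / 4"
      using tendstoD[OF L[THEN conjunct2, THEN conjunct2], of "r / 4"] r unfolding dist_real_def by simp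
    moreover have "\<forall>\<^sub>F n in sequentially. measure (\<mu> n) (- {..d}) < c"
      by (rule order_tendstoD(2)[OF lim[OF d] c(2)])
    ultimately have "\<forall>\<^sub>F n in sequentially. norm ((\<integral>v. f v \<partial>\<mu> n) - (\<integral>v. f v \<partial>\<nu>)) < r"
    proof eventually_elim
      case (elim n)
      have "\<bar>(\<integral>v. f v \<partial>\<mu> n) - (\<integral>v. ?s v \<partial>\<mu> n)\<bar> \<le> \<epsilon> * measure (\<mu> n) (- {..d})"
        using int[OF l(2) _ sets(1) fin(1)[OF d] nonneg(1)] L by blast
      also have "\<dots> \<le> \<epsilon> * c" using elim \<epsilon> by (intro mult_left_mono) auto
      finally have 1: "\<bar>(\<integral>v. f v \<partial>\<mu> n) - (\<integral>v. ?s v \<partial>\<mu> n)\<bar> \<le> r / 4" unfolding \<epsilon>(2) .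
      have "\<bar>(\<integral>v. f v \<partial>\<nu>) - (\<integral>v. ?s v \<partial>\<nu>)\<bar> \<le> \<epsilon> * measure \<nu> (- {..d})"
        using int[OF l(2) _ sets(2) fin(2)[OF d] nonneg(2)] L by blast
      also have "\<dots> \<le> \<epsilon> * c" using c \<epsilon> by (intro mult_left_mono) auto
      finally have 2: "\<bar>(\<integral>v. f v \<partial>\<nu>) - (\<integral>v. ?s v \<partial>\<nu>)\<bar> \<le> r / 4" unfolding \<epsilon>(2) .
      show ?case using 1 2 elim(1) r unfolding real_norm_def by linarith
    qed
    then show "\<exists>no. \<forall>n\<ge>no. norm ((\<integral>v. f v \<partial>\<mu> n) - (\<integral>v. f v \<partial>\<nu>)) < r"
      by (simp add: eventually_sequentially)
  qed
qed

section \<open>Weak limits of probability measures on cubes\<close>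

text \<open>Digit 0 is the integer part. Thus the right end point 1 has digits in {0, 1} too, at the
  price that arbitrary digit sequences decode to values up to 2.\<close>

definition digit :: "nat \<Rightarrow> real \<Rightarrow> real"
  where "digit k x = real_of_int (\<lfloor>2 ^ k * x\<rfloor> - (if k = 0 then 0 else 2 * \<lfloor>2 ^ (k - 1) * x\<rfloor>))"

lemma digit_cases:
  assumes "x \<in> {0..1}"
  shows "digit k x \<in> {0, 1}"
proof (cases k)
  case 0
  have "\<lfloor>x\<rfloor> = 0 \<or> \<lfloor>x\<rfloor> = 1" using assms by (cases "x = 1") (auto simp: floor_eq_iff)
  then show ?thesis using 0 by (auto simp: digit_def)
next
  case (Suc m)
  define y where "y = 2 ^ m * x"
  have "2 * \<lfloor>y\<rfloor> \<le> \<lfloor>2 * y\<rfloor>" "\<lfloor>2 * y\<rfloor> \<le> 2 * \<lfloor>y\<rfloor> + 1" by linarith+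
  then have "\<lfloor>2 * y\<rfloor> - 2 * \<lfloor>y\<rfloor> = 0 \<or> \<lfloor>2 * y\<rfloor> - 2 * \<lfloor>y\<rfloor> = 1" by linarith
  moreover have "digit k x = real_of_int (\<lfloor>2 * y\<rfloor> - 2 * \<lfloor>y\<rfloor>)"
    by (simp add: digit_def Suc y_def mult.assoc)
  ultimately show ?thesis by fastforce
qed

lemma digit_sums: "(\<lambda>k. digit k x / 2 ^ k) sums x"
proof -
  have partial: "(\<Sum>k\<le>m. digit k x / 2 ^ k) = real_of_int \<lfloor>2 ^ m * x\<rfloor> / 2 ^ m" for m
    by (induction m) (auto simp: digit_def field_simps)
  have "(\<lambda>m. real_of_int \<lfloor>2 ^ m * x\<rfloor> / 2 ^ m) \<longlonglongrightarrow> x"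
  proof (rule tendsto_sandwich)
    have lo: "x - 1 / 2 ^ m \<le> real_of_int \<lfloor>2 ^ m * x\<rfloor> / 2 ^ m" for m :: nat
    proof -
      have "2 ^ m * x - 1 \<le> real_of_int \<lfloor>2 ^ m * x\<rfloor>" by linarith
      then have "(2 ^ m * x - 1) / 2 ^ m \<le> real_of_int \<lfloor>2 ^ m * x\<rfloor> / 2 ^ m" by (intro divide_right_mono) auto
      then show ?thesis by (simp add: diff_divide_distrib)
    qed
    have hi: "real_of_int \<lfloor>2 ^ m * x\<rfloor> / 2 ^ m \<le> x" for m :: nat
    proof -
      have "real_of_int \<lfloor>2 ^ m * x\<rfloor> / 2 ^ m \<le> (2 ^ m * x) / 2 ^ m" by (intro divide_right_mono) auto
      then show ?thesis by simp
    qed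
    show "\<forall>\<^sub>F m in sequentially. x - 1 / 2 ^ m \<le> real_of_int \<lfloor>2 ^ m * x\<rfloor> / 2 ^ m"
      "\<forall>\<^sub>F m in sequentially. real_of_int \<lfloor>2 ^ m * x\<rfloor> / 2 ^ m \<le> x"
      using lo hi by auto
    have "(\<lambda>m. x - (1 / 2) ^ m) \<longlonglongrightarrow> x - 0" by (intro tendsto_intros LIMSEQ_power_zero) auto
    then show "(\<lambda>m. x - 1 / 2 ^ m) \<longlonglongrightarrow> x" by (simp add: power_one_over)
  qed simp
  then show ?thesis unfolding sums_def_le partial .
qed

section \<open>The Cantor set and its embedding into the line\<close>

definition cantor :: "(nat \<Rightarrow> real) set"
  where "cantor = {\<delta>. \<forall>i. \<delta> i \<in> {0, 1}}"

lemma compact_cantor: "compact cantor"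
proof -
  have "compactin (product_topology (\<lambda>_. euclidean) UNIV) (PiE UNIV (\<lambda>_::nat. {0, 1::real}))"
    by (subst compactin_PiE) auto
  then have "compact (PiE UNIV (\<lambda>_::nat. {0, 1::real}))"
    by (simp add: euclidean_product_topology flip: compactin_euclidean_iff)
  also have "PiE UNIV (\<lambda>_::nat. {0, 1::real}) = cantor" by (auto simp: cantor_def)
  finally show ?thesis .
qed

text \<open>Used twice: with base 2 for decoding, where \<open>g\<close> selects the digits of one
  coordinate, and with base 3 for the embedding into the line.\<close>

lemma continuous_on_cantor_series:
  fixes c :: real and g :: "nat \<Rightarrow> nat"
  assumes "1 < c"
  shows "continuous_on cantor (\<lambda>\<delta>. \<Sum>i. \<delta> (g i) / c ^ i)"
proof (rule uniform_limit_theorem)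
  show "uniform_limit cantor (\<lambda>n \<delta>. \<Sum>i<n. \<delta> (g i) / c ^ i) (\<lambda>\<delta>. \<Sum>i. \<delta> (g i) / c ^ i) sequentially"
  proof (rule Weierstrass_m_test)
    show "norm (\<delta> (g i) / c ^ i) \<le> (1 / c) ^ i" if "\<delta> \<in> cantor" for i \<delta>
    proof -
      have "\<delta> (g i) \<in> {0, 1}" using that by (auto simp: cantor_def)
      then show ?thesis using assms by (auto simp: power_one_over)
    qed
    show "summable (\<lambda>i. (1 / c) ^ i)" using assms by (intro summable_geometric) auto
  qed
  show "\<forall>\<^sub>F n in sequentially. continuous_on cantor (\<lambda>\<delta>. \<Sum>i<n. \<delta> (g i) / c ^ i)"
    using assms
    by (intro always_eventually allI continuous_intros continuous_on_subset[OF continuous_on_product_coordinates]) auto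
qed simp

text \<open>Up to the factor 3/2 the usual map onto the middle-thirds Cantor set.\<close>

definition ternary :: "(nat \<Rightarrow> real) \<Rightarrow> real"
  where "ternary \<delta> = (\<Sum>i. \<delta> i / 3 ^ i)"

lemma ternary_summable: "\<delta> \<in> cantor \<Longrightarrow> summable (\<lambda>i. \<delta> i / 3 ^ i)"
proof (rule summable_comparison_test'[of "\<lambda>i. (1 / 3) ^ i" 0])
  fix i assume "\<delta> \<in> cantor"
  then have "\<delta> i \<in> {0, 1}" by (auto simp: cantor_def)
  then show "norm (\<delta> i / 3 ^ i) \<le> (1 / 3) ^ i" by (auto simp: power_one_over)
qed simp

text \<open>At the first position \<open>k\<close> where two sequences differ, the term has size
  3^(-k), while all later terms together contribute at most half of that. In base 2 this would
  fail.\<close>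

lemma inj_on_ternary: "inj_on ternary cantor"
proof (rule inj_onI, rule ccontr)
  fix \<delta> \<epsilon> assume \<delta>: "\<delta> \<in> cantor" and \<epsilon>: "\<epsilon> \<in> cantor" and eq: "ternary \<delta> = ternary \<epsilon>" and "\<delta> \<noteq> \<epsilon>"
  define d where "d i = (\<delta> i - \<epsilon> i) / 3 ^ i" for i
  have d_abs: "\<bar>\<delta> i - \<epsilon> i\<bar> \<le> 1" for i
  proof -
    have "\<delta> i \<in> {0, 1}" "\<epsilon> i \<in> {0, 1}" using \<delta> \<epsilon> by (auto simp: cantor_def)
    then show ?thesis by auto
  qed
  have d_eq: "d = (\<lambda>i. \<delta> i / 3 ^ i - \<epsilon> i / 3 ^ i)" by (simp add: d_def diff_divide_distrib fun_eq_iff)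
  have d_sum: "summable d"
    unfolding d_eq by (rule summable_diff[OF ternary_summable[OF \<delta>] ternary_summable[OF \<epsilon>]])
  have d_sum0: "suminf d = 0"
    using suminf_diff[OF ternary_summable[OF \<delta>] ternary_summable[OF \<epsilon>]] eq unfolding d_eq ternary_def by simp
  define k where "k = (LEAST i. \<delta> i \<noteq> \<epsilon> i)"
  obtain i0 where "\<delta> i0 \<noteq> \<epsilon> i0" using \<open>\<delta> \<noteq> \<epsilon>\<close> by blast
  then have k: "\<delta> k \<noteq> \<epsilon> k" unfolding k_def by (rule LeastI)
  have less: "\<delta> i = \<epsilon> i" if "i < k" for i using not_less_Least[OF that[unfolded k_def]] by simp
  have "(\<Sum>i<Suc k. d i) = d k" using less by (simp add: d_def)
  then have tail: "(\<Sum>i. d (i + Suc k)) = - d k"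
    using suminf_split_initial_segment[OF d_sum, of "Suc k"] d_sum0 by linarith
  have "\<bar>\<Sum>i. d (i + Suc k)\<bar> \<le> (\<Sum>i. (1 / 3) ^ Suc k * (1 / 3) ^ i)"
  proof -
    have le: "\<bar>d (i + Suc k)\<bar> \<le> (1 / 3) ^ Suc k * (1 / 3) ^ i" for i
    proof -
      have "\<bar>d (i + Suc k)\<bar> = \<bar>\<delta> (i + Suc k) - \<epsilon> (i + Suc k)\<bar> / 3 ^ (i + Suc k)"
        unfolding d_def abs_divide by simp
      also have "\<dots> \<le> 1 / 3 ^ (i + Suc k)" using d_abs by (rule divide_right_mono) simp
      also have "\<dots> = (1 / 3) ^ Suc k * (1 / 3) ^ i" by (simp add: power_one_over power_add)
      finally show ?thesis .
    qed
    have s: "summable (\<lambda>i. (1 / 3) ^ Suc k * (1 / 3 :: real) ^ i)" by (intro summable_mult summable_geometric) auto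
    then have s': "summable (\<lambda>i. \<bar>d (i + Suc k)\<bar>)"
      by (rule summable_comparison_test'[where N = 0]) (use le in auto)
    have "\<bar>\<Sum>i. d (i + Suc k)\<bar> \<le> (\<Sum>i. \<bar>d (i + Suc k)\<bar>)" by (rule summable_rabs[OF s'])
    also have "\<dots> \<le> (\<Sum>i. (1 / 3) ^ Suc k * (1 / 3) ^ i)" by (rule suminf_le[OF le s' s])
    finally show ?thesis .
  qed
  also have "\<dots> = (1 / 3) ^ k / 2"
    by (subst suminf_mult) (auto intro: summable_geometric simp: suminf_geometric)
  finally have "\<bar>d k\<bar> \<le> (1 / 3) ^ k / 2" unfolding tail by simp
  moreover have "\<bar>\<delta> k - \<epsilon> k\<bar> = 1"
  proof -
    have "\<delta> k \<in> {0, 1}" "\<epsilon> k \<in> {0, 1}" using \<delta> \<epsilon> by (auto simp: cantor_def)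
    then show ?thesis using k by auto
  qed
  then have "\<bar>d k\<bar> = (1 / 3) ^ k" by (simp add: d_def abs_divide power_one_over)
  ultimately show False by (simp add: power_one_over field_simps)
qed

text \<open>The binary digits embed the cube into the Cantor set, hence into the line, where Helly's
  theorem applies; Dugundji's theorem extends the continuous decoding map to the whole line.\<close>

lemma cube_measures_convergent_subsequence:
  fixes P :: "nat \<Rightarrow> (real^'d) measure"
  assumes P: "\<And>n. prob_space (P n)" and sets [measurable_cong]: "\<And>n. sets (P n) = sets borel"
    and cube: "\<And>n. AE v in P n. \<forall>j. v $ j \<in> {0..1}"
  obtains r P' where "strict_mono (r :: nat \<Rightarrow> nat)" "prob_space P'" "sets P' = sets borel"
    "AE v in P'. \<forall>j. v $ j \<in> {0..2}"
    "\<And>f :: real^'d \<Rightarrow> real. continuous_on UNIV f \<Longrightarrow> (\<lambda>n. \<integral>v. f v \<partial>P (r n)) \<longlonglongrightarrow> (\<integral>v. f v \<partial>P')"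
proof -
  \<comment> \<open>An index encodes a digit position together with a coordinate, so one binary
    sequence carries the digits of all coordinates. Encoding is merely measurable; decoding by
    \<open>q\<close> is continuous.\<close>
  define s where "s v i = (case from_nat i of (k, j) \<Rightarrow> digit k (v $ j))" for v :: "real^'d" and i
  define q :: "(nat \<Rightarrow> real) \<Rightarrow> real^'d" where "q \<delta> = (\<chi> j. \<Sum>k. \<delta> (to_nat (k, j)) / 2 ^ k)" for \<delta>
  let ?B = "cbox 0 (\<chi> j. 2) :: (real^'d) set"
  have q_s: "q (s v) = v" for v :: "real^'d"
    using digit_sums by (simp add: q_def s_def vec_eq_iff sums_iff)
  have s_cantor: "s v \<in> cantor" if "\<forall>j. v $ j \<in> {0..1}" for v
    using digit_cases that by (fastforce simp: cantor_def s_def split: prod.split)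
  have q_cont: "continuous_on cantor q"
    unfolding q_def by (intro continuous_on_vec_lambda continuous_on_cantor_series) simp
  have q_box: "q \<delta> \<in> ?B" if "\<delta> \<in> cantor" for \<delta>
  proof -
    have d: "\<delta> i \<in> {0, 1}" for i using that by (auto simp: cantor_def)
    have "0 \<le> (\<Sum>k. \<delta> (to_nat (k, j)) / 2 ^ k) \<and> (\<Sum>k. \<delta> (to_nat (k, j)) / 2 ^ k) \<le> 2" for j :: 'd
    proof -
      have g: "summable (\<lambda>k. (1 / 2 :: real) ^ k)" by (intro summable_geometric) auto
      have le: "0 \<le> \<delta> (to_nat (k, j)) / 2 ^ k \<and> \<delta> (to_nat (k, j)) / 2 ^ k \<le> (1 / 2) ^ k" for k
        using d[of "to_nat (k, j)"] by (auto simp: power_one_over)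
      have "norm (\<delta> (to_nat (k, j)) / 2 ^ k) \<le> (1 / 2) ^ k" for k
        using le[of k] by (simp only: real_norm_def abs_of_nonneg)
      then have sm: "summable (\<lambda>k. \<delta> (to_nat (k, j)) / 2 ^ k)"
        by (intro summable_comparison_test'[OF g, of 0])
      have "(\<Sum>k. \<delta> (to_nat (k, j)) / 2 ^ k) \<le> (\<Sum>k. (1 / 2) ^ k)"
        by (rule suminf_le[OF _ sm g]) (use le in blast)
      also have "\<dots> = 2" by (simp add: suminf_geometric)
      finally show ?thesis using suminf_nonneg[OF sm] le by auto
    qed
    then show ?thesis by (auto simp: mem_box_cart q_def)
  qed
  have tc: "continuous_on cantor ternary"
    unfolding ternary_def[abs_def] by (rule continuous_on_cantor_series) simp
  have "continuous_on (ternary ` cantor) (inv_into cantor ternary)"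
    by (rule continuous_on_inv[OF tc compact_cantor]) (simp add: inv_into_f_f[OF inj_on_ternary])
  moreover have "inv_into cantor ternary ` (ternary ` cantor) \<subseteq> cantor"
    by (auto intro: inv_into_into)
  ultimately have qc: "continuous_on (ternary ` cantor) (q \<circ> inv_into cantor ternary)"
    by (intro continuous_on_compose) (auto intro: continuous_on_subset[OF q_cont])
  have "compact (ternary ` cantor)"
    by (intro compact_continuous_image compact_cantor tc)
  then have cl: "closedin (top_of_set UNIV) (ternary ` cantor)" by (simp add: compact_imp_closed)
  have img: "(q \<circ> inv_into cantor ternary) ` ternary ` cantor \<subseteq> ?B"
    using q_box inj_on_ternary by auto
  have ne: "?B \<noteq> {}" by (auto simp: box_ne_empty Basis_vec_def inner_axis)
  \<comment> \<open>The extension takes its values in the convex box with side 2, where decoded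
    sequences lie. Weak limits on the line can now be pushed forward by a map that is continuous
    everywhere.\<close>
  obtain g where g: "continuous_on UNIV g" "g ` UNIV \<subseteq> ?B"
    "\<And>t. t \<in> ternary ` cantor \<Longrightarrow> g t = (q \<circ> inv_into cantor ternary) t"
    by (rule Dugundji[OF convex_box(1) ne cl qc img]) (rule that)
  have g_s: "g (ternary (s v)) = v" if "\<forall>j. v $ j \<in> {0..1}" for v
    using g(3)[of "ternary (s v)"] s_cantor[OF that] inj_on_ternary q_s by simp
  have digit_m [measurable]: "digit k \<in> borel_measurable borel" for k
    unfolding digit_def[abs_def] by measurable
  have "(\<lambda>v. s v i) \<in> borel_measurable borel" for i
    unfolding s_def by (cases "from_nat i :: nat \<times> 'd") simp
  then have s_m: "(\<lambda>v. ternary (s v)) \<in> borel_measurable borel"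
    unfolding ternary_def by measurable
  have g_m [measurable]: "g \<in> borel_measurable borel" using g(1) by (rule borel_measurable_continuous_onI)
  define \<mu> where "\<mu> n = distr (P n) borel (\<lambda>v. ternary (s v))" for n
  have s_m' [measurable]: "(\<lambda>v. ternary (s v)) \<in> borel_measurable (P n)" for n
    using s_m by (simp add: measurable_cong_sets[OF sets refl])
  have real: "real_distribution (\<mu> n)" for n
    unfolding \<mu>_def by (rule prob_space.real_distribution_distr[OF P s_m'])
  have "tight \<mu>"
    unfolding tight_def
  proof (intro conjI allI impI real)
    fix \<epsilon> :: real assume "\<epsilon> > 0"
    \<comment> \<open>Encoded points lie between 0 and 3/2, the sum of the geometric series with
      ratio 1/3; one interval thus proves tightness for every \<epsilon>.\<close>
    have "measure (\<mu> n) {-1<..2} = 1" for n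
    proof -
      interpret P: prob_space "P n" by (rule P)
      have "AE v in P n. ternary (s v) \<in> {-1<..2}"
        using cube[of n]
      proof eventually_elim
        case (elim v)
        have sc: "s v \<in> cantor" by (rule s_cantor[OF elim])
        have le: "0 \<le> s v i / 3 ^ i \<and> s v i / 3 ^ i \<le> (1 / 3) ^ i" for i
        proof -
          have "s v i \<in> {0, 1}" using sc by (auto simp: cantor_def)
          then show ?thesis by (auto simp: power_one_over)
        qed
        have "ternary (s v) \<le> (\<Sum>i. (1 / 3) ^ i)"
          unfolding ternary_def by (rule suminf_le[OF _ ternary_summable[OF sc]]) (use le in auto)
        moreover have "(\<Sum>i. (1 / 3 :: real) ^ i) = 3 / 2" by (simp add: suminf_geometric)
        moreover have "0 \<le> ternary (s v)"
          unfolding ternary_def by (rule suminf_nonneg[OF ternary_summable[OF sc]]) (use le in auto)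
        ultimately show ?case by simp
      qed
      then have "P.prob ((\<lambda>v. ternary (s v)) -` {-1<..2} \<inter> space (P n)) = 1"
        by (subst P.prob_eq_1) (auto intro!: measurable_sets[OF s_m'])
      then show ?thesis unfolding \<mu>_def by (subst measure_distr) auto
    qed
    then show "\<exists>a b. a < b \<and> (\<forall>n. 1 - \<epsilon> < measure (\<mu> n) {a<..b})"
      using \<open>\<epsilon> > 0\<close> by (intro exI[of _ "-1"] exI[of _ 2]) auto
  qed
  from tight_imp_convergent_subsubsequence[OF this strict_mono_id]
  obtain r L where r: "strict_mono r" "real_distribution L" "weak_conv_m (\<mu> \<circ> id \<circ> r) L" by auto
  interpret L: real_distribution L by (rule r)
  show thesis
  proof (rule that[of r "distr L borel g"])
    show "prob_space (distr L borel g)" by (rule L.prob_space_distr) simp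
    have "\<forall>j. g t $ j \<in> {0..2}" for t
      using g(2) by (auto simp: image_subset_iff mem_box_cart)
    then show "AE v in distr L borel g. \<forall>j. v $ j \<in> {0..2}"
      by (subst AE_distr_iff) auto
    fix f :: "real^'d \<Rightarrow> real" assume f: "continuous_on UNIV f"
    then have [measurable]: "f \<in> borel_measurable borel" by (rule borel_measurable_continuous_onI)
    obtain C where C: "\<And>v. v \<in> ?B \<Longrightarrow> norm (f v) \<le> C"
      using compact_imp_bounded[OF compact_continuous_image[OF continuous_on_subset[OF f] compact_cbox[of 0 "\<chi> j. 2"]]]
      unfolding bounded_iff by auto
    have "(\<lambda>n. integral\<^sup>L ((\<mu> \<circ> id \<circ> r) n) (\<lambda>t. f (g t))) \<longlonglongrightarrow> integral\<^sup>L L (\<lambda>t. f (g t))"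
    proof (rule weak_conv_imp_integral_bdd_continuous_conv[OF _ r(2,3)])
      show "isCont (\<lambda>t. f (g t)) t" for t
        using continuous_on_compose2[OF f g(1)] by (simp add: continuous_on_eq_continuous_at)
      show "norm (f (g t)) \<le> C" for t using C g(2) by auto
    qed (simp add: real)
    moreover have "integral\<^sup>L (\<mu> n) (\<lambda>t. f (g t)) = (\<integral>v. f v \<partial>P n)" for n
    proof -
      have "integral\<^sup>L (\<mu> n) (\<lambda>t. f (g t)) = (\<integral>v. f (g (ternary (s v))) \<partial>P n)"
        unfolding \<mu>_def by (rule integral_distr) auto
      also have "\<dots> = (\<integral>v. f v \<partial>P n)"
      proof (rule integral_cong_AE)
        show "AE v in P n. f (g (ternary (s v))) = f v" using cube[of n] by eventually_elim (simp add: g_s)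
      qed measurable
      finally show ?thesis .
    qed
    moreover have "integral\<^sup>L L (\<lambda>t. f (g t)) = (\<integral>v. f v \<partial>distr L borel g)"
      by (rule integral_distr[symmetric]) auto
    ultimately show "(\<lambda>n. \<integral>v. f v \<partial>P (r n)) \<longlonglongrightarrow> (\<integral>v. f v \<partial>distr L borel g)" by simp
  qed (use r in auto)
qed

section \<open>Spectral laws of simple max-stable distributions\<close>

text \<open>The gauge of the box with corner \<open>x\<close>. Its expectation as a function of
  \<open>x\<close> is the spectral form of a max-stable exponent.\<close>

definition wmax :: "real^'d \<Rightarrow> real^'d \<Rightarrow> real"
  where "wmax x v = Max (range (\<lambda>j. v $ j / x $ j))"

lemma wmax_le_iff:
  assumes "\<forall>j. 0 < x $ j"
  shows "wmax x v \<le> s \<longleftrightarrow> v \<le> s *\<^sub>R x"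
  using assms by (auto simp: wmax_def less_eq_vec_def pos_divide_le_eq)

lemma wmax_ge: "v $ j / x $ j \<le> wmax x v"
  unfolding wmax_def by (intro Max_ge) auto

lemma wmax_attained: "\<exists>j. wmax x v = v $ j / x $ j"
proof -
  have "Max (range (\<lambda>j. v $ j / x $ j)) \<in> range (\<lambda>j. v $ j / x $ j)" by (rule Max_in) auto
  then show ?thesis unfolding wmax_def by blast
qed

lemma continuous_on_wmax: "continuous_on UNIV (wmax x)"
proof -
  have "wmax x = (\<lambda>v. Sup ((\<lambda>j. v $ j / x $ j) ` UNIV))"
    unfolding wmax_def by (auto simp: cSup_eq_Max)
  moreover have "continuous_on UNIV (\<lambda>v::real^'a. Sup ((\<lambda>j. v $ j / x $ j) ` UNIV))"
    unfolding continuous_on_def divide_inverse by (auto intro!: tendsto_Sup tendsto_mult tendsto_vec_nth)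
  ultimately show ?thesis by simp
qed

lemma borel_measurable_wmax [measurable]: "wmax x \<in> borel_measurable borel"
  by (rule borel_measurable_continuous_onI[OF continuous_on_wmax])

lemma wmax_scaleR: "0 < t \<Longrightarrow> wmax x (t *\<^sub>R v) = t * wmax x v"
  unfolding wmax_def by (subst mono_Max_commute[of "\<lambda>y. t * y"]) (auto simp: image_comp o_def mono_def)

text \<open>On the dyadic shell between 2^k and 2^(k+1) the p-th power is at most 2^(p(k+1)) and the
  probability at most 2^(-k), so the contributions are dominated by a geometric series with ratio
  2^(p-1) < 1.\<close>

lemma nn_integral_powr_finite:
  fixes Y :: "'a \<Rightarrow> real"
  assumes "prob_space M" and [measurable]: "Y \<in> borel_measurable M" and pos: "AE x in M. 0 < Y x"
    and tail: "\<And>s. 0 < s \<Longrightarrow> measure M {x \<in> space M. s < Y x} \<le> 1 / s" and p: "0 < p" "p < 1"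
  shows "(\<integral>\<^sup>+x. ennreal (Y x powr p) \<partial>M) < \<infinity>"
proof -
  interpret prob_space M by fact
  let ?c = "\<lambda>k::nat. 2 powr (p * real (Suc k))"
  have "AE x in M. ennreal (Y x powr p) \<le> 1 + (\<Sum>k. ennreal (?c k) * indicator {x \<in> space M. 2 ^ k < Y x} x)"
    using pos AE_space
  proof eventually_elim
    case (elim x)
    show ?case
    proof (cases "Y x \<le> 1")
      case True
      have "Y x powr p \<le> 1 powr p" using True elim p by (intro powr_mono2) auto
      then have "ennreal (Y x powr p) \<le> 1" using ennreal_leI[of "Y x powr p" 1] by simp
      then show ?thesis by (rule order_trans) simp
    next
      case False
      obtain m :: nat where "Y x < 2 ^ m" using real_arch_pow[of 2 "Y x"] by auto
      then have ex: "\<exists>m. Y x \<le> 2 ^ m" by (intro exI[of _ m]) simp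
      \<comment> \<open>Since \<open>Y x > 1\<close>, the least exponent is positive, and its
        predecessor \<open>k\<close> names the dyadic shell containing \<open>Y x\<close>.\<close>
      define n where "n = (LEAST m. Y x \<le> 2 ^ m)"
      have n: "Y x \<le> 2 ^ n" unfolding n_def by (rule LeastI_ex[OF ex])
      have "n \<noteq> 0" using n False by (intro notI) simp
      then obtain k where k: "n = Suc k" by (cases n) auto
      have "\<not> Y x \<le> 2 ^ k" using not_less_Least[of k "\<lambda>m. Y x \<le> 2 ^ m"] k unfolding n_def by simp
      then have less: "2 ^ k < Y x" by simp
      have "Y x powr p \<le> (2 ^ Suc k) powr p" using n k elim p by (intro powr_mono2) auto
      also have "\<dots> = (2 powr real (Suc k)) powr p" by (simp only: powr_realpow zero_less_numeral)
      also have "\<dots> = ?c k" by (simp only: powr_powr mult.commute)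
      finally have "ennreal (Y x powr p) \<le> ennreal (?c k) * indicator {x \<in> space M. 2 ^ k < Y x} x"
        using less elim by (simp add: ennreal_leI)
      also have "\<dots> \<le> (\<Sum>k. ennreal (?c k) * indicator {x \<in> space M. 2 ^ k < Y x} x)"
      proof -
        define h where "h k = ennreal (?c k) * indicator {x \<in> space M. 2 ^ k < Y x} x" for k
        have "h k \<le> suminf h" using sum_le_suminf[of h "{k}"] by simp
        then show ?thesis unfolding h_def .
      qed
      also have "\<dots> \<le> 1 + (\<Sum>k. ennreal (?c k) * indicator {x \<in> space M. 2 ^ k < Y x} x)" by simp
      finally show ?thesis .
    qed
  qed
  then have "(\<integral>\<^sup>+x. ennreal (Y x powr p) \<partial>M)
      \<le> (\<integral>\<^sup>+x. 1 + (\<Sum>k. ennreal (?c k) * indicator {x \<in> space M. 2 ^ k < Y x} x) \<partial>M)"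
    by (rule nn_integral_mono_AE)
  also have "\<dots> = 1 + (\<Sum>k. ennreal (?c k) * emeasure M {x \<in> space M. 2 ^ k < Y x})"
    by (subst nn_integral_add) (auto simp: emeasure_space_1 nn_integral_suminf nn_integral_cmult)
  also have "(\<Sum>k. ennreal (?c k) * emeasure M {x \<in> space M. 2 ^ k < Y x})
      \<le> (\<Sum>k. ennreal (2 powr p * (2 powr (p - 1)) ^ k))"
  proof (rule suminf_le)
    fix k
    have "?c k * measure M {x \<in> space M. 2 ^ k < Y x} \<le> ?c k * (1 / 2 ^ k)"
      by (intro mult_left_mono tail) auto
    also have "\<dots> = 2 powr (p * real (Suc k)) * 2 powr (- real k)"
      by (simp only: powr_minus powr_realpow zero_less_numeral inverse_eq_divide)
    also have "\<dots> = 2 powr (p * real (Suc k) + - real k)" by (simp only: powr_add)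
    also have "p * real (Suc k) + - real k = p + real k * (p - 1)" by (simp add: algebra_simps)
    also have "2 powr (p + real k * (p - 1)) = 2 powr p * (2 powr (p - 1)) ^ k" by (simp add: powr_add powr_power)
    finally show "ennreal (?c k) * emeasure M {x \<in> space M. 2 ^ k < Y x} \<le> ennreal (2 powr p * (2 powr (p - 1)) ^ k)"
      by (simp add: emeasure_eq_measure ennreal_leI flip: ennreal_mult)
  qed auto
  also have "\<dots> < \<infinity>"
  proof -
    have "2 powr (p - 1) < 2 powr (0::real)" using p by (intro powr_less_mono) auto
    then have "summable (\<lambda>k. 2 powr p * (2 powr (p - 1)) ^ k)" by (intro summable_mult summable_geometric) auto
    then have "(\<Sum>k. ennreal (2 powr p * (2 powr (p - 1)) ^ k)) \<noteq> \<infinity>"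
      by (subst suminf_ennreal2) auto
    then show ?thesis by (simp add: less_top)
  qed
  finally show ?thesis by (auto simp: less_top)
qed

section \<open>Fractional moments and tilted angular laws\<close>

text \<open>Homogeneity of order -1 expresses max-stability with norming by the factor
  \<open>t\<close> and without shift.\<close>

locale simple_max_stable = prob_space Q for Q :: "(real^'d) measure" +
  fixes V :: "real^'d \<Rightarrow> real"
  assumes sets_Q [measurable_cong]: "sets Q = sets borel"
    and pos: "AE z in Q. \<forall>j. 0 < z $ j"
    and cdf: "\<forall>j. 0 < x $ j \<Longrightarrow> prob {..x} = exp (- V x)"
    and V_pos: "\<forall>j. 0 < x $ j \<Longrightarrow> 0 < V x"
    and V_scaleR: "\<forall>j. 0 < x $ j \<Longrightarrow> 0 < t \<Longrightarrow> V (t *\<^sub>R x) = V x / t"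
begin

text \<open>The event is a box with corner a multiple of \<open>x\<close>, so homogeneity makes
  \<open>wmax x z / V x\<close> a unit Frechet variable whatever \<open>x\<close> is. Its moments
  therefore do not depend on \<open>x\<close>, the source of the exact formula for tilted
  laws.\<close>

lemma prob_wmax_le:
  assumes x: "\<forall>j. 0 < x $ j" and s: "0 < s"
  shows "prob {z \<in> space Q. wmax x z / V x \<le> s} = exp (- 1 / s)"
proof -
  have sp: "space Q = UNIV" using sets_eq_imp_space_eq[OF sets_Q] by simp
  have "{z \<in> space Q. wmax x z / V x \<le> s} = {..(s * V x) *\<^sub>R x}"
    using V_pos[OF x] wmax_le_iff[OF x] by (auto simp: sp pos_divide_le_eq)
  moreover have "\<forall>j. 0 < ((s * V x) *\<^sub>R x) $ j" using x s V_pos[OF x] by simp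
  ultimately have "prob {z \<in> space Q. wmax x z / V x \<le> s} = exp (- V ((s * V x) *\<^sub>R x))" by (simp add: cdf)
  also have "V ((s * V x) *\<^sub>R x) = 1 / s" using V_scaleR[OF x, of "s * V x"] s V_pos[OF x] by simp
  finally show ?thesis by simp
qed

lemma wmax_pos: "\<forall>j. 0 < x $ j \<Longrightarrow> AE z in Q. 0 < wmax x z / V x"
  using pos
proof eventually_elim
  case (elim z)
  then have "0 < z $ undefined / x $ undefined" by simp
  also have "\<dots> \<le> wmax x z" by (rule wmax_ge)
  finally show ?case using V_pos elim by simp
qed

lemma wmax_law:
  assumes x: "\<forall>j. 0 < x $ j" and y: "\<forall>j. 0 < y $ j"
  shows "distr Q borel (\<lambda>z. wmax x z / V x) = distr Q borel (\<lambda>z. wmax y z / V y)"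
proof (rule cdf_unique)
  have law: "cdf (distr Q borel (\<lambda>z. wmax x z / V x)) s = (if 0 < s then exp (- 1 / s) else 0)"
    if x: "\<forall>j. 0 < x $ j" for x s
  proof -
    have "cdf (distr Q borel (\<lambda>z. wmax x z / V x)) s = prob {z \<in> space Q. wmax x z / V x \<le> s}"
      unfolding cdf_def by (subst measure_distr) (auto intro!: arg_cong[where f = prob])
    also have "\<dots> = (if 0 < s then exp (- 1 / s) else 0)"
    proof (cases "0 < s")
      case False
      have "AE z in Q. z \<notin> {z \<in> space Q. wmax x z / V x \<le> s}"
        using wmax_pos[OF x] by eventually_elim (use False in auto)
      then have "prob {z \<in> space Q. wmax x z / V x \<le> s} = 0" by (subst prob_eq_0) auto
      then show ?thesis using False by simp
    qed (simp add: prob_wmax_le[OF x])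
    finally show ?thesis .
  qed
  show "cdf (distr Q borel (\<lambda>z. wmax x z / V x)) = cdf (distr Q borel (\<lambda>z. wmax y z / V y))"
    using law[OF x] law[OF y] by auto
qed (auto intro!: real_distribution_distr)

text \<open>The value is Gamma (1 - p). It diverges as p tends to 1, and dividing by it keeps the
  tilted laws normalized.\<close>

definition frechet_moment :: "real \<Rightarrow> real"
  where "frechet_moment p = (\<integral>z. (wmax 1 z / V 1) powr p \<partial>Q)"

lemma wmax_powr:
  assumes x: "\<forall>j. 0 < x $ j" and p: "0 < p" "p < 1"
  shows "integrable Q (\<lambda>z. (wmax x z / V x) powr p)"
    and "(\<integral>z. (wmax x z / V x) powr p \<partial>Q) = frechet_moment p"
proof -
  have "(\<integral>\<^sup>+z. ennreal ((wmax x z / V x) powr p) \<partial>Q) < \<infinity>"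
  proof (rule nn_integral_powr_finite[OF _ _ wmax_pos[OF x] _ p])
    fix s :: real assume s: "0 < s"
    have "prob {z \<in> space Q. s < wmax x z / V x} = 1 - prob {z \<in> space Q. wmax x z / V x \<le> s}"
      by (subst prob_compl[symmetric]) (auto intro!: arg_cong[where f = prob])
    also have "\<dots> = 1 - exp (- 1 / s)" by (simp add: prob_wmax_le[OF x s])
    also have "\<dots> \<le> 1 / s" using exp_ge_add_one_self[of "- 1 / s"] by simp
    finally show "prob {z \<in> space Q. s < wmax x z / V x} \<le> 1 / s" .
  qed (auto intro: prob_space_axioms)
  then show "integrable Q (\<lambda>z. (wmax x z / V x) powr p)"
    by (intro integrableI_nonneg) auto
  have "(\<integral>z. (wmax y z / V y) powr p \<partial>Q) = (\<integral>s. s powr p \<partial>distr Q borel (\<lambda>z. wmax y z / V y))" for y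
    by (rule integral_distr[symmetric]) auto
  then show "(\<integral>z. (wmax x z / V x) powr p \<partial>Q) = frechet_moment p"
    unfolding frechet_moment_def using wmax_law[OF x, of 1] by simp
qed

lemma frechet_moment_pos:
  assumes p: "0 < p" "p < 1"
  shows "0 < frechet_moment p"
proof -
  have one: "\<forall>j. 0 < (1::real^'d) $ j" by simp
  have "frechet_moment p \<noteq> 0"
  proof
    assume "frechet_moment p = 0"
    then have "AE z in Q. (wmax 1 z / V 1) powr p = 0"
      unfolding frechet_moment_def by (subst (asm) integral_nonneg_eq_0_iff_AE) (use wmax_powr(1)[OF one p] in auto)
    with wmax_pos[OF one] have "AE z in Q. False" by eventually_elim (auto simp: zero_less_divide_iff)
    then show False by simp
  qed
  moreover have "0 \<le> frechet_moment p" unfolding frechet_moment_def by (intro integral_nonneg_AE) auto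
  ultimately show ?thesis by simp
qed

text \<open>Tilting by the \<open>p\<close>-th power of the norm turns the angular part into a probability law whose
  \<open>p\<close>-th moments are known exactly. The law of \<open>W\<close> is a limit point as \<open>p \<rightarrow> 1\<close>.\<close>

definition tilted :: "real \<Rightarrow> (real^'d) measure"
  where "tilted p = distr (density Q (\<lambda>z. ennreal ((wmax 1 z / V 1) powr p / frechet_moment p))) borel
    (\<lambda>z. (1 / wmax 1 z) *\<^sub>R z)"

text \<open>The p-th power of the norm in the density cancels the one produced by projecting
  \<open>z\<close> to norm 1. What remains is the p-th moment of \<open>wmax x\<close>, namely the
  common Frechet moment times \<open>V x powr p\<close>.\<close>

lemma tilted:
  assumes p: "0 < p" "p < 1"
  shows prob_space_tilted: "prob_space (tilted p)"
    and tilted_cube: "AE v in tilted p. (\<forall>j. v $ j \<in> {0..1}) \<and> (\<exists>j. v $ j = 1)"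
    and tilted_wmax_powr: "\<forall>j. 0 < x $ j \<Longrightarrow> (\<integral>v. wmax x v powr p \<partial>tilted p) = (V x / V 1) powr p"
proof -
  have one: "\<forall>j. 0 < (1::real^'d) $ j" by simp
  note mom = frechet_moment_pos[OF p]
  let ?g = "\<lambda>z. (wmax 1 z / V 1) powr p / frechet_moment p"
  have [measurable]: "(\<lambda>z::real^'d. (1 / wmax 1 z) *\<^sub>R z) \<in> borel_measurable borel" by measurable
  have "emeasure (density Q (\<lambda>z. ennreal (?g z))) (space (density Q (\<lambda>z. ennreal (?g z))))
      = (\<integral>\<^sup>+z. ennreal (?g z) \<partial>Q)"
    by (subst emeasure_density) (auto intro!: nn_integral_cong)
  also have "\<dots> = ennreal (\<integral>z. ?g z \<partial>Q)"
    using wmax_powr(1)[OF one p] mom by (intro nn_integral_eq_integral) auto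
  also have "(\<integral>z. ?g z \<partial>Q) = 1" using wmax_powr[OF one p] mom by simp
  finally have "emeasure (density Q (\<lambda>z. ennreal (?g z))) (space (density Q (\<lambda>z. ennreal (?g z)))) = 1"
    by simp
  then interpret D: prob_space "density Q (\<lambda>z. ennreal (?g z))" by (intro prob_spaceI)
  show "prob_space (tilted p)" unfolding tilted_def by (rule D.prob_space_distr) simp
  have cube: "AE z in Q. (\<forall>j. ((1 / wmax 1 z) *\<^sub>R z) $ j \<in> {0..1}) \<and> (\<exists>j. ((1 / wmax 1 z) *\<^sub>R z) $ j = 1)"
    using pos wmax_pos[OF one]
  proof eventually_elim
    case (elim z)
    then have w: "0 < wmax 1 z" using V_pos[OF one] by (simp add: zero_less_divide_iff)
    obtain i where "wmax 1 z = z $ i" using wmax_attained[of 1 z] by auto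
    moreover have "z $ j \<le> wmax 1 z" for j using wmax_ge[of z j 1] by simp
    ultimately show ?case using w elim by (auto simp: less_imp_le intro!: exI[of _ i])
  qed
  show "AE v in tilted p. (\<forall>j. v $ j \<in> {0..1}) \<and> (\<exists>j. v $ j = 1)"
    unfolding tilted_def
    by (subst AE_distr_iff, simp, measurable, subst AE_density) (use cube in \<open>auto elim: eventually_mono\<close>)
  assume x: "\<forall>j. 0 < x $ j"
  have "(\<integral>v. wmax x v powr p \<partial>tilted p) = (\<integral>z. wmax x ((1 / wmax 1 z) *\<^sub>R z) powr p \<partial>density Q (\<lambda>z. ennreal (?g z)))"
    unfolding tilted_def by (rule integral_distr) auto
  also have "\<dots> = (\<integral>z. ?g z *\<^sub>R (wmax x ((1 / wmax 1 z) *\<^sub>R z) powr p) \<partial>Q)"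
    using mom by (intro integral_density) auto
  also have "\<dots> = (\<integral>z. (wmax x z / V x) powr p * ((V x / V 1) powr p / frechet_moment p) \<partial>Q)"
  proof (rule integral_cong_AE)
    show "AE z in Q. ?g z *\<^sub>R (wmax x ((1 / wmax 1 z) *\<^sub>R z) powr p)
        = (wmax x z / V x) powr p * ((V x / V 1) powr p / frechet_moment p)"
      using wmax_pos[OF one] wmax_pos[OF x]
    proof eventually_elim
      case (elim z)
      have w: "0 < wmax 1 z" "0 < wmax x z"
        using elim V_pos[OF one] V_pos[OF x] by (auto simp: zero_less_divide_iff)
      have "wmax x ((1 / wmax 1 z) *\<^sub>R z) = wmax x z / wmax 1 z" using wmax_scaleR[of "1 / wmax 1 z" x z] w by simp
      then show ?case using w V_pos[OF one] V_pos[OF x] by (simp add: powr_divide powr_mult)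
    qed
  qed auto
  also have "\<dots> = (V x / V 1) powr p" using wmax_powr[OF x p] mom by simp
  finally show "(\<integral>v. wmax x v powr p \<partial>tilted p) = (V x / V 1) powr p" .
qed

text \<open>Write \<open>wmax x v\<close> as its (1 - p)-th power times its p-th power. On vectors
  in the unit cube with some coordinate equal to 1 it lies between two positive constants, so the
  first factor is squeezed towards 1 as p tends to 1, and the second has an exact mean.\<close>

lemma tilted_wmax_bounds:
  assumes p: "0 < p" "p < 1" and x: "\<forall>j. 0 < x $ j"
  shows "(1 / (\<Sum>j\<in>UNIV. x $ j)) powr (1 - p) * (V x / V 1) powr p \<le> (\<integral>v. wmax x v \<partial>tilted p)"
    and "(\<integral>v. wmax x v \<partial>tilted p) \<le> wmax x 1 powr (1 - p) * (V x / V 1) powr p"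
proof -
  interpret T: prob_space "tilted p" by (rule prob_space_tilted[OF p])
  have [measurable_cong]: "sets (tilted p) = sets borel" by (simp add: tilted_def)
  let ?c = "1 / (\<Sum>j\<in>UNIV. x $ j)"
  have S: "0 < (\<Sum>j\<in>UNIV. x $ j)" using x by (intro sum_pos) auto
  have b: "AE v in tilted p. ?c \<le> wmax x v \<and> wmax x v \<le> wmax x 1"
    using tilted_cube[OF p]
  proof eventually_elim
    case (elim v)
    then obtain i where i: "v $ i = 1" by blast
    have "x $ i \<le> (\<Sum>j\<in>UNIV. x $ j)" using x by (intro member_le_sum) (auto simp: less_imp_le)
    then have "?c \<le> v $ i / x $ i" using i x S by (simp add: frac_le)
    also have "\<dots> \<le> wmax x v" by (rule wmax_ge)
    finally have 1: "?c \<le> wmax x v" .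
    obtain k where k: "wmax x v = v $ k / x $ k" using wmax_attained by blast
    have "v $ k \<le> 1" using elim by (meson atLeastAtMost_iff)
    then have "v $ k / x $ k \<le> 1 $ k / x $ k" using x by (intro divide_right_mono) (auto simp: less_imp_le)
    also have "\<dots> \<le> wmax x 1" by (rule wmax_ge)
    finally show ?case using 1 k by simp
  qed
  have c: "0 < ?c" using S by simp
  have int: "integrable (tilted p) (\<lambda>v. wmax x v)"
  proof (rule T.integrable_const_bound[of _ "wmax x 1"])
    show "AE v in tilted p. norm (wmax x v) \<le> wmax x 1"
      using b
    proof eventually_elim
      case (elim v)
      then show ?case using c unfolding real_norm_def by linarith
    qed
  qed simp
  have intp: "integrable (tilted p) (\<lambda>v. wmax x v powr p)"
  proof (rule T.integrable_const_bound[of _ "wmax x 1 powr p"])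
    show "AE v in tilted p. norm (wmax x v powr p) \<le> wmax x 1 powr p"
      using b
    proof eventually_elim
      case (elim v)
      then have "0 \<le> wmax x v" using c by linarith
      then show ?case using elim p by (auto intro!: powr_mono2)
    qed
  qed auto
  have eq: "wmax x v = wmax x v powr (1 - p) * wmax x v powr p" if "?c \<le> wmax x v" for v
  proof -
    have "0 < wmax x v" using that c by linarith
    then show ?thesis by (simp flip: powr_add)
  qed
  have "?c powr (1 - p) * (V x / V 1) powr p = (\<integral>v. ?c powr (1 - p) * wmax x v powr p \<partial>tilted p)"
    using tilted_wmax_powr[OF p x] by simp
  also have "\<dots> \<le> (\<integral>v. wmax x v \<partial>tilted p)"
  proof (rule integral_mono_AE)
    show "AE v in tilted p. ?c powr (1 - p) * wmax x v powr p \<le> wmax x v"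
      using b
    proof eventually_elim
      case (elim v)
      have "?c powr (1 - p) * wmax x v powr p \<le> wmax x v powr (1 - p) * wmax x v powr p"
        using elim c p by (intro mult_right_mono powr_mono2) auto
      then show ?case using eq elim by simp
    qed
  qed (use int intp in auto)
  finally show "?c powr (1 - p) * (V x / V 1) powr p \<le> (\<integral>v. wmax x v \<partial>tilted p)" .
  have "(\<integral>v. wmax x v \<partial>tilted p) \<le> (\<integral>v. wmax x 1 powr (1 - p) * wmax x v powr p \<partial>tilted p)"
  proof (rule integral_mono_AE)
    show "AE v in tilted p. wmax x v \<le> wmax x 1 powr (1 - p) * wmax x v powr p"
      using b
    proof eventually_elim
      case (elim v)
      have "0 \<le> wmax x v" using elim c by linarith
      then have "wmax x v powr (1 - p) \<le> wmax x 1 powr (1 - p)"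
        using elim p by (intro powr_mono2) simp_all
      then have "wmax x v powr (1 - p) * wmax x v powr p \<le> wmax x 1 powr (1 - p) * wmax x v powr p"
        by (rule mult_right_mono) simp
      then show ?case using eq elim by simp
    qed
  qed (use int intp in auto)
  also have "\<dots> = wmax x 1 powr (1 - p) * (V x / V 1) powr p"
    using tilted_wmax_powr[OF p x] by simp
  finally show "(\<integral>v. wmax x v \<partial>tilted p) \<le> wmax x 1 powr (1 - p) * (V x / V 1) powr p" .
qed

theorem spectral_law_exists:
  obtains PW :: "(real^'d) measure" and c where "prob_space PW" "sets PW = sets borel"
    "AE w in PW. \<forall>j. 0 \<le> w $ j \<and> w $ j \<le> c"
    "\<And>x. \<forall>j. 0 < x $ j \<Longrightarrow> (\<integral>w. wmax x w \<partial>PW) = V x"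
proof -
  have one: "\<forall>j. 0 < (1::real^'d) $ j" by simp
  \<comment> \<open>The summand 2 keeps \<open>p 0 = 1 / 2\<close> strictly between 0 and 1.\<close>
  define p where "p n = 1 - 1 / (real n + 2)" for n :: nat
  have p: "0 < p n" "p n < 1" for n unfolding p_def by auto
  have "(\<lambda>n. 1 / (real n + 2)) \<longlonglongrightarrow> 0"
    using LIMSEQ_ignore_initial_segment[OF lim_1_over_n[where 'a = real], of 2] by (simp add: add.commute)
  then have p_lim: "p \<longlonglongrightarrow> 1" unfolding p_def[abs_def] by (auto intro: tendsto_eq_intros)
  have lim: "(\<lambda>n. \<integral>v. wmax x v \<partial>tilted (p n)) \<longlonglongrightarrow> V x / V 1" if x: "\<forall>j. 0 < x $ j" for x
  proof (rule tendsto_sandwich)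
    let ?c = "1 / (\<Sum>j\<in>UNIV. x $ j)"
    have c: "?c \<noteq> 0" "V x / V 1 \<noteq> 0" using x V_pos[OF x] V_pos[OF one] sum_pos[of UNIV "\<lambda>j. x $ j"] by force+
    have w: "wmax x 1 \<noteq> 0"
    proof -
      have "0 < (1::real^'d) $ (undefined::'d) / x $ undefined" using x by simp
      also have "\<dots> \<le> wmax x 1" by (rule wmax_ge)
      finally show ?thesis by simp
    qed
    have "(\<lambda>n. ?c powr (1 - p n) * (V x / V 1) powr p n) \<longlonglongrightarrow> ?c powr (1 - 1) * (V x / V 1) powr 1"
      by (intro tendsto_intros p_lim) (use c in auto)
    then show "(\<lambda>n. ?c powr (1 - p n) * (V x / V 1) powr p n) \<longlonglongrightarrow> V x / V 1"
      using c V_pos[OF x] V_pos[OF one] by simp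
    have "(\<lambda>n. wmax x 1 powr (1 - p n) * (V x / V 1) powr p n) \<longlonglongrightarrow> wmax x 1 powr (1 - 1) * (V x / V 1) powr 1"
      by (intro tendsto_intros p_lim) (use c w in auto)
    then show "(\<lambda>n. wmax x 1 powr (1 - p n) * (V x / V 1) powr p n) \<longlonglongrightarrow> V x / V 1"
      using w V_pos[OF x] V_pos[OF one] by simp
  qed (use tilted_wmax_bounds[OF p x] in auto)
  obtain r P' where r: "strict_mono r" "prob_space P'" "sets P' = sets borel"
    "AE v in P'. \<forall>j. v $ j \<in> {0..2}"
    "\<And>f :: real^'d \<Rightarrow> real. continuous_on UNIV f \<Longrightarrow> (\<lambda>n. \<integral>v. f v \<partial>tilted (p (r n))) \<longlonglongrightarrow> (\<integral>v. f v \<partial>P')"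
  proof (rule cube_measures_convergent_subsequence[of "\<lambda>n. tilted (p n)"])
    show "AE v in tilted (p n). \<forall>j. v $ j \<in> {0..1}" for n
      using tilted_cube[OF p] by eventually_elim auto
    show "sets (tilted (p n)) = sets borel" for n by (simp add: tilted_def)
  qed (use prob_space_tilted[OF p] in auto)
  interpret P': prob_space P' by (rule r)
  note [measurable_cong] = r(3)
  have wP': "(\<integral>v. wmax x v \<partial>P') = V x / V 1" if "\<forall>j. 0 < x $ j" for x
    using LIMSEQ_unique[OF r(5)[OF continuous_on_wmax] LIMSEQ_subseq_LIMSEQ[OF lim[OF that] r(1), unfolded o_def]] .
  show thesis
  \<comment> \<open>The limit of the tilted laws has exponent \<open>V x / V 1\<close>; scaling the
    vectors by \<open>V 1\<close> restores \<open>V\<close>. The bound is \<open>2 * V 1\<close>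
    because the weak limit is only known to live on [0, 2].\<close>
  proof (rule that[of "distr P' borel (\<lambda>v. V 1 *\<^sub>R v)" "2 * V 1"])
    show "prob_space (distr P' borel (\<lambda>v. V 1 *\<^sub>R v))" by (rule P'.prob_space_distr) simp
    show "AE w in distr P' borel (\<lambda>v. V 1 *\<^sub>R v). \<forall>j. 0 \<le> w $ j \<and> w $ j \<le> 2 * V 1"
    proof (subst AE_distr_iff)
      show "AE v in P'. \<forall>j. 0 \<le> (V 1 *\<^sub>R v) $ j \<and> (V 1 *\<^sub>R v) $ j \<le> 2 * V 1"
        using r(4) by eventually_elim (use V_pos[OF one] in \<open>auto simp: mult.commute[of 2]\<close>)
    qed auto
    fix x :: "real^'d" assume x: "\<forall>j. 0 < x $ j"
    have "(\<integral>w. wmax x w \<partial>distr P' borel (\<lambda>v. V 1 *\<^sub>R v)) = (\<integral>v. wmax x (V 1 *\<^sub>R v) \<partial>P')"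
      by (rule integral_distr) auto
    also have "\<dots> = V x" using wP'[OF x] V_pos[OF one] by (simp add: wmax_scaleR)
    finally show "(\<integral>w. wmax x w \<partial>distr P' borel (\<lambda>v. V 1 *\<^sub>R v)) = V x" .
  qed simp
qed

end

section \<open>Standardization of the state space\<close>

text \<open>Coordinatewise, \<open>std\<close> maps the state space homeomorphically onto the closed orthant without
  the origin and turns the points of the limit process into \<open>W\<^sub>i / T\<^sub>i\<close>, where the components of
  \<open>W\<^sub>i\<close> are the quantities \<open>moment_R\<close>. The inverse map is \<open>unstd\<close>.\<close>

definition real_unstd :: "real \<Rightarrow> real \<Rightarrow> real \<Rightarrow> real"
  where "real_unstd g s v = (if g = 0 then s * ln v else sgn g * v powr g - s / g)"

definition unstd :: "real \<Rightarrow> real \<Rightarrow> real \<Rightarrow> ereal"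
  where "unstd g s v = (if v = 0 \<and> g \<le> 0 then - \<infinity> else ereal (real_unstd g s v))"

definition std :: "real \<Rightarrow> real \<Rightarrow> ereal \<Rightarrow> real"
  where "std g s y = (if y = - \<infinity> then 0 else if g = 0 then exp (real_of_ereal y / s)
    else \<bar>real_of_ereal y + s / g\<bar> powr (1 / g))"

lemma unstd_pos: "0 < v \<Longrightarrow> unstd g s v = ereal (real_unstd g s v)"
  by (simp add: unstd_def)

lemma std_nonneg: "0 \<le> std g s y"
  by (simp add: std_def)

lemma std_unstd:
  assumes "0 < s" "0 \<le> v"
  shows "std g s (unstd g s v) = v"
proof (cases "v = 0")
  case True
  then show ?thesis by (auto simp: std_def unstd_def real_unstd_def)
next
  case False
  then have "0 < v" using assms by simp
  then show ?thesis using assms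
    by (cases "g = 0") (auto simp: std_def unstd_def real_unstd_def abs_mult abs_sgn_eq powr_powr)
qed

lemma unstd_mem:
  assumes "0 \<le> v"
  shows "unstd g s v \<in> state_interval g s"
proof (cases "v = 0")
  case True
  then show ?thesis by (auto simp: unstd_def real_unstd_def state_interval_def)
next
  case False
  then have "0 < v powr g" using assms by simp
  then show ?thesis using False
    by (cases g "0::real" rule: linorder_cases) (auto simp: unstd_def real_unstd_def state_interval_def)
qed

lemma unstd_std:
  assumes s: "0 < s" and y: "y \<in> state_interval g s"
  shows "unstd g s (std g s y) = y"
proof (cases y)
  case (real r)
  consider "g = 0" | "0 < g" | "g < 0" by linarith
  then show ?thesis
  proof cases
    case 1
    then show ?thesis using s real by (simp add: std_def unstd_def real_unstd_def)
  next
    case 2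
    then have r: "0 \<le> r + s / g" using y real by (auto simp: state_interval_def)
    show ?thesis
    proof (cases "r + s / g = 0")
      case True
      then show ?thesis using 2 real by (simp add: std_def unstd_def real_unstd_def)
    next
      case False
      then show ?thesis using 2 r real by (simp add: std_def unstd_def real_unstd_def powr_powr)
    qed
  next
    case 3
    then have r: "r + s / g < 0" using y real by (auto simp: state_interval_def)
    then have "\<bar>r + s / g\<bar> powr (1 / g) \<noteq> 0" by simp
    then show ?thesis using 3 r real by (simp add: std_def unstd_def real_unstd_def powr_powr)
  qed
qed (use y in \<open>auto simp: state_interval_def std_def unstd_def split: if_splits\<close>)

lemma unstd_strict_mono:
  assumes "0 < s" "0 \<le> v" "v < w"
  shows "unstd g s v < unstd g s w"
proof -
  have w: "unstd g s w = ereal (real_unstd g s w)" using assms by (simp add: unstd_pos)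
  consider "v = 0" "g \<le> 0" | "g = 0" "0 < v" | "0 < g" | "g < 0" "0 < v" using assms by force
  then show ?thesis
  proof cases
    case 1 then show ?thesis unfolding w by (simp add: unstd_def)
  next
    case 2 then show ?thesis using assms by (simp add: unstd_def real_unstd_def)
  next
    case 3 then show ?thesis using assms by (simp add: unstd_def real_unstd_def powr_less_mono2)
  next
    case 4 then show ?thesis using assms by (simp add: unstd_def real_unstd_def powr_less_mono2_neg)
  qed
qed

lemma unstd_less_iff: "0 < s \<Longrightarrow> 0 \<le> v \<Longrightarrow> 0 \<le> w \<Longrightarrow> unstd g s v < unstd g s w \<longleftrightarrow> v < w"
  by (metis unstd_strict_mono linorder_less_linear order_less_asym)

lemma unstd_le_iff: "0 < s \<Longrightarrow> 0 \<le> v \<Longrightarrow> 0 \<le> w \<Longrightarrow> unstd g s v \<le> unstd g s w \<longleftrightarrow> v \<le> w"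
  by (meson unstd_less_iff not_le)

lemma real_unstd_less_iff: "0 < s \<Longrightarrow> 0 < v \<Longrightarrow> 0 < w \<Longrightarrow> real_unstd g s v < real_unstd g s w \<longleftrightarrow> v < w"
  using unstd_less_iff[of s v w g] by (simp add: unstd_pos)

lemma unstd_image: "0 < s \<Longrightarrow> unstd g s ` {0..} = state_interval g s"
proof (intro set_eqI iffI)
  fix y assume "0 < s" "y \<in> state_interval g s"
  then have "y = unstd g s (std g s y)" by (simp add: unstd_std)
  then show "y \<in> unstd g s ` {0..}" using std_nonneg by (intro image_eqI[of _ _ "std g s y"]) auto
qed (auto intro: unstd_mem)

lemma std_image: "0 < s \<Longrightarrow> std g s ` state_interval g s = {0..}"
proof (intro set_eqI iffI)
  fix v :: real assume "0 < s" "v \<in> {0..}"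
  then have "v = std g s (unstd g s v)" "unstd g s v \<in> state_interval g s"
    by (simp_all add: std_unstd unstd_mem)
  then show "v \<in> std g s ` state_interval g s" by (rule image_eqI)
qed (auto intro: std_nonneg)

lemma continuous_on_unstd:
  assumes "0 < s"
  shows "continuous_on {0..} (unstd g s)"
proof (rule continuous_on_strict_mono)
  show "strict_mono_on {0..} (unstd g s)" using unstd_strict_mono[OF assms] by (auto intro: strict_mono_onI)
  show "w \<in> unstd g s ` {0..}" if "u \<in> unstd g s ` {0..}" "v \<in> unstd g s ` {0..}" "u \<le> w" "w \<le> v" for u v w
    using that unfolding unstd_image[OF assms] state_interval_def by (auto split: if_splits)
qed

lemma continuous_on_std:
  assumes "0 < s"
  shows "continuous_on (state_interval g s) (std g s)"
proof (rule continuous_on_strict_mono)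
  show "strict_mono_on (state_interval g s) (std g s)"
  proof (rule strict_mono_onI)
    fix x y assume "x \<in> state_interval g s" "y \<in> state_interval g s" "x < y"
    then show "std g s x < std g s y"
      using unstd_less_iff[OF assms std_nonneg std_nonneg, of g g s x g s y] unstd_std[OF assms] by simp
  qed
  show "w \<in> std g s ` state_interval g s"
    if "u \<in> std g s ` state_interval g s" "v \<in> std g s ` state_interval g s" "u \<le> w" "w \<le> v" for u v w
    using that unfolding std_image[OF assms] by auto
qed

lemma borel_measurable_std [measurable]: "std g s \<in> borel_measurable borel"
  unfolding std_def[abs_def] by measurable

lemma borel_measurable_moment_R [measurable]: "moment_R g s \<in> borel_measurable borel"
  unfolding moment_R_def[abs_def] by measurable

lemma moment_R_nonneg: "0 \<le> moment_R g s r"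
  by (simp add: moment_R_def)

text \<open>With W the moment quantity, \<open>r\<close> is \<open>sgn g * W powr g\<close>, or
  \<open>s * ln W\<close> when \<open>g = 0\<close>. Division by \<open>t powr g\<close>, or
  subtraction of \<open>s * ln t\<close>, is then division of W by \<open>t\<close>; the value
  \<open>-\<infinity>\<close> corresponds to W = 0.\<close>

lemma limit_coordinate:
  assumes s: "0 < s" and t: "0 < t" and r: "r \<in> range_R g"
  shows "(if g = 0 then r - ereal (s * ln t) else r / ereal (t powr g) - ereal (s / g))
    = unstd g s (moment_R g s r / t)"
proof -
  consider "g = 0" | "0 < g" | "g < 0" by linarith
  then show ?thesis
  proof cases
    case 1
    then show ?thesis using s t r
      by (cases r) (auto simp: range_R_def moment_R_def unstd_def real_unstd_def ln_div algebra_simps)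
  next
    case 2
    then show ?thesis using s t r
      by (cases r) (auto simp: range_R_def moment_R_def unstd_def real_unstd_def powr_divide powr_powr)
  next
    case 3
    then show ?thesis using s t r
      by (cases r) (auto simp: range_R_def moment_R_def unstd_def real_unstd_def powr_divide powr_powr)
  qed
qed

definition vstd :: "real^'d \<Rightarrow> real^'d \<Rightarrow> ereal^'d \<Rightarrow> real^'d"
  where "vstd \<gamma> \<sigma> y = (\<chi> j. std (\<gamma> $ j) (\<sigma> $ j) (y $ j))"

definition vunstd :: "real^'d \<Rightarrow> real^'d \<Rightarrow> real^'d \<Rightarrow> ereal^'d"
  where "vunstd \<gamma> \<sigma> v = (\<chi> j. unstd (\<gamma> $ j) (\<sigma> $ j) (v $ j))"

section \<open>Polynomials, bumps and compact shells in the orthant\<close>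

text \<open>On the orthant this is the 1-norm. It detects both ways of leaving compact sets:
  approach to the deleted origin and escape to infinity.\<close>

definition total :: "real^'d \<Rightarrow> real"
  where "total v = (\<Sum>j\<in>UNIV. v $ j)"

lemma continuous_on_total: "continuous_on A total"
  unfolding total_def by (intro continuous_intros)

lemma total_ge: "\<forall>j. 0 \<le> v $ j \<Longrightarrow> v $ i \<le> total v"
  unfolding total_def by (rule member_le_sum) auto

lemma total_pos_iff: "\<forall>j. 0 \<le> v $ j \<Longrightarrow> 0 < total v \<longleftrightarrow> v \<noteq> 0"
proof -
  assume v: "\<forall>j. 0 \<le> v $ j"
  have "total v = 0 \<longleftrightarrow> v = 0"
    unfolding total_def by (subst sum_nonneg_eq_0_iff) (use v in \<open>auto simp: vec_eq_iff\<close>)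
  moreover have "0 \<le> total v" unfolding total_def using v by (intro sum_nonneg) auto
  ultimately show ?thesis by auto
qed

definition coord_monomial :: "'d list \<Rightarrow> real^'d \<Rightarrow> real"
  where "coord_monomial l v = (\<Prod>j\<leftarrow>l. v $ j)"

lemma continuous_on_coord_monomial: "continuous_on A (coord_monomial l)"
  unfolding coord_monomial_def by (induction l) (auto intro!: continuous_intros)

lemma coord_monomial_nonneg: "\<forall>j. 0 \<le> v $ j \<Longrightarrow> 0 \<le> coord_monomial l v"
  unfolding coord_monomial_def by (induction l) auto

lemma coord_monomial_span:
  fixes f :: "real^'d \<Rightarrow> real"
  assumes K: "compact K" and f: "continuous_on K f"
  shows "span_approx (range coord_monomial) K f"
proof (rule Stone_Weierstrass_span[OF K _ _ _ _ f])
  show "(\<lambda>_. 1) \<in> range coord_monomial"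
    by (intro image_eqI[of _ _ "[]"]) (auto simp: coord_monomial_def)
  show "(\<lambda>x. b x * b' x) \<in> range coord_monomial" if "b \<in> range coord_monomial" "b' \<in> range coord_monomial"
    for b b' :: "real^'d \<Rightarrow> real"
  proof -
    from that obtain l l' where "b = coord_monomial l" "b' = coord_monomial l'" by auto
    then show ?thesis by (intro image_eqI[of _ _ "l @ l'"]) (auto simp: coord_monomial_def)
  qed
  show "\<exists>c. \<forall>x\<in>K. \<bar>b x\<bar> \<le> c" if "b \<in> range coord_monomial" for b
    using that compact_imp_bounded[OF compact_continuous_image[OF continuous_on_coord_monomial K]]
    unfolding bounded_iff by fastforce
  fix x y :: "real^'d" assume "x \<noteq> y"
  then obtain i where i: "x $ i \<noteq> y $ i" by (auto simp: vec_eq_iff)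
  have "span_approx (range coord_monomial) K (coord_monomial [i])"
    by (rule span_approx_generator) auto
  then show "\<exists>g. continuous_on K g \<and> span_approx (range coord_monomial) K g \<and> g x \<noteq> g y"
    using continuous_on_coord_monomial[of K "[i]"] i
    by (intro exI[of _ "coord_monomial [i]"]) (auto simp: coord_monomial_def)
qed

definition bump :: "nat \<Rightarrow> real^'d \<Rightarrow> real"
  where "bump m v = max 0 (min 1 (min (2 * real (Suc m) * total v - 1) (2 - total v / real (Suc m))))"

lemma continuous_on_bump: "continuous_on A (bump m)"
  unfolding bump_def[abs_def] by (intro continuous_intros continuous_on_total) auto

lemma bump_bounds: "0 \<le> bump m v" "bump m v \<le> 1"
  by (auto simp: bump_def)

lemma bump_eq_1: "1 / real (Suc m) \<le> total v \<Longrightarrow> total v \<le> real (Suc m) \<Longrightarrow> bump m v = 1"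
  by (simp add: bump_def field_simps del: of_nat_Suc)

text \<open>The bounds are those of the shell with index \<open>2 * m + 1\<close>, since
  \<open>Suc (2 * m + 1)\<close> is twice \<open>Suc m\<close>.\<close>

lemma bump_nonzero:
  assumes "bump m v \<noteq> 0"
  shows "1 / real (Suc (2 * m + 1)) \<le> total v" "total v \<le> real (Suc (2 * m + 1))"
proof -
  have "0 < min 1 (min (2 * real (Suc m) * total v - 1) (2 - total v / real (Suc m)))"
    using assms unfolding bump_def by (simp only: max_def split: if_splits)
  then have "0 < 2 * real (Suc m) * total v - 1" "0 < 2 - total v / real (Suc m)"
    by (simp_all only: min_less_iff_conj)
  moreover have "real (Suc (2 * m + 1)) = 2 * real (Suc m)" by simp
  ultimately show "1 / real (Suc (2 * m + 1)) \<le> total v" "total v \<le> real (Suc (2 * m + 1))"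
    by (simp_all only:) (auto simp: field_simps simp del: of_nat_Suc)
qed

definition shell :: "nat \<Rightarrow> (real^'d) set"
  where "shell m = {v. (\<forall>j. 0 \<le> v $ j) \<and> 1 / real (Suc m) \<le> total v \<and> total v \<le> real (Suc m)}"

lemma compact_shell: "compact (shell m :: (real^'d) set)"
proof -
  have "shell m = cbox 0 (\<chi> j. real (Suc m)) \<inter> (total -` {1 / real (Suc m)..real (Suc m)} :: (real^'d) set)"
  proof -
    have "v $ i \<le> real (Suc m)" if "v \<in> shell m" for v i
      using total_ge[of v i] that by (auto simp: shell_def simp del: of_nat_Suc)
    note le = this
    show ?thesis
    proof (intro set_eqI iffI)
      fix v :: "real^'d" assume "v \<in> shell m"
      with le[OF this] show "v \<in> cbox 0 (\<chi> j. real (Suc m)) \<inter> total -` {1 / real (Suc m)..real (Suc m)}"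
        by (auto simp: shell_def mem_box_cart simp del: of_nat_Suc)
    qed (auto simp: shell_def mem_box_cart simp del: of_nat_Suc)
  qed
  moreover have "closed (total -` {1 / real (Suc m)..real (Suc m)} :: (real^'d) set)"
    using continuous_on_total[of "UNIV :: (real^'d) set"] by (intro closed_vimage) auto
  ultimately show ?thesis by (simp add: compact_Int_closed)
qed

section \<open>Transport between the state space and the orthant\<close>

locale state_params =
  fixes \<gamma> \<sigma> :: "real^'d"
  assumes \<sigma>_pos: "0 < \<sigma> $ j"
begin

abbreviation "S \<equiv> state_space \<gamma> \<sigma>"

abbreviation "E \<equiv> {v::real^'d. (\<forall>j. 0 \<le> v $ j) \<and> v \<noteq> 0}"

lemma lower_endpoint_eq: "lower_endpoint \<gamma> \<sigma> = vunstd \<gamma> \<sigma> 0"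
  by (auto simp: lower_endpoint_def vunstd_def unstd_def real_unstd_def vec_eq_iff)

lemma vstd_nonneg: "0 \<le> vstd \<gamma> \<sigma> y $ j"
  by (simp add: vstd_def std_nonneg)

lemma vstd_vunstd: "\<forall>j. 0 \<le> v $ j \<Longrightarrow> vstd \<gamma> \<sigma> (vunstd \<gamma> \<sigma> v) = v"
  by (simp add: vstd_def vunstd_def vec_eq_iff std_unstd \<sigma>_pos)

lemma vunstd_vstd: "\<forall>j. y $ j \<in> state_interval (\<gamma> $ j) (\<sigma> $ j) \<Longrightarrow> vunstd \<gamma> \<sigma> (vstd \<gamma> \<sigma> y) = y"
  by (simp add: vstd_def vunstd_def vec_eq_iff unstd_std \<sigma>_pos)

lemma vunstd_mem_iff: "\<forall>j. 0 \<le> v $ j \<Longrightarrow> vunstd \<gamma> \<sigma> v \<in> S \<longleftrightarrow> v \<noteq> 0"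
proof -
  assume v: "\<forall>j. 0 \<le> v $ j"
  have "vunstd \<gamma> \<sigma> v = vunstd \<gamma> \<sigma> 0 \<longleftrightarrow> v = 0"
    using vstd_vunstd[OF v] vstd_vunstd[of 0] by auto
  moreover have "\<forall>j. vunstd \<gamma> \<sigma> v $ j \<in> state_interval (\<gamma> $ j) (\<sigma> $ j)"
    using v unstd_mem by (simp add: vunstd_def)
  ultimately show ?thesis unfolding state_space_def lower_endpoint_eq by auto
qed

lemma state_space_interval: "y \<in> S \<Longrightarrow> \<forall>j. y $ j \<in> state_interval (\<gamma> $ j) (\<sigma> $ j)"
  by (simp add: state_space_def)

lemma vunstd_vstd_S: "y \<in> S \<Longrightarrow> vunstd \<gamma> \<sigma> (vstd \<gamma> \<sigma> y) = y"
  using vunstd_vstd state_space_interval by blast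

lemma vstd_mem: "y \<in> S \<Longrightarrow> vstd \<gamma> \<sigma> y \<in> E"
  using vunstd_mem_iff[of "vstd \<gamma> \<sigma> y"] vstd_nonneg vunstd_vstd_S[of y] by auto

lemma continuous_on_vunstd: "continuous_on {v. \<forall>j. 0 \<le> v $ j} (vunstd \<gamma> \<sigma>)"
  unfolding vunstd_def
proof (rule continuous_on_vec_lambda)
  fix j
  show "continuous_on {v. \<forall>j. 0 \<le> v $ j} (\<lambda>v. unstd (\<gamma> $ j) (\<sigma> $ j) (v $ j))"
    by (rule continuous_on_compose2[OF continuous_on_unstd[OF \<sigma>_pos]]) (auto intro: continuous_intros)
qed

lemma continuous_on_vstd: "continuous_on S (vstd \<gamma> \<sigma>)"
  unfolding vstd_def
proof (rule continuous_on_vec_lambda)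
  fix j
  have "continuous_on S (\<lambda>y. y $ j)"
    unfolding continuous_on_def by (auto intro!: tendsto_vec_nth tendsto_ident_at)
  then show "continuous_on S (\<lambda>y. std (\<gamma> $ j) (\<sigma> $ j) (y $ j))"
    by (rule continuous_on_compose2[OF continuous_on_std[OF \<sigma>_pos]]) (auto simp: state_space_def)
qed

lemma borel_measurable_vstd [measurable]: "vstd \<gamma> \<sigma> \<in> borel_measurable borel"
  unfolding vstd_def[abs_def]
  by (intro borel_measurable_vec_lambda measurable_compose[OF _ borel_measurable_std] borel_measurable_vec_nth) simp

lemma state_space_borel: "S \<in> sets borel"
proof -
  have [measurable]: "(\<lambda>y::ereal^'d. y $ j) \<in> borel_measurable borel" for j
    by (intro borel_measurable_vec_nth) simp
  have [measurable]: "state_interval g s \<in> sets borel" for g s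
    by (simp add: state_interval_def)
  have "S = {y \<in> space borel. (\<forall>j. y $ j \<in> state_interval (\<gamma> $ j) (\<sigma> $ j)) \<and> (\<exists>j. y $ j \<noteq> lower_endpoint \<gamma> \<sigma> $ j)}"
    by (auto simp: state_space_def vec_eq_iff)
  also have "\<dots> \<in> sets borel" by measurable
  finally show ?thesis .
qed

definition KK :: "nat \<Rightarrow> (ereal^'d) set"
  where "KK m = {y \<in> S. vstd \<gamma> \<sigma> y \<in> shell m}"

lemma KK_eq: "KK m = vunstd \<gamma> \<sigma> ` shell m"
proof (intro set_eqI iffI)
  fix y assume "y \<in> KK m"
  then show "y \<in> vunstd \<gamma> \<sigma> ` shell m"
    using vunstd_vstd_S by (intro image_eqI[of _ _ "vstd \<gamma> \<sigma> y"]) (auto simp: KK_def)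
next
  fix y assume "y \<in> vunstd \<gamma> \<sigma> ` shell m"
  then obtain v where v: "y = vunstd \<gamma> \<sigma> v" "v \<in> shell m" by auto
  then have v0: "\<forall>j. 0 \<le> v $ j" "0 < total v"
    by (auto simp: shell_def intro: less_le_trans[of 0 "1 / real (Suc m)"])
  then have "v \<noteq> 0" using total_pos_iff by blast
  then show "y \<in> KK m" using v v0 vunstd_mem_iff[OF v0(1)] vstd_vunstd[OF v0(1)] by (simp add: KK_def)
qed

lemma compact_KK: "compact (KK m)"
  unfolding KK_eq
  by (intro compact_continuous_image compact_shell continuous_on_subset[OF continuous_on_vunstd])
    (auto simp: shell_def)

lemma KK_borel: "KK m \<in> sets borel"
proof -
  have [measurable]: "shell m \<in> sets borel" "S \<in> sets borel"
    using compact_shell state_space_borel by (auto intro: borel_compact)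
  have "KK m = S \<inter> (vstd \<gamma> \<sigma> -` shell m \<inter> space borel)" by (auto simp: KK_def)
  also have "\<dots> \<in> sets borel" by measurable
  finally show ?thesis .
qed

text \<open>On the standardized image of a compact set, \<open>total\<close> attains a positive
  minimum and a maximum, which keeps the set away from the origin and from infinity.\<close>

lemma shell_exhaust:
  assumes K: "compact K" "K \<subseteq> S"
  shows "\<exists>m. K \<subseteq> KK m"
proof (cases "K = {}")
  case False
  have c: "continuous_on K (\<lambda>y. total (vstd \<gamma> \<sigma> y))"
    by (rule continuous_on_compose2[OF continuous_on_total continuous_on_subset[OF continuous_on_vstd K(2)]]) auto
  have pos: "0 < total (vstd \<gamma> \<sigma> y)" if "y \<in> K" for y
  proof -
    have "vstd \<gamma> \<sigma> y \<in> E" by (rule vstd_mem) (use that K in auto)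
    then show ?thesis using total_pos_iff by blast
  qed
  obtain y0 where y0: "y0 \<in> K" "\<And>y. y \<in> K \<Longrightarrow> total (vstd \<gamma> \<sigma> y0) \<le> total (vstd \<gamma> \<sigma> y)"
    using continuous_attains_inf[OF K(1) False c] by blast
  obtain y1 where y1: "y1 \<in> K" "\<And>y. y \<in> K \<Longrightarrow> total (vstd \<gamma> \<sigma> y) \<le> total (vstd \<gamma> \<sigma> y1)"
    using continuous_attains_sup[OF K(1) False c] by blast
  obtain m :: nat where m: "max (total (vstd \<gamma> \<sigma> y1)) (1 / total (vstd \<gamma> \<sigma> y0)) \<le> real m"
    using real_arch_simple by blast
  have "y \<in> KK m" if y: "y \<in> K" for y
  proof -
    have "1 / total (vstd \<gamma> \<sigma> y0) \<le> real (Suc m)" using m by simp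
    then have "1 / real (Suc m) \<le> total (vstd \<gamma> \<sigma> y0)"
      using pos[OF y0(1)] by (simp add: field_simps del: of_nat_Suc)
    then show ?thesis
      using y0(2)[OF y] y1(2)[OF y] m y K(2) vstd_nonneg by (auto simp: KK_def shell_def)
  qed
  then show ?thesis by blast
qed simp

text \<open>The monomials give density, the bumps compact support; both are nonnegative on the
  orthant. The empty monomial yields the bump itself, which is the dominating member required by
  \<open>dense\<close>.\<close>

definition fam :: "nat \<Rightarrow> ereal^'d \<Rightarrow> real"
  where "fam i y = (case from_nat i of (m, l) \<Rightarrow> bump m (vstd \<gamma> \<sigma> y) * coord_monomial l (vstd \<gamma> \<sigma> y))"

sublocale vague_family S fam KK
proof
  show "fam i \<in> test_functions S" for i
  proof -
    obtain m :: nat and l where i: "from_nat i = (m, l :: 'd list)" by (cases "from_nat i :: nat \<times> 'd list") auto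
    have f: "fam i = (\<lambda>y. bump m (vstd \<gamma> \<sigma> y) * coord_monomial l (vstd \<gamma> \<sigma> y))"
      by (simp add: fam_def[abs_def] i)
    have "continuous_on S (fam i)"
      unfolding f
      by (intro continuous_on_mult continuous_on_compose2[OF continuous_on_bump continuous_on_vstd subset_UNIV]
          continuous_on_compose2[OF continuous_on_coord_monomial continuous_on_vstd subset_UNIV])
    moreover have "0 \<le> fam i y" for y
      unfolding f by (intro mult_nonneg_nonneg bump_bounds coord_monomial_nonneg allI vstd_nonneg)
    moreover have "fam i y = 0" if "y \<in> S - KK (2 * m + 1)" for y
      using that bump_nonzero[of m "vstd \<gamma> \<sigma> y"] vstd_nonneg by (auto simp: f KK_def shell_def)
    ultimately show ?thesis
      unfolding test_functions_def using compact_KK[of "2 * m + 1"]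
      by (auto intro!: exI[of _ "KK (2 * m + 1)"] simp: KK_def)
  qed
  show "\<exists>m. \<forall>\<epsilon>>0. \<exists>l. snd ` set l \<subseteq> range fam \<and> (\<forall>x\<in>S. \<bar>f x - lincomb l x\<bar> \<le> \<epsilon> * fam m x)"
    if f: "f \<in> test_functions S" for f
  proof -
    obtain K where K: "compact K" "K \<subseteq> S" "\<And>y. y \<in> S - K \<Longrightarrow> f y = 0" and fc: "continuous_on S f"
      using f unfolding test_functions_def by auto
    obtain m where m: "K \<subseteq> KK m" using shell_exhaust[OF K(1,2)] by blast
    have fam_m: "fam (to_nat (m, l)) y = bump m (vstd \<gamma> \<sigma> y) * coord_monomial l (vstd \<gamma> \<sigma> y)"
      for l :: "'d list" and y by (simp add: fam_def)
    have "\<exists>l. snd ` set l \<subseteq> range fam \<and> (\<forall>y\<in>S. \<bar>f y - lincomb l y\<bar> \<le> \<epsilon> * fam (to_nat (m, [] :: 'd list)) y)"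
      if "\<epsilon> > 0" for \<epsilon>
    proof -
      \<comment> \<open>The polynomial approximation is made on the larger shell, which contains the
        whole support of the bump with index \<open>m\<close>.\<close>
      have sub: "vunstd \<gamma> \<sigma> ` shell (2 * m + 1) \<subseteq> S" unfolding KK_eq[symmetric] by (auto simp: KK_def)
      have "continuous_on (shell (2 * m + 1)) (\<lambda>v. f (vunstd \<gamma> \<sigma> v))"
        by (rule continuous_on_compose2[OF fc continuous_on_subset[OF continuous_on_vunstd] sub]) (auto simp: shell_def)
      from span_approxD[OF coord_monomial_span[OF compact_shell this] that]
      obtain l where l: "snd ` set l \<subseteq> range coord_monomial"
        "\<And>v. v \<in> shell (2 * m + 1) \<Longrightarrow> \<bar>f (vunstd \<gamma> \<sigma> v) - lincomb l v\<bar> \<le> \<epsilon>" by auto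
      define l' where "l' = map (\<lambda>(c, b). (c, \<lambda>y. bump m (vstd \<gamma> \<sigma> y) * b (vstd \<gamma> \<sigma> y))) l"
      have "(\<lambda>y. bump m (vstd \<gamma> \<sigma> y) * coord_monomial k (vstd \<gamma> \<sigma> y)) \<in> range fam" for k
        using fam_m[of k] by (intro image_eqI[of _ _ "to_nat (m, k)"]) auto
      then have "snd ` set l' \<subseteq> range fam" using l(1) by (fastforce simp: l'_def)
      moreover have l'_eq: "lincomb l' y = bump m (vstd \<gamma> \<sigma> y) * lincomb l (vstd \<gamma> \<sigma> y)" for y
        unfolding l'_def by (induction l) (auto simp: algebra_simps)
      have "\<bar>f y - lincomb l' y\<bar> \<le> \<epsilon> * fam (to_nat (m, [] :: 'd list)) y" if y: "y \<in> S" for y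
      proof -
        let ?v = "vstd \<gamma> \<sigma> y"
        \<comment> \<open>The bump is 1 on the support of \<open>f\<close>. Hence the error of the
          truncated polynomial is the bump times the polynomial error, exactly the form needed for
          domination.\<close>
        have fy: "f y = bump m ?v * f y"
        proof (cases "y \<in> K")
          case True
          then show ?thesis using m bump_eq_1[of m ?v] by (auto simp: KK_def shell_def)
        qed (use K(3) y in simp)
        have rhs: "fam (to_nat (m, [] :: 'd list)) y = bump m ?v" unfolding fam_m by (simp add: coord_monomial_def)
        show ?thesis
        proof (cases "bump m ?v = 0")
          case True
          then show ?thesis using fy rhs by (simp add: l'_eq)
        next
          case False
          then have "?v \<in> shell (2 * m + 1)" using bump_nonzero[OF False] vstd_nonneg by (simp add: shell_def)
          from l(2)[OF this] have b: "\<bar>f y - lincomb l ?v\<bar> \<le> \<epsilon>" by (simp add: vunstd_vstd_S[OF y])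
          have "f y - lincomb l' y = bump m ?v * (f y - lincomb l ?v)"
            using fy by (simp add: l'_eq algebra_simps)
          then have "\<bar>f y - lincomb l' y\<bar> = bump m ?v * \<bar>f y - lincomb l ?v\<bar>"
            using bump_bounds(1)[of m ?v] by (simp add: abs_mult)
          also have "\<dots> \<le> bump m ?v * \<epsilon>" using b bump_bounds(1) by (intro mult_left_mono)
          finally show ?thesis unfolding rhs by (simp add: mult.commute)
        qed
      qed
      ultimately show ?thesis by blast
    qed
    then show ?thesis by blast
  qed
  show "compact (KK m)" "KK m \<subseteq> S" "KK m \<in> sets borel" for m
    using compact_KK KK_borel by (auto simp: KK_def)
  show "\<exists>m. K \<subseteq> KK m" if "compact K" "K \<subseteq> S" for K using shell_exhaust that by blast
  show "S \<in> sets borel" by (rule state_space_borel)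
qed

text \<open>The value 0 at the origin lets discarded observations, which are represented by the
  origin, contribute nothing.\<close>

definition orthant_extension :: "(ereal^'d \<Rightarrow> real) \<Rightarrow> real^'d \<Rightarrow> real"
  where "orthant_extension f v = (if v \<in> E then f (vunstd \<gamma> \<sigma> v) else 0)"

lemma orthant_extension:
  assumes f: "f \<in> test_functions S"
  shows orthant_extension_nonneg: "0 \<le> orthant_extension f v"
    and continuous_on_orthant_extension: "continuous_on {v. \<forall>j. 0 \<le> v $ j} (orthant_extension f)"
    and orthant_extension_support: "\<exists>m. \<forall>v. orthant_extension f v \<noteq> 0 \<longrightarrow> v \<in> shell m"
    and borel_measurable_orthant_extension: "orthant_extension f \<in> borel_measurable borel"
proof -
  obtain K where K: "compact K" "K \<subseteq> S" "\<And>y. y \<in> S - K \<Longrightarrow> f y = 0" and fc: "continuous_on S f"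
    and f0: "\<And>y. y \<in> S \<Longrightarrow> 0 \<le> f y"
    using f unfolding test_functions_def by auto
  obtain m where m: "K \<subseteq> KK m" using shell_exhaust[OF K(1,2)] by blast
  have supp: "v \<in> shell m" if "orthant_extension f v \<noteq> 0" for v
  proof -
    have v: "v \<in> E" "f (vunstd \<gamma> \<sigma> v) \<noteq> 0" using that by (auto simp: orthant_extension_def split: if_splits)
    then have "vunstd \<gamma> \<sigma> v \<in> S" using vunstd_mem_iff by blast
    then have "vunstd \<gamma> \<sigma> v \<in> KK m" using K(3) v(2) m by blast
    then show ?thesis using v vstd_vunstd by (simp add: KK_def)
  qed
  then show "\<exists>m. \<forall>v. orthant_extension f v \<noteq> 0 \<longrightarrow> v \<in> shell m" by blast
  show "0 \<le> orthant_extension f v"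
    using f0[of "vunstd \<gamma> \<sigma> v"] vunstd_mem_iff[of v] by (auto simp: orthant_extension_def)
  let ?O = "{v::real^'d. \<forall>j. 0 \<le> v $ j}"
  \<comment> \<open>Half of the lower bound for \<open>total\<close> on the support. The function
    vanishes on the closed piece below \<open>?r\<close> and is a composition of continuous maps on
    the closed piece above, so it is continuous on their union.\<close>
  let ?r = "1 / (2 * real (Suc m))"
  let ?A = "?O \<inter> total -` {?r..}" and ?B = "?O \<inter> total -` {..?r}"
  have O_closed: "closed ?O"
  proof -
    have "?O = (\<Inter>j. {v. 0 \<le> v $ j})" by auto
    then show ?thesis by (auto intro!: closed_INT closed_Collect_le continuous_intros)
  qed
  have "closed (total -` {?r..} :: (real^'d) set)" "closed (total -` {..?r} :: (real^'d) set)"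
    using continuous_on_total[of "UNIV :: (real^'d) set"] by (auto intro!: closed_vimage)
  then have closed: "closed ?A" "closed ?B" using O_closed by auto
  have A_E: "v \<in> E" if "v \<in> ?A" for v
  proof -
    have "0 < ?r" by simp
    also have "?r \<le> total v" using that by simp
    finally have "0 < total v" .
    then show ?thesis using that total_pos_iff by auto
  qed
  have "continuous_on ?A (\<lambda>v. f (vunstd \<gamma> \<sigma> v))"
    by (rule continuous_on_compose2[OF fc continuous_on_subset[OF continuous_on_vunstd]])
      (use A_E vunstd_mem_iff in auto)
  then have 1: "continuous_on ?A (orthant_extension f)"
    by (rule continuous_on_eq) (use A_E in \<open>simp add: orthant_extension_def\<close>)
  have "orthant_extension f v = 0" if "v \<in> ?B" for v
  proof (rule ccontr)
    assume "orthant_extension f v \<noteq> 0"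
    then have "1 / real (Suc m) \<le> total v" using supp by (auto simp: shell_def)
    moreover have "?r < 1 / real (Suc m)" by (simp add: field_simps)
    ultimately show False using that by auto
  qed
  then have 2: "continuous_on ?B (orthant_extension f)"
    by (intro continuous_on_eq[OF continuous_on_const[of ?B 0]]) auto
  have "?O = ?A \<union> ?B" by auto
  then show c: "continuous_on ?O (orthant_extension f)"
    using continuous_on_closed_Un[OF closed 1 2] by simp
  have "(\<lambda>v. indicator ?O v *\<^sub>R orthant_extension f v) \<in> borel_measurable borel"
    by (rule borel_measurable_continuous_on_indicator[OF _ c]) (use O_closed in auto)
  moreover have "(\<lambda>v. indicator ?O v *\<^sub>R orthant_extension f v) = orthant_extension f"
    by (auto simp: orthant_extension_def indicator_def fun_eq_iff)
  ultimately show "orthant_extension f \<in> borel_measurable borel" by simp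
qed

end

section \<open>Poisson processes of rays\<close>

text \<open>By the marking and mapping theorems this is the intensity of the Poisson process of the
  points W_i / T_i when the W_i have law \<open>P\<close>.\<close>

definition intensity :: "(real^'d) measure \<Rightarrow> (real^'d) measure"
  where "intensity P = distr (P \<Otimes>\<^sub>M restrict_space lborel {0<..}) borel (\<lambda>(w, t). (1 / t) *\<^sub>R w)"

lemma sets_intensity [simp, measurable_cong]: "sets (intensity P) = sets borel"
  by (simp add: intensity_def)

locale ray_law =
  fixes P :: "(real^'d) measure"
  assumes prob_P: "prob_space P" and sets_P [measurable_cong]: "sets P = sets borel"
    and P_nonneg: "AE w in P. \<forall>j. 0 \<le> w $ j"
    and P_integrable: "integrable P (\<lambda>w. w $ j)"
begin

lemma measurable_component [measurable]: "(\<lambda>w::real^'d. w $ j) \<in> borel_measurable borel"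
  by (intro borel_measurable_vec_nth) simp

lemma measurable_ray:
  "(\<lambda>(w, t). (1 / t) *\<^sub>R w) \<in> borel_measurable (P \<Otimes>\<^sub>M restrict_space lborel {0<..})"
proof -
  have [measurable]: "(\<lambda>t::real. t) \<in> borel_measurable (restrict_space lborel {0<..})"
    by (intro measurable_restrict_space1) simp
  show ?thesis by measurable
qed

lemma sigma_finite_half_line: "sigma_finite_measure (restrict_space lborel {0<..} :: real measure)"
  by (rule sigma_finite_measure_restrict_space) (auto intro: lborel.sigma_finite_measure_axioms)

lemma nn_integral_intensity:
  assumes g [measurable]: "g \<in> borel_measurable borel"
  shows "(\<integral>\<^sup>+v. g v \<partial>intensity P) = (\<integral>\<^sup>+w. \<integral>\<^sup>+t. g ((1 / t) *\<^sub>R w) * indicator {0<..} t \<partial>lborel \<partial>P)"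
    and "(\<integral>\<^sup>+v. g v \<partial>intensity P) = (\<integral>\<^sup>+t. (\<integral>\<^sup>+w. g ((1 / t) *\<^sub>R w) \<partial>P) * indicator {0<..} t \<partial>lborel)"
proof -
  interpret P: prob_space P by (rule prob_P)
  interpret H: sigma_finite_measure "restrict_space lborel {0<..} :: real measure"
    by (rule sigma_finite_half_line)
  interpret PH: pair_sigma_finite P "restrict_space lborel {0<..} :: real measure" ..
  note [measurable] = measurable_ray
  have "(\<integral>\<^sup>+v. g v \<partial>intensity P) = (\<integral>\<^sup>+z. g (case z of (w, t) \<Rightarrow> (1 / t) *\<^sub>R w) \<partial>(P \<Otimes>\<^sub>M restrict_space lborel {0<..}))"
    unfolding intensity_def by (rule nn_integral_distr) measurable
  note 1 = this
  have m: "(\<lambda>z. g (case z of (w, t) \<Rightarrow> (1 / t) *\<^sub>R w)) \<in> borel_measurable (P \<Otimes>\<^sub>M restrict_space lborel {0<..})"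
    by measurable
  show "(\<integral>\<^sup>+v. g v \<partial>intensity P) = (\<integral>\<^sup>+w. \<integral>\<^sup>+t. g ((1 / t) *\<^sub>R w) * indicator {0<..} t \<partial>lborel \<partial>P)"
    unfolding 1 H.nn_integral_fst[OF m, symmetric] by (simp add: nn_integral_restrict_space)
  show "(\<integral>\<^sup>+v. g v \<partial>intensity P) = (\<integral>\<^sup>+t. (\<integral>\<^sup>+w. g ((1 / t) *\<^sub>R w) \<partial>P) * indicator {0<..} t \<partial>lborel)"
    unfolding 1 PH.nn_integral_snd[OF m, symmetric] by (simp add: nn_integral_restrict_space)
qed

lemma integrable_wmax: "\<forall>j. 0 < x $ j \<Longrightarrow> integrable P (wmax x)"
proof -
  assume x: "\<forall>j. 0 < x $ j"
  have [measurable]: "wmax x \<in> borel_measurable P" by simp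
  show ?thesis
  proof (rule Bochner_Integration.integrable_bound)
    show "integrable P (\<lambda>w. \<Sum>j\<in>UNIV. w $ j / x $ j)" using P_integrable by auto
    show "AE w in P. norm (wmax x w) \<le> norm (\<Sum>j\<in>UNIV. w $ j / x $ j)"
      using P_nonneg
    proof eventually_elim
      case (elim w)
      have nn: "0 \<le> w $ j / x $ j" for j using elim x by (simp add: less_imp_le)
      obtain i where i: "wmax x w = w $ i / x $ i" using wmax_attained by blast
      have "w $ i / x $ i \<le> (\<Sum>j\<in>UNIV. w $ j / x $ j)" by (rule member_le_sum) (use nn in auto)
      then show ?case using i nn[of i] by simp
    qed
  qed simp
qed

text \<open>For fixed \<open>w\<close> the ray \<open>w / t\<close> lies outside the box exactly
  while \<open>t < wmax x w\<close>, a set of times of length \<open>wmax x w\<close>.\<close>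

lemma emeasure_intensity:
  assumes x: "\<forall>j. 0 < x $ j"
  shows "emeasure (intensity P) (- {..x}) = ennreal (\<integral>w. wmax x w \<partial>P)"
proof -
  have "emeasure (intensity P) (- {..x}) = (\<integral>\<^sup>+v. indicator (- {..x}) v \<partial>intensity P)" by simp
  also have "\<dots> = (\<integral>\<^sup>+w. \<integral>\<^sup>+t. indicator (- {..x}) ((1 / t) *\<^sub>R w) * indicator {0<..} t \<partial>lborel \<partial>P)"
    by (rule nn_integral_intensity) simp
  also have "\<dots> = (\<integral>\<^sup>+w. ennreal (wmax x w) \<partial>P)"
  proof (rule nn_integral_cong_AE)
    show "AE w in P. (\<integral>\<^sup>+t. indicator (- {..x}) ((1 / t) *\<^sub>R w) * indicator {0<..} t \<partial>lborel) = ennreal (wmax x w)"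
      using P_nonneg
    proof eventually_elim
      case (elim w)
      have nn: "0 \<le> wmax x w"
        using wmax_attained[of x w] elim x by (auto simp: less_imp_le)
      have "indicator (- {..x}) ((1 / t) *\<^sub>R w) * indicator {0<..} t = (indicator {0<..<wmax x w} t :: ennreal)" for t
      proof (cases "0 < t")
        case True
        have "(1 / t) *\<^sub>R w \<le> x \<longleftrightarrow> w \<le> t *\<^sub>R x"
          using True by (auto simp: less_eq_vec_def pos_divide_le_eq mult.commute)
        also have "\<dots> \<longleftrightarrow> wmax x w \<le> t" by (rule wmax_le_iff[OF x, symmetric])
        finally show ?thesis using True by (auto simp: indicator_def)
      qed simp
      then have "(\<integral>\<^sup>+t. indicator (- {..x}) ((1 / t) *\<^sub>R w) * indicator {0<..} t \<partial>lborel)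
          = emeasure lborel {0<..<wmax x w}" by simp
      also have "\<dots> = ennreal (wmax x w)" using nn by simp
      finally show ?case .
    qed
  qed
  also have "\<dots> = ennreal (\<integral>w. wmax x w \<partial>P)"
  proof (rule nn_integral_eq_integral[OF integrable_wmax[OF x]])
    show "AE w in P. 0 \<le> wmax x w"
      using P_nonneg
    proof eventually_elim
      case (elim w)
      then show ?case using wmax_attained[of x w] x by (auto simp: less_imp_le)
    qed
  qed
  finally show ?thesis .
qed

lemma intensity_nonneg: "AE v in intensity P. \<forall>j. 0 \<le> v $ j"
proof -
  interpret H: sigma_finite_measure "restrict_space lborel {0<..} :: real measure"
    by (rule sigma_finite_half_line)
  have "(\<integral>\<^sup>+v. indicator {v. \<not> (\<forall>j. 0 \<le> v $ j)} v \<partial>intensity P)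
      = (\<integral>\<^sup>+w. \<integral>\<^sup>+t. indicator {v. \<not> (\<forall>j. 0 \<le> v $ j)} ((1 / t) *\<^sub>R w) * indicator {0<..} t \<partial>lborel \<partial>P)"
    by (rule nn_integral_intensity) measurable
  also have "\<dots> = (\<integral>\<^sup>+w. 0 \<partial>P)"
  proof (rule nn_integral_cong_AE)
    show "AE w in P. (\<integral>\<^sup>+t. indicator {v. \<not> (\<forall>j. 0 \<le> v $ j)} ((1 / t) *\<^sub>R w) * indicator {0<..} t \<partial>lborel) = 0"
      using P_nonneg
    proof eventually_elim
      case (elim w)
      have "indicator {v. \<not> (\<forall>j. 0 \<le> v $ j)} ((1 / t) *\<^sub>R w) * indicator {0<..} t = (0::ennreal)" for t
        using elim by (auto simp: indicator_def)
      then have "(\<lambda>t. indicator {v. \<not> (\<forall>j. 0 \<le> v $ j)} ((1 / t) *\<^sub>R w) * indicator {0<..} t) = (\<lambda>_. 0::ennreal)"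
        by (rule ext)
      then show ?case by (simp only:) simp
    qed
  qed
  finally have z: "(\<integral>\<^sup>+v. indicator {v. \<not> (\<forall>j. 0 \<le> v $ j)} v \<partial>intensity P) = 0" by simp
  have [measurable]: "{v::real^'d. \<not> (\<forall>j. 0 \<le> v $ j)} \<in> sets borel" by measurable
  have "emeasure (intensity P) {v. \<not> (\<forall>j. 0 \<le> v $ j)} = 0" using z by simp
  then show ?thesis by (intro AE_I[of _ _ "{v. \<not> (\<forall>j. 0 \<le> v $ j)}"]) auto
qed

text \<open>A function bounded by 1 and vanishing near the origin is dominated by the indicator of
  the complement of a box, which has finite intensity; so the order of integration can be
  exchanged.\<close>

lemma integral_intensity:
  fixes g :: "real^'d \<Rightarrow> real"
  assumes g [measurable]: "g \<in> borel_measurable borel" and g01: "\<And>v. 0 \<le> g v" "\<And>v. g v \<le> 1"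
    and \<delta>: "0 < \<delta>" "\<And>v. \<forall>j. 0 \<le> v $ j \<Longrightarrow> \<forall>j. v $ j \<le> \<delta> \<Longrightarrow> g v = 0"
  shows "integrable lborel (\<lambda>t. indicator {0<..} t * (\<integral>w. g ((1 / t) *\<^sub>R w) \<partial>P))"
    and "(LINT t|lborel. indicator {0<..} t * (\<integral>w. g ((1 / t) *\<^sub>R w) \<partial>P)) = (\<integral>v. g v \<partial>intensity P)"
proof -
  interpret P: prob_space P by (rule prob_P)
  let ?d = "\<chi> j. \<delta> :: real^'d"
  have d: "\<forall>j. 0 < ?d $ j" using \<delta> by simp
  have "(\<integral>\<^sup>+v. ennreal (g v) \<partial>intensity P) \<le> (\<integral>\<^sup>+v. indicator (- {..?d}) v \<partial>intensity P)"
  proof (rule nn_integral_mono_AE)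
    show "AE v in intensity P. ennreal (g v) \<le> indicator (- {..?d}) v"
      using intensity_nonneg
    proof eventually_elim
      case (elim v)
      show ?case
      proof (cases "v \<le> ?d")
        case True
        then show ?thesis using \<delta>(2)[OF elim] by (simp add: less_eq_vec_def)
      next
        case False
        then show ?thesis using g01(2)[of v] ennreal_leI[of "g v" 1] by simp
      qed
    qed
  qed
  also have "\<dots> = emeasure (intensity P) (- {..?d})" by simp
  also have "\<dots> < \<infinity>" by (simp add: emeasure_intensity[OF d])
  finally have fin: "(\<integral>\<^sup>+v. ennreal (g v) \<partial>intensity P) < \<infinity>" .
  have int: "integrable P (\<lambda>w. g ((1 / t) *\<^sub>R w))" for t
    by (rule P.integrable_const_bound[of _ 1]) (use g01 in auto)
  have nn: "(\<integral>\<^sup>+t. ennreal (indicator {0<..} t * (\<integral>w. g ((1 / t) *\<^sub>R w) \<partial>P)) \<partial>lborel) = (\<integral>\<^sup>+v. ennreal (g v) \<partial>intensity P)"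
  proof -
    have "(\<integral>\<^sup>+v. ennreal (g v) \<partial>intensity P)
        = (\<integral>\<^sup>+t. (\<integral>\<^sup>+w. ennreal (g ((1 / t) *\<^sub>R w)) \<partial>P) * indicator {0<..} t \<partial>lborel)"
      by (rule nn_integral_intensity) simp
    also have "\<dots> = (\<integral>\<^sup>+t. ennreal (indicator {0<..} t * (\<integral>w. g ((1 / t) *\<^sub>R w) \<partial>P)) \<partial>lborel)"
      using g01 by (intro nn_integral_cong) (auto simp: nn_integral_eq_integral[OF int] indicator_def)
    finally show ?thesis by simp
  qed
  have [measurable]: "(\<lambda>t. \<integral>w. g ((1 / t) *\<^sub>R w) \<partial>P) \<in> borel_measurable lborel"
    by (rule P.borel_measurable_lebesgue_integral) measurable
  have nonneg: "0 \<le> indicator {0<..} t * (\<integral>w. g ((1 / t) *\<^sub>R w) \<partial>P)" for t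
    using g01 by (intro mult_nonneg_nonneg integral_nonneg_AE) auto
  show "integrable lborel (\<lambda>t. indicator {0<..} t * (\<integral>w. g ((1 / t) *\<^sub>R w) \<partial>P))"
    by (rule integrableI_nonneg) (use nn fin nonneg in auto)
  have "(LINT t|lborel. indicator {0<..} t * (\<integral>w. g ((1 / t) *\<^sub>R w) \<partial>P))
      = enn2real (\<integral>\<^sup>+v. ennreal (g v) \<partial>intensity P)"
    using nonneg by (subst integral_eq_nn_integral) (auto simp: nn)
  also have "\<dots> = (\<integral>v. g v \<partial>intensity P)"
    using g01 by (subst integral_eq_nn_integral) auto
  finally show "(LINT t|lborel. indicator {0<..} t * (\<integral>w. g ((1 / t) *\<^sub>R w) \<partial>P)) = (\<integral>v. g v \<partial>intensity P)" .
qed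

end

locale ray_poisson = marked_poisson M P X T + ray_law P
  for M :: "'v measure" and P :: "(real^'d) measure" and X T +
  assumes X_nonneg: "0 \<le> X i \<omega> $ j"
begin

text \<open>The condition says that \<open>T i \<omega>\<close> is at most a constant times
  \<open>total (X i \<omega>)\<close>, and \<open>total\<close> has finite mean, so Campbell's
  formula applies.\<close>

lemma finite_large_points: "AE \<omega> in M. \<forall>m::nat. finite {i. 1 / real (Suc m) \<le> total ((1 / T i \<omega>) *\<^sub>R X i \<omega>)}"
proof (subst AE_all_countable, intro allI)
  fix m :: nat
  \<comment> \<open>The truncation at 0 is needed because a bound in
    \<open>finite_points_below\<close> must be nonnegative on the whole space, not only on the
    orthant.\<close>
  let ?c = "\<lambda>w::real^'d. max 0 (real (Suc m) * total w)"
  have [measurable]: "(total :: real^'d \<Rightarrow> real) \<in> borel_measurable borel"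
    by (rule borel_measurable_continuous_onI[OF continuous_on_total])
  have "integrable P total" unfolding total_def using P_integrable by auto
  then have "integrable P ?c" by (intro integrable_max) auto
  from finite_points_below[OF _ this]
  have "AE \<omega> in M. finite {i. T i \<omega> \<le> ?c (X i \<omega>)}" by simp
  then show "AE \<omega> in M. finite {i. 1 / real (Suc m) \<le> total ((1 / T i \<omega>) *\<^sub>R X i \<omega>)}"
    using T_pos
  proof eventually_elim
    case (elim \<omega>)
    have "total ((1 / T i \<omega>) *\<^sub>R X i \<omega>) = total (X i \<omega>) / T i \<omega>" for i
      by (simp add: total_def sum_divide_distrib)
    then have "{i. 1 / real (Suc m) \<le> total ((1 / T i \<omega>) *\<^sub>R X i \<omega>)} \<subseteq> {i. T i \<omega> \<le> ?c (X i \<omega>)}"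
      using elim(2) by (auto simp: field_simps max_def simp del: of_nat_Suc)
    then show ?case using elim(1) by (rule finite_subset)
  qed
qed

lemma Laplace_limit:
  fixes g :: "real^'d \<Rightarrow> real"
  assumes g [measurable]: "g \<in> borel_measurable borel" and g0: "\<And>v. 0 \<le> g v"
    and gc: "continuous_on {v. \<forall>j. 0 \<le> v $ j} g"
    and supp: "\<And>v. g v \<noteq> 0 \<Longrightarrow> 1 / real (Suc m) \<le> total v"
    and Y: "Y \<in> borel_measurable M"
      "AE \<omega> in M. Y \<omega> = exp (- (\<Sum>i | g ((1 / T i \<omega>) *\<^sub>R X i \<omega>) \<noteq> 0. g ((1 / T i \<omega>) *\<^sub>R X i \<omega>)))"
  shows "expectation Y = exp (- (\<integral>v. 1 - exp (- g v) \<partial>intensity P))"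
proof -
  interpret P: prob_space P by (rule prob_P)
  let ?h = "\<lambda>x t. exp (- g ((1 / t) *\<^sub>R x))"
  have fin: "AE \<omega> in M. finite {i. g ((1 / T i \<omega>) *\<^sub>R X i \<omega>) \<noteq> 0}"
    using finite_large_points
  proof eventually_elim
    case (elim \<omega>)
    then have "finite {i. 1 / real (Suc m) \<le> total ((1 / T i \<omega>) *\<^sub>R X i \<omega>)}" by (rule spec)
    then show ?case by (rule finite_subset[rotated]) (use supp in blast)
  qed
  \<comment> \<open>If all coordinates are at most \<open>\<delta>\<close>, then
    \<open>total\<close> is at most half of its lower bound on the support of
    \<open>g\<close>.\<close>
  define \<delta> where "\<delta> = 1 / (2 * real (Suc m) * real CARD('d))"
  have \<delta>: "0 < \<delta>" by (simp add: \<delta>_def)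
  have gz: "g v = 0" if "\<forall>j. v $ j \<le> \<delta>" for v
  proof (rule ccontr)
    assume "g v \<noteq> 0"
    then have "1 / real (Suc m) \<le> total v" by (rule supp)
    also have "\<dots> \<le> (\<Sum>j\<in>(UNIV::'d set). \<delta>)" unfolding total_def using that by (intro sum_mono) auto
    also have "\<dots> = 1 / (2 * real (Suc m))" by (simp add: \<delta>_def)
    finally show False by (simp add: field_simps)
  qed
  have int: "integrable P (\<lambda>w. ?h w t)" for t
    by (rule P.integrable_const_bound[of _ 1]) (use g0 in auto)
  have D: "(LINT w|P. 1 - ?h w t) = 1 - (LINT w|P. ?h w t)" for t
    using int[of t] by (simp add: P.prob_space)
  note I = integral_intensity[of "\<lambda>v. 1 - exp (- g v)" \<delta>]
  have "expectation Y = exp (- (LINT t|lborel. indicator {0<..} t * (1 - (LINT x|P. ?h x t))))"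
  proof (rule marked_Laplace[where h = ?h and Y = Y])
    show "(\<lambda>n. LINT x|P. ?h x (s n)) \<longlonglongrightarrow> (LINT x|P. ?h x t)"
      if t: "0 < t" and s: "s \<longlonglongrightarrow> t" and le: "\<And>n. t \<le> s n" for t s
    proof (rule integral_dominated_convergence[where w = "\<lambda>_. 1"])
      show "AE x in P. (\<lambda>n. ?h x (s n)) \<longlonglongrightarrow> ?h x t"
        using P_nonneg
      proof eventually_elim
        case (elim x)
        have "(\<lambda>n. g ((1 / s n) *\<^sub>R x)) \<longlonglongrightarrow> g ((1 / t) *\<^sub>R x)"
        proof (rule continuous_on_tendsto_compose[OF gc])
          show "(\<lambda>n. (1 / s n) *\<^sub>R x) \<longlonglongrightarrow> (1 / t) *\<^sub>R x" using t by (intro tendsto_intros s) auto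
          have "0 < s n" for n using t le[of n] by simp
          then show "\<forall>\<^sub>F n in sequentially. (1 / s n) *\<^sub>R x \<in> {v. \<forall>j. 0 \<le> v $ j}"
            using elim by (intro always_eventually) (auto simp: less_imp_le)
        qed (use t elim in auto)
        then show ?case by (intro tendsto_intros)
      qed
    qed (use g0 in auto)
    show "AE \<omega> in M. finite {i. ?h (X i \<omega>) (T i \<omega>) \<noteq> 1}" using fin by simp
    show "integrable lborel (\<lambda>t. indicator {0<..} t * (1 - (LINT x|P. ?h x t)))"
      using I(1) g0 gz \<delta> by (simp add: D)
    show "AE \<omega> in M. Y \<omega> = (\<Prod>i | ?h (X i \<omega>) (T i \<omega>) \<noteq> 1. ?h (X i \<omega>) (T i \<omega>))"
      using Y(2) fin by eventually_elim (simp add: exp_sum flip: sum_negf)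
  qed (use g0 Y in auto)
  also have "(LINT t|lborel. indicator {0<..} t * (1 - (LINT x|P. ?h x t))) = (\<integral>v. 1 - exp (- g v) \<partial>intensity P)"
    using I(2) g0 gz \<delta> by (simp add: D)
  finally show ?thesis .
qed

text \<open>A void probability: the factor is 0 as soon as a point leaves the box. The indicator
  jumps in \<open>t\<close> at \<open>wmax x w\<close> but is right continuous there, as
  \<open>marked_Laplace\<close> requires.\<close>

lemma prob_all_le:
  assumes x: "\<forall>j. 0 < x $ j" and Y: "Y \<in> borel_measurable M"
    "AE \<omega> in M. Y \<omega> = (if \<forall>i. X i \<omega> \<le> T i \<omega> *\<^sub>R x then 1 else 0)"
  shows "expectation Y = exp (- (\<integral>w. wmax x w \<partial>P))"
proof -
  interpret P: prob_space P by (rule prob_P)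
  let ?h = "\<lambda>w t. if w \<le> t *\<^sub>R x then 1 else 0 :: real"
  have le_iff: "(1 / t) *\<^sub>R w \<le> x \<longleftrightarrow> w \<le> t *\<^sub>R x" if "0 < t" for t w
    using that by (auto simp: less_eq_vec_def pos_divide_le_eq mult.commute)
  have h_eq: "(if w \<le> t *\<^sub>R x then 1 else 0 :: real) = (if wmax x w \<le> t then 1 else 0)" for w t
    by (simp add: wmax_le_iff[OF x])
  have [measurable]: "wmax x \<in> borel_measurable P" by simp
  \<comment> \<open>The largest cube inside the box; on it the indicator of the complement
    vanishes.\<close>
  define \<delta> where "\<delta> = Min (range (\<lambda>j. x $ j))"
  have \<delta>: "0 < \<delta>" "\<delta> \<le> x $ j" for j using x by (auto simp: \<delta>_def Min_gr_iff)
  have hI: "indicator {0<..} t * (1 - (LINT w|P. ?h w t)) = indicator {0<..} t * (\<integral>w. indicator (- {..x}) ((1 / t) *\<^sub>R w) \<partial>P)" for t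
  proof (cases "0 < t")
    case True
    have "(\<integral>w. indicator (- {..x}) ((1 / t) *\<^sub>R w) \<partial>P) = (\<integral>w. 1 - ?h w t \<partial>P)"
      by (intro Bochner_Integration.integral_cong) (auto simp: indicator_def le_iff[OF True])
    also have "\<dots> = 1 - (LINT w|P. ?h w t)"
    proof -
      have "integrable P (\<lambda>w. ?h w t)" unfolding h_eq by (rule P.integrable_const_bound[of _ 1]) auto
      then show ?thesis by (simp add: P.prob_space)
    qed
    finally show ?thesis by simp
  qed simp
  have small: "indicator (- {..x}) v = (0::real)" if "\<forall>j. v $ j \<le> \<delta>" for v
    using that \<delta>(2) by (auto simp: indicator_def less_eq_vec_def intro: order_trans)
  note I = integral_intensity[of "indicator (- {..x})" \<delta>]
  have "AE \<omega> in M. finite {i. T i \<omega> \<le> max 0 (wmax x (X i \<omega>))}"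
    using integrable_wmax[OF x] by (intro finite_points_below integrable_max) auto
  then have fin: "AE \<omega> in M. finite {i. ?h (X i \<omega>) (T i \<omega>) \<noteq> 1}"
    by eventually_elim (rule finite_subset[rotated], assumption, auto simp: wmax_le_iff[OF x, symmetric])
  have "expectation Y = exp (- (LINT t|lborel. indicator {0<..} t * (1 - (LINT w|P. ?h w t))))"
  proof (rule marked_Laplace[where h = ?h and Y = Y])
    show "(\<lambda>(w, t). ?h w t) \<in> borel_measurable (borel \<Otimes>\<^sub>M borel)"
      unfolding h_eq by measurable
    show "(\<lambda>n. LINT w|P. ?h w (s n)) \<longlonglongrightarrow> (LINT w|P. ?h w t)"
      if t: "0 < t" and s: "s \<longlonglongrightarrow> t" and le: "\<And>n. t \<le> s n" for t s
      unfolding h_eq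
    proof (rule integral_dominated_convergence[where w = "\<lambda>_. 1"])
      show "AE w in P. (\<lambda>n. if wmax x w \<le> s n then 1 else 0 :: real) \<longlonglongrightarrow> (if wmax x w \<le> t then 1 else 0)"
      proof (rule AE_I2)
        fix w
        show "(\<lambda>n. if wmax x w \<le> s n then 1 else 0 :: real) \<longlonglongrightarrow> (if wmax x w \<le> t then 1 else 0)"
        proof (cases "wmax x w \<le> t")
          case True
          then have "wmax x w \<le> s n" for n using le[of n] by simp
          then show ?thesis using True by simp
        next
          case False
          then have "\<forall>\<^sub>F n in sequentially. s n < wmax x w" by (intro order_tendstoD(2)[OF s]) simp
          then have "\<forall>\<^sub>F n in sequentially. (if wmax x w \<le> s n then 1 else 0 :: real) = 0"
            by eventually_elim simp
          then show ?thesis using False by (simp add: tendsto_eventually)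
        qed
      qed
    qed auto
    show "integrable lborel (\<lambda>t. indicator {0<..} t * (1 - (LINT w|P. ?h w t)))"
      unfolding hI using I(1) \<delta>(1) small by simp
    show "AE \<omega> in M. Y \<omega> = (\<Prod>i | ?h (X i \<omega>) (T i \<omega>) \<noteq> 1. ?h (X i \<omega>) (T i \<omega>))"
      using Y(2) fin
    proof eventually_elim
      case (elim \<omega>)
      show ?case
      proof (cases "\<forall>i. X i \<omega> \<le> T i \<omega> *\<^sub>R x")
        case False
        then obtain i where "\<not> X i \<omega> \<le> T i \<omega> *\<^sub>R x" by blast
        then have "(\<Prod>i | ?h (X i \<omega>) (T i \<omega>) \<noteq> 1. ?h (X i \<omega>) (T i \<omega>)) = 0"
          using elim(2) by (intro prod_zero) auto
        then show ?thesis using elim(1) False by simp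
      qed (use elim(1) in simp)
    qed
  qed (use fin Y in auto)
  also have "(LINT t|lborel. indicator {0<..} t * (1 - (LINT w|P. ?h w t))) = (\<integral>v. indicator (- {..x}) v \<partial>intensity P)"
    unfolding hI using I(2) \<delta>(1) small by simp
  also have "\<dots> = (\<integral>w. wmax x w \<partial>P)"
  proof -
    have "0 \<le> (\<integral>w. wmax x w \<partial>P)"
    proof (rule integral_nonneg_AE)
      show "AE w in P. 0 \<le> wmax x w"
        using P_nonneg
      proof eventually_elim
        case (elim w)
        then show ?case using wmax_attained[of x w] x by (auto simp: less_imp_le)
      qed
    qed
    then show ?thesis using emeasure_intensity[OF x] by (simp add: measure_def)
  qed
  finally show ?thesis .
qed

end

section \<open>Convergence of sample point processes\<close>

lemma prob_measure_eq_cdf: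
  fixes N N' :: "(real^'d) measure"
  assumes "prob_space N" "prob_space N'" and sets: "sets N = sets borel" "sets N' = sets borel"
    and eq: "\<And>x. measure N {..x} = measure N' {..x}"
  shows "N = N'"
proof (rule measure_eqI_generator_eq[where E = "range atMost" and \<Omega> = UNIV and A = "\<lambda>n::nat. {..\<chi> j. real n}"])
  interpret N: prob_space N by fact
  interpret N': prob_space N' by fact
  have "{..a} \<inter> {..b} = {..inf a b}" for a b :: "real^'d" by auto
  then show "Int_stable (range atMost :: (real^'d) set set)" by (auto simp: Int_stable_def)
  show "emeasure N X = emeasure N' X" if "X \<in> range atMost" for X
    using that eq by (auto simp: N.emeasure_eq_measure N'.emeasure_eq_measure)
  have b: "sets borel = sigma_sets UNIV (range atMost :: (real^'d) set set)"
    by (subst borel_eq_atMost) simp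
  show "sets N = sigma_sets UNIV (range atMost)" "sets N' = sigma_sets UNIV (range atMost)"
    using sets b by auto
  show "emeasure N {..\<chi> j. real n} \<noteq> \<infinity>" for n :: nat by (simp add: N.emeasure_eq_measure)
  show "(\<Union>n::nat. {..\<chi> j. real n}) = (UNIV :: (real^'d) set)"
  proof (rule set_eqI)
    fix v :: "real^'d"
    obtain n :: nat where n: "Max (range (\<lambda>j. v $ j)) \<le> real n" using real_arch_simple by blast
    have "v $ j \<le> real n" for j using n Max_ge[of "range (\<lambda>j. v $ j)" "v $ j"] by (auto intro: order_trans)
    then show "v \<in> (\<Union>n::nat. {..\<chi> j. real n}) \<longleftrightarrow> v \<in> UNIV" by (auto simp: less_eq_vec_def)
  qed
qed auto

definition moments :: "real^'d \<Rightarrow> real^'d \<Rightarrow> ereal^'d \<Rightarrow> real^'d"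
  where "moments \<gamma> \<sigma> r = (\<chi> j. moment_R (\<gamma> $ j) (\<sigma> $ j) (r $ j))"

lemma borel_measurable_moments [measurable]: "moments \<gamma> \<sigma> \<in> borel_measurable borel"
  unfolding moments_def[abs_def]
  by (intro borel_measurable_vec_lambda measurable_compose[OF _ borel_measurable_moment_R] borel_measurable_vec_nth) simp

lemma moments_nonneg: "0 \<le> moments \<gamma> \<sigma> r $ j"
  by (simp add: moments_def moment_R_nonneg)

lemma ray_law_moments:
  assumes L: "condition_R \<gamma> \<sigma> L"
  shows "ray_law (distr L borel (moments \<gamma> \<sigma>))"
proof -
  interpret L: prob_space L using L by (simp add: condition_R_def)
  have sets [measurable_cong]: "sets L = sets borel" using L by (simp add: condition_R_def)
  have [measurable]: "(\<lambda>w::real^'d. w $ j) \<in> borel_measurable borel" for j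
    by (intro borel_measurable_vec_nth) simp
  show ?thesis
  proof (rule ray_law.intro)
    show "prob_space (distr L borel (moments \<gamma> \<sigma>))" by (rule L.prob_space_distr) measurable
    show "AE w in distr L borel (moments \<gamma> \<sigma>). \<forall>j. 0 \<le> w $ j"
      by (subst AE_distr_iff) (auto simp: moments_nonneg)
    fix j
    have "(\<integral>\<^sup>+r. ennreal (moments \<gamma> \<sigma> r $ j) \<partial>L) < \<infinity>"
      using L by (simp add: condition_R_def moments_def)
    then have "integrable L (\<lambda>r. moments \<gamma> \<sigma> r $ j)"
      by (intro integrableI_nonneg) (auto simp: moments_nonneg)
    then show "integrable (distr L borel (moments \<gamma> \<sigma>)) (\<lambda>w. w $ j)"
      by (subst integrable_distr_eq) auto
  qed simp
qed

lemma ray_poisson_moments: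
  fixes R :: "nat \<Rightarrow> 'v \<Rightarrow> ereal^'d"
  assumes L: "condition_R \<gamma> \<sigma> L" and lim: "limit_ingredients L M R T"
  shows "ray_poisson M (distr L borel (moments \<gamma> \<sigma>)) (\<lambda>i \<omega>. moments \<gamma> \<sigma> (R i \<omega>)) T"
proof -
  interpret ray_law "distr L borel (moments \<gamma> \<sigma>)" by (rule ray_law_moments[OF L])
  interpret M: prob_space M using lim by (simp add: limit_ingredients_def)
  have ind: "M.indep_vars (\<lambda>_. borel) R UNIV" and d: "\<And>i. distr M borel (R i) = L"
    and T: "unit_poisson_points M T"
    and RT: "M.indep_set (sets (vimage_algebra (space M) (\<lambda>\<omega> i. R i \<omega>) (\<Pi>\<^sub>M i\<in>UNIV. borel)))
      (sets (vimage_algebra (space M) (\<lambda>\<omega> i. T i \<omega>) (\<Pi>\<^sub>M i\<in>UNIV. borel)))"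
    using lim by (auto simp: limit_ingredients_def)
  have [measurable]: "R i \<in> borel_measurable M" for i using ind by (auto simp: M.indep_vars_def)
  show ?thesis
  proof
    show "M.indep_vars (\<lambda>_. borel) (\<lambda>i \<omega>. moments \<gamma> \<sigma> (R i \<omega>)) UNIV"
      by (rule M.indep_vars_compose2[OF ind]) measurable
    show "distr M borel (\<lambda>\<omega>. moments \<gamma> \<sigma> (R i \<omega>)) = distr L borel (moments \<gamma> \<sigma>)" for i
      by (subst d[of i, symmetric], subst distr_distr) (auto simp: o_def)
    show "unit_poisson_points M T" by (rule T)
    let ?A = "sets (vimage_algebra (space M) (\<lambda>\<omega> i. R i \<omega>) (\<Pi>\<^sub>M i\<in>UNIV. borel))"
    let ?A' = "sets (vimage_algebra (space M) (\<lambda>\<omega> i. moments \<gamma> \<sigma> (R i \<omega>)) (\<Pi>\<^sub>M i\<in>UNIV. borel))"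
    \<comment> \<open>The moment vectors are measurable functions of the \<open>R i\<close>, so they
      generate a smaller sigma-algebra and inherit the independence of the arrival times.\<close>
    have "?A' \<subseteq> ?A"
    proof
      fix B assume "B \<in> ?A'"
      then obtain C where C: "C \<in> sets (\<Pi>\<^sub>M i\<in>(UNIV::nat set). (borel :: (real^'d) measure))"
        "B = (\<lambda>\<omega> i. moments \<gamma> \<sigma> (R i \<omega>)) -` C \<inter> space M"
        by (subst (asm) sets_vimage_algebra2) (auto simp: space_PiM)
      have m: "(\<lambda>r i. moments \<gamma> \<sigma> (r i)) \<in> measurable (\<Pi>\<^sub>M i\<in>(UNIV::nat set). (borel :: (ereal^'d) measure)) (\<Pi>\<^sub>M i\<in>UNIV. borel)"
        by (rule measurable_PiM_single') auto
      define D where "D = (\<lambda>r i. moments \<gamma> \<sigma> (r i)) -` C \<inter> space (\<Pi>\<^sub>M i\<in>(UNIV::nat set). (borel :: (ereal^'d) measure))"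
      have "D \<in> sets (\<Pi>\<^sub>M i\<in>(UNIV::nat set). (borel :: (ereal^'d) measure))"
        unfolding D_def by (rule measurable_sets[OF m C(1)])
      then have "(\<lambda>\<omega> i. R i \<omega>) -` D \<inter> space M \<in> ?A" by (rule in_vimage_algebra)
      moreover have "B = (\<lambda>\<omega> i. R i \<omega>) -` D \<inter> space M" by (auto simp: C(2) D_def space_PiM)
      ultimately show "B \<in> ?A" by simp
    qed
    then show "M.indep_set ?A' (sets (vimage_algebra (space M) (\<lambda>\<omega> i. T i \<omega>) (\<Pi>\<^sub>M i\<in>UNIV. borel)))"
      using RT unfolding M.indep_sets2_eq by blast
    show "0 \<le> moments \<gamma> \<sigma> (R i \<omega>) $ j" for i \<omega> j by (rule moments_nonneg)
  qed
qed

context state_params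
begin

lemma limit_point_eq:
  assumes "\<forall>j. r $ j \<in> range_R (\<gamma> $ j)" "0 < t"
  shows "limit_point \<gamma> \<sigma> r t = vunstd \<gamma> \<sigma> ((1 / t) *\<^sub>R moments \<gamma> \<sigma> r)"
  using limit_coordinate[OF \<sigma>_pos assms(2) assms(1)[rule_format]]
  by (simp add: limit_point_def vunstd_def moments_def vec_eq_iff)

end

locale limit_process = state_params \<gamma> \<sigma> for \<gamma> \<sigma> :: "real^'d" +
  fixes L :: "(ereal^'d) measure" and M :: "'v measure" and R T
  assumes L: "condition_R \<gamma> \<sigma> L" and ingredients: "limit_ingredients L M R T"
begin

sublocale ray_poisson M "distr L borel (moments \<gamma> \<sigma>)" "\<lambda>i \<omega>. moments \<gamma> \<sigma> (R i \<omega>)" T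
  by (rule ray_poisson_moments[OF L ingredients])

abbreviation ray :: "nat \<Rightarrow> 'v \<Rightarrow> real^'d"
  where "ray i \<omega> \<equiv> (1 / T i \<omega>) *\<^sub>R moments \<gamma> \<sigma> (R i \<omega>)"

lemma measurable_R [measurable]: "R i \<in> borel_measurable M"
  using ingredients by (auto simp: limit_ingredients_def indep_vars_def)

lemma limit_points: "AE \<omega> in M. \<forall>i. 0 < T i \<omega> \<and> limit_point \<gamma> \<sigma> (R i \<omega>) (T i \<omega>) = vunstd \<gamma> \<sigma> (ray i \<omega>)"
proof -
  have "AE \<omega> in M. \<forall>j. R i \<omega> $ j \<in> range_R (\<gamma> $ j)" for i
  proof -
    have "AE r in distr M borel (R i). \<forall>j. r $ j \<in> range_R (\<gamma> $ j)"
      using L ingredients by (auto simp: condition_R_def limit_ingredients_def AE_all_countable)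
    then show ?thesis by (intro AE_distrD[of "R i" M borel]) auto
  qed
  then have "AE \<omega> in M. \<forall>i. \<forall>j. R i \<omega> $ j \<in> range_R (\<gamma> $ j)" by (simp add: AE_all_countable)
  then show ?thesis using T_pos by eventually_elim (simp add: limit_point_eq)
qed

lemma measurable_limit_point [measurable]: "(\<lambda>\<omega>. limit_point \<gamma> \<sigma> (R i \<omega>) (T i \<omega>)) \<in> borel_measurable M"
proof -
  have [measurable]: "(\<lambda>\<omega>. R i \<omega> $ j) \<in> borel_measurable M" for j
    by (intro borel_measurable_vec_nth) simp
  show ?thesis unfolding limit_point_def by (intro borel_measurable_vec_lambda) measurable
qed

lemma ray_nonneg: "0 < T i \<omega> \<Longrightarrow> 0 \<le> ray i \<omega> $ j"
  using moments_nonneg[of \<gamma> \<sigma> "R i \<omega>" j] by simp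

lemma random_element_limit_pp: "random_element (vague_topology S) M (limit_pp \<gamma> \<sigma> R T)"
  unfolding limit_pp_def[abs_def]
proof (rule random_element_dirac_sum)
  show "AE \<omega> in M. dirac_sum S UNIV (\<lambda>i. limit_point \<gamma> \<sigma> (R i \<omega>) (T i \<omega>)) \<in> point_measures S"
    using limit_points finite_large_points
  proof eventually_elim
    case (elim \<omega>)
    show ?case
      unfolding dirac_sum_in_point_measures_iff
    proof
      fix m
      have "{i \<in> UNIV. limit_point \<gamma> \<sigma> (R i \<omega>) (T i \<omega>) \<in> KK m} \<subseteq> {i. 1 / real (Suc m) \<le> total (ray i \<omega>)}"
        using elim(1) vstd_vunstd ray_nonneg by (auto simp: KK_def shell_def)
      moreover from elim(2) have "finite {i. 1 / real (Suc m) \<le> total (ray i \<omega>)}" by (rule spec)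
      ultimately show "finite {i \<in> UNIV. limit_point \<gamma> \<sigma> (R i \<omega>) (T i \<omega>) \<in> KK m}"
        by (rule finite_subset)
    qed
  qed
qed measurable

lemma Laplace_limit_pp:
  assumes f: "f \<in> test_functions S"
  shows "(LINT \<omega>|M. (if limit_pp \<gamma> \<sigma> R T \<omega> \<in> point_measures S then exp (- (\<integral>y. f y \<partial>limit_pp \<gamma> \<sigma> R T \<omega>)) else 0))
    = exp (- (\<integral>v. 1 - exp (- orthant_extension f v) \<partial>intensity (distr L borel (moments \<gamma> \<sigma>))))"
proof -
  let ?g = "orthant_extension f"
  obtain m where m: "\<And>v. ?g v \<noteq> 0 \<Longrightarrow> v \<in> shell m" using orthant_extension_support[OF f] by blast
  show ?thesis
  proof (rule Laplace_limit[of ?g m])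
    have "continuous_map euclideanreal euclideanreal (\<lambda>x. exp (- x :: real))" by (simp add: continuous_intros)
    from continuous_map_compose[OF continuous_map_vague_integral[OF f] this]
    have "continuous_map (vague_topology S) euclideanreal (\<lambda>\<mu>. exp (- (\<integral>y. f y \<partial>\<mu>)))" by (simp add: o_def)
    from random_element_measurable[OF random_element_limit_pp this]
    show "(\<lambda>\<omega>. if limit_pp \<gamma> \<sigma> R T \<omega> \<in> point_measures S then exp (- (\<integral>y. f y \<partial>limit_pp \<gamma> \<sigma> R T \<omega>)) else 0) \<in> borel_measurable M"
      by (simp add: topspace_vague_topology)
    have "AE \<omega> in M. limit_pp \<gamma> \<sigma> R T \<omega> \<in> point_measures S"
      using random_element_limit_pp by (simp add: random_element_def topspace_vague_topology)
    then show "AE \<omega> in M. (if limit_pp \<gamma> \<sigma> R T \<omega> \<in> point_measures S then exp (- (\<integral>y. f y \<partial>limit_pp \<gamma> \<sigma> R T \<omega>)) else 0)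
        = exp (- (\<Sum>i | ?g (ray i \<omega>) \<noteq> 0. ?g (ray i \<omega>)))"
      using limit_points finite_large_points
    proof eventually_elim
      case (elim \<omega>)
      let ?x = "\<lambda>i. limit_point \<gamma> \<sigma> (R i \<omega>) (T i \<omega>)"
      have g: "?g (ray i \<omega>) = (if ?x i \<in> S then f (?x i) else 0)" for i
        using elim(2) ray_nonneg[of i \<omega>] vunstd_mem_iff[of "ray i \<omega>"] unfolding orthant_extension_def by auto
      then have set_eq: "{i \<in> UNIV. ?x i \<in> S \<and> f (?x i) \<noteq> 0} = {i. ?g (ray i \<omega>) \<noteq> 0}" by auto
      have "{i. ?g (ray i \<omega>) \<noteq> 0} \<subseteq> {i. 1 / real (Suc m) \<le> total (ray i \<omega>)}"
        using m by (auto simp: shell_def)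
      moreover from elim(3) have "finite {i. 1 / real (Suc m) \<le> total (ray i \<omega>)}" by (rule spec)
      ultimately have fin: "finite {i. ?g (ray i \<omega>) \<noteq> 0}" by (rule finite_subset)
      have fc: "continuous_on S f" using f by (simp add: test_functions_def)
      have "(\<integral>y. f y \<partial>limit_pp \<gamma> \<sigma> R T \<omega>) = (\<Sum>i | i \<in> UNIV \<and> ?x i \<in> S \<and> f (?x i) \<noteq> 0. f (?x i))"
        unfolding limit_pp_def by (rule integral_dirac_sum[OF S_borel fc]) (use fin set_eq in simp)
      also have "\<dots> = (\<Sum>i | ?g (ray i \<omega>) \<noteq> 0. ?g (ray i \<omega>))"
        using g by (intro sum.cong) auto
      finally show ?case using elim(1) by simp
    qed
  qed (use orthant_extension_nonneg[OF f] continuous_on_orthant_extension[OF f]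
      borel_measurable_orthant_extension[OF f] m in \<open>auto simp: shell_def\<close>)
qed

end

section \<open>Standardized observations\<close>

definition vreal_unstd :: "real^'d \<Rightarrow> real^'d \<Rightarrow> real^'d \<Rightarrow> real^'d"
  where "vreal_unstd \<gamma> \<sigma> z = (\<chi> j. real_unstd (\<gamma> $ j) (\<sigma> $ j) (z $ j))"

context state_params
begin

definition sample_point :: "real^'d \<Rightarrow> real^'d \<Rightarrow> real^'d \<Rightarrow> ereal^'d"
  where "sample_point a b x = raise_to (lower_endpoint \<gamma> \<sigma>) (normalized a b x)"

definition in_range :: "ereal^'d \<Rightarrow> bool"
  where "in_range y \<longleftrightarrow> (\<forall>j. y $ j \<in> state_interval (\<gamma> $ j) (\<sigma> $ j))"

text \<open>Observations beyond an upper endpoint are not counted by the sample process. They are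
  represented by the origin.\<close>

definition obs :: "real^'d \<Rightarrow> real^'d \<Rightarrow> real^'d \<Rightarrow> real^'d"
  where "obs a b x = (if in_range (sample_point a b x) then vstd \<gamma> \<sigma> (sample_point a b x) else 0)"

lemma measurable_sample_point [measurable]: "sample_point a b \<in> borel_measurable borel"
proof -
  have [measurable]: "(\<lambda>x::real^'d. x $ j) \<in> borel_measurable borel" for j
    by (intro borel_measurable_vec_nth) simp
  show ?thesis unfolding sample_point_def[abs_def] raise_to_def normalized_def
    by (intro borel_measurable_vec_lambda) simp
qed

lemma measurable_obs [measurable]: "obs a b \<in> borel_measurable borel"
proof -
  have [measurable]: "(\<lambda>x. sample_point a b x $ j) \<in> borel_measurable borel" for j
    by (intro borel_measurable_vec_nth) simp
  have [measurable]: "state_interval g s \<in> sets borel" for g s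
    by (simp add: state_interval_def)
  show ?thesis unfolding obs_def[abs_def] in_range_def by measurable
qed

lemma obs_nonneg: "0 \<le> obs a b x $ j"
  by (simp add: obs_def vstd_nonneg)

text \<open>An interior corner lies above the lower endpoint in each coordinate, so raising an
  observation to that endpoint does not change the comparison. The distribution function at corners
  thus describes the raised observations.\<close>

lemma sample_point_le_iff:
  assumes a: "\<forall>j. 0 < a $ j" and z: "\<forall>j. 0 < z $ j"
  shows "(\<forall>j. sample_point a b x $ j \<le> unstd (\<gamma> $ j) (\<sigma> $ j) (z $ j)) \<longleftrightarrow> x \<le> a * vreal_unstd \<gamma> \<sigma> z + b"
proof -
  have "sample_point a b x $ j \<le> unstd (\<gamma> $ j) (\<sigma> $ j) (z $ j) \<longleftrightarrow> x $ j \<le> (a * vreal_unstd \<gamma> \<sigma> z + b) $ j" for j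
  proof -
    have "lower_endpoint \<gamma> \<sigma> $ j \<le> unstd (\<gamma> $ j) (\<sigma> $ j) (z $ j)"
      unfolding lower_endpoint_eq vunstd_def using unstd_le_iff[OF \<sigma>_pos[of j], of 0 "z $ j" "\<gamma> $ j"] z
      by (simp add: less_imp_le)
    then have "sample_point a b x $ j \<le> unstd (\<gamma> $ j) (\<sigma> $ j) (z $ j)
        \<longleftrightarrow> (x $ j - b $ j) / a $ j \<le> real_unstd (\<gamma> $ j) (\<sigma> $ j) (z $ j)"
      using z by (simp add: sample_point_def raise_to_def normalized_def unstd_pos)
    also have "\<dots> \<longleftrightarrow> x $ j \<le> (a * vreal_unstd \<gamma> \<sigma> z + b) $ j"
      using a by (simp add: vreal_unstd_def pos_divide_le_eq algebra_simps)
    finally show ?thesis .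
  qed
  then show ?thesis by (simp add: less_eq_vec_def)
qed

lemma sample_point_ge: "lower_endpoint \<gamma> \<sigma> $ j \<le> sample_point a b x $ j"
  by (simp add: sample_point_def raise_to_def)

lemma in_rangeI:
  assumes "\<forall>j. 0 < a $ j" "\<forall>j. 0 < z $ j" "x \<le> a * vreal_unstd \<gamma> \<sigma> z + b"
  shows "in_range (sample_point a b x)"
  unfolding in_range_def
proof
  fix j
  have le: "sample_point a b x $ j \<le> unstd (\<gamma> $ j) (\<sigma> $ j) (z $ j)"
    using sample_point_le_iff[OF assms(1,2)] assms(3) by blast
  have ge: "unstd (\<gamma> $ j) (\<sigma> $ j) 0 \<le> sample_point a b x $ j"
    using sample_point_ge[of j a b x] by (simp add: lower_endpoint_eq vunstd_def)
  have "unstd (\<gamma> $ j) (\<sigma> $ j) 0 \<in> state_interval (\<gamma> $ j) (\<sigma> $ j)"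
    "unstd (\<gamma> $ j) (\<sigma> $ j) (z $ j) \<in> state_interval (\<gamma> $ j) (\<sigma> $ j)"
    using assms(2) by (auto intro: unstd_mem simp: less_imp_le)
  then show "sample_point a b x $ j \<in> state_interval (\<gamma> $ j) (\<sigma> $ j)"
    using le ge unfolding state_interval_def by (auto split: if_splits)
qed

lemma obs_le_iff:
  assumes a: "\<forall>j. 0 < a $ j" and z: "\<forall>j. 0 < z $ j"
  shows "obs a b x \<le> z \<longleftrightarrow> x \<le> a * vreal_unstd \<gamma> \<sigma> z + b \<or> \<not> in_range (sample_point a b x)"
proof (cases "in_range (sample_point a b x)")
  case True
  have "std (\<gamma> $ j) (\<sigma> $ j) (sample_point a b x $ j) \<le> z $ j
      \<longleftrightarrow> sample_point a b x $ j \<le> unstd (\<gamma> $ j) (\<sigma> $ j) (z $ j)" for j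
    using unstd_le_iff[OF \<sigma>_pos[of j] std_nonneg, of "z $ j" "\<gamma> $ j" "\<gamma> $ j" "\<sigma> $ j" "sample_point a b x $ j"]
      unstd_std[OF \<sigma>_pos[of j]] True z by (simp add: in_range_def less_imp_le)
  then have "obs a b x \<le> z \<longleftrightarrow> (\<forall>j. sample_point a b x $ j \<le> unstd (\<gamma> $ j) (\<sigma> $ j) (z $ j))"
    using True by (simp add: obs_def vstd_def less_eq_vec_def)
  then show ?thesis using True sample_point_le_iff[OF a z] by simp
next
  case False
  then show ?thesis using z by (simp add: obs_def less_eq_vec_def less_imp_le)
qed

lemma orthant_extension_obs:
  "orthant_extension f (obs a b x) = (if sample_point a b x \<in> S then f (sample_point a b x) else 0)"
proof (cases "sample_point a b x \<in> S")
  case True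
  then have "in_range (sample_point a b x)" using state_space_interval by (simp add: in_range_def)
  then have "obs a b x = vstd \<gamma> \<sigma> (sample_point a b x)" by (simp add: obs_def)
  then show ?thesis using True vstd_mem[OF True] vunstd_vstd_S[OF True] by (simp add: orthant_extension_def)
next
  case False
  have "obs a b x = 0"
  proof (cases "in_range (sample_point a b x)")
    case True
    then have "sample_point a b x = vunstd \<gamma> \<sigma> 0"
      using False unfolding state_space_def in_range_def lower_endpoint_eq by auto
    then have "vstd \<gamma> \<sigma> (sample_point a b x) = 0" using vstd_vunstd[of 0] by simp
    then show ?thesis by (simp add: obs_def)
  qed (simp add: obs_def)
  then show ?thesis using False by (simp add: orthant_extension_def)
qed

lemma sample_pp_eq: "sample_pp \<gamma> \<sigma> a b X n = (\<lambda>\<omega>. dirac_sum S {..<n} (\<lambda>i. sample_point (a n) (b n) (X i \<omega>)))"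
  by (auto simp: sample_pp_def sample_point_def fun_eq_iff)

lemma random_element_finite_sum:
  assumes "\<And>i. x i \<in> borel_measurable M"
  shows "random_element (vague_topology S) M (\<lambda>\<omega>. dirac_sum S {..<n::nat} (\<lambda>i. x i \<omega>))"
  by (rule random_element_dirac_sum) (use assms in \<open>auto simp: dirac_sum_in_point_measures_iff\<close>)

lemma integral_sample_pp:
  assumes f: "f \<in> test_functions S"
  shows "(\<integral>y. f y \<partial>sample_pp \<gamma> \<sigma> a b X n \<omega>) = (\<Sum>i<n. orthant_extension f (obs (a n) (b n) (X i \<omega>)))"
proof -
  let ?x = "\<lambda>i. sample_point (a n) (b n) (X i \<omega>)"
  have fc: "continuous_on S f" using f by (simp add: test_functions_def)
  have "(\<integral>y. f y \<partial>sample_pp \<gamma> \<sigma> a b X n \<omega>) = (\<Sum>i | i \<in> {..<n} \<and> ?x i \<in> S \<and> f (?x i) \<noteq> 0. f (?x i))"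
    unfolding sample_pp_eq by (rule integral_dirac_sum[OF S_borel fc]) simp
  also have "\<dots> = (\<Sum>i<n. orthant_extension f (obs (a n) (b n) (X i \<omega>)))"
    unfolding orthant_extension_obs by (rule sum.mono_neutral_cong_left) auto
  finally show ?thesis .
qed

end

context limit_process
begin

text \<open>Only the limits of \<open>F ^ n\<close> at interior corners enter, which is why both
  halves of the theorem reduce to this statement.\<close>

theorem sample_pp_converges:
  fixes X :: "nat \<Rightarrow> 'w \<Rightarrow> real^'d" and MX :: "'w measure"
  assumes iid: "iid_with_cdf MX X F" and a: "\<forall>n\<ge>1. \<forall>j. 0 < a n $ j"
    and lim: "\<And>z. \<forall>j. 0 < z $ j \<Longrightarrow>
      (\<lambda>n. F (a n * vreal_unstd \<gamma> \<sigma> z + b n) ^ n) \<longlonglongrightarrow> exp (- (\<integral>w. wmax z w \<partial>distr L borel (moments \<gamma> \<sigma>)))"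
  shows "converges_weakly (vague_topology S) MX (sample_pp \<gamma> \<sigma> a b X) M (limit_pp \<gamma> \<sigma> R T)"
proof -
  interpret MX: prob_space MX using iid by (simp add: iid_with_cdf_def)
  let ?P = "distr L borel (moments \<gamma> \<sigma>)"
  have ind: "MX.indep_vars (\<lambda>_. borel) X UNIV" and F: "\<And>i x. MX.prob {\<omega> \<in> space MX. X i \<omega> \<le> x} = F x"
    using iid by (auto simp: iid_with_cdf_def)
  have X [measurable]: "X i \<in> borel_measurable MX" for i using ind by (auto simp: MX.indep_vars_def)
  have law: "distr MX borel (X i) = distr MX borel (X 0)" for i
  proof (rule prob_measure_eq_cdf)
    show "measure (distr MX borel (X i)) {..x} = measure (distr MX borel (X 0)) {..x}" for x
    proof -
      have "measure (distr MX borel (X k)) {..x} = F x" for k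
        unfolding F[of k x, symmetric] by (subst measure_distr) (auto intro!: arg_cong[where f = MX.prob])
      then show ?thesis by simp
    qed
  qed (auto intro: MX.prob_space_distr)
  define V where "V z = (\<integral>w. wmax z w \<partial>?P)" for z
  define p where "p z n = F (a n * vreal_unstd \<gamma> \<sigma> z + b n)" for z n
  have p_lim: "(\<lambda>n. real n * (1 - p z n)) \<longlonglongrightarrow> V z" if z: "\<forall>j. 0 < z $ j" for z
  proof (rule power_tendsto_exp_imp)
    show "0 \<le> p z n" "p z n \<le> 1" for n unfolding p_def F[of 0, symmetric] by auto
    show "(\<lambda>n. p z n ^ n) \<longlonglongrightarrow> exp (- V z)" using lim[OF z] by (simp add: p_def V_def)
  qed
  \<comment> \<open>This may be smaller than \<open>1 - p z n\<close>, because observations beyond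
    an upper endpoint are represented by the origin and count as lying in every box.\<close>
  define far where "far z n = MX.prob {\<omega> \<in> space MX. \<not> obs (a n) (b n) (X 0 \<omega>) \<le> z}" for z n
  have compl: "MX.prob {\<omega> \<in> space MX. \<not> X 0 \<omega> \<le> x} = 1 - F x" for x
    unfolding F[of 0 x, symmetric]
    by (subst MX.prob_compl[symmetric]) (auto intro!: arg_cong[where f = MX.prob])
  \<comment> \<open>The defect is the probability of leaving the range at an upper endpoint. Such an
    observation lies below no corner, so for every \<open>y\<close> its probability is at most
    \<open>1 - p y n\<close>.\<close>
  have far_le: "far z n \<le> 1 - p z n" and far_ge: "1 - p z n \<le> far z n + (1 - p y n)"
    if n: "1 \<le> n" and z: "\<forall>j. 0 < z $ j" and y: "\<forall>j. 0 < y $ j" for n z y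
  proof -
    have an: "\<forall>j. 0 < a n $ j" using a n by blast
    have 1: "\<not> obs (a n) (b n) (X 0 \<omega>) \<le> z \<Longrightarrow> \<not> X 0 \<omega> \<le> a n * vreal_unstd \<gamma> \<sigma> z + b n" for \<omega>
      using obs_le_iff[OF an z] by blast
    show "far z n \<le> 1 - p z n"
      unfolding far_def p_def compl[symmetric] by (rule MX.finite_measure_mono) (use 1 in auto)
    have "{\<omega> \<in> space MX. \<not> X 0 \<omega> \<le> a n * vreal_unstd \<gamma> \<sigma> z + b n}
        \<subseteq> {\<omega> \<in> space MX. \<not> obs (a n) (b n) (X 0 \<omega>) \<le> z} \<union> {\<omega> \<in> space MX. \<not> X 0 \<omega> \<le> a n * vreal_unstd \<gamma> \<sigma> y + b n}"
      using obs_le_iff[OF an z] in_rangeI[OF an y] by blast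
    then have "1 - p z n \<le> MX.prob ({\<omega> \<in> space MX. \<not> obs (a n) (b n) (X 0 \<omega>) \<le> z} \<union> {\<omega> \<in> space MX. \<not> X 0 \<omega> \<le> a n * vreal_unstd \<gamma> \<sigma> y + b n})"
      unfolding p_def compl[symmetric] by (intro MX.finite_measure_mono) auto
    also have "\<dots> \<le> far z n + (1 - p y n)"
      unfolding far_def p_def compl[symmetric] by (rule measure_Un_le) auto
    finally show "1 - p z n \<le> far z n + (1 - p y n)" .
  qed
  have far_lim: "(\<lambda>n. real n * far z n) \<longlonglongrightarrow> V z" if z: "\<forall>j. 0 < z $ j" for z
  proof (rule LIMSEQ_I)
    fix r :: real assume r: "r > 0"
    have V_scale: "V (real (Suc m) *\<^sub>R 1) = V 1 / real (Suc m)" for m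
    proof -
      have "wmax (real (Suc m) *\<^sub>R 1) w = wmax 1 w / real (Suc m)" for w :: "real^'d"
      proof -
        have "wmax (real (Suc m) *\<^sub>R 1) w = wmax 1 ((1 / real (Suc m)) *\<^sub>R w)" by (simp add: wmax_def)
        then show ?thesis by (subst (asm) wmax_scaleR) auto
      qed
      then have "wmax (real (Suc m) *\<^sub>R 1) = (\<lambda>w::real^'d. wmax 1 w / real (Suc m))" by (rule ext)
      then show ?thesis unfolding V_def by simp
    qed
    obtain m :: nat where m: "2 * V 1 / r < real m" using reals_Archimedean2 by blast
    \<comment> \<open>At this corner \<open>V y = V 1 / Suc m\<close> is below \<open>r / 2\<close>,
      so the expected number of observations beyond an upper endpoint is eventually below
      \<open>r / 2\<close>.\<close>
    define y where "y = real (Suc m) *\<^sub>R (1 :: real^'d)"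
    have y: "\<forall>j. 0 < y $ j" by (simp add: y_def)
    have "2 * V 1 / r < real (Suc m)" using m by simp
    then have "V y < r / 2" using r unfolding y_def V_scale by (simp add: field_simps del: of_nat_Suc)
    then have e1: "\<forall>\<^sub>F n in sequentially. real n * (1 - p y n) < r / 2"
      by (rule order_tendstoD(2)[OF p_lim[OF y]])
    have e2: "\<forall>\<^sub>F n in sequentially. \<bar>real n * (1 - p z n) - V z\<bar> < r / 2"
      using tendstoD[OF p_lim[OF z], of "r / 2"] r by (simp add: dist_real_def)
    from e1 e2 eventually_ge_at_top[of 1]
    have "\<forall>\<^sub>F n in sequentially. norm (real n * far z n - V z) < r"
    proof eventually_elim
      case (elim n)
      have "real n * far z n \<le> real n * (1 - p z n)" using far_le[OF elim(3) z y] by (intro mult_left_mono) auto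
      moreover have "real n * (1 - p z n) \<le> real n * (far z n + (1 - p y n))"
        using far_ge[OF elim(3) z y] by (intro mult_left_mono) auto
      ultimately show ?case using elim(1,2) unfolding real_norm_def distrib_left by linarith
    qed
    then show "\<exists>no. \<forall>n\<ge>no. norm (real n * far z n - V z) < r" by (simp add: eventually_sequentially)
  qed
  define \<mu> where "\<mu> n = density (distr MX borel (\<lambda>\<omega>. obs (a n) (b n) (X 0 \<omega>))) (\<lambda>_. ennreal (real n))" for n
  have \<mu>_em: "emeasure (\<mu> n) (- {..z}) = ennreal (real n * far z n)" for n z
  proof -
    have eq: "(\<lambda>\<omega>. obs (a n) (b n) (X 0 \<omega>)) -` (- {..z}) \<inter> space MX = {\<omega> \<in> space MX. \<not> obs (a n) (b n) (X 0 \<omega>) \<le> z}"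
      by auto
    have "emeasure (\<mu> n) (- {..z}) = ennreal (real n) * emeasure (distr MX borel (\<lambda>\<omega>. obs (a n) (b n) (X 0 \<omega>))) (- {..z})"
      unfolding \<mu>_def by (rule emeasure_density_const) simp
    also have "emeasure (distr MX borel (\<lambda>\<omega>. obs (a n) (b n) (X 0 \<omega>))) (- {..z}) = ennreal (far z n)"
      by (subst emeasure_distr) (auto simp: eq MX.emeasure_eq_measure far_def)
    also have "ennreal (real n) * ennreal (far z n) = ennreal (real n * far z n)"
      by (simp add: ennreal_mult far_def)
    finally show ?thesis .
  qed
  have far_nonneg: "0 \<le> far z n" for z n by (simp add: far_def)
  have \<mu>_m: "measure (\<mu> n) (- {..z}) = real n * far z n" for n z
    unfolding measure_def \<mu>_em by (simp add: far_nonneg)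
  have V_nonneg: "0 \<le> V z" if z: "\<forall>j. 0 < z $ j" for z
    by (rule LIMSEQ_le_const[OF far_lim[OF z]]) (auto simp: far_nonneg)
  have \<nu>_m: "measure (intensity ?P) (- {..z}) = V z" if z: "\<forall>j. 0 < z $ j" for z
    using V_nonneg[OF z] unfolding measure_def emeasure_intensity[OF z] V_def by simp
  show ?thesis
  proof (rule Laplace_imp_converges_weakly[OF MX.prob_space_axioms prob_space_axioms _ random_element_limit_pp])
    show "random_element (vague_topology S) MX (sample_pp \<gamma> \<sigma> a b X n)" for n
      unfolding sample_pp_eq by (rule random_element_finite_sum) measurable
    fix f assume f: "f \<in> test_functions S"
    let ?g = "orthant_extension f"
    let ?q = "\<lambda>v. 1 - exp (- ?g v)"
    note g_nonneg = orthant_extension_nonneg[OF f]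
    have g_m [measurable]: "?g \<in> borel_measurable borel" by (rule borel_measurable_orthant_extension[OF f])
    obtain m where m: "\<And>v. ?g v \<noteq> 0 \<Longrightarrow> v \<in> shell m" using orthant_extension_support[OF f] by blast
    have PM: "sample_pp \<gamma> \<sigma> a b X n \<omega> \<in> point_measures S" for n \<omega>
      by (simp add: sample_pp_eq dirac_sum_in_point_measures_iff)
    define A where "A n = (\<integral>v. ?q v \<partial>\<mu> n)" for n
    have A_eq: "A n = real n * MX.expectation (\<lambda>\<omega>. ?q (obs (a n) (b n) (X 0 \<omega>)))" for n
    proof -
      have "A n = (\<integral>v. real n *\<^sub>R ?q v \<partial>distr MX borel (\<lambda>\<omega>. obs (a n) (b n) (X 0 \<omega>)))"
        unfolding A_def \<mu>_def by (rule integral_density) auto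
      also have "\<dots> = MX.expectation (\<lambda>\<omega>. real n *\<^sub>R ?q (obs (a n) (b n) (X 0 \<omega>)))"
        by (rule integral_distr) auto
      finally show ?thesis by simp
    qed
    have int: "integrable MX (\<lambda>\<omega>. exp (- ?g (obs (a n) (b n) (X i \<omega>))))" for n i
      by (rule MX.integrable_const_bound[of _ 1]) (use g_nonneg in auto)
    have "MX.expectation (\<lambda>\<omega>. exp (- (\<integral>y. f y \<partial>sample_pp \<gamma> \<sigma> a b X n \<omega>))) = (1 - A n / real n) ^ n" for n
    proof (cases "n = 0")
      case True
      then show ?thesis by (simp add: integral_sample_pp[OF f] MX.prob_space)
    next
      case False
      have "MX.expectation (\<lambda>\<omega>. exp (- (\<integral>y. f y \<partial>sample_pp \<gamma> \<sigma> a b X n \<omega>)))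
          = MX.expectation (\<lambda>\<omega>. \<Prod>i<n. exp (- ?g (obs (a n) (b n) (X i \<omega>))))"
        unfolding integral_sample_pp[OF f] by (simp add: exp_sum flip: sum_negf)
      also have "\<dots> = (\<Prod>i<n. MX.expectation (\<lambda>\<omega>. exp (- ?g (obs (a n) (b n) (X i \<omega>)))))"
      proof (rule MX.indep_vars_lebesgue_integral)
        show "MX.indep_vars (\<lambda>_. borel) (\<lambda>i \<omega>. exp (- ?g (obs (a n) (b n) (X i \<omega>)))) {..<n}"
          by (rule MX.indep_vars_compose2[OF MX.indep_vars_subset[OF ind]]) auto
      qed (use int in auto)
      also have "\<dots> = (\<Prod>i<n. MX.expectation (\<lambda>\<omega>. exp (- ?g (obs (a n) (b n) (X 0 \<omega>)))))"
      proof (rule prod.cong)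
        fix i
        have eq: "MX.expectation (\<lambda>\<omega>. exp (- ?g (obs (a n) (b n) (X k \<omega>)))) = (\<integral>x. exp (- ?g (obs (a n) (b n) x)) \<partial>distr MX borel (X k))" for k
          by (rule integral_distr[symmetric]) auto
        show "MX.expectation (\<lambda>\<omega>. exp (- ?g (obs (a n) (b n) (X i \<omega>)))) = MX.expectation (\<lambda>\<omega>. exp (- ?g (obs (a n) (b n) (X 0 \<omega>))))"
          unfolding eq law[of i] ..
      qed simp
      also have "MX.expectation (\<lambda>\<omega>. exp (- ?g (obs (a n) (b n) (X 0 \<omega>)))) = 1 - A n / real n"
        unfolding A_eq using int[of n 0] False by (simp add: MX.prob_space)
      finally show ?thesis by simp
    qed
    moreover have "(\<lambda>n. (1 - A n / real n) ^ n) \<longlonglongrightarrow> exp (- (\<integral>v. ?q v \<partial>intensity ?P))"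
    proof (rule power_one_minus_tendsto_exp)
      show "0 \<le> A n" for n unfolding A_def using g_nonneg by (intro integral_nonneg_AE) auto
      \<comment> \<open>Coordinates up to \<open>\<delta>\<close> give a \<open>total\<close> of at
        most half the lower bound of the shell that supports \<open>?g\<close>.\<close>
      define \<delta> where "\<delta> = 1 / (2 * real (Suc m) * real CARD('d))"
      show "A \<longlonglongrightarrow> (\<integral>v. ?q v \<partial>intensity ?P)"
        unfolding A_def
      proof (rule box_measures_imp_tendsto[where \<delta> = \<delta> and M = "real (Suc m)"])
        show "sets (\<mu> n) = sets borel" for n by (simp add: \<mu>_def)
        show "emeasure (\<mu> n) (- {..x}) < \<infinity>" for n x by (simp add: \<mu>_em)
        show "emeasure (intensity ?P) (- {..x}) < \<infinity>" if "\<forall>j. 0 < x $ j" for x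
          by (simp add: emeasure_intensity[OF that])
        show "(\<lambda>n. measure (\<mu> n) (- {..x})) \<longlonglongrightarrow> measure (intensity ?P) (- {..x})" if "\<forall>j. 0 < x $ j" for x
          unfolding \<mu>_m \<nu>_m[OF that] by (rule far_lim[OF that])
        have "AE v in distr MX borel (\<lambda>\<omega>. obs (a n) (b n) (X 0 \<omega>)). \<forall>j. 0 \<le> v $ j" for n
          by (subst AE_distr_iff) (auto simp: obs_nonneg)
        then show "AE v in \<mu> n. \<forall>j. 0 \<le> v $ j" for n
          unfolding \<mu>_def by (subst AE_density) (auto elim: eventually_mono)
        show "AE v in intensity ?P. \<forall>j. 0 \<le> v $ j" by (rule intensity_nonneg)
        show "continuous_on {v. \<forall>j. 0 \<le> v $ j} ?q"
          by (intro continuous_intros continuous_on_orthant_extension[OF f])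
        show "?q v = 0" if "\<forall>j. v $ j \<le> \<delta>" for v
        proof (rule ccontr)
          assume "?q v \<noteq> 0"
          then have "?g v \<noteq> 0" by auto
          then have "1 / real (Suc m) \<le> total v" using m by (auto simp: shell_def)
          also have "\<dots> \<le> (\<Sum>j\<in>(UNIV::'d set). \<delta>)" unfolding total_def using that by (intro sum_mono) auto
          also have "\<dots> = 1 / (2 * real (Suc m))" by (simp add: \<delta>_def)
          finally show False by (simp add: field_simps)
        qed
        show "?q v = 0" if "\<forall>j. 0 \<le> v $ j" "real (Suc m) < v $ i" for v i
        proof (rule ccontr)
          assume "?q v \<noteq> 0"
          then have "?g v \<noteq> 0" by auto
          then have "total v \<le> real (Suc m)" using m by (auto simp: shell_def)
          then show False using total_ge[OF that(1), of i] that(2) by simp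
        qed
      qed (auto simp: \<delta>_def)
    qed
    ultimately show "(\<lambda>n. LINT \<omega>|MX. (if sample_pp \<gamma> \<sigma> a b X n \<omega> \<in> point_measures S then exp (- (\<integral>y. f y \<partial>sample_pp \<gamma> \<sigma> a b X n \<omega>)) else 0))
        \<longlonglongrightarrow> (LINT \<omega>|M. (if limit_pp \<gamma> \<sigma> R T \<omega> \<in> point_measures S then exp (- (\<integral>y. f y \<partial>limit_pp \<gamma> \<sigma> R T \<omega>)) else 0))"
      unfolding Laplace_limit_pp[OF f] by (simp add: PM)
  qed
qed

end

section \<open>Standardization of GEV distributions\<close>

text \<open>Dominated convergence for indicators. Almost sure eventual agreement is used because the
  approximating sets need not be monotone.\<close>

lemma measure_tendsto_AE:
  assumes "prob_space Q" and [measurable]: "\<And>k. A k \<in> sets Q" "B \<in> sets Q"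
    and ae: "AE x in Q. eventually (\<lambda>k. x \<in> A k \<longleftrightarrow> x \<in> B) sequentially"
  shows "(\<lambda>k. measure Q (A k)) \<longlonglongrightarrow> measure Q B"
proof -
  interpret prob_space Q by fact
  have "(\<lambda>k. \<integral>x. indicator (A k) x \<partial>Q) \<longlonglongrightarrow> (\<integral>x. indicator B x \<partial>Q :: real)"
  proof (rule integral_dominated_convergence[where w = "\<lambda>_. 1"])
    show "AE x in Q. (\<lambda>k. indicator (A k) x) \<longlonglongrightarrow> (indicator B x :: real)"
      using ae
    proof eventually_elim
      case (elim x)
      have "eventually (\<lambda>k. indicator (A k) x = (indicator B x :: real)) sequentially"
        using elim by eventually_elim (auto simp: indicator_def)
      then show ?case by (rule tendsto_eventually)
    qed
  qed (auto simp: indicator_def)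
  then show ?thesis by simp
qed

lemma eventually_ge_real: "eventually (\<lambda>k. c \<le> real k) sequentially"
  using filterlim_real_sequentially unfolding filterlim_at_top by blast

lemma real_unstd_between:
  assumes s: "0 < s" and v: "0 < v1" "0 < v2" and u: "real_unstd g s v1 \<le> u" "u \<le> real_unstd g s v2"
  obtains w where "v1 \<le> w" "w \<le> v2" "u = real_unstd g s w"
proof -
  have "ereal u \<in> unstd g s ` {0..}"
  proof -
    have "unstd g s v1 \<in> state_interval g s" "unstd g s v2 \<in> state_interval g s"
      using v by (auto intro!: unstd_mem simp: less_imp_le)
    then have "ereal u \<in> state_interval g s"
      using u unfolding unstd_pos[OF v(1)] unstd_pos[OF v(2)] state_interval_def
      by (auto split: if_splits)
    then show ?thesis using unstd_image[OF s] by simp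
  qed
  then obtain w where w: "0 \<le> w" "ereal u = unstd g s w" by auto
  have "unstd g s v1 \<le> unstd g s w" "unstd g s w \<le> unstd g s v2"
    using u v w(2)[symmetric] by (auto simp: unstd_pos)
  then have "v1 \<le> w" "w \<le> v2" using unstd_le_iff[OF s] v w by (auto simp: less_imp_le)
  moreover have "u = real_unstd g s w" using w(2) unstd_pos[of w g s] \<open>v1 \<le> w\<close> v by simp
  ultimately show thesis by (rule that)
qed

lemma real_unstd_le_iff: "0 < s \<Longrightarrow> 0 < v \<Longrightarrow> 0 < w \<Longrightarrow> real_unstd g s v \<le> real_unstd g s w \<longleftrightarrow> v \<le> w"
  by (meson real_unstd_less_iff not_le)

lemma borel_measurable_real_unstd [measurable]: "real_unstd g s \<in> borel_measurable borel"
  unfolding real_unstd_def[abs_def] by measurable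

text \<open>With \<sigma> = \<alpha> - \<gamma> \<mu>, the quantity 1 + \<gamma> (y - \<mu>) /
  \<alpha> becomes (|\<gamma>| / \<alpha>) z^\<gamma>, so each margin turns into a Frechet law of
  index 1 with scale \<open>c\<close>. For \<gamma> = 0 the scale is exp (\<mu> / \<sigma>).\<close>

lemma gev_margin_real_unstd:
  assumes par: "gev_parameters Q \<gamma> \<mu> \<alpha>" and \<sigma>: "s = \<alpha> $ j - \<gamma> $ j * \<mu> $ j" and s: "0 < s"
  obtains c where "0 < c" "\<And>z. 0 < z \<Longrightarrow> margin Q j (real_unstd (\<gamma> $ j) s z) = exp (- c / z)"
proof (cases "\<gamma> $ j = 0")
  case True
  have \<alpha>: "\<alpha> $ j = s" using \<sigma> True by simp
  show thesis
  proof (rule that[of "exp (\<mu> $ j / s)"])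
    fix z :: real assume z: "0 < z"
    have "margin Q j (real_unstd (\<gamma> $ j) s z) = exp (- exp (- (s * ln z - \<mu> $ j) / s))"
      using par s True \<alpha> unfolding gev_parameters_def real_unstd_def by simp
    also have "- (s * ln z - \<mu> $ j) / s = \<mu> $ j / s - ln z" using s by (simp add: diff_divide_distrib)
    also have "exp (\<mu> $ j / s - ln z) = exp (\<mu> $ j / s) / z" using z by (simp add: exp_diff)
    finally show "margin Q j (real_unstd (\<gamma> $ j) s z) = exp (- exp (\<mu> $ j / s) / z)" by simp
  qed simp
next
  case False
  let ?g = "\<gamma> $ j"
  have \<alpha>: "0 < \<alpha> $ j" using par unfolding gev_parameters_def by blast
  show thesis
  proof (rule that[of "(\<bar>?g\<bar> / \<alpha> $ j) powr (- 1 / ?g)"])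
    show "0 < (\<bar>?g\<bar> / \<alpha> $ j) powr (- 1 / ?g)" using False \<alpha> by simp
    fix z :: real assume z: "0 < z"
    define y where "y = real_unstd ?g s z"
    have y: "?g * (y - \<mu> $ j) = \<bar>?g\<bar> * z powr ?g - \<alpha> $ j"
    proof -
      have "?g * (y - \<mu> $ j) = (?g * sgn ?g) * z powr ?g - s - ?g * \<mu> $ j"
        using False by (simp add: y_def real_unstd_def algebra_simps)
      also have "?g * sgn ?g = \<bar>?g\<bar>" by (simp add: abs_sgn)
      finally show ?thesis using \<sigma> by simp
    qed
    have pos: "0 < \<alpha> $ j + ?g * (y - \<mu> $ j)" unfolding y using False z by simp
    have "margin Q j y = exp (- ((1 + ?g * (y - \<mu> $ j) / \<alpha> $ j) powr (- 1 / ?g)))"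
      using par pos False unfolding gev_parameters_def by simp
    also have "1 + ?g * (y - \<mu> $ j) / \<alpha> $ j = \<bar>?g\<bar> / \<alpha> $ j * z powr ?g"
      unfolding y using \<alpha> by (simp add: field_simps)
    also have "(\<bar>?g\<bar> / \<alpha> $ j * z powr ?g) powr (- 1 / ?g)
        = (\<bar>?g\<bar> / \<alpha> $ j) powr (- 1 / ?g) * (z powr ?g) powr (- 1 / ?g)"
      by (rule powr_mult)
    also have "(z powr ?g) powr (- 1 / ?g) = 1 / z"
      using False z by (simp add: powr_powr powr_minus_divide)
    finally show "margin Q j (real_unstd ?g s z) = exp (- ((\<bar>?g\<bar> / \<alpha> $ j) powr (- 1 / ?g)) / z)"
      by (simp add: y_def)
  qed
qed

lemma joint_cdf_tendsto_margin:
  assumes Q: "prob_space Q" "sets Q = sets borel"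
    and xs: "\<And>k. xs k $ j = y" "\<And>i c. i \<noteq> j \<Longrightarrow> eventually (\<lambda>k. c \<le> xs k $ i) sequentially"
  shows "(\<lambda>k. joint_cdf Q (xs k)) \<longlonglongrightarrow> margin Q j y"
proof -
  have [measurable]: "(\<lambda>x::real^'a. x $ i) \<in> borel_measurable borel" for i
    by (intro borel_measurable_vec_nth) simp
  note [measurable_cong] = Q(2)
  have sp: "space Q = UNIV" using sets_eq_imp_space_eq[OF Q(2)] by simp
  have "margin Q j y = measure Q {x. x $ j \<le> y}"
    unfolding margin_def cdf_def by (subst measure_distr) (auto simp: sp vimage_def)
  moreover have "(\<lambda>k. measure Q {..xs k}) \<longlonglongrightarrow> measure Q {x. x $ j \<le> y}"
  proof (rule measure_tendsto_AE[OF Q(1)])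
    show "{..xs k} \<in> sets Q" for k by (simp add: Q(2))
    have "{x \<in> space borel. x $ j \<le> y} \<in> sets (borel :: (real^'a) measure)" by measurable
    then show "{x. x $ j \<le> y} \<in> sets Q" by (simp add: Q(2))
    show "AE x in Q. \<forall>\<^sub>F k in sequentially. (x \<in> {..xs k}) = (x \<in> {x. x $ j \<le> y})"
    proof (rule AE_I2)
      fix x
      have "\<forall>\<^sub>F k in sequentially. i \<noteq> j \<longrightarrow> x $ i \<le> xs k $ i" for i
        using xs(2)[of i "x $ i"] by (cases "i = j") auto
      then have "\<forall>\<^sub>F k in sequentially. \<forall>i. i \<noteq> j \<longrightarrow> x $ i \<le> xs k $ i" by (rule eventually_all_finite)
      then show "\<forall>\<^sub>F k in sequentially. (x \<in> {..xs k}) = (x \<in> {x. x $ j \<le> y})"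
        by eventually_elim (auto simp: less_eq_vec_def, metis xs(1), metis xs(1))
    qed
  qed
  ultimately show ?thesis by (simp add: joint_cdf_def)
qed

text \<open>Let all other coordinates tend to infinity in the joint identity; the affine map
  preserves this because the components of \<open>a\<close> are positive.\<close>

lemma gev_margin_max_stable:
  assumes Q: "prob_space Q" "sets Q = sets borel" and t: "0 < t" and a: "\<forall>j. 0 < a $ j"
    and stable: "\<forall>x. joint_cdf Q (a * x + b) powr t = joint_cdf Q x"
  shows "margin Q j (a $ j * y + b $ j) powr t = margin Q j y"
proof (rule LIMSEQ_unique)
  define xs where "xs k = (\<chi> i. if i = j then y else real k)" for k :: nat
  show "(\<lambda>k. joint_cdf Q (xs k)) \<longlonglongrightarrow> margin Q j y"
    by (rule joint_cdf_tendsto_margin[OF Q]) (auto simp: xs_def eventually_ge_real)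
  have "(\<lambda>k. joint_cdf Q (a * xs k + b)) \<longlonglongrightarrow> margin Q j (a $ j * y + b $ j)"
  proof (rule joint_cdf_tendsto_margin[OF Q])
    fix i c assume i: "i \<noteq> j"
    have "\<forall>\<^sub>F k in sequentially. (c - b $ i) / a $ i \<le> real k" by (rule eventually_ge_real)
    then show "\<forall>\<^sub>F k in sequentially. c \<le> (a * xs k + b) $ i"
      by eventually_elim (use i a in \<open>simp add: xs_def pos_divide_le_eq algebra_simps\<close>)
  qed (simp add: xs_def)
  then have "(\<lambda>k. joint_cdf Q (a * xs k + b) powr t) \<longlonglongrightarrow> margin Q j (a $ j * y + b $ j) powr t"
    using t by (intro tendsto_powr2 tendsto_const) (auto simp: joint_cdf_def)
  then show "(\<lambda>k. joint_cdf Q (xs k)) \<longlonglongrightarrow> margin Q j (a $ j * y + b $ j) powr t"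
    using stable by simp
qed

definition unmoment :: "real \<Rightarrow> real \<Rightarrow> real \<Rightarrow> ereal"
  where "unmoment g s v = (if v = 0 \<and> g \<le> 0 then - \<infinity> else ereal (if g = 0 then s * ln v else sgn g * v powr g))"

lemma moment_R_unmoment:
  assumes "0 < s" "0 \<le> v"
  shows "moment_R g s (unmoment g s v) = v"
proof (cases "v = 0")
  case True
  then show ?thesis by (auto simp: moment_R_def unmoment_def)
next
  case False
  then have "0 < v" using assms by simp
  then show ?thesis using assms
    by (cases "g = 0") (auto simp: moment_R_def unmoment_def abs_mult abs_sgn_eq powr_powr)
qed

lemma unmoment_mem: "0 \<le> v \<Longrightarrow> unmoment g s v \<in> range_R g"
  by (cases g "0::real" rule: linorder_cases) (auto simp: range_R_def unmoment_def)

lemma borel_measurable_unmoment [measurable]: "unmoment g s \<in> borel_measurable borel"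
  unfolding unmoment_def[abs_def] by measurable

locale gev_law = state_params \<gamma> \<sigma> + prob_space Q
  for \<gamma> \<sigma> :: "real^'d" and Q :: "(real^'d) measure" +
  fixes \<mu> \<alpha> :: "real^'d"
  assumes gev: "gev Q" and par: "gev_parameters Q \<gamma> \<mu> \<alpha>" and \<sigma>_eq: "\<sigma> $ j = \<alpha> $ j - \<gamma> $ j * \<mu> $ j"
begin

lemma sets_Q [measurable_cong]: "sets Q = sets borel"
  using gev by (simp add: gev_def)

lemma space_Q: "space Q = UNIV"
  using sets_eq_imp_space_eq[OF sets_Q] by simp

lemma measurable_component [measurable]: "(\<lambda>w::real^'d. w $ j) \<in> borel_measurable borel"
  by (intro borel_measurable_vec_nth) simp

abbreviation ru :: "'d \<Rightarrow> real \<Rightarrow> real"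
  where "ru j \<equiv> real_unstd (\<gamma> $ j) (\<sigma> $ j)"

definition scale :: "'d \<Rightarrow> real"
  where "scale j = (SOME c. 0 < c \<and> (\<forall>z>0. margin Q j (ru j z) = exp (- c / z)))"

lemma scale: "0 < scale j" "0 < z \<Longrightarrow> margin Q j (ru j z) = exp (- scale j / z)"
proof -
  have "\<exists>c. 0 < c \<and> (\<forall>z>0. margin Q j (ru j z) = exp (- c / z))"
  proof -
    obtain c where "0 < c" "\<And>z. 0 < z \<Longrightarrow> margin Q j (ru j z) = exp (- c / z)"
      by (rule gev_margin_real_unstd[OF par \<sigma>_eq \<sigma>_pos]) blast
    then show ?thesis by blast
  qed
  then have "0 < scale j \<and> (\<forall>z>0. margin Q j (ru j z) = exp (- scale j / z))"
    unfolding scale_def by (rule someI_ex)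
  then show "0 < scale j" "0 < z \<Longrightarrow> margin Q j (ru j z) = exp (- scale j / z)" by blast+
qed

lemma margin_eq: "margin Q j y = prob {x. x $ j \<le> y}"
  unfolding margin_def cdf_def by (subst measure_distr) (auto simp: space_Q vimage_def)

lemma margin_mono: "y \<le> y' \<Longrightarrow> margin Q j y \<le> margin Q j y'"
proof -
  assume "y \<le> y'"
  have "{x \<in> space Q. x $ j \<le> y'} \<in> sets Q" by measurable
  then show ?thesis unfolding margin_eq using \<open>y \<le> y'\<close>
    by (intro finite_measure_mono) (auto simp: space_Q)
qed

text \<open>The parameters prescribe a margin only on the interior of its support, and
  \<open>u\<close> is not known to lie there. If \<open>u\<close> were on the wrong side of
  \<open>ru j w\<close>, an interior point strictly between \<open>ru j w\<close> and
  \<open>u\<close>, or \<open>u\<close> itself, would have a strictly different margin, against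
  monotonicity.\<close>

lemma margin_inj:
  assumes w: "0 < w" and eq: "margin Q j u = exp (- scale j / w)"
  shows "u = ru j w"
proof (rule ccontr)
  assume "u \<noteq> ru j w"
  have lt: "exp (- scale j / v) < exp (- scale j / v')" if "0 < v" "v < v'" for v v'
    using that scale(1)[of j] by (simp add: divide_strict_left_mono)
  consider "u < ru j w" | "ru j w < u" using \<open>u \<noteq> ru j w\<close> by linarith
  then show False
  proof cases
    case 1
    have "\<exists>w'. 0 < w' \<and> w' < w \<and> u \<le> ru j w'"
    proof (cases "u \<le> ru j (w / 2)")
      case True
      then show ?thesis using w by (intro exI[of _ "w / 2"]) auto
    next
      case False
      then obtain v where v: "w / 2 \<le> v" "v \<le> w" "u = ru j v"
        using real_unstd_between[OF \<sigma>_pos[of j], of "w / 2" w "\<gamma> $ j" u] 1 w by auto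
      then show ?thesis using 1 w by (intro exI[of _ v]) (auto simp: order_le_less)
    qed
    then obtain w' where w': "0 < w'" "w' < w" "u \<le> ru j w'" by blast
    show False using margin_mono[OF w'(3), of j] lt[OF w'(1,2)] scale(2)[OF w'(1), of j] eq by simp
  next
    case 2
    have "\<exists>w'. w < w' \<and> ru j w' \<le> u"
    proof (cases "ru j (2 * w) \<le> u")
      case True
      then show ?thesis using w by (intro exI[of _ "2 * w"]) auto
    next
      case False
      then obtain v where v: "w \<le> v" "v \<le> 2 * w" "u = ru j v"
        using real_unstd_between[OF \<sigma>_pos[of j], of w "2 * w" "\<gamma> $ j" u] 2 w by auto
      then show ?thesis using 2 by (intro exI[of _ v]) (auto simp: order_le_less)
    qed
    then obtain w' where w': "w < w'" "ru j w' \<le> u" by blast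
    show False using margin_mono[OF w'(2), of j] lt[OF w w'(1)] scale(2)[of w' j] eq w w' by simp
  qed
qed

text \<open>The margins tend to 0 at \<open>ru j (1 / Suc k)\<close> and to 1 at
  \<open>ru j (Suc k)\<close>, so no mass lies outside the interior range; between two interior
  values the range has no gaps.\<close>

lemma AE_range: "AE x in Q. \<forall>j. \<exists>z>0. x $ j = ru j z"
proof (subst AE_all_countable, intro allI)
  fix j
  have ev: "{x. x $ j \<le> y} \<in> sets Q" for y
  proof -
    have "{x \<in> space Q. x $ j \<le> y} \<in> sets Q" by measurable
    then show ?thesis by (simp add: space_Q)
  qed
  have low: "AE x in Q. \<exists>k::nat. ru j (1 / real (Suc k)) < x $ j"
  proof -
    have lim: "(\<lambda>k. prob {x. x $ j \<le> ru j (1 / real (Suc k))}) \<longlonglongrightarrow> 0"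
    proof -
      have "prob {x. x $ j \<le> ru j (1 / real (Suc k))} = exp (- scale j) ^ Suc k" for k
      proof -
        have "prob {x. x $ j \<le> ru j (1 / real (Suc k))} = exp (- scale j / (1 / real (Suc k)))"
          unfolding margin_eq[symmetric] by (rule scale(2)) simp
        also have "\<dots> = exp (real (Suc k) * - scale j)" by (simp del: of_nat_Suc)
        also have "\<dots> = exp (- scale j) ^ Suc k" by (rule exp_of_nat_mult)
        finally show ?thesis .
      qed
      moreover have "(\<lambda>k. exp (- scale j) ^ Suc k) \<longlonglongrightarrow> 0"
        using scale(1)[of j] by (intro LIMSEQ_Suc LIMSEQ_power_zero) auto
      ultimately show ?thesis by simp
    qed
    let ?N = "{x. \<forall>k::nat. x $ j \<le> ru j (1 / real (Suc k))}"
    have N: "?N \<in> sets Q"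
    proof -
      have "?N = (\<Inter>k::nat. {x. x $ j \<le> ru j (1 / real (Suc k))})" by auto
      then show ?thesis using ev by auto
    qed
    have "prob ?N \<le> prob {x. x $ j \<le> ru j (1 / real (Suc k))}" for k
      using ev by (intro finite_measure_mono) auto
    then have "prob ?N \<le> 0" using LIMSEQ_le_const[OF lim] by blast
    then have "prob ?N = 0" using measure_nonneg[of Q ?N] by linarith
    then have "AE x in Q. x \<notin> ?N" using N by (simp add: prob_eq_0)
    then show ?thesis by eventually_elim (auto simp: not_le)
  qed
  have high: "AE x in Q. \<exists>k::nat. x $ j \<le> ru j (real (Suc k))"
  proof -
    have lim: "(\<lambda>k. prob {x. x $ j \<le> ru j (real (Suc k))}) \<longlonglongrightarrow> 1"
    proof -
      have "(\<lambda>k. exp (- scale j * (1 / real (Suc k)))) \<longlonglongrightarrow> exp (- scale j * 0)"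
        by (intro tendsto_intros LIMSEQ_Suc[OF lim_1_over_n])
      then show ?thesis unfolding margin_eq[symmetric] by (simp add: scale(2))
    qed
    let ?N = "{x. \<exists>k::nat. x $ j \<le> ru j (real (Suc k))}"
    have N: "?N \<in> sets Q"
    proof -
      have "?N = (\<Union>k::nat. {x. x $ j \<le> ru j (real (Suc k))})" by auto
      then show ?thesis using ev by auto
    qed
    have "prob {x. x $ j \<le> ru j (real (Suc k))} \<le> prob ?N" for k
      using N by (intro finite_measure_mono) auto
    then have "1 \<le> prob ?N" using LIMSEQ_le_const2[OF lim] by blast
    then have "prob ?N = 1" using prob_le_1[of ?N] by linarith
    then have "AE x in Q. x \<in> ?N" using N by (simp add: prob_eq_1)
    then show ?thesis by eventually_elim auto
  qed
  from low high show "AE x in Q. \<exists>z>0. x $ j = ru j z"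
  proof eventually_elim
    case (elim x)
    then obtain k l :: nat where "ru j (1 / real (Suc k)) < x $ j" "x $ j \<le> ru j (real (Suc l))" by blast
    then obtain z where "1 / real (Suc k) \<le> z" "x $ j = ru j z"
      using real_unstd_between[OF \<sigma>_pos[of j], of "1 / real (Suc k)" "real (Suc l)" "\<gamma> $ j" "x $ j"] by auto
    then show ?case by (intro exI[of _ z]) (auto intro: less_le_trans[of 0 "1 / real (Suc k)"])
  qed
qed

definition simple_cdf :: "real^'d \<Rightarrow> real"
  where "simple_cdf z = joint_cdf Q (vreal_unstd \<gamma> \<sigma> z)"

lemma atMost_sets: "{..x} \<in> sets Q"
  by (simp add: sets_Q)

text \<open>The norming vectors are only known to exist. Comparing margins through
  \<open>margin_inj\<close> identifies their effect: they carry the corner belonging to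
  \<open>z\<close> to the corner belonging to \<open>t *\<^sub>R z\<close>.\<close>

lemma simple_cdf_scaleR:
  assumes z: "\<forall>j. 0 < z $ j" and t: "0 < t"
  shows "simple_cdf (t *\<^sub>R z) powr t = simple_cdf z"
proof -
  obtain a b where a: "\<forall>j. 0 < a $ j" and st: "\<forall>x. joint_cdf Q (a * x + b) powr t = joint_cdf Q x"
    using gev t unfolding gev_def by blast
  have "a $ j * ru j (z $ j) + b $ j = ru j (t * z $ j)" for j
  proof (rule margin_inj)
    show "0 < t * z $ j" using z t by simp
    have "margin Q j (a $ j * ru j (z $ j) + b $ j) powr t = margin Q j (ru j (z $ j))"
      by (rule gev_margin_max_stable[OF prob_space_axioms sets_Q t a st])
    then have "(margin Q j (a $ j * ru j (z $ j) + b $ j) powr t) powr (1 / t) = exp (- scale j / z $ j) powr (1 / t)"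
      using scale(2)[of "z $ j" j] z by simp
    then show "margin Q j (a $ j * ru j (z $ j) + b $ j) = exp (- scale j / (t * z $ j))"
      using t z by (simp add: powr_powr margin_eq) (simp add: powr_def field_simps)
  qed
  then have "a * vreal_unstd \<gamma> \<sigma> z + b = vreal_unstd \<gamma> \<sigma> (t *\<^sub>R z)"
    by (simp add: vreal_unstd_def vec_eq_iff)
  then show ?thesis using st unfolding simple_cdf_def by metis
qed

lemma simple_cdf_less: "\<forall>j. 0 < z $ j \<Longrightarrow> simple_cdf z \<le> exp (- scale j / z $ j)"
proof -
  assume z: "\<forall>j. 0 < z $ j"
  have "{x \<in> space Q. x $ j \<le> ru j (z $ j)} \<in> sets Q" by measurable
  then have "prob {..vreal_unstd \<gamma> \<sigma> z} \<le> prob {x. x $ j \<le> ru j (z $ j)}"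
    by (intro finite_measure_mono) (auto simp: space_Q less_eq_vec_def vreal_unstd_def)
  then show ?thesis using scale(2)[of "z $ j" j] z by (simp add: simple_cdf_def joint_cdf_def margin_eq)
qed

text \<open>A zero at \<open>z\<close> would by homogeneity be a zero at all multiples of
  \<open>z\<close>, but these corners exhaust a set of full probability.\<close>

lemma simple_cdf_pos:
  assumes z: "\<forall>j. 0 < z $ j"
  shows "0 < simple_cdf z"
proof (rule ccontr)
  assume "\<not> 0 < simple_cdf z"
  then have z0: "simple_cdf z = 0" by (simp add: simple_cdf_def joint_cdf_def not_less measure_le_0_iff)
  have zero: "simple_cdf (real (Suc k) *\<^sub>R z) = 0" for k
    using simple_cdf_scaleR[OF z, of "real (Suc k)"] z0 by simp
  have "(\<lambda>k. prob {..vreal_unstd \<gamma> \<sigma> (real (Suc k) *\<^sub>R z)}) \<longlonglongrightarrow> prob (space Q)"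
  proof (rule measure_tendsto_AE[OF prob_space_axioms atMost_sets])
    show "AE x in Q. \<forall>\<^sub>F k in sequentially. (x \<in> {..vreal_unstd \<gamma> \<sigma> (real (Suc k) *\<^sub>R z)}) = (x \<in> space Q)"
      using AE_range
    proof eventually_elim
      case (elim x)
      have "\<forall>\<^sub>F k in sequentially. x $ j \<le> ru j (real (Suc k) * z $ j)" for j
      proof -
        obtain w where w: "0 < w" "x $ j = ru j w" using elim by blast
        have "\<forall>\<^sub>F k in sequentially. w / z $ j \<le> real k" by (rule eventually_ge_real)
        then show ?thesis
        proof eventually_elim
          case (elim k)
          have zj: "0 < z $ j" using z by blast
          have "w \<le> real k * z $ j" using elim zj by (simp add: pos_divide_le_eq)
          also have "\<dots> \<le> real (Suc k) * z $ j" using zj by (intro mult_right_mono) auto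
          finally show ?case unfolding w(2) using zj w(1) by (subst real_unstd_le_iff[OF \<sigma>_pos]) auto
        qed
      qed
      then have "\<forall>\<^sub>F k in sequentially. \<forall>j. x $ j \<le> ru j (real (Suc k) * z $ j)" by (rule eventually_all_finite)
      then show ?case by eventually_elim (auto simp: less_eq_vec_def vreal_unstd_def space_Q)
    qed
  qed simp
  then have "(\<lambda>k. 0 :: real) \<longlonglongrightarrow> 1"
    using zero by (simp add: simple_cdf_def joint_cdf_def prob_space)
  then show False using LIMSEQ_unique[OF tendsto_const] by fastforce
qed

definition exponent :: "real^'d \<Rightarrow> real"
  where "exponent z = - ln (simple_cdf z)"

definition standardized :: "real^'d \<Rightarrow> real^'d"
  where "standardized x = (\<chi> j. std (\<gamma> $ j) (\<sigma> $ j) (ereal (x $ j)))"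

lemma measurable_standardized [measurable]: "standardized \<in> borel_measurable borel"
  unfolding standardized_def[abs_def]
  by (intro borel_measurable_vec_lambda measurable_compose[OF _ borel_measurable_std]) simp

lemma std_ru: "0 < z \<Longrightarrow> std (\<gamma> $ j) (\<sigma> $ j) (ereal (ru j z)) = z"
  using std_unstd[OF \<sigma>_pos[of j], of z "\<gamma> $ j"] by (simp add: unstd_pos)

lemma simple_max_stable_standardized: "simple_max_stable (distr Q borel standardized) exponent"
proof (rule simple_max_stable.intro)
  show "prob_space (distr Q borel standardized)" by (rule prob_space_distr) simp
  show "simple_max_stable_axioms (distr Q borel standardized) exponent"
  proof
    show "AE z in distr Q borel standardized. \<forall>j. 0 < z $ j"
    proof (subst AE_distr_iff)
      show "AE x in Q. \<forall>j. 0 < standardized x $ j"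
        using AE_range
      proof eventually_elim
        case (elim x)
        show ?case
        proof
          fix j
          obtain z where "0 < z" "x $ j = ru j z" using elim by blast
          then show "0 < standardized x $ j" by (simp add: standardized_def std_ru)
        qed
      qed
    qed simp_all
    fix z :: "real^'d" assume z: "\<forall>j. 0 < z $ j"
    have "measure (distr Q borel standardized) {..z} = prob {x \<in> space Q. standardized x \<le> z}"
      by (subst measure_distr) (auto intro!: arg_cong[where f = prob])
    also have "\<dots> = prob {..vreal_unstd \<gamma> \<sigma> z}"
    proof (rule finite_measure_eq_AE)
      show "AE x in Q. (x \<in> {x \<in> space Q. standardized x \<le> z}) = (x \<in> {..vreal_unstd \<gamma> \<sigma> z})"
        using AE_range
      proof eventually_elim
        case (elim x)
        have "standardized x $ j \<le> z $ j \<longleftrightarrow> x $ j \<le> vreal_unstd \<gamma> \<sigma> z $ j" for j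
        proof -
          obtain w where "0 < w" "x $ j = ru j w" using elim by blast
          then show ?thesis using z by (simp add: standardized_def std_ru vreal_unstd_def real_unstd_le_iff[OF \<sigma>_pos])
        qed
        then show ?case by (simp add: space_Q less_eq_vec_def)
      qed
    qed (auto simp: sets_Q)
    also have "\<dots> = exp (- exponent z)"
      using simple_cdf_pos[OF z] by (simp add: exponent_def simple_cdf_def joint_cdf_def)
    finally show "measure (distr Q borel standardized) {..z} = exp (- exponent z)" .
    show "0 < exponent z"
    proof -
      fix j
      have "simple_cdf z \<le> exp (- scale j / z $ j)" by (rule simple_cdf_less[OF z])
      also have "\<dots> < 1" using scale(1)[of j] z by simp
      finally show ?thesis using simple_cdf_pos[OF z] by (simp add: exponent_def)
    qed
    fix t :: real assume t: "0 < t"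
    have tz: "\<forall>j. 0 < (t *\<^sub>R z) $ j" using z t by simp
    have "t * ln (simple_cdf (t *\<^sub>R z)) = ln (simple_cdf z)"
      using simple_cdf_scaleR[OF z t] simple_cdf_pos[OF tz] by (metis ln_powr)
    then show "exponent (t *\<^sub>R z) = exponent z / t" using t by (simp add: exponent_def field_simps)
  qed simp
qed

lemma exponent_ge: "\<forall>j. 0 < z $ j \<Longrightarrow> scale j / z $ j \<le> exponent z"
proof -
  assume z: "\<forall>j. 0 < z $ j"
  have "ln (simple_cdf z) \<le> ln (exp (- scale j / z $ j))"
    using simple_cdf_less[OF z] simple_cdf_pos[OF z] by (subst ln_le_cancel_iff) auto
  then show ?thesis by (simp add: exponent_def)
qed

lemma condition_R_exists:
  obtains L where "condition_R \<gamma> \<sigma> L"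
    "\<And>z. \<forall>j. 0 < z $ j \<Longrightarrow> (\<integral>w. wmax z w \<partial>distr L borel (moments \<gamma> \<sigma>)) = exponent z"
proof -
  interpret Z: simple_max_stable "distr Q borel standardized" exponent by (rule simple_max_stable_standardized)
  obtain PW c where PW: "prob_space PW" "sets PW = sets borel" "AE w in PW. \<forall>j. 0 \<le> w $ j \<and> w $ j \<le> c"
    "\<And>x. \<forall>j. 0 < x $ j \<Longrightarrow> (\<integral>w. wmax x w \<partial>PW) = exponent x"
    using Z.spectral_law_exists by blast
  interpret PW: prob_space PW by (rule PW)
  note [measurable_cong] = PW(2)
  \<comment> \<open>On the orthant this map is a right inverse of \<open>moments\<close>, so its
    image law realizes the given spectral law as the law of moment vectors.\<close>
  define \<rho> where "\<rho> w = (\<chi> j. unmoment (\<gamma> $ j) (\<sigma> $ j) (w $ j))" for w :: "real^'d"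
  have \<rho> [measurable]: "\<rho> \<in> borel_measurable borel"
    unfolding \<rho>_def[abs_def]
    by (intro borel_measurable_vec_lambda measurable_compose[OF _ borel_measurable_unmoment]) simp
  define L where "L = distr PW borel \<rho>"
  have mom: "moments \<gamma> \<sigma> (\<rho> w) = w" if "\<forall>j. 0 \<le> w $ j" for w
    using that by (simp add: moments_def \<rho>_def vec_eq_iff moment_R_unmoment[OF \<sigma>_pos])
  have int: "(\<integral>w. wmax z w \<partial>distr L borel (moments \<gamma> \<sigma>)) = exponent z" if z: "\<forall>j. 0 < z $ j" for z
  proof -
    have "(\<integral>w. wmax z w \<partial>distr L borel (moments \<gamma> \<sigma>)) = (\<integral>r. wmax z (moments \<gamma> \<sigma> r) \<partial>L)"
      by (rule integral_distr) (auto simp: L_def)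
    also have "\<dots> = (\<integral>w. wmax z (moments \<gamma> \<sigma> (\<rho> w)) \<partial>PW)"
      unfolding L_def by (rule integral_distr) auto
    also have "\<dots> = (\<integral>w. wmax z w \<partial>PW)"
    proof (rule integral_cong_AE)
      show "AE w in PW. wmax z (moments \<gamma> \<sigma> (\<rho> w)) = wmax z w"
        using PW(3) by eventually_elim (simp add: mom)
    qed measurable
    finally show ?thesis using PW(4)[OF z] by simp
  qed
  \<comment> \<open>If coordinate \<open>j\<close> vanished, the exponent at the corner with j-th
    entry 1 and all others \<open>K\<close> would be at most \<open>C / K\<close>, where
    \<open>C\<close> bounds the spectral vectors. The choice of \<open>K\<close> puts this below
    \<open>scale j\<close>, whereas the j-th margin forces the exponent to be at least
    \<open>scale j\<close>.\<close>
  have pos: "\<not> (AE w in PW. w $ j = 0)" for j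
  proof
    assume "AE w in PW. w $ j = 0"
    define C where "C = \<bar>c\<bar> + 1"
    define K where "K = max 1 (2 * C / scale j)"
    have C: "0 < C" unfolding C_def by simp
    have K: "0 < K" "C / K < scale j"
    proof -
      show "0 < K" unfolding K_def by simp
      have "2 * C / scale j \<le> K" unfolding K_def by simp
      then have "2 * C \<le> K * scale j" using scale(1)[of j] by (simp add: pos_divide_le_eq)
      then have "C < K * scale j" using C by linarith
      then show "C / K < scale j" using \<open>0 < K\<close> by (simp add: pos_divide_less_eq mult.commute)
    qed
    define x where "x = (\<chi> i. if i = j then 1 else K)"
    have x: "\<forall>i. 0 < x $ i" using K by (simp add: x_def)
    have bd: "AE w in PW. 0 \<le> wmax x w \<and> wmax x w \<le> C / K"
      using PW(3) \<open>AE w in PW. w $ j = 0\<close>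
    proof eventually_elim
      case (elim w)
      obtain i where i: "wmax x w = w $ i / x $ i" using wmax_attained by blast
      have "w $ i \<le> C" using elim unfolding C_def by (smt (verit))
      then show ?case using i elim K C x
        by (cases "i = j") (auto simp: x_def divide_right_mono less_imp_le)
    qed
    have "(\<integral>w. wmax x w \<partial>PW) \<le> C / K"
    proof (rule PW.integral_le_const)
      show "integrable PW (wmax x)"
        by (rule PW.integrable_const_bound[of _ "C / K"]) (use bd in \<open>auto elim: eventually_mono\<close>)
      show "AE w in PW. wmax x w \<le> C / K" using bd by eventually_elim simp
    qed
    then show False using exponent_ge[OF x, of j] PW(4)[OF x] K(2) by (simp add: x_def)
  qed
  have "condition_R \<gamma> \<sigma> L"
    unfolding condition_R_def
  proof (intro conjI allI)
    show "prob_space L" unfolding L_def by (rule PW.prob_space_distr) simp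
    show "sets L = sets borel" by (simp add: L_def)
    fix j
    have rm: "range_R g \<in> sets borel" for g by (simp add: range_R_def)
    have [measurable]: "(\<lambda>y::ereal^'d. y $ j) \<in> borel_measurable borel"
      by (intro borel_measurable_vec_nth) simp
    have "{r \<in> space (borel :: (ereal^'d) measure). r $ j \<in> range_R (\<gamma> $ j)} \<in> sets borel" using rm by measurable
    then have "(AE r in L. r $ j \<in> range_R (\<gamma> $ j)) \<longleftrightarrow> (AE w in PW. \<rho> w $ j \<in> range_R (\<gamma> $ j))"
      unfolding L_def by (subst AE_distr_iff) auto
    then show "AE r in L. r $ j \<in> range_R (\<gamma> $ j)"
      using PW(3) by (auto elim!: eventually_mono simp: \<rho>_def unmoment_mem)
    have "(\<integral>\<^sup>+r. ennreal (moment_R (\<gamma> $ j) (\<sigma> $ j) (r $ j)) \<partial>L) = (\<integral>\<^sup>+w. ennreal (moment_R (\<gamma> $ j) (\<sigma> $ j) (\<rho> w $ j)) \<partial>PW)"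
      unfolding L_def by (rule nn_integral_distr) (use borel_measurable_moment_R in measurable)
    also have "\<dots> = (\<integral>\<^sup>+w. ennreal (w $ j) \<partial>PW)"
    proof (rule nn_integral_cong_AE)
      show "AE w in PW. ennreal (moment_R (\<gamma> $ j) (\<sigma> $ j) (\<rho> w $ j)) = ennreal (w $ j)"
        using PW(3) by eventually_elim (simp add: \<rho>_def moment_R_unmoment[OF \<sigma>_pos])
    qed
    finally have eq: "(\<integral>\<^sup>+r. ennreal (moment_R (\<gamma> $ j) (\<sigma> $ j) (r $ j)) \<partial>L) = (\<integral>\<^sup>+w. ennreal (w $ j) \<partial>PW)" .
    show "(\<integral>\<^sup>+r. ennreal (moment_R (\<gamma> $ j) (\<sigma> $ j) (r $ j)) \<partial>L) < \<infinity>"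
    proof -
      have "(\<integral>\<^sup>+w. ennreal (w $ j) \<partial>PW) \<le> (\<integral>\<^sup>+w. ennreal c \<partial>PW)"
        by (rule nn_integral_mono_AE) (use PW(3) in \<open>auto elim!: eventually_mono intro: ennreal_leI\<close>)
      also have "\<dots> < \<infinity>" by (simp add: PW.emeasure_space_1)
      finally show ?thesis using eq by simp
    qed
    show "0 < (\<integral>\<^sup>+r. ennreal (moment_R (\<gamma> $ j) (\<sigma> $ j) (r $ j)) \<partial>L)"
    proof (rule ccontr)
      assume "\<not> ?thesis"
      then have "(\<integral>\<^sup>+w. ennreal (w $ j) \<partial>PW) = 0" using eq by (simp add: not_gr_zero)
      then have "AE w in PW. ennreal (w $ j) = 0" by (subst (asm) nn_integral_0_iff_AE) auto
      then have "AE w in PW. w $ j = 0"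
        using PW(3)
      proof eventually_elim
        case (elim w)
        then have "w $ j \<le> 0" "0 \<le> w $ j" by (auto simp: ennreal_eq_0_iff)
        then show ?case by linarith
      qed
      then show False using pos by blast
    qed
  qed
  then show thesis using int by (rule that)
qed

text \<open>Convergence of the normalized maxima is assumed only at continuity points. The margins
  have no atoms at interior points, so almost surely no coordinate equals that of the corner, and
  small moves of the corner do not matter in the limit.\<close>

lemma isCont_joint_cdf:
  assumes z: "\<forall>j. 0 < z $ j"
  shows "isCont (joint_cdf Q) (vreal_unstd \<gamma> \<sigma> z)"
  unfolding continuous_at_sequentially
proof (intro allI impI)
  fix xs :: "nat \<Rightarrow> real^'d" assume xs: "xs \<longlonglongrightarrow> vreal_unstd \<gamma> \<sigma> z"
  have ne: "AE x in Q. x $ j \<noteq> ru j (z $ j)" for j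
  proof -
    have ev: "{x. x $ j \<le> y} \<in> sets Q" for y
    proof -
      have "{x \<in> space Q. x $ j \<le> y} \<in> sets Q" by measurable
      then show ?thesis by (simp add: space_Q)
    qed
    have ev': "{x. x $ j = y} \<in> sets Q" for y
    proof -
      have "{x \<in> space Q. x $ j = y} \<in> sets Q" by measurable
      then show ?thesis by (simp add: space_Q)
    qed
    have zj: "0 < z $ j" using z by blast
    have bound: "prob {x. x $ j = ru j (z $ j)} \<le> exp (- scale j / z $ j) - exp (- scale j / w)" if w: "0 < w" "w < z $ j" for w
    proof -
      have "ru j w < ru j (z $ j)" using w zj real_unstd_less_iff[OF \<sigma>_pos] by simp
      then have "prob {x. x $ j \<le> ru j w} + prob {x. x $ j = ru j (z $ j)} \<le> prob {x. x $ j \<le> ru j (z $ j)}"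
        by (subst finite_measure_Union[symmetric]) (auto intro!: finite_measure_mono ev ev')
      then show ?thesis using scale(2)[OF w(1), of j] scale(2)[OF zj, of j] by (simp add: margin_eq)
    qed
    \<comment> \<open>The comparison point \<open>w\<close> is taken just below
      \<open>z $ j\<close>; its factor \<open>1 - 1 / (real n + 2)\<close> is positive for every
      \<open>n\<close> and tends to 1.\<close>
    have le: "prob {x. x $ j = ru j (z $ j)} \<le> exp (- scale j / z $ j) - exp (- scale j / (z $ j * (1 - 1 / (real n + 2))))" for n
    proof (rule bound)
      have c: "0 < 1 - 1 / (real n + 2)" "1 - 1 / (real n + 2) < 1" by (auto simp: field_simps)
      show "0 < z $ j * (1 - 1 / (real n + 2))" using zj c(1) by (rule mult_pos_pos)
      show "z $ j * (1 - 1 / (real n + 2)) < z $ j" using mult_strict_left_mono[OF c(2) zj] by simp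
    qed
    have "(\<lambda>n. 1 / (real n + 2)) \<longlonglongrightarrow> 0"
      using LIMSEQ_ignore_initial_segment[OF lim_1_over_n[where 'a = real], of 2] by (simp add: add.commute)
    then have "(\<lambda>n. exp (- scale j / z $ j) - exp (- scale j / (z $ j * (1 - 1 / (real n + 2)))))
        \<longlonglongrightarrow> exp (- scale j / z $ j) - exp (- scale j / (z $ j * (1 - 0)))"
      using zj by (intro tendsto_intros) auto
    then have "prob {x. x $ j = ru j (z $ j)} \<le> exp (- scale j / z $ j) - exp (- scale j / (z $ j * (1 - 0)))"
      using le by (intro LIMSEQ_le_const) auto
    then have "prob {x. x $ j = ru j (z $ j)} = 0" by (simp add: measure_le_0_iff)
    then have "AE x in Q. x \<notin> {x. x $ j = ru j (z $ j)}" using ev' by (simp add: prob_eq_0)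
    then show ?thesis by simp
  qed
  have "(\<lambda>n. prob {..xs n}) \<longlonglongrightarrow> prob {..vreal_unstd \<gamma> \<sigma> z}"
  proof (rule measure_tendsto_AE[OF prob_space_axioms atMost_sets atMost_sets])
    have "AE x in Q. \<forall>j. x $ j \<noteq> ru j (z $ j)" using ne by (simp add: AE_all_countable)
    then show "AE x in Q. \<forall>\<^sub>F n in sequentially. (x \<in> {..xs n}) = (x \<in> {..vreal_unstd \<gamma> \<sigma> z})"
    proof eventually_elim
      case (elim x)
      have "\<forall>\<^sub>F n in sequentially. x $ j \<le> xs n $ j \<longleftrightarrow> x $ j \<le> ru j (z $ j)" for j
      proof -
        have lim: "(\<lambda>n. xs n $ j) \<longlonglongrightarrow> ru j (z $ j)"
          using tendsto_vec_nth[OF xs, of j] by (simp add: vreal_unstd_def)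
        consider "x $ j < ru j (z $ j)" | "ru j (z $ j) < x $ j" using elim by (meson linorder_neqE)
        then show ?thesis
        proof cases
          case 1
          from order_tendstoD(1)[OF lim this] show ?thesis by eventually_elim (use 1 in auto)
        next
          case 2
          from order_tendstoD(2)[OF lim this] show ?thesis by eventually_elim (use 2 in auto)
        qed
      qed
      then have "\<forall>\<^sub>F n in sequentially. \<forall>j. x $ j \<le> xs n $ j \<longleftrightarrow> x $ j \<le> ru j (z $ j)" by (rule eventually_all_finite)
      then show ?case by eventually_elim (simp add: less_eq_vec_def vreal_unstd_def)
    qed
  qed
  then show "(joint_cdf Q \<circ> xs) \<longlonglongrightarrow> joint_cdf Q (vreal_unstd \<gamma> \<sigma> z)" by (simp add: joint_cdf_def o_def)
qed

end

lemma prob_max_le: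
  fixes X :: "nat \<Rightarrow> 'w \<Rightarrow> real^'d"
  assumes iid: "iid_with_cdf M X F" and n: "1 \<le> n" and a: "\<forall>j. 0 < a $ j"
  shows "measure M {\<omega> \<in> space M. \<forall>j. ((MAX i\<in>{..<n}. X i \<omega> $ j) - b $ j) / a $ j \<le> x $ j} = F (a * x + b) ^ n"
proof -
  interpret prob_space M using iid by (simp add: iid_with_cdf_def)
  have ind: "indep_vars (\<lambda>_. borel) X UNIV" and F: "\<And>i x. prob {\<omega> \<in> space M. X i \<omega> \<le> x} = F x"
    using iid by (auto simp: iid_with_cdf_def)
  have "0 \<in> {..<n}" using n by simp
  then have ne: "{..<n} \<noteq> {}" by blast
  have "((MAX i\<in>{..<n}. X i \<omega> $ j) - b $ j) / a $ j \<le> x $ j \<longleftrightarrow> (\<forall>i<n. X i \<omega> $ j \<le> (a * x + b) $ j)" for \<omega> j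
  proof -
    have "((MAX i\<in>{..<n}. X i \<omega> $ j) - b $ j) / a $ j \<le> x $ j \<longleftrightarrow> (MAX i\<in>{..<n}. X i \<omega> $ j) \<le> (a * x + b) $ j"
      using a by (simp add: pos_divide_le_eq algebra_simps)
    also have "\<dots> \<longleftrightarrow> (\<forall>i<n. X i \<omega> $ j \<le> (a * x + b) $ j)"
      using ne by (subst Max_le_iff) auto
    finally show ?thesis .
  qed
  then have "{\<omega> \<in> space M. \<forall>j. ((MAX i\<in>{..<n}. X i \<omega> $ j) - b $ j) / a $ j \<le> x $ j}
      = (\<Inter>i\<in>{..<n}. X i -` {..a * x + b} \<inter> space M)"
    using ne by (auto simp: less_eq_vec_def)
  also have "prob \<dots> = (\<Prod>i\<in>{..<n}. prob (X i -` {..a * x + b} \<inter> space M))"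
     by (rule indep_varsD[OF ind]) (use ne in auto)
  also have "\<dots> = (\<Prod>i\<in>{..<n}. F (a * x + b))"
  proof (rule prod.cong)
    fix i show "prob (X i -` {..a * x + b} \<inter> space M) = F (a * x + b)"
      unfolding F[of i "a * x + b", symmetric] by (auto intro!: arg_cong[where f = prob])
  qed simp
  finally show ?thesis by simp
qed

section \<open>The law of the componentwise supremum\<close>

text \<open>Multiplication by \<open>t\<close> in standardized coordinates is affine in the original
  ones. This is the origin of the norming vectors: \<open>t\<close> to the power \<gamma> as scale
  and the additive term as shift.\<close>

lemma real_unstd_mult:
  assumes "0 < t" "0 < v"
  shows "real_unstd g s (t * v) = t powr g * real_unstd g s v + (if g = 0 then s * ln t else (t powr g - 1) * s / g)"
  using assms by (simp add: real_unstd_def ln_mult powr_mult algebra_simps diff_divide_distrib)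

text \<open>Since \<sigma> > 0, the origin is interior to the range in each coordinate, and
  \<open>std g s 0\<close> is its positive standardized coordinate. The vectors b_n will be the
  images of n times it, hence interior too.\<close>

lemma real_unstd_std_0:
  assumes "0 < s"
  shows "0 < std g s 0" "real_unstd g s (std g s 0) = 0"
  using assms by (auto simp: std_def real_unstd_def powr_powr abs_divide sgn_if)

lemma converges_weakly_cong:
  assumes Z: "converges_weakly T M Z M' Z'" and W: "\<And>n. random_element T M (W n)"
    and eq: "\<And>n. AE \<omega> in M. Z n \<omega> = W n \<omega>"
  shows "converges_weakly T M W M' Z'"
proof -
  have "(LINT \<omega>:{\<omega> \<in> space M. Z n \<omega> \<in> topspace T}|M. \<Phi> (Z n \<omega>)) = (LINT \<omega>:{\<omega> \<in> space M. W n \<omega> \<in> topspace T}|M. \<Phi> (W n \<omega>))"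
    if \<Phi>: "continuous_map T euclideanreal \<Phi>" for \<Phi> n
    unfolding set_integral_random_element
  proof (rule integral_cong_AE)
    have "random_element T M (Z n)" using Z by (simp add: converges_weakly_def)
    then show "(\<lambda>\<omega>. if Z n \<omega> \<in> topspace T then \<Phi> (Z n \<omega>) else 0) \<in> borel_measurable M"
      by (rule random_element_measurable[OF _ \<Phi>])
    show "(\<lambda>\<omega>. if W n \<omega> \<in> topspace T then \<Phi> (W n \<omega>) else 0) \<in> borel_measurable M"
      by (rule random_element_measurable[OF W \<Phi>])
    show "AE \<omega> in M. (if Z n \<omega> \<in> topspace T then \<Phi> (Z n \<omega>) else 0) = (if W n \<omega> \<in> topspace T then \<Phi> (W n \<omega>) else 0)"
      using eq[of n] by eventually_elim simp
  qed
  then show ?thesis using Z W unfolding converges_weakly_def by auto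
qed

definition norming_scale :: "real^'d \<Rightarrow> real \<Rightarrow> real^'d"
  where "norming_scale \<gamma> t = (\<chi> j. t powr (\<gamma> $ j))"

definition norming_shift :: "real^'d \<Rightarrow> real^'d \<Rightarrow> real \<Rightarrow> real^'d"
  where "norming_shift \<gamma> \<sigma> t = (\<chi> j. if \<gamma> $ j = 0 then \<sigma> $ j * ln t else (t powr (\<gamma> $ j) - 1) * \<sigma> $ j / \<gamma> $ j)"

lemma norming_scale_pos: "0 < t \<Longrightarrow> 0 < norming_scale \<gamma> t $ j"
  by (simp add: norming_scale_def)

lemma real_unstd_norming:
  assumes "0 < t" "0 < v"
  shows "real_unstd (\<gamma> $ j) (\<sigma> $ j) (t * v) = norming_scale \<gamma> t $ j * real_unstd (\<gamma> $ j) (\<sigma> $ j) v + norming_shift \<gamma> \<sigma> t $ j"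
  using real_unstd_mult[OF assms] by (simp add: norming_scale_def norming_shift_def)

lemma vreal_unstd_norming:
  assumes "0 < t" "\<forall>j. 0 < z $ j"
  shows "norming_scale \<gamma> t * vreal_unstd \<gamma> \<sigma> z + norming_shift \<gamma> \<sigma> t = vreal_unstd \<gamma> \<sigma> (t *\<^sub>R z)"
proof (rule vec_eq_iff[THEN iffD2, rule_format])
  fix j
  have "0 < z $ j" using assms(2) by blast
  from real_unstd_norming[OF assms(1) this, of \<gamma> j \<sigma>]
  show "(norming_scale \<gamma> t * vreal_unstd \<gamma> \<sigma> z + norming_shift \<gamma> \<sigma> t) $ j = vreal_unstd \<gamma> \<sigma> (t *\<^sub>R z) $ j"
    by (simp add: vreal_unstd_def)
qed

section \<open>The supremum of the points and its law\<close>

context limit_process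
begin

abbreviation ru :: "'d \<Rightarrow> real \<Rightarrow> real"
  where "ru j \<equiv> real_unstd (\<gamma> $ j) (\<sigma> $ j)"

text \<open>The supremum is formed in standardized coordinates and in \<open>ennreal\<close>, where
  it exists and is measurable without any bound; almost surely it is finite.\<close>

definition peak :: "'v \<Rightarrow> real^'d"
  where "peak \<omega> = (\<chi> j. enn2real (SUP i. ennreal (ray i \<omega> $ j)))"

lemma measurable_peak [measurable]: "peak \<in> borel_measurable M"
proof -
  have [measurable]: "(\<lambda>\<omega>. moments \<gamma> \<sigma> (R i \<omega>) $ j) \<in> borel_measurable M" for i j
    by (rule measurable_compose[OF _ measurable_component]) measurable
  show ?thesis unfolding peak_def[abs_def] by (intro borel_measurable_vec_lambda) simp
qed

lemma measurable_peak_nth [measurable]: "(\<lambda>\<omega>. peak \<omega> $ j) \<in> borel_measurable M"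
  by (rule measurable_compose[OF measurable_peak measurable_component])

text \<open>Only finitely many points have \<open>total\<close> at least 1, so the supremum is
  finite and \<open>enn2real\<close> loses nothing. One null set serves all
  \<open>x\<close>.\<close>

lemma AE_peak_le_iff:
  "AE \<omega> in M. \<forall>x. (\<forall>j. 0 \<le> x $ j) \<longrightarrow> (peak \<omega> \<le> x \<longleftrightarrow> (\<forall>i. moments \<gamma> \<sigma> (R i \<omega>) \<le> T i \<omega> *\<^sub>R x))"
  using T_pos finite_large_points
proof eventually_elim
  case (elim \<omega>)
  have T: "0 < T i \<omega>" for i using elim(1) by blast
  have fin: "finite {i. 1 \<le> total (ray i \<omega>)}" using elim(2)[rule_format, of 0] by simp
  \<comment> \<open>The inserted 1 bounds the infinitely many points with small \<open>total\<close>
    and keeps the set nonempty.\<close>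
  define B where "B = Max (insert 1 ((\<lambda>i. total (ray i \<omega>)) ` {i. 1 \<le> total (ray i \<omega>)}))"
  have B: "ray i \<omega> $ j \<le> B" for i j
  proof -
    have "ray i \<omega> $ j \<le> total (ray i \<omega>)" by (rule total_ge) (use ray_nonneg[OF T] in blast)
    also have "\<dots> \<le> B"
    proof (cases "1 \<le> total (ray i \<omega>)")
      case True
      then show ?thesis unfolding B_def using fin by (intro Max_ge) auto
    next
      case False
      moreover have "1 \<le> B" unfolding B_def using fin by (intro Max_ge) auto
      ultimately show ?thesis by linarith
    qed
    finally show ?thesis .
  qed
  have le: "peak \<omega> $ j \<le> s \<longleftrightarrow> (\<forall>i. moments \<gamma> \<sigma> (R i \<omega>) $ j \<le> T i \<omega> * s)" if s: "0 \<le> s" for j s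
  proof -
    have "(SUP i. ennreal (ray i \<omega> $ j)) \<le> ennreal B" by (intro SUP_least ennreal_leI B)
    then have ne: "(SUP i. ennreal (ray i \<omega> $ j)) < \<top>" by (rule order_le_less_trans) simp
    have "peak \<omega> $ j \<le> s \<longleftrightarrow> (SUP i. ennreal (ray i \<omega> $ j)) \<le> ennreal s"
    proof
      assume "peak \<omega> $ j \<le> s"
      then have "ennreal (peak \<omega> $ j) \<le> ennreal s" by (rule ennreal_leI)
      then show "(SUP i. ennreal (ray i \<omega> $ j)) \<le> ennreal s" using ne by (simp add: peak_def)
    qed (simp add: peak_def enn2real_leI s)
    also have "\<dots> \<longleftrightarrow> (\<forall>i. ray i \<omega> $ j \<le> s)" using s by (simp add: SUP_le_iff ennreal_le_iff)
    also have "\<dots> \<longleftrightarrow> (\<forall>i. moments \<gamma> \<sigma> (R i \<omega>) $ j \<le> T i \<omega> * s)"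
      using T by (simp add: pos_divide_le_eq mult.commute)
    finally show ?thesis .
  qed
  show ?case
  proof (intro allI impI)
    fix x :: "real^'d" assume "\<forall>j. 0 \<le> x $ j"
    then show "peak \<omega> \<le> x \<longleftrightarrow> (\<forall>i. moments \<gamma> \<sigma> (R i \<omega>) \<le> T i \<omega> *\<^sub>R x)"
      using le by (auto simp: less_eq_vec_def)
  qed
qed

definition V :: "real^'d \<Rightarrow> real"
  where "V z = (\<integral>w. wmax z w \<partial>distr L borel (moments \<gamma> \<sigma>))"

definition mean :: "'d \<Rightarrow> real"
  where "mean j = (\<integral>w. w $ j \<partial>distr L borel (moments \<gamma> \<sigma>))"

lemma peak_sets [measurable]: "{\<omega> \<in> space M. peak \<omega> \<le> z} \<in> sets M"
proof -
  have "peak -` {..z} \<inter> space M \<in> sets M" by (rule measurable_sets[OF measurable_peak]) simp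
  then show ?thesis by (auto simp: vimage_def Int_def conj_commute)
qed

lemma prob_peak_le:
  assumes z: "\<forall>j. 0 < z $ j"
  shows "prob {\<omega> \<in> space M. peak \<omega> \<le> z} = exp (- V z)"
proof -
  have "prob {\<omega> \<in> space M. peak \<omega> \<le> z} = expectation (indicator {\<omega> \<in> space M. peak \<omega> \<le> z})" by simp
  also have "\<dots> = exp (- V z)"
    unfolding V_def
  proof (rule prob_all_le[OF z])
    show "AE \<omega> in M. indicator {\<omega> \<in> space M. peak \<omega> \<le> z} \<omega> = (if \<forall>i. moments \<gamma> \<sigma> (R i \<omega>) \<le> T i \<omega> *\<^sub>R z then 1 else 0 :: real)"
      using AE_peak_le_iff AE_space
    proof eventually_elim
      case (elim \<omega>)
      have "\<forall>j. 0 \<le> z $ j" using z by (simp add: less_imp_le)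
      then have "peak \<omega> \<le> z \<longleftrightarrow> (\<forall>i. moments \<gamma> \<sigma> (R i \<omega>) \<le> T i \<omega> *\<^sub>R z)" using elim(1) by blast
      then show ?case using elim(2) by (simp add: indicator_def)
    qed
  qed simp
  finally show ?thesis .
qed

lemma V_scaleR:
  assumes t: "0 < t"
  shows "V (t *\<^sub>R z) = V z / t"
proof -
  have "wmax (t *\<^sub>R z) w = wmax z w / t" for w :: "real^'d"
  proof -
    have "wmax (t *\<^sub>R z) w = wmax z ((1 / t) *\<^sub>R w)" by (simp add: wmax_def)
    then show ?thesis by (subst (asm) wmax_scaleR) (use t in auto)
  qed
  then have "wmax (t *\<^sub>R z) = (\<lambda>w::real^'d. wmax z w / t)" by (rule ext)
  then show ?thesis unfolding V_def by simp
qed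

lemma V_ge: "\<forall>j. 0 < z $ j \<Longrightarrow> mean j / z $ j \<le> V z"
proof -
  assume z: "\<forall>j. 0 < z $ j"
  have "mean j / z $ j = (\<integral>w. w $ j / z $ j \<partial>distr L borel (moments \<gamma> \<sigma>))" by (simp add: mean_def)
  also have "\<dots> \<le> V z"
    unfolding V_def by (rule integral_mono) (use P_integrable integrable_wmax[OF z] wmax_ge in auto)
  finally show ?thesis .
qed

lemma mean_pos: "0 < mean j"
proof -
  interpret L: prob_space L using L by (simp add: condition_R_def)
  have sets [measurable_cong]: "sets L = sets borel" using L by (simp add: condition_R_def)
  have "mean j = (\<integral>r. moments \<gamma> \<sigma> r $ j \<partial>L)" unfolding mean_def by (rule integral_distr) auto
  moreover have int: "integrable L (\<lambda>r. moments \<gamma> \<sigma> r $ j)"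
    using P_integrable[of j] by (subst (asm) integrable_distr_eq) auto
  moreover have "(\<integral>\<^sup>+r. ennreal (moments \<gamma> \<sigma> r $ j) \<partial>L) = ennreal (\<integral>r. moments \<gamma> \<sigma> r $ j \<partial>L)"
    by (rule nn_integral_eq_integral[OF int]) (simp add: moments_nonneg)
  moreover have "0 < (\<integral>\<^sup>+r. ennreal (moments \<gamma> \<sigma> r $ j) \<partial>L)"
    using L by (simp add: condition_R_def moments_def)
  ultimately show ?thesis by (simp add: ennreal_less_zero_iff)
qed

text \<open>The lower bound comes from the cube with side \<open>s\<close>, the upper bound from
  boxes with j-th side \<open>s\<close> whose other sides tend to infinity. These bounds yield
  nondegenerate margins and their convergence to 1.\<close>

lemma prob_peak_nth_le:
  assumes s: "0 < s"
  shows "exp (- V 1 / s) \<le> prob {\<omega> \<in> space M. peak \<omega> $ j \<le> s}"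
    and "prob {\<omega> \<in> space M. peak \<omega> $ j \<le> s} \<le> exp (- mean j / s)"
proof -
  have pos: "\<forall>i. 0 < (s *\<^sub>R 1 :: real^'d) $ i" using s by simp
  have "exp (- V 1 / s) = prob {\<omega> \<in> space M. peak \<omega> \<le> s *\<^sub>R 1}"
    using prob_peak_le[OF pos] V_scaleR[OF s, of 1] by simp
  also have "\<dots> \<le> prob {\<omega> \<in> space M. peak \<omega> $ j \<le> s}"
    by (rule finite_measure_mono) (auto simp: less_eq_vec_def)
  finally show "exp (- V 1 / s) \<le> prob {\<omega> \<in> space M. peak \<omega> $ j \<le> s}" .
  define z where "z k = (\<chi> i. if i = j then s else real (Suc k))" for k
  have z: "\<forall>i. 0 < z k $ i" for k using s by (simp add: z_def)
  have "(\<lambda>k. prob {\<omega> \<in> space M. peak \<omega> \<le> z k}) \<longlonglongrightarrow> prob {\<omega> \<in> space M. peak \<omega> $ j \<le> s}"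
  proof (rule measure_tendsto_AE[OF prob_space_axioms])
    show "AE \<omega> in M. \<forall>\<^sub>F k in sequentially. (\<omega> \<in> {\<omega> \<in> space M. peak \<omega> \<le> z k}) = (\<omega> \<in> {\<omega> \<in> space M. peak \<omega> $ j \<le> s})"
    proof (rule AE_I2)
      fix \<omega> assume \<omega>: "\<omega> \<in> space M"
      have "\<forall>\<^sub>F k in sequentially. peak \<omega> $ i \<le> real (Suc k)" for i
        using eventually_ge_real[of "peak \<omega> $ i"] by eventually_elim simp
      then have "\<forall>\<^sub>F k in sequentially. \<forall>i. peak \<omega> $ i \<le> real (Suc k)" by (rule eventually_all_finite)
      then show "\<forall>\<^sub>F k in sequentially. (\<omega> \<in> {\<omega> \<in> space M. peak \<omega> \<le> z k}) = (\<omega> \<in> {\<omega> \<in> space M. peak \<omega> $ j \<le> s})"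
      proof eventually_elim
        case (elim k)
        then have "peak \<omega> \<le> z k \<longleftrightarrow> peak \<omega> $ j \<le> s"
          unfolding less_eq_vec_def z_def by (auto dest: spec[of _ j] simp del: of_nat_Suc)
        then show ?case using \<omega> by simp
      qed
    qed
  qed measurable
  then show "prob {\<omega> \<in> space M. peak \<omega> $ j \<le> s} \<le> exp (- mean j / s)"
  proof (rule LIMSEQ_le_const2)
    have "prob {\<omega> \<in> space M. peak \<omega> \<le> z k} \<le> exp (- mean j / s)" for k
      using prob_peak_le[OF z] V_ge[OF z, of j k] by (simp add: z_def)
    then show "\<exists>N. \<forall>k\<ge>N. prob {\<omega> \<in> space M. peak \<omega> \<le> z k} \<le> exp (- mean j / s)" by blast
  qed
qed

text \<open>The bound \<open>exp (- mean j / s)\<close> tends to 0 with \<open>s\<close> because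
  \<open>mean j\<close> is positive, which is the positivity of the moments in Condition
  (R).\<close>

lemma peak_pos: "AE \<omega> in M. \<forall>j. 0 < peak \<omega> $ j"
proof (subst AE_all_countable, intro allI)
  fix j
  have "prob {\<omega> \<in> space M. peak \<omega> $ j \<le> 0} \<le> exp (- mean j) ^ Suc k" for k
  proof -
    have "prob {\<omega> \<in> space M. peak \<omega> $ j \<le> 0} \<le> prob {\<omega> \<in> space M. peak \<omega> $ j \<le> 1 / real (Suc k)}"
      by (rule finite_measure_mono) (auto intro: order_trans[of _ 0])
    also have "\<dots> \<le> exp (- mean j / (1 / real (Suc k)))" by (rule prob_peak_nth_le) simp
    also have "\<dots> = exp (real (Suc k) * - mean j)" by (simp del: of_nat_Suc)
    also have "\<dots> = exp (- mean j) ^ Suc k" by (rule exp_of_nat_mult)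
    finally show ?thesis .
  qed
  moreover have "(\<lambda>k. exp (- mean j) ^ Suc k) \<longlonglongrightarrow> 0"
    using mean_pos[of j] by (intro LIMSEQ_Suc LIMSEQ_power_zero) auto
  ultimately have "prob {\<omega> \<in> space M. peak \<omega> $ j \<le> 0} \<le> 0" by (intro LIMSEQ_le_const) blast+
  then have "prob {\<omega> \<in> space M. peak \<omega> $ j \<le> 0} = 0" by (simp add: measure_le_0_iff)
  then have "AE \<omega> in M. \<omega> \<notin> {\<omega> \<in> space M. peak \<omega> $ j \<le> 0}" by (subst (asm) prob_eq_0) auto
  then show "AE \<omega> in M. 0 < peak \<omega> $ j" using AE_space by eventually_elim auto
qed

section \<open>Max-stability and margins of the law of the supremum\<close>

definition extremal :: "(real^'d) measure"
  where "extremal = distr M borel (\<lambda>\<omega>. vreal_unstd \<gamma> \<sigma> (peak \<omega>))"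

lemma measurable_vreal_unstd [measurable]: "vreal_unstd \<gamma> \<sigma> \<in> borel_measurable borel"
  unfolding vreal_unstd_def[abs_def]
  by (intro borel_measurable_vec_lambda measurable_compose[OF _ borel_measurable_real_unstd]) simp

lemma prob_space_extremal: "prob_space extremal"
  unfolding extremal_def by (rule prob_space_distr) simp

lemma joint_cdf_extremal: "joint_cdf extremal x = prob {\<omega> \<in> space M. vreal_unstd \<gamma> \<sigma> (peak \<omega>) \<le> x}"
  unfolding joint_cdf_def extremal_def by (subst measure_distr) (auto intro!: arg_cong[where f = prob])

lemma extremal_sets [measurable]: "{\<omega> \<in> space M. vreal_unstd \<gamma> \<sigma> (peak \<omega>) \<le> x} \<in> sets M"
proof -
  have "(\<lambda>\<omega>. vreal_unstd \<gamma> \<sigma> (peak \<omega>)) -` {..x} \<inter> space M \<in> sets M" by (rule measurable_sets[of _ _ borel]) auto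
  then show ?thesis by (auto simp: vimage_def Int_def conj_commute)
qed

lemma joint_cdf_extremal_unstd:
  assumes z: "\<forall>j. 0 < z $ j"
  shows "joint_cdf extremal (vreal_unstd \<gamma> \<sigma> z) = exp (- V z)"
proof -
  have "joint_cdf extremal (vreal_unstd \<gamma> \<sigma> z) = prob {\<omega> \<in> space M. peak \<omega> \<le> z}"
    unfolding joint_cdf_extremal
  proof (rule finite_measure_eq_AE)
    show "AE \<omega> in M. (\<omega> \<in> {\<omega> \<in> space M. vreal_unstd \<gamma> \<sigma> (peak \<omega>) \<le> vreal_unstd \<gamma> \<sigma> z}) = (\<omega> \<in> {\<omega> \<in> space M. peak \<omega> \<le> z})"
      using peak_pos
    proof eventually_elim
      case (elim \<omega>)
      then show ?case using z by (simp add: less_eq_vec_def vreal_unstd_def real_unstd_le_iff[OF \<sigma>_pos])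
    qed
  qed measurable
  then show ?thesis using prob_peak_le[OF z] by simp
qed

lemma margin_extremal:
  assumes s: "0 < s"
  shows "margin extremal j (ru j s) = prob {\<omega> \<in> space M. peak \<omega> $ j \<le> s}"
proof -
  have [measurable]: "(\<lambda>\<omega>. ru j (peak \<omega> $ j)) \<in> borel_measurable M"
    by (rule measurable_compose[OF measurable_peak_nth borel_measurable_real_unstd])
  have "distr extremal borel (\<lambda>x. x $ j) = distr M borel (\<lambda>\<omega>. ru j (peak \<omega> $ j))"
    unfolding extremal_def by (subst distr_distr[OF measurable_component]) (measurable, simp add: o_def vreal_unstd_def)
  then have "margin extremal j (ru j s) = prob {\<omega> \<in> space M. ru j (peak \<omega> $ j) \<le> ru j s}"
    unfolding margin_def cdf_def by (auto simp: measure_distr intro!: arg_cong[where f = prob])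
  also have "\<dots> = prob {\<omega> \<in> space M. peak \<omega> $ j \<le> s}"
  proof (rule finite_measure_eq_AE)
    show "AE \<omega> in M. (\<omega> \<in> {\<omega> \<in> space M. ru j (peak \<omega> $ j) \<le> ru j s}) = (\<omega> \<in> {\<omega> \<in> space M. peak \<omega> $ j \<le> s})"
      using peak_pos
    proof eventually_elim
      case (elim \<omega>)
      then show ?case using s by (simp add: real_unstd_le_iff[OF \<sigma>_pos])
    qed
  qed measurable
  finally show ?thesis .
qed

lemma margin_extremal_bounds:
  assumes s: "0 < s"
  shows "0 < margin extremal j (ru j s)" "margin extremal j (ru j s) < 1"
    and "exp (- V 1 / s) \<le> margin extremal j (ru j s)"
proof -
  show ge: "exp (- V 1 / s) \<le> margin extremal j (ru j s)"
    using prob_peak_nth_le(1)[OF s, of j] by (simp add: margin_extremal[OF s])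
  show "0 < margin extremal j (ru j s)" by (rule less_le_trans[OF exp_gt_zero ge])
  have "margin extremal j (ru j s) \<le> exp (- mean j / s)"
    using prob_peak_nth_le(2)[OF s, of j] by (simp add: margin_extremal[OF s])
  also have "\<dots> < 1" using mean_pos[of j] s by simp
  finally show "margin extremal j (ru j s) < 1" .
qed

text \<open>The distribution function is explicit only at interior corners, while max-stability
  concerns all arguments. Cutting each coordinate at \<open>ru j (K n)\<close> keeps it below any
  upper endpoint and does not change the event once \<open>K n\<close> exceeds the supremum.\<close>

lemma joint_cdf_extremal_truncate:
  assumes K: "filterlim K at_top sequentially"
  shows "(\<lambda>n. joint_cdf extremal (\<chi> j. min (x $ j) (ru j (K n)))) \<longlonglongrightarrow> joint_cdf extremal x"
  unfolding joint_cdf_extremal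
proof (rule measure_tendsto_AE[OF prob_space_axioms])
  show "AE \<omega> in M. \<forall>\<^sub>F n in sequentially.
      (\<omega> \<in> {\<omega> \<in> space M. vreal_unstd \<gamma> \<sigma> (peak \<omega>) \<le> (\<chi> j. min (x $ j) (ru j (K n)))})
      = (\<omega> \<in> {\<omega> \<in> space M. vreal_unstd \<gamma> \<sigma> (peak \<omega>) \<le> x})"
    using peak_pos
  proof eventually_elim
    case (elim \<omega>)
    have "\<forall>\<^sub>F n in sequentially. peak \<omega> $ j \<le> K n" for j
      using K unfolding filterlim_at_top by blast
    then have "\<forall>\<^sub>F n in sequentially. \<forall>j. peak \<omega> $ j \<le> K n" by (rule eventually_all_finite)
    then show ?case
    proof eventually_elim
      case (elim n)
      have "ru j (peak \<omega> $ j) \<le> ru j (K n)" for j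
      proof -
        have "0 < peak \<omega> $ j" "peak \<omega> $ j \<le> K n" using elim \<open>\<forall>j. 0 < peak \<omega> $ j\<close> by auto
        then show ?thesis by (subst real_unstd_le_iff[OF \<sigma>_pos]) auto
      qed
      then show ?case by (simp add: less_eq_vec_def vreal_unstd_def)
    qed
  qed
qed measurable

lemma joint_cdf_extremal_stable:
  assumes t: "0 < t"
  shows "joint_cdf extremal (norming_scale \<gamma> t * x + norming_shift \<gamma> \<sigma> t) powr t = joint_cdf extremal x"
proof (cases "\<forall>j. \<exists>s>0. ru j s \<le> x $ j")
  case True
  let ?a = "norming_scale \<gamma> t" and ?b = "norming_shift \<gamma> \<sigma> t"
  obtain s where s: "\<And>j. 0 < s j" "\<And>j. ru j (s j) \<le> x $ j" using True by metis
  define N where "N = Max (range s)"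
  have N: "s j \<le> N" for j unfolding N_def by (intro Max_ge) auto
  have N0: "0 < N" using less_le_trans[OF s(1) N] .
  define K where "K n = N + real n" for n
  have K: "filterlim K at_top sequentially"
    unfolding K_def by (intro filterlim_tendsto_add_at_top[OF tendsto_const] filterlim_real_sequentially)
  \<comment> \<open>The norming map carries \<open>ru j (K n)\<close> to
    \<open>ru j (t * K n)\<close> and commutes with minima, so truncation at these two levels
    matches on the two sides of the identity.\<close>
  have tK: "filterlim (\<lambda>n. t * K n) at_top sequentially"
    by (rule filterlim_tendsto_pos_mult_at_top[OF tendsto_const t K])
  let ?y = "\<lambda>n. \<chi> j. min (x $ j) (ru j (K n))"
  have K0: "0 < K n" for n using N0 by (simp add: K_def)
  have eq: "joint_cdf extremal (\<chi> j. min ((?a * x + ?b) $ j) (ru j (t * K n))) powr t = joint_cdf extremal (?y n)" for n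
  proof -
    have "\<exists>w>0. min (x $ j) (ru j (K n)) = ru j w" for j
    proof -
      have "s j \<le> K n" using N[of j] by (simp add: K_def)
      then have "ru j (s j) \<le> ru j (K n)" using s(1)[of j] K0 by (subst real_unstd_le_iff[OF \<sigma>_pos]) auto
      then obtain w where "s j \<le> w" "min (x $ j) (ru j (K n)) = ru j w"
        using real_unstd_between[OF \<sigma>_pos[of j] s(1)[of j] K0[of n], of "\<gamma> $ j" "min (x $ j) (ru j (K n))"] s(2)[of j]
        by auto
      then show ?thesis using s(1)[of j] by (intro exI[of _ w]) auto
    qed
    then obtain w where w: "\<And>j. 0 < w j" "\<And>j. min (x $ j) (ru j (K n)) = ru j (w j)" by metis
    define z where "z = (\<chi> j. w j)"
    have z: "\<forall>j. 0 < z $ j" using w by (simp add: z_def)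
    have tz: "\<forall>j. 0 < (t *\<^sub>R z) $ j" using z t by simp
    have y: "?y n = vreal_unstd \<gamma> \<sigma> z" using w by (simp add: vreal_unstd_def z_def)
    have "min ((?a * x + ?b) $ j) (ru j (t * K n)) = (?a * ?y n + ?b) $ j" for j
    proof -
      have "0 < ?a $ j" by (rule norming_scale_pos[OF t])
      then show ?thesis unfolding real_unstd_norming[OF t K0]
        by (simp add: min_def)
    qed
    then have "(\<chi> j. min ((?a * x + ?b) $ j) (ru j (t * K n))) = ?a * ?y n + ?b" by (simp add: vec_eq_iff)
    also have "\<dots> = vreal_unstd \<gamma> \<sigma> (t *\<^sub>R z)" unfolding y by (rule vreal_unstd_norming[OF t z])
    finally show ?thesis
      unfolding y using joint_cdf_extremal_unstd[OF tz] joint_cdf_extremal_unstd[OF z] V_scaleR[OF t, of z] t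
      by (simp add: powr_def)
  qed
  have "(\<lambda>n. joint_cdf extremal (\<chi> j. min ((?a * x + ?b) $ j) (ru j (t * K n))) powr t)
      \<longlonglongrightarrow> joint_cdf extremal (?a * x + ?b) powr t"
    by (rule tendsto_powr2[OF joint_cdf_extremal_truncate[OF tK] tendsto_const])
      (use t in \<open>auto simp: joint_cdf_def\<close>)
  then show ?thesis
    unfolding eq by (rule LIMSEQ_unique[OF _ joint_cdf_extremal_truncate[OF K]])
next
  case False
  \<comment> \<open>Some coordinate lies below the whole range. The norming map preserves this
    property, so both distribution functions vanish, and \<open>0 powr t = 0\<close>.\<close>
  then obtain j where j: "\<And>s. 0 < s \<Longrightarrow> x $ j < ru j s" by (auto simp: not_le)
  have zero: "joint_cdf extremal y = 0" if y: "\<And>s. 0 < s \<Longrightarrow> y $ j < ru j s" for y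
  proof -
    have "prob {\<omega> \<in> space M. vreal_unstd \<gamma> \<sigma> (peak \<omega>) \<le> y} = prob {}"
    proof (rule finite_measure_eq_AE)
      show "AE \<omega> in M. (\<omega> \<in> {\<omega> \<in> space M. vreal_unstd \<gamma> \<sigma> (peak \<omega>) \<le> y}) = (\<omega> \<in> {})"
        using peak_pos
      proof eventually_elim
        case (elim \<omega>)
        then have "y $ j < vreal_unstd \<gamma> \<sigma> (peak \<omega>) $ j" using y by (simp add: vreal_unstd_def)
        then show ?case by (auto simp: less_eq_vec_def not_le)
      qed
    qed auto
    then show ?thesis by (simp add: joint_cdf_extremal)
  qed
  have "(norming_scale \<gamma> t * x + norming_shift \<gamma> \<sigma> t) $ j < ru j s" if s: "0 < s" for s
  proof -
    have "x $ j < ru j (s / t)" using j s t by simp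
    then have "norming_scale \<gamma> t $ j * x $ j < norming_scale \<gamma> t $ j * ru j (s / t)"
      using norming_scale_pos[OF t, of \<gamma> j] by simp
    then show ?thesis using real_unstd_norming[OF t, of "s / t" \<gamma> j \<sigma>] s t by simp
  qed
  then show ?thesis using zero j by simp
qed

lemma gev_extremal: "gev extremal"
  unfolding gev_def
proof (intro conjI allI impI)
  show "prob_space extremal" by (rule prob_space_extremal)
  interpret Q: prob_space extremal by (rule prob_space_extremal)
  show sets: "sets extremal = sets borel" by (simp add: extremal_def)
  note [measurable_cong] = sets
  fix j
  \<comment> \<open>A constant margin would take only the values 0 and 1, but at
    \<open>ru j 1\<close> the margin lies strictly between them.\<close>
  show "\<not> (\<exists>c. AE x in extremal. x $ j = c)"
  proof
    assume "\<exists>c. AE x in extremal. x $ j = c"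
    then obtain c where c: "AE x in extremal. x $ j = c" by blast
    have eq: "margin extremal j y = Q.prob {x \<in> space extremal. x $ j \<le> y}" for y
      unfolding margin_def cdf_def by (subst measure_distr) (auto intro!: arg_cong[where f = Q.prob])
    have "{x \<in> space extremal. x $ j \<le> ru j 1} \<in> sets extremal" by measurable
    then have "Q.prob {x \<in> space extremal. x $ j \<le> ru j 1} = (if c \<le> ru j 1 then 1 else 0)"
      using c by (auto simp: Q.prob_eq_1 Q.prob_eq_0 elim: eventually_mono intro: AE_mp)
    then show False using margin_extremal_bounds(1,2)[of 1 j] eq by (auto split: if_splits)
  qed
next
  fix t :: real assume t: "0 < t"
  show "\<exists>a b :: real^'d. (\<forall>j. 0 < a $ j) \<and> (\<forall>x. joint_cdf extremal (a * x + b) powr t = joint_cdf extremal x)"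
    using norming_scale_pos[OF t] joint_cdf_extremal_stable[OF t] by blast
qed

lemma norming_shift_eq:
  assumes t: "0 < t"
  shows "norming_shift \<gamma> \<sigma> t $ j = ru j (t * std (\<gamma> $ j) (\<sigma> $ j) 0)"
  using real_unstd_norming[OF t real_unstd_std_0(1)[OF \<sigma>_pos[of j], of "\<gamma> $ j"], of \<gamma> j \<sigma>] real_unstd_std_0(2)[OF \<sigma>_pos[of j], of "\<gamma> $ j"]
  by simp

lemma margin_norming_shift:
  shows "1 \<le> n \<Longrightarrow> 0 < margin extremal j (norming_shift \<gamma> \<sigma> (real n) $ j)"
    and "1 \<le> n \<Longrightarrow> margin extremal j (norming_shift \<gamma> \<sigma> (real n) $ j) < 1"
    and "(\<lambda>n. margin extremal j (norming_shift \<gamma> \<sigma> (real n) $ j)) \<longlonglongrightarrow> 1"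
proof -
  let ?k = "std (\<gamma> $ j) (\<sigma> $ j) 0"
  have k: "0 < ?k" by (rule real_unstd_std_0(1)[OF \<sigma>_pos])
  have pos: "0 < real n * ?k" if "1 \<le> n" for n using k that by simp
  have eq: "norming_shift \<gamma> \<sigma> (real n) $ j = ru j (real n * ?k)" if "1 \<le> n" for n
    using that by (intro norming_shift_eq) simp
  show "1 \<le> n \<Longrightarrow> 0 < margin extremal j (norming_shift \<gamma> \<sigma> (real n) $ j)"
    and "1 \<le> n \<Longrightarrow> margin extremal j (norming_shift \<gamma> \<sigma> (real n) $ j) < 1"
    using margin_extremal_bounds(1,2)[OF pos] eq by simp_all
  show "(\<lambda>n. margin extremal j (norming_shift \<gamma> \<sigma> (real n) $ j)) \<longlonglongrightarrow> 1"
  proof (rule tendsto_sandwich)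
    show "\<forall>\<^sub>F n in sequentially. exp (- (V 1 / ?k) * (1 / real n)) \<le> margin extremal j (norming_shift \<gamma> \<sigma> (real n) $ j)"
      using eventually_ge_at_top[of 1]
    proof eventually_elim
      case (elim n)
      then show ?case using margin_extremal_bounds(3)[OF pos[OF elim], of j] eq[OF elim]
        by (simp add: mult.commute)
    qed
    show "\<forall>\<^sub>F n in sequentially. margin extremal j (norming_shift \<gamma> \<sigma> (real n) $ j) \<le> 1"
      using eventually_ge_at_top[of 1]
      by eventually_elim (use margin_extremal_bounds(2)[OF pos] eq in \<open>simp add: less_imp_le\<close>)
    have "(\<lambda>n. exp (- (V 1 / ?k) * (1 / real n))) \<longlonglongrightarrow> exp (- (V 1 / ?k) * 0)"
      by (intro tendsto_intros lim_1_over_n)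
    then show "(\<lambda>n. exp (- (V 1 / ?k) * (1 / real n))) \<longlonglongrightarrow> 1" by simp
  qed simp
qed

text \<open>Observations drawn from this law never fall below a lower endpoint. This is why the
  plain and the raised sample process agree almost surely in the converse half.\<close>

lemma AE_extremal_ge: "AE x in extremal. \<forall>j. 0 < \<gamma> $ j \<longrightarrow> - \<sigma> $ j / \<gamma> $ j \<le> x $ j"
  unfolding extremal_def
proof (subst AE_distr_iff)
  show "AE \<omega> in M. \<forall>j. 0 < \<gamma> $ j \<longrightarrow> - \<sigma> $ j / \<gamma> $ j \<le> vreal_unstd \<gamma> \<sigma> (peak \<omega>) $ j"
    by (rule AE_I2) (simp add: vreal_unstd_def real_unstd_def)
qed measurable

lemma sample_extremal_converges:
  fixes X :: "nat \<Rightarrow> 'w \<Rightarrow> real^'d" and MX :: "'w measure"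
  assumes iid: "iid_with_cdf MX X (joint_cdf extremal)"
  shows "converges_weakly (vague_topology S) MX
      (sample_pp \<gamma> \<sigma> (\<lambda>n. norming_scale \<gamma> (real n)) (\<lambda>n. norming_shift \<gamma> \<sigma> (real n)) X) M (limit_pp \<gamma> \<sigma> R T)" (is ?raised)
    and "converges_weakly (vague_topology S) MX
      (sample_pp_plain \<gamma> \<sigma> (\<lambda>n. norming_scale \<gamma> (real n)) (\<lambda>n. norming_shift \<gamma> \<sigma> (real n)) X) M (limit_pp \<gamma> \<sigma> R T)"
proof -
  let ?a = "\<lambda>n. norming_scale \<gamma> (real n)" and ?b = "\<lambda>n. norming_shift \<gamma> \<sigma> (real n)"
  show raised: ?raised
  proof (rule sample_pp_converges[OF iid])
    show "\<forall>n\<ge>1. \<forall>j. 0 < ?a n $ j" by (simp add: norming_scale_pos)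
    fix z :: "real^'d" assume z: "\<forall>j. 0 < z $ j"
    \<comment> \<open>Max-stability with t = n makes the limit an identity at every stage;
      homogeneity of \<open>V\<close> cancels the exponent n.\<close>
    have "joint_cdf extremal (?a n * vreal_unstd \<gamma> \<sigma> z + ?b n) ^ n = exp (- V z)" if n: "1 \<le> n" for n
    proof -
      have n0: "0 < real n" using n by simp
      have nz: "\<forall>j. 0 < (real n *\<^sub>R z) $ j" using z n0 by simp
      show ?thesis
        unfolding vreal_unstd_norming[OF n0 z] joint_cdf_extremal_unstd[OF nz] V_scaleR[OF n0]
        using n0 by (simp add: exp_of_nat_mult[symmetric])
    qed
    then have "\<forall>\<^sub>F n in sequentially. joint_cdf extremal (?a n * vreal_unstd \<gamma> \<sigma> z + ?b n) ^ n = exp (- V z)"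
      by (intro eventually_sequentiallyI)
    then show "(\<lambda>n. joint_cdf extremal (?a n * vreal_unstd \<gamma> \<sigma> z + ?b n) ^ n)
        \<longlonglongrightarrow> exp (- (\<integral>w. wmax z w \<partial>distr L borel (moments \<gamma> \<sigma>)))"
      unfolding V_def by (rule tendsto_eventually)
  qed
  interpret MX: prob_space MX using iid by (simp add: iid_with_cdf_def)
  have X [measurable]: "X i \<in> borel_measurable MX" for i
    using iid by (auto simp: iid_with_cdf_def MX.indep_vars_def)
  have law: "distr MX borel (X i) = extremal" for i
  proof (rule prob_measure_eq_cdf)
    fix x
    have "measure (distr MX borel (X i)) {..x} = measure MX {\<omega> \<in> space MX. X i \<omega> \<le> x}"
      by (subst measure_distr) (auto intro!: arg_cong[where f = MX.prob])
    then show "measure (distr MX borel (X i)) {..x} = measure extremal {..x}"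
      using iid by (simp add: iid_with_cdf_def joint_cdf_def)
  qed (use prob_space_extremal in \<open>auto intro: MX.prob_space_distr simp: extremal_def\<close>)
  have ge: "AE \<omega> in MX. \<forall>i j. 0 < \<gamma> $ j \<longrightarrow> - \<sigma> $ j / \<gamma> $ j \<le> X i \<omega> $ j"
  proof (subst AE_all_countable, intro allI)
    fix i
    have "AE x in distr MX borel (X i). \<forall>j. 0 < \<gamma> $ j \<longrightarrow> - \<sigma> $ j / \<gamma> $ j \<le> x $ j"
      unfolding law by (rule AE_extremal_ge)
    from AE_distrD[OF X this] show "AE \<omega> in MX. \<forall>j. 0 < \<gamma> $ j \<longrightarrow> - \<sigma> $ j / \<gamma> $ j \<le> X i \<omega> $ j" .
  qed
  show "converges_weakly (vague_topology S) MX (sample_pp_plain \<gamma> \<sigma> ?a ?b X) M (limit_pp \<gamma> \<sigma> R T)"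
  proof (rule converges_weakly_cong[OF raised])
    fix n
    have "normalized (?a n) (?b n) \<in> borel_measurable borel"
      unfolding normalized_def[abs_def] by (intro borel_measurable_vec_lambda) simp
    then have "(\<lambda>\<omega>. normalized (?a n) (?b n) (X i \<omega>)) \<in> borel_measurable MX" for i
      using X by (rule measurable_compose[rotated])
    then show "random_element (vague_topology S) MX (sample_pp_plain \<gamma> \<sigma> ?a ?b X n)"
      unfolding sample_pp_plain_def[abs_def] by (rule random_element_finite_sum)
    show "AE \<omega> in MX. sample_pp \<gamma> \<sigma> ?a ?b X n \<omega> = sample_pp_plain \<gamma> \<sigma> ?a ?b X n \<omega>"
    \<comment> \<open>For \<open>n = 0\<close> the norming scale is 0 and division by it is
      meaningless, but both processes are empty.\<close>
    proof (cases "n = 0")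
      case True
      then show ?thesis by (simp add: sample_pp_def sample_pp_plain_def dirac_sum_def distr_def)
    next
      case False
      show ?thesis
        using ge
      proof eventually_elim
        case (elim \<omega>)
        have "raise_to (lower_endpoint \<gamma> \<sigma>) (normalized (?a n) (?b n) (X i \<omega>)) = normalized (?a n) (?b n) (X i \<omega>)" for i
        proof -
          have "lower_endpoint \<gamma> \<sigma> $ j \<le> normalized (?a n) (?b n) (X i \<omega>) $ j" for j
          proof (cases "0 < \<gamma> $ j")
            case True
            have a: "0 < ?a n $ j" using False by (simp add: norming_scale_pos)
            \<comment> \<open>The norming map fixes the lower endpoint, the point with standardized
              coordinate 0; so normalization keeps observations above it.\<close>
            have "- \<sigma> $ j / \<gamma> $ j * ?a n $ j + ?b n $ j = - \<sigma> $ j / \<gamma> $ j"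
              using True by (simp add: norming_scale_def norming_shift_def field_simps)
            also have "\<dots> \<le> X i \<omega> $ j" using elim True by blast
            finally have "- \<sigma> $ j / \<gamma> $ j \<le> (X i \<omega> $ j - ?b n $ j) / ?a n $ j"
              using a by (simp add: pos_le_divide_eq)
            then show ?thesis using True by (simp add: lower_endpoint_def normalized_def)
          qed (simp add: lower_endpoint_def)
          then show ?thesis by (simp add: raise_to_def vec_eq_iff max_absorb2)
        qed
        then show ?case by (simp add: sample_pp_def sample_pp_plain_def)
      qed
    qed
  qed
qed

end

text \<open>In the first half the law \<open>L\<close> is chosen before any realization of the limit
  process, so one law serves all of them. In the second half the observations follow the max-stable
  law itself, and convergence is obtained for the plain sample process too.\<close>

theorem theorem3:
  fixes \<gamma> \<sigma> :: "real^'d"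
  assumes "\<forall>j. 0 < \<sigma> $ j"
  shows
    "(\<forall>(M :: 'w measure) X F a b Q \<mu> \<alpha>.
        iid_with_cdf M X F \<and> (\<forall>n\<ge>1. \<forall>j. 0 < a n $ j) \<and>
        gev Q \<and> gev_parameters Q \<gamma> \<mu> \<alpha> \<and> (\<forall>j. \<sigma> $ j = \<alpha> $ j - \<gamma> $ j * \<mu> $ j) \<and>
        0 < joint_cdf Q 0 \<and> joint_cdf Q 0 < 1 \<and>
        (\<forall>x. isCont (joint_cdf Q) x \<longrightarrow>
          (\<lambda>n. measure M {\<omega> \<in> space M. \<forall>j. ((MAX i\<in>{..<n}. X i \<omega> $ j) - b n $ j) / a n $ j \<le> x $ j})
            \<longlonglongrightarrow> joint_cdf Q x)
        \<longrightarrow>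
        (\<exists>L. condition_R \<gamma> \<sigma> L \<and>
          (\<forall>(M' :: 'v measure) R T. limit_ingredients L M' R T \<longrightarrow>
            converges_weakly (vague_topology (state_space \<gamma> \<sigma>))
              M (sample_pp \<gamma> \<sigma> a b X) M' (limit_pp \<gamma> \<sigma> R T))))
     \<and>
     (\<forall>L (M' :: 'v measure) R T.
        condition_R \<gamma> \<sigma> L \<and> limit_ingredients L M' R T \<longrightarrow>
        (\<exists>Q a b. gev Q \<and>
          (\<forall>n\<ge>1. \<forall>j. 0 < a n $ j) \<and>
          (\<forall>n\<ge>1. \<forall>j. 0 < margin Q j (b n $ j) \<and> margin Q j (b n $ j) < 1) \<and>
          (\<forall>j. (\<lambda>n. margin Q j (b n $ j)) \<longlonglongrightarrow> 1) \<and>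
          (\<forall>(M :: 'w measure) X. iid_with_cdf M X (joint_cdf Q) \<longrightarrow>
            converges_weakly (vague_topology (state_space \<gamma> \<sigma>))
              M (sample_pp_plain \<gamma> \<sigma> a b X) M' (limit_pp \<gamma> \<sigma> R T) \<and>
            converges_weakly (vague_topology (state_space \<gamma> \<sigma>))
              M (sample_pp \<gamma> \<sigma> a b X) M' (limit_pp \<gamma> \<sigma> R T))))"
proof (intro conjI allI impI; elim conjE)
  fix M :: "'w measure" and X F a b Q \<mu> \<alpha>
  assume iid: "iid_with_cdf M X F" and a: "\<forall>n\<ge>1. \<forall>j. 0 < a n $ j"
    and Q: "gev Q" "gev_parameters Q \<gamma> \<mu> \<alpha>" "\<forall>j. \<sigma> $ j = \<alpha> $ j - \<gamma> $ j * \<mu> $ j"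
    and lim: "\<forall>x. isCont (joint_cdf Q) x \<longrightarrow>
          (\<lambda>n. measure M {\<omega> \<in> space M. \<forall>j. ((MAX i\<in>{..<n}. X i \<omega> $ j) - b n $ j) / a n $ j \<le> x $ j})
            \<longlonglongrightarrow> joint_cdf Q x"
  interpret state_params \<gamma> \<sigma> by unfold_locales (use assms in blast)
  interpret Q: prob_space Q using Q(1) by (simp add: gev_def)
  interpret G: gev_law \<gamma> \<sigma> Q \<mu> \<alpha> by unfold_locales (use Q in auto)
  obtain L where L: "condition_R \<gamma> \<sigma> L"
    "\<And>z. \<forall>j. 0 < z $ j \<Longrightarrow> (\<integral>w. wmax z w \<partial>distr L borel (moments \<gamma> \<sigma>)) = G.exponent z"
    using G.condition_R_exists by blast
  have "converges_weakly (vague_topology (state_space \<gamma> \<sigma>)) M (sample_pp \<gamma> \<sigma> a b X) M' (limit_pp \<gamma> \<sigma> R T)"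
    if lim_ing: "limit_ingredients L M' R T" for M' :: "'v measure" and R T
  proof -
    interpret P: limit_process \<gamma> \<sigma> L M' R T by unfold_locales (use L lim_ing in auto)
    show ?thesis
    proof (rule P.sample_pp_converges[OF iid a])
      fix z :: "real^'d" assume z: "\<forall>j. 0 < z $ j"
      let ?x = "vreal_unstd \<gamma> \<sigma> z"
      have "\<forall>\<^sub>F n in sequentially. measure M {\<omega> \<in> space M. \<forall>j. ((MAX i\<in>{..<n}. X i \<omega> $ j) - b n $ j) / a n $ j \<le> ?x $ j}
          = F (a n * ?x + b n) ^ n"
        using eventually_ge_at_top[of 1]
      proof eventually_elim
        case (elim n)
        show ?case by (rule prob_max_le[OF iid elim]) (use a elim in blast)
      qed
      moreover have "(\<lambda>n. measure M {\<omega> \<in> space M. \<forall>j. ((MAX i\<in>{..<n}. X i \<omega> $ j) - b n $ j) / a n $ j \<le> ?x $ j})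
          \<longlonglongrightarrow> joint_cdf Q ?x"
        using lim G.isCont_joint_cdf[OF z] by blast
      ultimately have "(\<lambda>n. F (a n * ?x + b n) ^ n) \<longlonglongrightarrow> joint_cdf Q ?x"
        by (rule Lim_transform_eventually[rotated])
      also have "joint_cdf Q ?x = exp (- G.exponent z)"
        using G.simple_cdf_pos[OF z] by (simp add: G.exponent_def G.simple_cdf_def)
      finally show "(\<lambda>n. F (a n * ?x + b n) ^ n) \<longlonglongrightarrow> exp (- (\<integral>w. wmax z w \<partial>distr L borel (moments \<gamma> \<sigma>)))"
        using L(2)[OF z] by simp
    qed
  qed
  then show "\<exists>L. condition_R \<gamma> \<sigma> L \<and>
          (\<forall>(M' :: 'v measure) R T. limit_ingredients L M' R T \<longrightarrow>
            converges_weakly (vague_topology (state_space \<gamma> \<sigma>))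
              M (sample_pp \<gamma> \<sigma> a b X) M' (limit_pp \<gamma> \<sigma> R T))"
    using L(1) by blast
next
  fix L and M' :: "'v measure" and R T
  assume L: "condition_R \<gamma> \<sigma> L" and lim_ing: "limit_ingredients L M' R T"
  interpret P: limit_process \<gamma> \<sigma> L M' R T by unfold_locales (use L lim_ing assms in auto)
  show "\<exists>Q a b. gev Q \<and>
          (\<forall>n\<ge>1. \<forall>j. 0 < a n $ j) \<and>
          (\<forall>n\<ge>1. \<forall>j. 0 < margin Q j (b n $ j) \<and> margin Q j (b n $ j) < 1) \<and>
          (\<forall>j. (\<lambda>n. margin Q j (b n $ j)) \<longlonglongrightarrow> 1) \<and>
          (\<forall>(M :: 'w measure) X. iid_with_cdf M X (joint_cdf Q) \<longrightarrow>
            converges_weakly (vague_topology (state_space \<gamma> \<sigma>))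
              M (sample_pp_plain \<gamma> \<sigma> a b X) M' (limit_pp \<gamma> \<sigma> R T) \<and>
            converges_weakly (vague_topology (state_space \<gamma> \<sigma>))
              M (sample_pp \<gamma> \<sigma> a b X) M' (limit_pp \<gamma> \<sigma> R T))"
  proof (intro exI conjI allI impI)
    show "gev P.extremal" by (rule P.gev_extremal)
    show "0 < norming_scale \<gamma> (real n) $ j" if "1 \<le> n" for n j using that by (simp add: norming_scale_pos)
  qed (use P.margin_norming_shift P.sample_extremal_converges in auto)
qed

end
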